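(* Let $d\ge 1$. The space $\mathcal{H}_{\mathbb{R}^d}\big(W(C_0,\ell^1),W(M,\ell^\infty)\big)$ of all bounded linear operators $T: W(C_0,\ell^1)(\mathbb{R}^d)\to W(M,\ell^\infty)(\mathbb{R}^d)$ that commute with all translations can be naturally identified with the dual space $S_0'(\mathbb{R}^d)=W(\mathcal{F}L^\infty,\ell^\infty)(\mathbb{R}^d)$ of $S_0(\mathbb{R}^d)$, with equivalence of the natural Banach space norms. That is: for every $T\in \mathcal{H}_{\mathbb{R}^d}\big(W(C_0,\ell^1),W(M,\ell^\infty)\big)$ there is a unique $\sigma\in S_0'(\mathbb{R}^d)$ such that $$Tf=\sigma* f\quad\text{for all } f\in S_0(\mathbb{R}^d),\qquad (\sigma* f)(x):=\sigma(T_x f^{\checkmark}),\ x\in\mathbb{R}^d;$$ conversely, for every $\sigma\in S_0'(\mathbb{R}^d)$ the map $f\mapsto\sigma* f$ on $S_0(\mathbb{R}^d)$ extends uniquely to an operator in $\mathcal{H}_{\mathbb{R}^d}\big(W(C_0,\ell^1),W(M,\ell^\infty)\big)$; and under this linear bijection the operator norm of $T$ and the functional norm $\|\sigma\|_{S_0'}$ are equivalent norms.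
   Context: Notation on $\mathbb{R}^d$: $T_xf(z)=f(z-x)$, $f^{\checkmark}(z)=f(-z)$; translation of measures and of functionals is defined by the corresponding dual action. $\hat f(s)=\int_{\mathbb{R}^d}f(t)e^{-2\pi i s\cdot t}\,dt$. $C_0(\mathbb{R}^d)$ is the space of continuous complex-valued functions vanishing at infinity, and $Q=[0,1)^d$. Wiener's algebra $W(C_0,\ell^1)(\mathbb{R}^d)$ consists of all continuous $f:\mathbb{R}^d\to\mathbb{C}$ with $\|f\|_{W(C_0,\ell^1)}=\sum_{k\in\mathbb{Z}^d}\|f\cdot \mathbf{1}_{k+Q}\|_\infty<\infty$. $W(M,\ell^\infty)(\mathbb{R}^d)$ is the space of translation-bounded complex Radon measures $\mu$ on $\mathbb{R}^d$, with norm $\sup_{k\in\mathbb{Z}^d}|\mu|(k+Q)<\infty$; it is (up to equivalent norms) the dual space of $W(C_0,\ell^1)(\mathbb{R}^d)$. The Segal algebra $S_0(\mathbb{R}^d)=W(\mathcal{F}L^1,\ell^1)(\mathbb{R}^d)$: fix $\psi\in C_c^\infty(\mathbb{R}^d)$ with $\sum_{k\in\mathbb{Z}^d}\psi(x-k)=1$ for all $x$. Then $S_0(\mathbb{R}^d)$ consists of all continuous $f$ on $\mathbb{R}^d$ such that each $f\cdot T_k\psi$ lies in $\mathcal{F}L^1(\mathbb{R}^d)=\{\hat h: h\in L^1\}$ and $\|f\|_{S_0}=\sum_{k\in\mathbb{Z}^d}\|f\cdot T_k\psi\|_{\mathcal{F}L^1}<\infty$, where $\|g\|_{\mathcal{F}L^1}=\|\hat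 g\|_{L^1}$. Different choices of $\psi$ give the same space with equivalent norms. $S_0'(\mathbb{R}^d)$ is its Banach dual (the space of mild distributions). There are continuous embeddings $S_0\hookrightarrow W(C_0,\ell^1)\hookrightarrow W(M,\ell^\infty)\hookrightarrow S_0'$, where a function $h$ is identified with the measure $h\,dx$ and a measure $\mu$ with the functional $f\mapsto\int f\,d\mu$. *)

theory Defs
  imports "HOL-Analysis.Analysis"
begin

text \<open>
  Euclidean \<open>d\<close>-space is \<^typ>\<open>real^'n\<close> with \<open>d = CARD('n) \<ge> 1\<close>.  The spaces of functions,
  measures and functionals are given by carrier sets together with real-valued norms.
  Operators and functionals are set-theoretic functions on their carrier, that is, they take
  the value \<^const>\<open>undefined\<close> outside it (\<^const>\<open>extensional\<close>), so that equality of operators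
  or functionals is HOL equality.
\<close>

type_synonym 'n cfun = "real^'n \<Rightarrow> complex"
type_synonym 'n cmeas = "(real^'n) set \<Rightarrow> complex"

definition translate :: "real^'n::finite \<Rightarrow> 'n cfun \<Rightarrow> 'n cfun" where
  "translate x f = (\<lambda>z. f (z - x))"

definition flip :: "'n::finite cfun \<Rightarrow> 'n cfun" where
  "flip f = (\<lambda>z. f (- z))"

definition int_lattice :: "(real^'n::finite) set" where
  "int_lattice = {k. \<forall>i. k $ i \<in> \<int>}"

definition unit_cube :: "(real^'n::finite) set" where
  "unit_cube = {x. \<forall>i. 0 \<le> x $ i \<and> x $ i < 1}"

definition cube :: "real^'n::finite \<Rightarrow> (real^'n) set" where
  "cube k = (\<lambda>x. k + x) ` unit_cube"


subsection \<open>Wiener's algebra\<close>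

definition wiener :: "'n::finite cfun set" where
  "wiener = {f. continuous_on UNIV f \<and>
     (\<lambda>k. SUP x\<in>cube k. cmod (f x)) summable_on int_lattice}"

definition wiener_norm :: "'n::finite cfun \<Rightarrow> real" where
  "wiener_norm f = (\<Sum>\<^sub>\<infinity>k\<in>int_lattice. SUP x\<in>cube k. cmod (f x))"


subsection \<open>Translation-bounded complex Radon measures\<close>

text \<open>
  A complex Radon measure need not be finite, so it is only defined on bounded Borel sets, where
  it is countably additive; this amounts to a consistent family of complex measures on the
  bounded Borel sets, and on Euclidean space regularity is automatic.  The value on all other
  sets is normalised to 0.
\<close>

definition bounded_borel :: "(real^'n::finite) set set" where
  "bounded_borel = {A \<in> sets borel. bounded A}"

definition radon_measure :: "'n::finite cmeas \<Rightarrow> bool" where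
  "radon_measure \<mu> \<longleftrightarrow>
     (\<forall>A. A \<notin> bounded_borel \<longrightarrow> \<mu> A = 0) \<and>
     (\<forall>A :: nat \<Rightarrow> (real^'n) set.
        range A \<subseteq> bounded_borel \<and> disjoint_family A \<and> bounded (\<Union>i. A i)
        \<longrightarrow> (\<lambda>i. \<mu> (A i)) sums \<mu> (\<Union>i. A i))"

definition total_variation :: "'n::finite cmeas \<Rightarrow> (real^'n) set \<Rightarrow> ennreal" where
  "total_variation \<mu> A =
     (SUP P \<in> {P. finite P \<and> disjoint P \<and> P \<subseteq> bounded_borel \<and> \<Union>P = A}.
        \<Sum>B\<in>P. ennreal (cmod (\<mu> B)))"

definition tb_measures :: "'n::finite cmeas set" where
  "tb_measures = {\<mu>. radon_measure \<mu> \<and>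
     (SUP k\<in>int_lattice. total_variation \<mu> (cube k)) < \<infinity>}"

definition tb_norm :: "'n::finite cmeas \<Rightarrow> real" where
  "tb_norm \<mu> = enn2real (SUP k\<in>int_lattice. total_variation \<mu> (cube k))"

text \<open>Dual action: integrating \<open>f\<close> against the translated measure is integrating
  \<open>translate (- x) f\<close> against \<open>\<mu>\<close>; for indicator functions this reads as follows.\<close>

definition translate_measure :: "real^'n::finite \<Rightarrow> 'n cmeas \<Rightarrow> 'n cmeas" where
  "translate_measure x \<mu> = (\<lambda>A. \<mu> ((\<lambda>z. z - x) ` A))"

text \<open>The measure \<open>\<mu>\<close> is (identified with) the function \<open>h\<close>, i.e. \<open>\<mu> = h dx\<close>.\<close>

definition has_density :: "'n::finite cmeas \<Rightarrow> 'n cfun \<Rightarrow> bool" where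
  "has_density \<mu> h \<longleftrightarrow> (\<forall>A\<in>bounded_borel.
     set_integrable lborel A h \<and> \<mu> A = (LINT x:A|lborel. h x))"


subsection \<open>The Segal algebra \<open>S\<^sub>0\<close> and its dual\<close>

definition fourier :: "'n::finite cfun \<Rightarrow> 'n cfun" where
  "fourier f = (\<lambda>s. LINT t|lborel. f t * cis (- (2 * pi * (s \<bullet> t))))"

definition FL1 :: "'n::finite cfun set" where
  "FL1 = {fourier h | h. integrable lborel h}"

text \<open>This is only applied to compactly supported members of \<^const>\<open>FL1\<close>, whose Fourier
  transform is given by the integral and is integrable by Fourier inversion.\<close>

definition FL1_norm :: "'n::finite cfun \<Rightarrow> real" where
  "FL1_norm g = (LINT s|lborel. cmod (fourier g s))"

text \<open>Continuous differentiability of order \<open>m\<close>, by iterated directional derivatives.\<close>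

primrec C_k :: "nat \<Rightarrow> 'n::finite cfun \<Rightarrow> bool" where
  "C_k 0 f \<longleftrightarrow> continuous_on UNIV f"
| "C_k (Suc m) f \<longleftrightarrow> f differentiable_on UNIV \<and>
     (\<forall>v. C_k m (\<lambda>x. frechet_derivative f (at x) v))"

definition test_function :: "'n::finite cfun \<Rightarrow> bool" where
  "test_function \<psi> \<longleftrightarrow> (\<forall>m. C_k m \<psi>) \<and> compact (closure {x. \<psi> x \<noteq> 0})"

definition smooth_partition :: "'n::finite cfun \<Rightarrow> bool" where
  "smooth_partition \<psi> \<longleftrightarrow> test_function \<psi> \<and>
     (\<forall>x. ((\<lambda>k. \<psi> (x - k)) has_sum 1) int_lattice)"

definition S0 :: "'n::finite cfun \<Rightarrow> 'n cfun set" where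
  "S0 \<psi> = {f. continuous_on UNIV f \<and>
     (\<forall>k\<in>int_lattice. (\<lambda>x. f x * translate k \<psi> x) \<in> FL1) \<and>
     (\<lambda>k. FL1_norm (\<lambda>x. f x * translate k \<psi> x)) summable_on int_lattice}"

definition S0_norm :: "'n::finite cfun \<Rightarrow> 'n cfun \<Rightarrow> real" where
  "S0_norm \<psi> f = (\<Sum>\<^sub>\<infinity>k\<in>int_lattice. FL1_norm (\<lambda>x. f x * translate k \<psi> x))"

definition S0_dual :: "'n::finite cfun \<Rightarrow> ('n cfun \<Rightarrow> complex) set" where
  "S0_dual \<psi> = {\<sigma> \<in> extensional (S0 \<psi>).
     (\<forall>f\<in>S0 \<psi>. \<forall>g\<in>S0 \<psi>. \<forall>a b. \<sigma> (\<lambda>x. a * f x + b * g x) = a * \<sigma> f + b * \<sigma> g) \<and>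
     (\<exists>C. \<forall>f\<in>S0 \<psi>. cmod (\<sigma> f) \<le> C * S0_norm \<psi> f)}"

definition S0_dual_norm :: "'n::finite cfun \<Rightarrow> ('n cfun \<Rightarrow> complex) \<Rightarrow> real" where
  "S0_dual_norm \<psi> \<sigma> = (SUP f\<in>{f \<in> S0 \<psi>. S0_norm \<psi> f \<le> 1}. cmod (\<sigma> f))"

definition conv :: "('n::finite cfun \<Rightarrow> complex) \<Rightarrow> 'n cfun \<Rightarrow> 'n cfun" where
  "conv \<sigma> f = (\<lambda>x. \<sigma> (translate x (flip f)))"


subsection \<open>Translation-invariant operators\<close>

definition bounded_operators :: "('n::finite cfun \<Rightarrow> 'n cmeas) set" where
  "bounded_operators = {T \<in> extensional wiener.
     (\<forall>f\<in>wiener. T f \<in> tb_measures) \<and>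
     (\<forall>f\<in>wiener. \<forall>g\<in>wiener. \<forall>a b.
        T (\<lambda>x. a * f x + b * g x) = (\<lambda>A. a * T f A + b * T g A)) \<and>
     (\<exists>C. \<forall>f\<in>wiener. tb_norm (T f) \<le> C * wiener_norm f)}"

definition operator_norm :: "('n::finite cfun \<Rightarrow> 'n cmeas) \<Rightarrow> real" where
  "operator_norm T = (SUP f\<in>{f \<in> wiener. wiener_norm f \<le> 1}. tb_norm (T f))"

definition invariant_operators :: "('n::finite cfun \<Rightarrow> 'n cmeas) set" where
  "invariant_operators = {T \<in> bounded_operators.
     \<forall>x. \<forall>f\<in>wiener. T (translate x f) = translate_measure x (T f)}"

definition is_convolution ::
    "'n::finite cfun \<Rightarrow> ('n cfun \<Rightarrow> 'n cmeas) \<Rightarrow> ('n cfun \<Rightarrow> complex) \<Rightarrow> bool" where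
  "is_convolution \<psi> T \<sigma> \<longleftrightarrow> (\<forall>f\<in>S0 \<psi>. has_density (T f) (conv \<sigma> f))"

end

theory Submission
  imports Defs "HOL-Probability.Probability"
begin

text \<open>
  Formally \<open>\<sigma> * f\<close> is the density \<open>x \<mapsto> \<sigma> (translate x (flip f))\<close>, so its mass on a bounded Borel set \<open>A\<close> is
  \<open>\<sigma> (1\<^sub>A * flip f)\<close>; conversely \<open>\<sigma> (flip f)\<close> is the density at the origin of the measure that the operator
  assigns to \<open>f\<close>.  The correspondence follows once both expressions make sense with norm control:
  the first for every \<open>f\<close> in Wiener's algebra, the second for every invariant operator and every
  \<open>f\<close> in \<open>S\<^sub>0\<close>.

  The tool for \<open>S\<^sub>0\<close> is synthesis (\<open>S0_synthesis\<close>): a sum of functions \<open>g k\<close> living near the lattice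
  points \<open>k\<close>, with integrable Fourier transforms whose \<open>L\<^sup>1\<close> norms are summable, belongs to \<open>S\<^sub>0\<close>.
  It rests on Fourier inversion, on the estimate for the transform of a product and on the
  integrability of the transform of the window \<open>\<psi>\<close>.

  From functionals to operators.  Cut \<open>f\<close> in Wiener's algebra into its restrictions to unit cubes, which
  are \<open>L\<^sup>2\<close> functions with summable norms.  Convolving one of them with a function \<open>b\<close> in \<open>L\<^sup>2\<close> gives, by
  Bessel's inequality and Cauchy-Schwarz, a function with integrable transform, so
  \<open>b * f\<close> lies in \<open>S\<^sub>0\<close> when \<open>b\<close> has bounded support (\<open>S0_convolve\<close>).  Hence \<open>A \<mapsto> \<sigma> (1\<^sub>A * flip f)\<close> is
  defined outright for all \<open>f\<close>, without extending anything by density.  It is countably additive because indicators of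
  sets of small measure are small in \<open>L\<^sup>2\<close>, and its variation over a unit cube is bounded because a
  unimodular step function on the cube has \<open>L\<^sup>2\<close> norm at most one (\<open>conv_measure_tb\<close>).

  From operators to functionals.  The heart is the estimate
  \<open>|T f (B)| \<le> C |B| \<parallel>T\<parallel> \<parallel>f\<parallel>\<close> for every \<open>f\<close> in \<open>S\<^sub>0\<close> and every cube \<open>B\<close> of side \<open>1/N\<close>
  (\<open>S0_box_bound\<close>).  By Fourier inversion each local piece of \<open>f\<close> is a superposition of localized plane
  waves, with total weight its \<open>FL1\<close> norm.  Translating a localized plane wave changes it only by a
  phase and by moving its cut-off, so by invariance the values of \<open>T\<close> on its translates, at one cube
  \<open>B\<close>, have the moduli of the values of a single measure at the translates of \<open>B\<close>.
  A unit cube consists of \<open>N\<^sup>d\<close> translates of \<open>B\<close>, and the moduli of their values sum up to at most a multiple of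
  \<open>\<parallel>T\<parallel>\<close> (\<open>wave_tile_bound\<close>); averaging over the translations therefore gains the
  factor \<open>N\<^sup>-\<^sup>d = |B|\<close> (\<open>bwave_bound\<close>).  As translation is continuous in \<open>S\<^sub>0\<close>, the averages of \<open>T f\<close> over
  shrinking cubes are equicontinuous and converge uniformly to a continuous density of \<open>T f\<close>
  (\<open>operator_density\<close>), whose value at the origin gives the functional (\<open>symbol_exists\<close>).

  Uniqueness.  The functional is recovered from the operator by differentiation at the
  origin (\<open>symbol_limit\<close>), and doing so for the operator built from \<open>\<sigma>\<close> returns \<open>\<sigma>\<close>
  (\<open>conv_operator_limit\<close>).  An operator is determined by its values on \<open>S\<^sub>0\<close> because averages of \<open>f\<close>
  over small cubes lie in \<open>S\<^sub>0\<close> and approximate \<open>f\<close> in Wiener's algebra (\<open>operator_unique\<close>).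
\<close>

section \<open>Lattice points and unit cubes\<close>

text \<open>Only finitely many lattice points lie within a given distance of \<open>x\<close>.  Locally finite sums over
the lattice are written as finite sums over such sets, so that no convergence question arises.\<close>

definition near :: "real \<Rightarrow> real^'n::finite \<Rightarrow> (real^'n) set" where
  "near R x = {k \<in> int_lattice. norm (k - x) \<le> R}"

definition vfloor :: "real^'n::finite \<Rightarrow> real^'n" where
  "vfloor x = (\<chi> i. of_int \<lfloor>x $ i\<rfloor>)"

lemma mem_cube: "x \<in> cube k \<longleftrightarrow> (\<forall>i. k $ i \<le> x $ i \<and> x $ i < k $ i + 1)"
proof
  assume "x \<in> cube k"
  then show "\<forall>i. k $ i \<le> x $ i \<and> x $ i < k $ i + 1"
    by (auto simp: cube_def unit_cube_def)
next
  assume *: "\<forall>i. k $ i \<le> x $ i \<and> x $ i < k $ i + 1"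
  show "x \<in> cube k"
    unfolding cube_def
    by (rule image_eqI[of _ _ "x - k"]) (use * in \<open>auto simp: unit_cube_def algebra_simps\<close>)
qed

lemma vfloor_lattice [simp]: "vfloor x \<in> int_lattice"
  by (auto simp: vfloor_def int_lattice_def)

lemma mem_cube_vfloor [simp]: "x \<in> cube (vfloor x)"
  by (auto simp: mem_cube vfloor_def)

lemma cube_unique: 
  assumes "k \<in> int_lattice" "x \<in> cube k" shows "k = vfloor x"
proof -
  have "k $ i = of_int \<lfloor>x $ i\<rfloor>" for i
  proof -
    obtain m where m: "k $ i = of_int m" using assms by (auto simp: int_lattice_def Ints_def)
    with assms(2) have "of_int m \<le> x $ i" "x $ i < of_int m + 1" by (metis mem_cube)+
    then have "\<lfloor>x $ i\<rfloor> = m" by (rule floor_unique)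
    with m show ?thesis by simp
  qed
  then show ?thesis by (simp add: vfloor_def vec_eq_iff)
qed

lemma lattice_add [simp]: "k \<in> int_lattice \<Longrightarrow> m \<in> int_lattice \<Longrightarrow> k + m \<in> int_lattice"
  and lattice_diff [simp]: "k \<in> int_lattice \<Longrightarrow> m \<in> int_lattice \<Longrightarrow> k - m \<in> int_lattice"
  and lattice_minus [simp]: "k \<in> int_lattice \<Longrightarrow> - k \<in> int_lattice"
  and lattice_0 [simp]: "0 \<in> int_lattice"
  by (auto simp: int_lattice_def)

lemma cube_norm: 
  fixes k :: "real^'n::finite"
  assumes "x \<in> cube k" shows "norm (k - x) \<le> real CARD('n)"
proof -
  have "norm (k - x) \<le> (\<Sum>i\<in>UNIV. \<bar>(k - x) $ i\<bar>)" by (rule norm_le_l1_cart)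
  also have "\<dots> \<le> (\<Sum>i\<in>(UNIV::'n set). 1)"
  proof (rule sum_mono)
    fix i
    have "k $ i \<le> x $ i" "x $ i < k $ i + 1" using assms by (auto simp: mem_cube)
    then show "\<bar>(k - x) $ i\<bar> \<le> 1" by simp
  qed
  finally show ?thesis by simp
qed

lemma finite_near [simp]: "finite (near R (x :: real^'n::finite))"
proof -
  obtain N :: int where N: "R + norm x \<le> of_int N" by (meson ex_le_of_int)
  have "near R x \<subseteq> (\<lambda>f. \<chi> i. of_int (f i)) ` (PiE UNIV (\<lambda>_::'n. {-N..N}))"
  proof
    fix k assume k: "k \<in> near R x"
    have b: "\<bar>k $ i\<bar> \<le> of_int N" for i
    proof -
      have "\<bar>k $ i\<bar> \<le> norm k" by (rule component_le_norm_cart)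
      also have "\<dots> \<le> norm (k - x) + norm x" by (metis add.commute norm_triangle_sub)
      finally show ?thesis using k N by (auto simp: near_def)
    qed
    have e: "k = (\<chi> i. of_int \<lfloor>k $ i\<rfloor>)"
      using k by (auto simp: near_def int_lattice_def vec_eq_iff)
    have "- of_int N \<le> k $ i" "k $ i \<le> of_int N" for i using b[of i] by auto
    then have "(\<lambda>i. \<lfloor>k $ i\<rfloor>) \<in> PiE UNIV (\<lambda>_::'n. {-N..N})"
      by (auto simp: le_floor_iff) (metis floor_mono floor_of_int)
    with e show "k \<in> (\<lambda>f. \<chi> i. of_int (f i)) ` (PiE UNIV (\<lambda>_::'n. {-N..N}))" by (rule image_eqI)
  qed
  moreover have "finite ((\<lambda>f. (\<chi> i. of_int (f i)) :: real^'n) ` (PiE UNIV (\<lambda>_::'n. {-N..N})))"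
    by (intro finite_imageI finite_PiE) auto
  ultimately show ?thesis by (rule finite_subset)
qed

lemma near_shift: "norm (x - y) \<le> r \<Longrightarrow> near R x \<subseteq> near (R + r) y"
  by (auto simp: near_def) (smt (verit) diff_add_cancel norm_triangle_ineq add_diff_eq)

lemma near_lattice: "k \<in> int_lattice \<Longrightarrow> near R k = (\<lambda>j. k + j) ` near R 0"
  by (auto simp: near_def image_iff) (metis add_diff_cancel_left' diff_add_cancel lattice_diff add.commute)

text \<open>The number of lattice points in a ball depends on its centre; rounding the centre to the
lattice bounds it by a quantity that does not, at the price of a larger radius.\<close>

lemma card_near_le: "card (near R (x :: real^'n::finite)) \<le> card (near (R + real CARD('n)) (0 :: real^'n))"
proof -
  have "near R x \<subseteq> near (R + real CARD('n)) (vfloor x)"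
    by (rule near_shift) (metis cube_norm mem_cube_vfloor norm_minus_commute)
  also have "\<dots> = (\<lambda>j. vfloor x + j) ` near (R + real CARD('n)) 0"
    by (rule near_lattice) simp
  finally show ?thesis
    by (meson card_image_le card_mono finite_imageI finite_near le_trans)
qed

lemma bij_lattice_add: "m \<in> int_lattice \<Longrightarrow> bij_betw (\<lambda>k. k + m) int_lattice int_lattice"
  by (rule bij_betwI[where g="\<lambda>k. k - m"]) auto

lemma bij_lattice_minus: "bij_betw uminus int_lattice int_lattice"
  by (rule bij_betwI[where g="uminus"]) auto

lemma summable_lattice_shift:
  fixes a :: "real^'n::finite \<Rightarrow> real"
  assumes "a summable_on int_lattice" "m \<in> int_lattice"
  shows "(\<lambda>k. a (k + m)) summable_on int_lattice"
    and "(\<Sum>\<^sub>\<infinity>k\<in>int_lattice. a (k + m)) = (\<Sum>\<^sub>\<infinity>k\<in>int_lattice. a k)"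
  using assms summable_on_reindex_bij_betw[OF bij_lattice_add[OF assms(2)], of a]
    infsum_reindex_bij_betw[OF bij_lattice_add[OF assms(2)], of a] by auto

lemma has_sum_sum:
  fixes f :: "'i \<Rightarrow> 'a \<Rightarrow> 'b :: topological_comm_monoid_add"
  assumes "\<And>i. i \<in> I \<Longrightarrow> (f i has_sum S i) A"
  shows "((\<lambda>x. \<Sum>i\<in>I. f i x) has_sum (\<Sum>i\<in>I. S i)) A"
  using assms by (induction I rule: infinite_finite_induct) (auto intro: has_sum_add)

text \<open>This is convolution on the lattice with the indicator of a ball: each term is counted once for
every lattice point of the ball.  It accounts for all constants of the form
\<open>card (near \<rho> 0)\<close> below.\<close>

lemma lattice_convolution_sum:
  fixes a :: "real^'n::finite \<Rightarrow> real"
  assumes "a summable_on int_lattice"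
  shows "(\<lambda>k. \<Sum>m\<in>near R k. a m) summable_on int_lattice"
    and "(\<Sum>\<^sub>\<infinity>k\<in>int_lattice. \<Sum>m\<in>near R k. a m)
           = real (card (near R (0::real^'n))) * (\<Sum>\<^sub>\<infinity>k\<in>int_lattice. a k)"
proof -
  have eq: "(\<Sum>m\<in>near R k. a m) = (\<Sum>j\<in>near R 0. a (k + j))" if "k \<in> int_lattice" for k
    unfolding near_lattice[OF that] by (subst sum.reindex) auto
  have l: "j \<in> int_lattice" if "j \<in> near R 0" for j using that by (auto simp: near_def)
  have hs: "((\<lambda>k. \<Sum>j\<in>near R 0. a (k + j)) has_sum (\<Sum>j\<in>near R (0::real^'n). \<Sum>\<^sub>\<infinity>k\<in>int_lattice. a k)) int_lattice"
  proof (rule has_sum_sum)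
    show "((\<lambda>k. a (k + j)) has_sum (\<Sum>\<^sub>\<infinity>k\<in>int_lattice. a k)) int_lattice" if "j \<in> near R 0" for j
      using summable_lattice_shift[OF assms l[OF that]] by (metis has_sum_infsum)
  qed
  then have "((\<lambda>k. \<Sum>m\<in>near R k. a m) has_sum (real (card (near R (0::real^'n))) * (\<Sum>\<^sub>\<infinity>k\<in>int_lattice. a k))) int_lattice"
    by (subst has_sum_cong[OF eq]) (use hs in auto)
  then show "(\<lambda>k. \<Sum>m\<in>near R k. a m) summable_on int_lattice"
     "(\<Sum>\<^sub>\<infinity>k\<in>int_lattice. \<Sum>m\<in>near R k. a m)
           = real (card (near R (0::real^'n))) * (\<Sum>\<^sub>\<infinity>k\<in>int_lattice. a k)"
    by (auto simp: infsumI has_sum_imp_summable)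
qed

text \<open>Dominated convergence for sums: a finite part of the index set carries all but a small
amount of the majorant, and on that part the terms tend to zero uniformly.\<close>

lemma infsum_dominated_null:
  fixes a :: "'y \<Rightarrow> 'k \<Rightarrow> real"
  assumes b: "b summable_on I"
    and nn: "\<And>y k. k \<in> I \<Longrightarrow> 0 \<le> a y k"
    and le: "\<forall>\<^sub>F y in F. \<forall>k\<in>I. a y k \<le> b k"
    and lim: "\<And>k. k \<in> I \<Longrightarrow> ((\<lambda>y. a y k) \<longlongrightarrow> 0) F"
  shows "((\<lambda>y. \<Sum>\<^sub>\<infinity>k\<in>I. a y k) \<longlongrightarrow> 0) F"
proof (cases "F = bot")
  case False
  obtain y0 where y0: "\<forall>k\<in>I. a y0 k \<le> b k"
    using eventually_happens'[OF False le] by (elim exE)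
  have bn: "0 \<le> b k" if "k \<in> I" for k
    using order_trans[OF nn[OF that] bspec[OF y0 that]] .
  show ?thesis
  proof (rule tendstoI)
    fix e :: real assume e: "e > 0"
    obtain K where K: "finite K" "K \<subseteq> I" "dist (sum b K) (infsum b I) \<le> e / 4"
      using infsum_finite_approximation[OF b, of "e / 4"] e by auto
    then have K3: "norm (infsum b I - sum b K) < e / 2" using e unfolding dist_real_def real_norm_def by linarith
    have "((\<lambda>y. \<Sum>k\<in>K. a y k) \<longlongrightarrow> (\<Sum>k\<in>K. 0)) F"
      by (intro tendsto_sum lim) (use K in auto)
    then have "\<forall>\<^sub>F y in F. dist (\<Sum>k\<in>K. a y k) (\<Sum>k\<in>K. 0) < e / 2" 
      by (rule tendstoD) (use e in simp)
    with le show "\<forall>\<^sub>F y in F. dist (\<Sum>\<^sub>\<infinity>k\<in>I. a y k) 0 < e"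
    proof eventually_elim
      case (elim y)
      have s: "a y summable_on I"
        by (rule summable_on_comparison_test[OF b]) (use elim nn in auto)
      have sK: "a y summable_on K" "a y summable_on (I - K)" "b summable_on K" "b summable_on (I - K)"
        using s b K by (auto intro: summable_on_subset_banach)
      have "infsum (a y) I = sum (a y) K + infsum (a y) (I - K)"
        using infsum_Un_disjoint[OF sK(1,2)] K by (simp add: Un_absorb1)
      moreover have "infsum b I = sum b K + infsum b (I - K)"
        using infsum_Un_disjoint[OF sK(3,4)] K by (simp add: Un_absorb1)
      moreover have "infsum (a y) (I - K) \<le> infsum b (I - K)"
        by (rule infsum_mono) (use sK elim in auto)
      moreover have "infsum (a y) I \<ge> 0" by (rule infsum_nonneg) (use nn in auto)
      ultimately show ?case using elim K3 unfolding dist_real_def real_norm_def sum.neutral_const by linarith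
    qed
  qed
qed auto

section \<open>Wiener's algebra\<close>

definition cube_sup :: "'n::finite cfun \<Rightarrow> real^'n \<Rightarrow> real" where
  "cube_sup f k = (SUP x\<in>cube k. cmod (f x))"

lemma cube_subset_cball: "cube k \<subseteq> cball (k :: real^'n::finite) (real CARD('n))"
  using cube_norm by (auto simp: dist_norm)

lemma cube_nonempty [simp]: "cube k \<noteq> {}"
  by (auto simp: cube_def unit_cube_def intro: exI[of _ 0])

lemma cube_sup_upper:
  assumes "continuous_on UNIV f" "x \<in> cube k"
  shows "cmod (f x) \<le> cube_sup f k"
  unfolding cube_sup_def
proof (rule cSUP_upper[OF assms(2)])
  have "compact ((\<lambda>x. cmod (f x)) ` cball k (real CARD('a)))"
    by (intro compact_continuous_image continuous_intros continuous_on_subset[OF assms(1)]) auto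
  then have "bdd_above ((\<lambda>x. cmod (f x)) ` cball k (real CARD('a)))"
    by (intro bounded_imp_bdd_above compact_imp_bounded)
  then show "bdd_above ((\<lambda>x. cmod (f x)) ` cube k)"
    by (rule bdd_above_mono) (intro image_mono cube_subset_cball)
qed

lemma cube_sup_least: "(\<And>x. x \<in> cube k \<Longrightarrow> cmod (f x) \<le> B) \<Longrightarrow> cube_sup f k \<le> B"
  unfolding cube_sup_def by (rule cSUP_least) auto

lemma cube_sup_nonneg: "continuous_on UNIV f \<Longrightarrow> 0 \<le> cube_sup f k"
  by (metis cube_nonempty cube_sup_upper ex_in_conv norm_ge_zero order_trans)

lemma wiener_iff: "f \<in> wiener \<longleftrightarrow> continuous_on UNIV f \<and> cube_sup f summable_on int_lattice"
  by (simp add: wiener_def cube_sup_def[abs_def])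

lemma wiener_norm_eq: "wiener_norm f = (\<Sum>\<^sub>\<infinity>k\<in>int_lattice. cube_sup f k)"
  by (simp add: wiener_norm_def cube_sup_def)

lemma wiener_continuous: "f \<in> wiener \<Longrightarrow> continuous_on UNIV f"
  by (simp add: wiener_iff)

lemma wiener_norm_nonneg: "f \<in> wiener \<Longrightarrow> 0 \<le> wiener_norm f"
  by (auto simp: wiener_norm_eq wiener_iff intro!: infsum_nonneg cube_sup_nonneg)

lemma wienerI_cube:
  assumes c: "continuous_on UNIV f" and a: "a summable_on int_lattice"
    and le: "\<And>k x. k \<in> int_lattice \<Longrightarrow> x \<in> cube k \<Longrightarrow> cmod (f x) \<le> a k"
  shows "f \<in> wiener" and "wiener_norm f \<le> (\<Sum>\<^sub>\<infinity>k\<in>int_lattice. a k)"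
proof -
  have l: "cube_sup f k \<le> a k" if "k \<in> int_lattice" for k
    by (rule cube_sup_least) (rule le[OF that])
  have s: "cube_sup f summable_on int_lattice"
    by (rule summable_on_comparison_test[OF a]) (use l cube_sup_nonneg[OF c] in auto)
  then show "f \<in> wiener" using c by (simp add: wiener_iff)
  show "wiener_norm f \<le> (\<Sum>\<^sub>\<infinity>k\<in>int_lattice. a k)"
    unfolding wiener_norm_eq by (rule infsum_mono[OF s a l])
qed

text \<open>The bound at \<open>x\<close> involves the lattice points around \<open>x\<close>, whereas the norm asks for
bounds by cubes; the radius grows by the diameter of a cube.\<close>

lemma wienerI_near:
  fixes f :: "'n::finite cfun"
  assumes c: "continuous_on UNIV f" and a: "a summable_on int_lattice"
    and nn: "\<And>k. k \<in> int_lattice \<Longrightarrow> 0 \<le> a k"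
    and le: "\<And>x. cmod (f x) \<le> (\<Sum>k\<in>near R x. a k)"
  shows "f \<in> wiener"
    and "wiener_norm f \<le> real (card (near (R + real CARD('n)) (0::real^'n))) * (\<Sum>\<^sub>\<infinity>k\<in>int_lattice. a k)"
proof -
  have "cmod (f x) \<le> (\<Sum>m\<in>near (R + real CARD('n)) k. a m)" if "k \<in> int_lattice" "x \<in> cube k" for k x
  proof -
    have "near R x \<subseteq> near (R + real CARD('n)) k"
      by (rule near_shift) (metis cube_norm norm_minus_commute that(2))
    then have "(\<Sum>m\<in>near R x. a m) \<le> (\<Sum>m\<in>near (R + real CARD('n)) k. a m)"
      by (intro sum_mono2 finite_near) (auto simp: near_def nn)
    with le[of x] show ?thesis by linarith
  qed
  from wienerI_cube[OF c lattice_convolution_sum(1)[OF a] this]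
  show "f \<in> wiener"
    "wiener_norm f \<le> real (card (near (R + real CARD('n)) (0::real^'n))) * (\<Sum>\<^sub>\<infinity>k\<in>int_lattice. a k)"
    by (simp_all add: lattice_convolution_sum(2)[OF a])
qed

lemma wiener_upper: "f \<in> wiener \<Longrightarrow> cmod (f x) \<le> cube_sup f (vfloor x)"
  by (simp add: wiener_iff cube_sup_upper)

lemma wiener_lincomb:
  assumes f: "f \<in> wiener" and g: "g \<in> wiener"
  shows "(\<lambda>x. a * f x + b * g x) \<in> wiener"
    and "wiener_norm (\<lambda>x. a * f x + b * g x) \<le> cmod a * wiener_norm f + cmod b * wiener_norm g"
proof -
  have s: "cube_sup f summable_on int_lattice" "cube_sup g summable_on int_lattice"
    and c: "continuous_on UNIV f" "continuous_on UNIV g" using f g by (auto simp: wiener_iff)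
  have "cmod (a * f x + b * g x) \<le> cmod a * cube_sup f k + cmod b * cube_sup g k" if "x \<in> cube k" for x k
    using cube_sup_upper[OF c(1) that] cube_sup_upper[OF c(2) that]
    by (intro norm_triangle_le add_mono) (auto simp: norm_mult mult_left_mono)
  note le = this
  have "((\<lambda>k. cmod a * cube_sup f k + cmod b * cube_sup g k) has_sum
       (cmod a * wiener_norm f + cmod b * wiener_norm g)) int_lattice"
    unfolding wiener_norm_eq using s by (intro has_sum_add has_sum_cmult_right has_sum_infsum)
  moreover have "continuous_on UNIV (\<lambda>x. a * f x + b * g x)" by (intro continuous_intros c)
  ultimately show "(\<lambda>x. a * f x + b * g x) \<in> wiener"
    "wiener_norm (\<lambda>x. a * f x + b * g x) \<le> cmod a * wiener_norm f + cmod b * wiener_norm g"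
    using wienerI_cube[where f="\<lambda>x. a * f x + b * g x" and a="\<lambda>k. cmod a * cube_sup f k + cmod b * cube_sup g k", OF _ _ le]
    by (auto simp: has_sum_iff)
qed

lemma wiener_cmult: "f \<in> wiener \<Longrightarrow> (\<lambda>x. a * f x) \<in> wiener"
  and wiener_norm_cmult_le: "f \<in> wiener \<Longrightarrow> wiener_norm (\<lambda>x. a * f x) \<le> cmod a * wiener_norm f"
  using wiener_lincomb[of f f a 0] by auto

lemma wiener_add: "f \<in> wiener \<Longrightarrow> g \<in> wiener \<Longrightarrow> (\<lambda>x. f x + g x) \<in> wiener"
  using wiener_lincomb(1)[of f g 1 1] by auto

lemma wiener_diff: "f \<in> wiener \<Longrightarrow> g \<in> wiener \<Longrightarrow> (\<lambda>x. f x - g x) \<in> wiener"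
  using wiener_lincomb(1)[of f g 1 "-1"] by auto

lemma wiener_zero [simp]: 
  "(\<lambda>x :: real^'n::finite. 0) \<in> wiener" "wiener_norm (\<lambda>x :: real^'n::finite. 0) = 0"
proof -
  have "cube_sup (\<lambda>x. 0) = (\<lambda>k :: real^'n. 0)" by (simp add: cube_sup_def[abs_def])
  then show "(\<lambda>x :: real^'n. 0) \<in> wiener" "wiener_norm (\<lambda>x::real^'n. 0) = 0"
    by (simp_all add: wiener_iff wiener_norm_eq)
qed

lemma wiener_sum: "(\<And>i. i \<in> I \<Longrightarrow> f i \<in> wiener) \<Longrightarrow> (\<lambda>x. \<Sum>i\<in>I. f i x) \<in> wiener"
  by (induction I rule: infinite_finite_induct) (auto intro: wiener_add)

lemma wiener_norm_sup: "f \<in> wiener \<Longrightarrow> cmod (f x) \<le> wiener_norm f"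
proof -
  assume f: "f \<in> wiener"
  have "cmod (f x) \<le> (\<Sum>k\<in>{vfloor x}. cube_sup f k)" using wiener_upper[OF f] by simp
  also have "\<dots> \<le> wiener_norm f"
    unfolding wiener_norm_eq using f
    by (intro finite_sum_le_infsum) (auto simp: wiener_iff intro: cube_sup_nonneg)
  finally show ?thesis .
qed

lemma translate_continuous: 
  "continuous_on UNIV f \<Longrightarrow> continuous_on UNIV (translate y f)"
  unfolding translate_def by (rule continuous_on_compose2[of UNIV f]) (auto intro!: continuous_intros)

lemma flip_continuous: 
  "continuous_on UNIV f \<Longrightarrow> continuous_on UNIV (flip f)"
  unfolding flip_def by (rule continuous_on_compose2[of UNIV f]) (auto intro!: continuous_intros)

lemma vfloor_near: "vfloor x \<in> near (real CARD('n)) (x :: real^'n::finite)"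
  by (simp add: near_def cube_norm)

lemma vfloor_near': "norm (x - y) \<le> r \<Longrightarrow> vfloor x \<in> near (real CARD('n) + r) (y :: real^'n::finite)"
  using vfloor_near near_shift by blast

lemma wiener_translate:
  fixes f :: "'n::finite cfun"
  assumes f: "f \<in> wiener"
  shows "translate y f \<in> wiener"
proof (rule wienerI_near(1)[where a="cube_sup f" and R="real CARD('n) + norm y"])
  show "cmod (translate y f x) \<le> (\<Sum>k\<in>near (real CARD('n) + norm y) x. cube_sup f k)" for x
  proof -
    have "cmod (translate y f x) \<le> cube_sup f (vfloor (x - y))"
      using wiener_upper[OF f] by (simp add: translate_def)
    also have "\<dots> \<le> (\<Sum>k\<in>near (real CARD('n) + norm y) x. cube_sup f k)"
      by (rule member_le_sum) (use f in \<open>auto intro!: vfloor_near' cube_sup_nonneg simp: wiener_iff\<close>)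
    finally show ?thesis .
  qed
qed (use f in \<open>auto simp: wiener_iff intro: translate_continuous cube_sup_nonneg\<close>)

text \<open>Reflection maps half-open cubes to cubes that are open on the other side, so it is not isometric for this
norm: a reflected cube meets several cubes of the tiling.\<close>

lemma wiener_flip:
  fixes f :: "'n::finite cfun"
  assumes f: "f \<in> wiener"
  shows "flip f \<in> wiener"
    and "wiener_norm (flip f) \<le> real (card (near (2 * real CARD('n)) (0::real^'n))) * wiener_norm f"
proof -
  have *: "cmod (flip f x) \<le> (\<Sum>k\<in>near (real CARD('n)) x. cube_sup f (- k))" for x
  proof -
    have "cmod (flip f x) \<le> cube_sup f (vfloor (- x))"
      using wiener_upper[OF f] by (simp add: flip_def)
    also have "\<dots> = cube_sup f (- (- vfloor (- x)))" by simp
    also have "\<dots> \<le> (\<Sum>k\<in>near (real CARD('n)) x. cube_sup f (- k))"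
    proof (rule member_le_sum)
      show "- vfloor (- x) \<in> near (real CARD('n)) x"
        using vfloor_near[of "- x"] norm_minus_cancel[of "vfloor (- x) + x"] by (simp add: near_def)
    qed (use f in \<open>auto intro!: cube_sup_nonneg simp: wiener_iff\<close>)
    finally show ?thesis .
  qed
  have s: "(\<lambda>k. cube_sup f (- k)) summable_on int_lattice" 
     "(\<Sum>\<^sub>\<infinity>k\<in>int_lattice. cube_sup f (- k)) = wiener_norm f"
    using f summable_on_reindex_bij_betw[OF bij_lattice_minus, of "cube_sup f"]
      infsum_reindex_bij_betw[OF bij_lattice_minus, of "cube_sup f"] by (auto simp: wiener_iff wiener_norm_eq)
  note w = wienerI_near[OF flip_continuous s(1) _ *]
  show "flip f \<in> wiener"
    "wiener_norm (flip f) \<le> real (card (near (2 * real CARD('n)) (0::real^'n))) * wiener_norm f"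
    using w f s(2) by (auto simp: wiener_iff cube_sup_nonneg)
qed

lemma cube_translate: "x - m \<in> cube (k - m) \<longleftrightarrow> x \<in> cube k"
  by (simp add: mem_cube algebra_simps)

lemma cube_sup_translate: "cube_sup (translate m f) k = cube_sup f (k - m)"
proof -
  have "x \<in> cube (k - m) \<longleftrightarrow> x \<in> (\<lambda>x. x - m) ` cube k" for x
    using cube_translate[of "x + m" m k] 
    by (auto simp: cube_translate intro: image_eqI[of _ _ "x + m"])
  then have "cube (k - m) = (\<lambda>x. x - m) ` cube k" by blast
  then show ?thesis by (simp add: cube_sup_def translate_def image_image)
qed

text \<open>Translations by lattice points permute the cubes and are isometric; for other
translations this fails.\<close>

lemma wiener_norm_translate:
  assumes "m \<in> int_lattice" "f \<in> wiener"
  shows "wiener_norm (translate m f) = wiener_norm f"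
  using summable_lattice_shift(2)[of "cube_sup f" "- m"] assms
  by (simp add: wiener_norm_eq cube_sup_translate wiener_iff)

lemma wiener_bounded_support:
  fixes u :: "'n::finite cfun"
  assumes c: "continuous_on UNIV u" and z: "\<And>x. norm (x - p) > r \<Longrightarrow> u x = 0"
    and B: "\<And>x. cmod (u x) \<le> B"
  shows "u \<in> wiener" "wiener_norm u \<le> real (card (near (r + 2 * real CARD('n)) (0::real^'n))) * B"
proof -
  have B0: "0 \<le> B" using B[of 0] norm_ge_zero order_trans by blast
  define K where "K = near (r + real CARD('n)) p"
  have K: "finite K" "K \<subseteq> int_lattice" unfolding K_def by (rule finite_near) (auto simp: near_def)
  define a where "a k = (if k \<in> K then B else 0)" for k
  have hs: "(a has_sum (real (card K) * B)) int_lattice"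
    by (rule has_sum_finite_neutralI[of K]) (use K in \<open>auto simp: a_def\<close>)
  have le: "cmod (u x) \<le> a k" if "k \<in> int_lattice" "x \<in> cube k" for k x
  proof (cases "k \<in> K")
    case False
    then have "norm (k - p) > r + real CARD('n)" using that by (auto simp: K_def near_def)
    moreover have "norm (k - p) \<le> norm (k - x) + norm (x - p)" 
      by (metis diff_add_cancel norm_triangle_ineq add_diff_eq)
    ultimately have "norm (x - p) > r" using cube_norm[OF that(2)] by linarith
    then show ?thesis using z False by (simp add: a_def)
  qed (use B in \<open>simp add: a_def\<close>)
  show "u \<in> wiener" by (rule wienerI_cube(1)[OF c _ le]) (use hs has_sum_imp_summable in auto)
  have "wiener_norm u \<le> infsum a int_lattice"
    by (rule wienerI_cube(2)[OF c _ le]) (use hs has_sum_imp_summable in auto)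
  also have "\<dots> = real (card K) * B" using hs by (rule infsumI)
  also have "\<dots> \<le> real (card (near (r + 2 * real CARD('n)) (0::real^'n))) * B"
    using card_near_le[of "r + real CARD('n)" p] B0
    unfolding K_def mult_2 add.assoc by (intro mult_right_mono) simp_all
  finally show "wiener_norm u \<le> real (card (near (r + 2 * real CARD('n)) (0::real^'n))) * B" .
qed

text \<open>The oscillation of \<open>f\<close> on steps of length at most \<open>\<delta>\<close> tends to zero in the Wiener norm: on each cube
it does by uniform continuity, and it is dominated by the summable local suprema of
\<open>f\<close>.  Members of Wiener's algebra are continuous, so the conclusion is stated for the continuous functions
\<open>g\<close> that are dominated by the oscillation.\<close>

lemma wiener_oscillation:
  fixes f :: "'n::finite cfun"
  assumes f: "f \<in> wiener" and e: "e > 0"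
  obtains \<delta> where "\<delta> > 0"
    "\<And>g. continuous_on UNIV g \<Longrightarrow> (\<And>x B. (\<And>y. norm y \<le> \<delta> \<Longrightarrow> cmod (f (x - y) - f x) \<le> B) \<Longrightarrow> cmod (g x) \<le> B)
       \<Longrightarrow> g \<in> wiener \<and> wiener_norm g \<le> e"
proof -
  have c: "continuous_on UNIV f" and s: "cube_sup f summable_on int_lattice" using f by (auto simp: wiener_iff)
  define R where "R = 2 * real CARD('n) + 1"
  define b where "b k = 2 * (\<Sum>m\<in>near R k. cube_sup f m)" for k
  have bs: "b summable_on int_lattice"
    unfolding b_def by (intro summable_on_cmult_right lattice_convolution_sum s)
  (* The oscillation of f over the cube at k, for steps of length at most \<delta>. *)
  define w where "w \<delta> k = (SUP (x,y)\<in>cube k \<times> cball 0 \<delta>. cmod (f (x - y) - f x))" for \<delta> k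
  have bb: "cmod (f (x - y) - f x) \<le> b k" if "x \<in> cube k" "norm y \<le> 1" "k \<in> int_lattice" for x y k
  proof -
    have "cmod (f z) \<le> (\<Sum>m\<in>near R k. cube_sup f m)" if "norm (z - k) \<le> real CARD('n) + 1" for z
    proof -
      have "vfloor z \<in> near R k" using vfloor_near'[OF that] by (simp add: R_def)
      then have "cube_sup f (vfloor z) \<le> (\<Sum>m\<in>near R k. cube_sup f m)"
        by (intro member_le_sum) (auto intro: cube_sup_nonneg[OF c])
      then show ?thesis using wiener_upper[OF f, of z] by linarith
    qed
    note * = this
    have "norm (x - k) \<le> real CARD('n)" using cube_norm[OF that(1)] by (metis norm_minus_commute)
    moreover have "norm (x - y - k) \<le> norm (x - k) + norm y"
      by (metis add_diff_eq diff_diff_eq add.commute norm_triangle_ineq4)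
    ultimately have "cmod (f (x - y)) \<le> b k / 2" "cmod (f x) \<le> b k / 2"
      using that *[of x] *[of "x - y"] by (auto simp: b_def)
    then show ?thesis using norm_triangle_ineq4[of "f (x - y)" "f x"] by linarith
  qed
  have bdd: "bdd_above ((\<lambda>(x,y). cmod (f (x - y) - f x)) ` (cube k \<times> cball 0 \<delta>))"
    if "\<delta> \<le> 1" "k \<in> int_lattice" for \<delta> k
    by (rule bdd_aboveI[of _ "b k"]) (use bb that in \<open>auto simp: dist_norm\<close>)
  have wu: "cmod (f (x - y) - f x) \<le> w \<delta> k" if "\<delta> \<le> 1" "k \<in> int_lattice" "x \<in> cube k" "norm y \<le> \<delta>" for \<delta> k x y
    unfolding w_def using cSUP_upper[OF _ bdd[OF that(1,2)], of "(x,y)"] that by auto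
  have wl: "w \<delta> k \<le> B" if "\<delta> > 0" "\<And>x y. x \<in> cube k \<Longrightarrow> norm y \<le> \<delta> \<Longrightarrow> cmod (f (x - y) - f x) \<le> B" for \<delta> k B
    unfolding w_def by (rule cSUP_least) (use that in \<open>auto simp: dist_norm\<close>)
  have wn: "0 \<le> w \<delta> k" if "0 < \<delta>" "\<delta> \<le> 1" "k \<in> int_lattice" for \<delta> k
  proof -
    obtain x where x: "x \<in> cube k" using cube_nonempty by blast
    show ?thesis using wu[OF that(2,3) x, of 0] that by simp
  qed
  (* Setting the value to zero outside (0, 1] makes nonnegativity and the majorant b hold for
     every \<delta>, and it leaves the limit at 0 unchanged. *)
  define w' where "w' \<delta> k = (if 0 < \<delta> \<and> \<delta> \<le> 1 then w \<delta> k else 0)" for \<delta> k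
  have "((\<lambda>\<delta>. \<Sum>\<^sub>\<infinity>k\<in>int_lattice. w' \<delta> k) \<longlongrightarrow> 0) (at_right 0)"
  proof (rule infsum_dominated_null[OF bs])
    have bn: "b k \<ge> 0" for k unfolding b_def by (auto intro!: sum_nonneg cube_sup_nonneg[OF c])
    show "\<forall>\<^sub>F \<delta> in at_right 0. \<forall>k\<in>int_lattice. w' \<delta> k \<le> b k"
      unfolding w'_def by (intro always_eventually allI ballI) (auto intro!: wl bn bb)
    show "0 \<le> w' \<delta> k" if "k \<in> int_lattice" for \<delta> k
      using wn that by (auto simp: w'_def)
    fix k :: "real^'n" assume k: "k \<in> int_lattice"
    show "((\<lambda>\<delta>. w' \<delta> k) \<longlongrightarrow> 0) (at_right 0)"
    proof (rule tendstoI)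
      fix e :: real assume e: "e > 0"
      have "uniformly_continuous_on (cball k (real CARD('n) + 1)) f"
        by (intro compact_uniformly_continuous continuous_on_subset[OF c]) auto
      then obtain d where d: "d > 0" "\<And>x x'. x \<in> cball k (real CARD('n) + 1) \<Longrightarrow> x' \<in> cball k (real CARD('n) + 1)
          \<Longrightarrow> dist x' x < d \<Longrightarrow> dist (f x') (f x) < e / 2"
        unfolding uniformly_continuous_on_def using e by (metis half_gt_zero)
      have small: "w \<delta> k \<le> e / 2" if "0 < \<delta>" "\<delta> \<le> 1" "\<delta> < d" for \<delta>
      proof (rule wl[OF that(1)])
        fix x y :: "real^'n" assume x: "x \<in> cube k" and y: "norm y \<le> \<delta>"
        have "norm (k - x) \<le> real CARD('n)" by (rule cube_norm[OF x])
        moreover have "norm (k - (x - y)) \<le> norm (k - x) + norm y"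
          by (metis diff_diff_eq2 add_diff_eq diff_add_eq norm_triangle_ineq add.commute)
        ultimately show "cmod (f (x - y) - f x) \<le> e / 2"
          using d(2)[of x "x - y"] y that by (auto simp: dist_norm)
      qed
      have "\<forall>\<^sub>F \<delta> in at_right 0. \<delta> < d" "\<forall>\<^sub>F \<delta> in at_right 0. \<delta> \<le> (1::real)" "\<forall>\<^sub>F \<delta> in at_right (0::real). \<delta> > 0"
        using d(1) by (auto intro: eventually_at_right_less eventually_at_rightI[of 0 d] eventually_at_rightI[of 0 1])
      then show "\<forall>\<^sub>F \<delta> in at_right 0. dist (w' \<delta> k) 0 < e"
      proof eventually_elim
        case (elim \<delta>)
        then have "w' \<delta> k \<le> e / 2" "w' \<delta> k \<ge> 0" using wn[OF _ _ k, of \<delta>] small by (auto simp: w'_def)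
        then show ?case using e unfolding dist_real_def by linarith
      qed
    qed
  qed
  then have "\<forall>\<^sub>F \<delta> in at_right 0. dist (\<Sum>\<^sub>\<infinity>k\<in>int_lattice. w' \<delta> k) 0 < e"
    using e by (simp add: tendsto_iff)
  moreover have "\<forall>\<^sub>F \<delta> in at_right 0. \<delta> \<le> (1::real)" "\<forall>\<^sub>F \<delta> in at_right (0::real). \<delta> > 0"
    by (auto intro: eventually_at_right_less eventually_at_rightI[of 0 1])
  ultimately have "\<forall>\<^sub>F \<delta> in at_right 0. 0 < \<delta> \<and> \<delta> \<le> 1 \<and> dist (\<Sum>\<^sub>\<infinity>k\<in>int_lattice. w' \<delta> k) 0 < e"
    by eventually_elim auto
  then obtain \<delta> where \<delta>: "0 < \<delta>" "\<delta> \<le> 1" "(\<Sum>\<^sub>\<infinity>k\<in>int_lattice. w \<delta> k) < e"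
    using eventually_happens'[of "at_right (0::real)"] by (force simp: w'_def dist_norm)
  have ws: "w \<delta> summable_on int_lattice"
    by (rule summable_on_comparison_test[OF bs]) (use wl[OF \<delta>(1)] bb wn \<delta> in auto)
  show thesis
  proof (rule that[OF \<delta>(1)])
    fix g :: "'n cfun"
    assume g: "continuous_on UNIV g" "\<And>x B. (\<And>y. norm y \<le> \<delta> \<Longrightarrow> cmod (f (x - y) - f x) \<le> B) \<Longrightarrow> cmod (g x) \<le> B"
    have le: "cmod (g x) \<le> w \<delta> k" if "k \<in> int_lattice" "x \<in> cube k" for k x
      by (rule g(2)) (use wu \<delta> that in auto)
    show "g \<in> wiener \<and> wiener_norm g \<le> e"
      using wienerI_cube[OF g(1) ws le] \<delta>(3) by auto
  qed
qed

section \<open>Changes of variables and product integrability\<close>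

lemma nn_integral_affine:
  fixes t :: "'a::euclidean_space"
  assumes [measurable]: "f \<in> borel_measurable borel" and c: "c \<noteq> 0"
  shows "(\<integral>\<^sup>+x. f x \<partial>lborel) = ennreal (\<bar>c\<bar> ^ DIM('a)) * (\<integral>\<^sup>+x. f (t + c *\<^sub>R x) \<partial>lborel)"
  by (subst lborel_affine[OF c, of t])
     (simp add: nn_integral_density nn_integral_distr nn_integral_cmult ennreal_power)

lemma integrable_affine:
  fixes f :: "'a::euclidean_space \<Rightarrow> 'b :: {banach, second_countable_topology}"
  assumes f: "integrable lborel f" and c: "c \<noteq> 0"
  shows "integrable lborel (\<lambda>x. f (t + c *\<^sub>R x))"
proof -
  note [measurable] = borel_measurable_integrable[OF f]
  have "(\<integral>\<^sup>+x. ennreal (norm (f x)) \<partial>lborel) < \<infinity>" using f by (simp add: integrable_iff_bounded)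
  then show ?thesis
    unfolding integrable_iff_bounded
    by (subst (asm) nn_integral_affine[where c=c and t=t]) (use c in \<open>auto simp: ennreal_mult_less_top\<close>)
qed

lemma integrable_affine_iff:
  fixes f :: "'a::euclidean_space \<Rightarrow> 'b :: {banach, second_countable_topology}"
  assumes c: "c \<noteq> 0"
  shows "integrable lborel (\<lambda>x. f (t + c *\<^sub>R x)) \<longleftrightarrow> integrable lborel f"
  using integrable_affine[of f c t] integrable_affine[of "\<lambda>x. f (t + c *\<^sub>R x)" "1/c" "- (1/c) *\<^sub>R t"] c
  by (auto simp: algebra_simps)

lemma integral_affine:
  fixes f :: "'a::euclidean_space \<Rightarrow> 'b :: {banach, second_countable_topology}"
  assumes c: "c \<noteq> 0"
  shows "(\<integral>x. f x \<partial>lborel) = \<bar>c\<bar> ^ DIM('a) *\<^sub>R (\<integral>x. f (t + c *\<^sub>R x) \<partial>lborel)"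
proof cases
  assume f: "integrable lborel f"
  note [measurable] = borel_measurable_integrable[OF f]
  show ?thesis
    using c f integrable_affine[OF f c, of t]
    by (subst lborel_affine[OF c, of t]) (simp add: integral_density integral_distr)
next
  assume "\<not> integrable lborel f" with c show ?thesis
    by (simp add: integrable_affine_iff not_integrable_integral_eq)
qed

lemma integrable_shift_iff:
  fixes f :: "'a::euclidean_space \<Rightarrow> 'b :: {banach, second_countable_topology}"
  shows "integrable lborel (\<lambda>x. f (x - y)) \<longleftrightarrow> integrable lborel f"
  using integrable_affine_iff[of 1 f "- y"] by simp

lemma integral_shift:
  fixes f :: "'a::euclidean_space \<Rightarrow> 'b :: {banach, second_countable_topology}"
  shows "(\<integral>x. f (x - y) \<partial>lborel) = (\<integral>x. f x \<partial>lborel)"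
  using integral_affine[of 1 f "- y"] by simp

lemma integrable_uminus_iff:
  fixes f :: "'a::euclidean_space \<Rightarrow> 'b :: {banach, second_countable_topology}"
  shows "integrable lborel (\<lambda>x. f (- x)) \<longleftrightarrow> integrable lborel f"
  using integrable_affine_iff[of "-1" f 0] by simp

lemma integral_uminus_arg:
  fixes f :: "'a::euclidean_space \<Rightarrow> 'b :: {banach, second_countable_topology}"
  shows "(\<integral>x. f (- x) \<partial>lborel) = (\<integral>x. f x \<partial>lborel)"
  using integral_affine[of "-1" f 0] by simp

lemma nn_integral_shift:
  fixes y :: "'a::euclidean_space"
  assumes "f \<in> borel_measurable borel"
  shows "(\<integral>\<^sup>+x. f (x - y) \<partial>lborel) = (\<integral>\<^sup>+x. f x \<partial>lborel)"
  using nn_integral_affine[OF assms, of 1 "- y"] by simp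

lemma cis_measurable [measurable]:
  assumes "f \<in> borel_measurable M"
  shows "(\<lambda>x. cis (f x)) \<in> borel_measurable M"
proof -
  have "cis \<in> borel_measurable borel"
    by (intro borel_measurable_continuous_onI continuous_intros)
  from measurable_compose[OF assms this] show ?thesis .
qed

lemma cnj_measurable [measurable]:
  assumes "f \<in> borel_measurable M"
  shows "(\<lambda>x. cnj (f x)) \<in> borel_measurable M"
proof -
  have "cnj \<in> borel_measurable borel"
    by (intro borel_measurable_continuous_onI continuous_intros)
  from measurable_compose[OF assms this] show ?thesis .
qed

lemma integrable_pair_bound:
  fixes f :: "'a::euclidean_space \<Rightarrow> 'c::{banach, second_countable_topology}" 
    and g :: "'b::euclidean_space \<Rightarrow> 'd::{banach, second_countable_topology}"
    and h :: "'a \<Rightarrow> 'b \<Rightarrow> 'e::{banach, second_countable_topology}"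
  assumes f: "integrable lborel f" and g: "integrable lborel g"
    and h: "case_prod h \<in> borel_measurable (lborel \<Otimes>\<^sub>M lborel)"
    and le: "\<And>x y. norm (h x y) \<le> norm (f x) * norm (g y)"
  shows "integrable (lborel \<Otimes>\<^sub>M lborel) (case_prod h)"
proof (rule integrableI_bounded[OF h])
  note [measurable] = borel_measurable_integrable[OF f] borel_measurable_integrable[OF g]
  have "(\<integral>\<^sup>+p. ennreal (norm (case_prod h p)) \<partial>(lborel \<Otimes>\<^sub>M lborel))
     \<le> (\<integral>\<^sup>+p. ennreal (norm (f (fst p)) * norm (g (snd p))) \<partial>(lborel \<Otimes>\<^sub>M lborel))"
    by (intro nn_integral_mono ennreal_leI) (auto simp: le)
  also have "\<dots> = (\<integral>\<^sup>+x. \<integral>\<^sup>+y. ennreal (norm (f x)) * ennreal (norm (g y)) \<partial>lborel \<partial>lborel)"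
    by (subst lborel.nn_integral_fst[symmetric]) (auto simp: ennreal_mult)
  also have "\<dots> = (\<integral>\<^sup>+x. ennreal (norm (f x)) \<partial>lborel) * (\<integral>\<^sup>+y. ennreal (norm (g y)) \<partial>lborel)"
    by (simp add: nn_integral_cmult nn_integral_multc)
  also have "\<dots> < \<infinity>"
    using f g by (auto simp: integrable_iff_bounded ennreal_mult_less_top)
  finally show "(\<integral>\<^sup>+p. ennreal (norm (case_prod h p)) \<partial>(lborel \<Otimes>\<^sub>M lborel)) < \<infinity>" .
qed

text \<open>After the substitution \<open>x \<mapsto> x - y\<close> the majorant is a product of functions of one variable
each, to which the product bound applies.\<close>

lemma integrable_pair_convolution:
  fixes b f :: "'a::euclidean_space \<Rightarrow> complex"
  assumes b: "integrable lborel b" and f: "integrable lborel f"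
    and h: "case_prod h \<in> borel_measurable (lborel \<Otimes>\<^sub>M lborel)"
    and le: "\<And>x y. norm (h x y :: complex) \<le> norm (b y) * norm (f (x - y))"
  shows "integrable (lborel \<Otimes>\<^sub>M lborel) (case_prod h)"
proof (rule integrableI_bounded[OF h])
  note [measurable] = borel_measurable_integrable[OF b] borel_measurable_integrable[OF f] h
  have "(\<integral>\<^sup>+p. ennreal (norm (case_prod h p)) \<partial>(lborel \<Otimes>\<^sub>M lborel))
     \<le> (\<integral>\<^sup>+p. ennreal (norm (b (snd p)) * norm (f (fst p - snd p))) \<partial>(lborel \<Otimes>\<^sub>M lborel))"
    by (intro nn_integral_mono ennreal_leI) (auto simp: le)
  also have "\<dots> = (\<integral>\<^sup>+y. \<integral>\<^sup>+x. ennreal (norm (b y)) * ennreal (norm (f (x - y))) \<partial>lborel \<partial>lborel)"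
    by (subst lborel_pair.nn_integral_snd[symmetric]) (auto simp: ennreal_mult)
  also have "\<dots> = (\<integral>\<^sup>+y. ennreal (norm (b y)) \<partial>lborel) * (\<integral>\<^sup>+x. ennreal (norm (f x)) \<partial>lborel)"
    by (simp add: nn_integral_cmult nn_integral_multc nn_integral_shift[of "\<lambda>x. ennreal (norm (f x))"])
  also have "\<dots> < \<infinity>"
    using f b by (auto simp: integrable_iff_bounded ennreal_mult_less_top)
  finally show "(\<integral>\<^sup>+p. ennreal (norm (case_prod h p)) \<partial>(lborel \<Otimes>\<^sub>M lborel)) < \<infinity>" .
qed

section \<open>Gaussians and their Fourier transforms\<close>

lemma integral_Basis_prod:
  fixes f :: "'a::euclidean_space \<Rightarrow> real \<Rightarrow> complex"
  assumes "\<And>b. b \<in> Basis \<Longrightarrow> integrable lborel (f b)"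
  shows "integrable lborel (\<lambda>x::'a. \<Prod>b\<in>Basis. f b (x \<bullet> b))"
    and "(\<integral>x. (\<Prod>b\<in>Basis. f b (x \<bullet> b)) \<partial>(lborel :: 'a measure)) = (\<Prod>b\<in>Basis. \<integral>x. f b x \<partial>lborel)"
proof -
  interpret product_sigma_finite "\<lambda>_::'a. lborel :: real measure" ..
  have m [measurable]: "f b \<in> borel_measurable borel" if "b \<in> Basis" for b
    using borel_measurable_integrable[OF assms[OF that]] by simp
  have [measurable]: "(\<lambda>x::'a. \<Prod>b\<in>Basis. f b (x \<bullet> b)) \<in> borel_measurable borel"
    by measurable
  have [measurable]: "(\<lambda>f. \<Sum>b\<in>Basis. f b *\<^sub>R b) \<in> (\<Pi>\<^sub>M b\<in>Basis. lborel) \<rightarrow>\<^sub>M (borel :: 'a measure)"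
    by measurable
  have eq: "(\<Prod>b\<in>Basis. f b ((\<Sum>b\<in>Basis. x b *\<^sub>R b) \<bullet> b)) = (\<Prod>b\<in>Basis. f b (x b))" for x :: "'a \<Rightarrow> real"
    by (rule prod.cong) auto
  show "integrable lborel (\<lambda>x::'a. \<Prod>b\<in>Basis. f b (x \<bullet> b))"
    unfolding lborel_eq[where 'a='a]
    by (subst integrable_distr_eq) (use product_integrable_prod[OF finite_Basis assms] in \<open>simp_all add: eq\<close>)
  show "(\<integral>x. (\<Prod>b\<in>Basis. f b (x \<bullet> b)) \<partial>(lborel :: 'a measure)) = (\<Prod>b\<in>Basis. \<integral>x. f b x \<partial>lborel)"
    unfolding lborel_eq[where 'a='a]
    by (subst integral_distr) (use product_integral_prod[OF finite_Basis assms] in \<open>simp_all add: eq\<close>)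
qed

definition gauss :: "'a::euclidean_space \<Rightarrow> real" where
  "gauss y = (\<Prod>b\<in>Basis. std_normal_density (y \<bullet> b))"

lemma gauss_eq: "gauss (y::'a::euclidean_space) = (1 / sqrt (2 * pi)) ^ DIM('a) * exp (- (y \<bullet> y) / 2)"
proof -
  have "- (y \<bullet> y) / 2 = (\<Sum>b\<in>Basis. - (y \<bullet> b)\<^sup>2 / 2)"
    by (subst euclidean_inner) (simp add: sum_negf sum_divide_distrib power2_eq_square)
  then have "exp (- (y \<bullet> y) / 2) = (\<Prod>b\<in>Basis. exp (- (y \<bullet> b)\<^sup>2 / 2))"
    by (simp only: exp_sum[OF finite_Basis])
  then show ?thesis
    unfolding gauss_def std_normal_density_def prod.distrib by (simp only: prod_constant)
qed

lemma gauss_pos: "gauss y > 0"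
  unfolding gauss_def by (intro prod_pos ballI normal_density_pos) simp

lemma cis_sum: "cis (\<Sum>i\<in>I. g i) = (\<Prod>i\<in>I. cis (g i))"
  by (induction I rule: infinite_finite_induct) (simp_all add: cis_mult[symmetric])

lemma cis_inner_prod: "cis (u \<bullet> y) = (\<Prod>b\<in>Basis. cis ((u \<bullet> b) * (y \<bullet> b)))"
  unfolding cis_sum[symmetric] by (rule arg_cong[where f=cis]) (rule euclidean_inner)

lemma std_normal_cis:
  "integrable lborel (\<lambda>x. of_real (std_normal_density x) * cis (t * x))"
  "(\<integral>x. of_real (std_normal_density x) * cis (t * x) \<partial>lborel) = of_real (exp (- t\<^sup>2 / 2))"
proof -
  have "integrable lborel (\<lambda>x. complex_of_real (std_normal_density x))"
    by (intro integrable_of_real integrable_normal_density) simp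
  then show "integrable lborel (\<lambda>x. of_real (std_normal_density x) * cis (t * x))"
    by (rule Bochner_Integration.integrable_bound) (auto simp: norm_mult)
  have "of_real (exp (- t\<^sup>2 / 2)) = char std_normal_distribution t"
    by (simp add: char_std_normal_distribution)
  also have "\<dots> = (\<integral>x. std_normal_density x *\<^sub>R iexp (t * x) \<partial>lborel)"
    unfolding char_def by (subst integral_density) (auto simp: normal_density_nonneg)
  also have "\<dots> = (\<integral>x. of_real (std_normal_density x) * cis (t * x) \<partial>lborel)"
    by (simp add: scaleR_conv_of_real cis_conv_exp)
  finally show "(\<integral>x. of_real (std_normal_density x) * cis (t * x) \<partial>lborel) = of_real (exp (- t\<^sup>2 / 2))" ..
qed

text \<open>Product over the coordinates of the characteristic function of the standard normal
distribution.\<close>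

lemma gauss_cis:
  fixes u :: "'a::euclidean_space"
  shows "integrable lborel (\<lambda>y. of_real (gauss y) * cis (u \<bullet> y))"
    and "(\<integral>y. of_real (gauss y) * cis (u \<bullet> y) \<partial>lborel) = of_real (exp (- (u \<bullet> u) / 2))"
proof -
  have eq: "(\<lambda>y. of_real (gauss y) * cis (u \<bullet> y)) =
    (\<lambda>y. \<Prod>b\<in>Basis. of_real (std_normal_density (y \<bullet> b)) * cis ((u \<bullet> b) * (y \<bullet> b)))"
    by (simp add: gauss_def cis_inner_prod prod.distrib)
  show "integrable lborel (\<lambda>y. of_real (gauss y) * cis (u \<bullet> y))"
    unfolding eq
    using integral_Basis_prod(1)[of "\<lambda>b x. of_real (std_normal_density x) * cis ((u \<bullet> b) * x)"] std_normal_cis(1) by simp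
  have "- (u \<bullet> u) / 2 = (\<Sum>b\<in>Basis. - (u \<bullet> b)\<^sup>2 / 2)"
    by (subst euclidean_inner) (simp add: sum_negf sum_divide_distrib power2_eq_square)
  then have "complex_of_real (exp (- (u \<bullet> u) / 2)) = (\<Prod>b\<in>Basis. of_real (exp (- (u \<bullet> b)\<^sup>2 / 2)))"
    by (simp add: exp_sum of_real_prod[symmetric] del: of_real_prod minus_divide_left)
  moreover have "(\<integral>y. (\<Prod>b\<in>Basis. of_real (std_normal_density (y \<bullet> b)) * cis ((u \<bullet> b) * (y \<bullet> b))) \<partial>(lborel :: 'a measure))
    = (\<Prod>b\<in>Basis. \<integral>x. of_real (std_normal_density x) * cis ((u \<bullet> b) * x) \<partial>lborel)"
    by (rule integral_Basis_prod(2)[of "\<lambda>b x. of_real (std_normal_density x) * cis ((u \<bullet> b) * x)"])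
       (rule std_normal_cis(1))
  ultimately show "(\<integral>y. of_real (gauss y) * cis (u \<bullet> y) \<partial>lborel) = of_real (exp (- (u \<bullet> u) / 2))"
    unfolding eq std_normal_cis(2) by metis
qed

lemma gauss_measurable [measurable]: "(gauss :: 'a::euclidean_space \<Rightarrow> real) \<in> borel_measurable borel"
proof -
  have "(\<lambda>y::'a. (1 / sqrt (2 * pi)) ^ DIM('a) * exp (- (y \<bullet> y) / 2)) \<in> borel_measurable borel"
    by measurable
  then show ?thesis by (simp only: gauss_eq[symmetric])
qed

lemma gauss_integrable: "integrable lborel (gauss :: 'a::euclidean_space \<Rightarrow> real)"
proof -
  have "integrable lborel (\<lambda>y::'a. complex_of_real (gauss y))"
    using gauss_cis(1)[of "0::'a"] by simp
  then show ?thesis by (subst (asm) complex_of_real_integrable_eq)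
qed

lemma gauss_integral: "(\<integral>y. gauss y \<partial>(lborel :: 'a::euclidean_space measure)) = 1"
proof -
  have "complex_of_real (\<integral>y. gauss y \<partial>(lborel :: 'a measure)) = 1"
    using gauss_cis(2)[of "0::'a"] 
    unfolding inner_zero_left cis_zero mult_1_right integral_complex_of_real minus_zero div_0 exp_zero of_real_1 .
  then show ?thesis by (simp only: of_real_eq_1_iff)
qed

lemma gauss_nn_integral: "(\<integral>\<^sup>+y. ennreal (gauss y) \<partial>(lborel :: 'a::euclidean_space measure)) = 1"
proof -
  have "AE y in lborel. 0 \<le> gauss (y :: 'a)" by (intro AE_I2 less_imp_le gauss_pos)
  from nn_integral_eq_integral[OF gauss_integrable this] show ?thesis by (simp add: gauss_integral)
qed

text \<open>The characteristic function of the standard normal distribution at \<open>2 \<pi> \<epsilon> s\<close>.  As a multiplier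
on the Fourier side it makes every bounded transform integrable; on the other side it averages against a normal
density of scale \<open>\<epsilon>\<close>, and \<open>\<epsilon> \<rightarrow> 0\<close> removes it.\<close>

definition damp :: "real \<Rightarrow> 'a::euclidean_space \<Rightarrow> real" where
  "damp \<epsilon> s = exp (- ((2 * pi * \<epsilon>) *\<^sub>R s \<bullet> (2 * pi * \<epsilon>) *\<^sub>R s) / 2)"

lemma damp_gauss: "damp \<epsilon> (s::'a::euclidean_space) = sqrt (2 * pi) ^ DIM('a) * gauss ((2 * pi * \<epsilon>) *\<^sub>R s)"
  by (simp add: damp_def gauss_eq power_divide)

lemma damp_measurable [measurable]: "damp \<epsilon> \<in> borel_measurable borel"
  unfolding damp_def[abs_def] by measurable

lemma damp_bounds: "0 < damp \<epsilon> s" "damp \<epsilon> s \<le> 1"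
  unfolding damp_def using inner_ge_zero[of "(2 * pi * \<epsilon>) *\<^sub>R s"]
  by (auto simp del: inner_scaleR_left inner_scaleR_right)

lemma damp_integrable: "\<epsilon> > 0 \<Longrightarrow> integrable lborel (damp \<epsilon> :: 'a::euclidean_space \<Rightarrow> real)"
  using integrable_affine[OF gauss_integrable, of "2 * pi * \<epsilon>" "0::'a"]
  unfolding damp_gauss[abs_def] by simp

lemma damp_cis:
  fixes z :: "'a::euclidean_space"
  assumes e: "\<epsilon> > 0"
  shows "(\<integral>s. of_real (damp \<epsilon> s) * cis (2 * pi * (s \<bullet> z)) \<partial>lborel) = of_real (gauss ((1 / \<epsilon>) *\<^sub>R z) / \<epsilon> ^ DIM('a))"
proof -
  let ?c = "2 * pi * \<epsilon>"
  let ?k = "sqrt (2 * pi) ^ DIM('a)"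
  have c: "?c > 0" using e by simp
  have solve: "J = of_real (q / p) * G" if "p > 0" "q > 0" "G = (p / q) *\<^sub>R J" for p q :: real and G J :: complex
    using that by (simp add: scaleR_conv_of_real)
  have "(\<integral>s. of_real (gauss s) * cis (((1 / \<epsilon>) *\<^sub>R z) \<bullet> s) \<partial>lborel)
     = \<bar>?c\<bar> ^ DIM('a) *\<^sub>R (\<integral>s. of_real (gauss (0 + ?c *\<^sub>R s)) * cis (((1 / \<epsilon>) *\<^sub>R z) \<bullet> (0 + ?c *\<^sub>R s)) \<partial>lborel)"
    by (rule integral_affine) (use e in simp)
  also have "\<dots> = (?c ^ DIM('a) / ?k) *\<^sub>R (\<integral>s. of_real (damp \<epsilon> s) * cis (2 * pi * (s \<bullet> z)) \<partial>lborel)"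
  proof -
    have "of_real (damp \<epsilon> s) * cis (2 * pi * (s \<bullet> z)) 
       = of_real ?k * (of_real (gauss (0 + ?c *\<^sub>R s)) * cis (((1 / \<epsilon>) *\<^sub>R z) \<bullet> (0 + ?c *\<^sub>R s)))" for s
      using e by (simp add: damp_gauss inner_commute field_simps)
    then show ?thesis using c by (simp add: scaleR_conv_of_real del: of_real_power)
  qed
  finally have "(\<integral>s. of_real (damp \<epsilon> s) * cis (2 * pi * (s \<bullet> z)) \<partial>lborel) = 
     of_real (?k / ?c ^ DIM('a)) * of_real (exp (- (((1 / \<epsilon>) *\<^sub>R z) \<bullet> ((1 / \<epsilon>) *\<^sub>R z)) / 2))"
    unfolding gauss_cis(2) by (rule solve[rotated 2]) (use c in auto)
  then have "(\<integral>s. of_real (damp \<epsilon> s) * cis (2 * pi * (s \<bullet> z)) \<partial>lborel) = 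
     of_real (?k / ?c ^ DIM('a) * exp (- (((1 / \<epsilon>) *\<^sub>R z) \<bullet> ((1 / \<epsilon>) *\<^sub>R z)) / 2))"
    by (simp only: of_real_mult)
  also have "?k / ?c ^ DIM('a) * exp (- (((1 / \<epsilon>) *\<^sub>R z) \<bullet> ((1 / \<epsilon>) *\<^sub>R z)) / 2) = gauss ((1 / \<epsilon>) *\<^sub>R z) / \<epsilon> ^ DIM('a)"
  proof -
    define r where "r = sqrt (2 * pi)"
    have r: "r > 0" "2 * pi = r * r"
      using real_sqrt_mult_self[of "2 * pi"] unfolding r_def by auto
    have "r ^ DIM('a) / (r * r * \<epsilon>) ^ DIM('a) = (r / (r * r * \<epsilon>)) ^ DIM('a)"
      by (simp only: power_divide)
    also have "r / (r * r * \<epsilon>) = (1 / r) / \<epsilon>" using r(1) by simp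
    also have "((1 / r) / \<epsilon>) ^ DIM('a) = (1 / r) ^ DIM('a) / \<epsilon> ^ DIM('a)" by (simp only: power_divide)
    finally have "?k / ?c ^ DIM('a) = (1 / sqrt (2 * pi)) ^ DIM('a) / \<epsilon> ^ DIM('a)"
      unfolding r(2)[symmetric] unfolding r_def .
    then show ?thesis by (simp only: gauss_eq times_divide_eq_left)
  qed
  finally show ?thesis .
qed

section \<open>Fourier inversion and Bessel's inequality\<close>

lemma fourier_measurable [measurable]:
  assumes [measurable]: "f \<in> borel_measurable borel"
  shows "fourier f \<in> borel_measurable borel"
proof -
  have "(\<lambda>s. LINT t|lborel. f t * cis (- (2 * pi * (s \<bullet> t)))) \<in> borel_measurable lborel"
    by (rule lborel.borel_measurable_lebesgue_integral) measurable
  then show ?thesis by (simp add: fourier_def[abs_def])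
qed

lemma integrable_cis:
  assumes "integrable lborel f" "h \<in> borel_measurable borel"
  shows "integrable lborel (\<lambda>t. f t * cis (h t))"
  by (rule Bochner_Integration.integrable_bound[OF assms(1)])
     (use assms in \<open>auto simp: norm_mult\<close>)

lemma fourier_bound:
  assumes "integrable lborel f" shows "cmod (fourier f s) \<le> (\<integral>t. cmod (f t) \<partial>lborel)"
  unfolding fourier_def
  by (rule order_trans[OF integral_norm_bound]) (simp add: norm_mult)

text \<open>Inserting the definition of the transform and exchanging the integrals leaves the inverse
transform of \<open>damp \<epsilon>\<close>, which is a rescaled Gaussian.  With the damping the exchange is covered by Fubini's theorem.\<close>

lemma gauss_inversion:
  fixes f :: "'n::finite cfun"
  assumes f: "integrable lborel f" and e: "\<epsilon> > 0"
  shows "(\<integral>s. fourier f s * of_real (damp \<epsilon> s) * cis (2 * pi * (s \<bullet> x)) \<partial>lborel)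
     = (\<integral>y. f (x - \<epsilon> *\<^sub>R y) * of_real (gauss y) \<partial>lborel)"
proof -
  note [measurable] = borel_measurable_integrable[OF f]
  let ?h = "\<lambda>t s. f t * (of_real (damp \<epsilon> s) * cis (2 * pi * (s \<bullet> (x - t))))"
  have int: "integrable (lborel \<Otimes>\<^sub>M lborel) (case_prod ?h)"
    by (rule integrable_pair_bound[OF f damp_integrable[OF e]]) 
       (auto simp: norm_mult less_imp_le[OF damp_bounds(1)])
  have "(\<integral>s. fourier f s * of_real (damp \<epsilon> s) * cis (2 * pi * (s \<bullet> x)) \<partial>lborel)
    = (\<integral>s. \<integral>t. ?h t s \<partial>lborel \<partial>lborel)"
  proof (rule Bochner_Integration.integral_cong[OF refl])
    fix s
    have "fourier f s * of_real (damp \<epsilon> s) * cis (2 * pi * (s \<bullet> x)) =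
      (\<integral>t. f t * cis (- (2 * pi * (s \<bullet> t))) * (of_real (damp \<epsilon> s) * cis (2 * pi * (s \<bullet> x))) \<partial>lborel)"
      unfolding fourier_def by (simp only: integral_mult_left_zero) (simp only: mult.assoc)
    also have "\<dots> = (\<integral>t. ?h t s \<partial>lborel)"
    proof -
      have "cis (2 * pi * (s \<bullet> (x - t))) = cis (- (2 * pi * (s \<bullet> t))) * cis (2 * pi * (s \<bullet> x))" for t
        by (simp add: cis_mult inner_diff_right algebra_simps)
      then show ?thesis by (simp add: mult_ac)
    qed
    finally show "fourier f s * of_real (damp \<epsilon> s) * cis (2 * pi * (s \<bullet> x)) = (\<integral>t. ?h t s \<partial>lborel)" .
  qed
  also have "\<dots> = (\<integral>t. \<integral>s. ?h t s \<partial>lborel \<partial>lborel)"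
    using lborel_pair.Fubini_integral[OF int] by simp
  also have "\<dots> = (\<integral>t. f t * of_real (gauss ((1 / \<epsilon>) *\<^sub>R (x - t)) / \<epsilon> ^ CARD('n)) \<partial>lborel)"
    by (simp only: integral_mult_right_zero damp_cis[OF e] DIM_cart DIM_real mult_1_right)
  also have "\<dots> = \<bar>- \<epsilon>\<bar> ^ DIM(real^'n) *\<^sub>R (\<integral>y. f (x + (- \<epsilon>) *\<^sub>R y) * of_real (gauss ((1 / \<epsilon>) *\<^sub>R (x - (x + (- \<epsilon>) *\<^sub>R y))) / \<epsilon> ^ CARD('n)) \<partial>lborel)"
    by (rule integral_affine) (use e in simp)
  also have "\<dots> = (\<integral>y. f (x - \<epsilon> *\<^sub>R y) * of_real (gauss y) \<partial>lborel)"
  proof -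
    have "f (x + (- \<epsilon>) *\<^sub>R y) * of_real (gauss ((1 / \<epsilon>) *\<^sub>R (x - (x + (- \<epsilon>) *\<^sub>R y))) / \<epsilon> ^ CARD('n))
      = (f (x - \<epsilon> *\<^sub>R y) * of_real (gauss y)) * of_real (1 / \<epsilon> ^ CARD('n))" for y
      using e by simp
    note eq = this
    have gen: "\<bar>- \<epsilon>\<bar> ^ DIM(real^'n) *\<^sub>R (J * of_real (1 / \<epsilon> ^ CARD('n))) = J" for J :: complex
      using e by (simp add: scaleR_conv_of_real)
    show ?thesis by (simp only: eq gen integral_mult_left_zero)
  qed
  finally show ?thesis .
qed

lemma damp_lim: "(\<lambda>n. damp (1 / Suc n) s) \<longlonglongrightarrow> 1"
proof -
  have "(\<lambda>n. exp (- (((2 * pi * (1 / Suc n)) *\<^sub>R s) \<bullet> ((2 * pi * (1 / Suc n)) *\<^sub>R s)) / 2)) 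
     \<longlonglongrightarrow> exp (- (((2 * pi * 0) *\<^sub>R s) \<bullet> ((2 * pi * 0) *\<^sub>R s)) / 2)"
    by (intro tendsto_intros) (use LIMSEQ_Suc[OF lim_inverse_n'] in \<open>auto simp: field_simps\<close>)
  then show ?thesis by (simp add: damp_def)
qed

lemma damped_transform_lim:
  fixes g :: "'n::finite cfun"
  assumes g: "integrable lborel g"
  shows "(\<lambda>n. \<integral>s. g s * of_real (damp (1 / Suc n) s) * cis (2 * pi * (s \<bullet> x)) \<partial>lborel)
    \<longlonglongrightarrow> (\<integral>s. g s * cis (2 * pi * (s \<bullet> x)) \<partial>lborel)"
proof (rule integral_dominated_convergence[where w="\<lambda>s. cmod (g s)"])
  note [measurable] = borel_measurable_integrable[OF g]
  show "(\<lambda>s. g s * cis (2 * pi * (s \<bullet> x))) \<in> borel_measurable lborel" by measurable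
  show "(\<lambda>s. g s * of_real (damp (1 / Suc n) s) * cis (2 * pi * (s \<bullet> x))) \<in> borel_measurable lborel" for n by measurable
  show "integrable lborel (\<lambda>s. cmod (g s))" using g by simp
  have "(\<lambda>n. g s * of_real (damp (1 / Suc n) s) * cis (2 * pi * (s \<bullet> x))) \<longlonglongrightarrow> g s * of_real 1 * cis (2 * pi * (s \<bullet> x))" for s
    by (intro tendsto_intros damp_lim)
  then show "AE s in lborel. (\<lambda>n. g s * of_real (damp (1 / Suc n) s) * cis (2 * pi * (s \<bullet> x))) \<longlonglongrightarrow> g s * cis (2 * pi * (s \<bullet> x))"
    by simp
  show "AE s in lborel. norm (g s * of_real (damp (1 / Suc n) s) * cis (2 * pi * (s \<bullet> x))) \<le> cmod (g s)" for n
    by (intro AE_I2) (auto simp: norm_mult abs_of_pos[OF damp_bounds(1)] intro!: mult_left_le damp_bounds(2))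
qed

text \<open>Both sides of \<open>gauss_inversion\<close> converge as the damping is removed: the averages of \<open>f\<close> to \<open>f x\<close>
by continuity and boundedness, the transform side by dominated convergence.\<close>

theorem fourier_inversion:
  fixes f :: "'n::finite cfun"
  assumes f: "integrable lborel f" and c: "continuous_on UNIV f" and B: "\<And>x. cmod (f x) \<le> B"
    and F: "integrable lborel (fourier f)"
  shows "f x = (\<integral>s. fourier f s * cis (2 * pi * (s \<bullet> x)) \<partial>lborel)"
proof (rule LIMSEQ_unique)
  note [measurable] = borel_measurable_integrable[OF f]
  show "(\<lambda>n. \<integral>y. f (x - (1 / Suc n) *\<^sub>R y) * of_real (gauss y) \<partial>lborel) \<longlonglongrightarrow> (\<integral>s. fourier f s * cis (2 * pi * (s \<bullet> x)) \<partial>lborel)"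
    using damped_transform_lim[OF F, of x] by (simp add: gauss_inversion[OF f])
  have "(\<lambda>n. \<integral>y. f (x - (1 / Suc n) *\<^sub>R y) * of_real (gauss y) \<partial>lborel) \<longlonglongrightarrow> (\<integral>y. f x * of_real (gauss y) \<partial>(lborel :: (real^'n) measure))"
  proof (rule integral_dominated_convergence[where w="\<lambda>y::real^'n. B * gauss y"])
    show "integrable lborel (\<lambda>y::real^'n. B * gauss y)" by (intro integrable_mult_right gauss_integrable)
    have "(\<lambda>n. x - (1 / Suc n) *\<^sub>R y) \<longlonglongrightarrow> x - 0 *\<^sub>R y" for y
      by (intro tendsto_intros) (use LIMSEQ_Suc[OF lim_inverse_n'] in \<open>auto simp: field_simps\<close>)
    then have "(\<lambda>n. f (x - (1 / Suc n) *\<^sub>R y)) \<longlonglongrightarrow> f x" for y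
      using continuous_on_tendsto_compose[OF c, of "\<lambda>n. x - (1 / Suc n) *\<^sub>R y" x sequentially] by simp
    then show "AE y in lborel. (\<lambda>n. f (x - (1 / Suc n) *\<^sub>R y) * of_real (gauss y)) \<longlonglongrightarrow> f x * of_real (gauss y)"
      by (intro AE_I2 tendsto_intros)
    show "AE y in lborel. norm (f (x - (1 / Suc n) *\<^sub>R y) * of_real (gauss y)) \<le> B * gauss y" for n
      using B by (intro AE_I2) (auto simp: norm_mult abs_of_pos[OF gauss_pos] intro!: mult_right_mono less_imp_le[OF gauss_pos])
  qed auto
  also have "(\<integral>y. f x * of_real (gauss y) \<partial>(lborel :: (real^'n) measure)) = f x * of_real (\<integral>y. gauss y \<partial>(lborel :: (real^'n) measure))"
    by simp
  finally show "(\<lambda>n. \<integral>y. f (x - (1 / Suc n) *\<^sub>R y) * of_real (gauss y) \<partial>lborel) \<longlonglongrightarrow> f x"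
    by (simp add: gauss_integral)
qed

text \<open>As \<open>h\<close> need not be continuous, it is not recovered at every point, but the Gaussian averages of \<open>h\<close> have
\<open>L\<^sup>1\<close> norm at most that of \<open>h\<close> and converge everywhere to the reflected double transform, so Fatou's
lemma bounds the latter.\<close>

lemma integrable_fourier_fourier:
  fixes h :: "'n::finite cfun"
  assumes h: "integrable lborel h" and F: "integrable lborel (fourier h)"
  shows "integrable lborel (fourier (fourier h))"
proof -
  note [measurable] = borel_measurable_integrable[OF h]
  let ?L = "\<lambda>n x. \<integral>y. h (x - (1 / Suc n) *\<^sub>R y) * of_real (gauss y) \<partial>lborel"
  have lim: "(\<lambda>n. ?L n x) \<longlonglongrightarrow> fourier (fourier h) (- x)" for x
    using damped_transform_lim[OF F, of x] unfolding gauss_inversion[OF h]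
    by (simp add: gauss_inversion[OF h] fourier_def[of "fourier h"] inner_commute)
  have L_m [measurable]: "?L n \<in> borel_measurable borel" for n
  proof -
    have "?L n \<in> borel_measurable lborel"
      by (rule lborel.borel_measurable_lebesgue_integral) measurable
    then show ?thesis by simp
  qed
  have L_b: "(\<integral>\<^sup>+x. ennreal (cmod (?L n x)) \<partial>lborel) \<le> (\<integral>\<^sup>+x. ennreal (cmod (h x)) \<partial>lborel)" for n
  proof -
    have "(\<integral>\<^sup>+x. ennreal (cmod (?L n x)) \<partial>lborel) \<le> (\<integral>\<^sup>+x. \<integral>\<^sup>+y. ennreal (cmod (h (x - (1 / Suc n) *\<^sub>R y))) * ennreal (gauss y) \<partial>lborel \<partial>lborel)"
    proof (rule nn_integral_mono)
      fix x
      have "ennreal (cmod (?L n x)) \<le> (\<integral>\<^sup>+y. ennreal (norm (h (x - (1 / Suc n) *\<^sub>R y) * of_real (gauss y))) \<partial>lborel)"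
        by (cases "integrable lborel (\<lambda>y. h (x - (1 / Suc n) *\<^sub>R y) * complex_of_real (gauss y))")
           (auto intro: integral_norm_bound_ennreal simp: not_integrable_integral_eq)
      also have "\<dots> = (\<integral>\<^sup>+y. ennreal (cmod (h (x - (1 / Suc n) *\<^sub>R y))) * ennreal (gauss y) \<partial>lborel)"
        by (intro nn_integral_cong) (simp add: norm_mult ennreal_mult less_imp_le[OF gauss_pos])
      finally show "ennreal (cmod (?L n x)) \<le> (\<integral>\<^sup>+y. ennreal (cmod (h (x - (1 / Suc n) *\<^sub>R y))) * ennreal (gauss y) \<partial>lborel)" .
    qed
    also have "\<dots> = (\<integral>\<^sup>+y. \<integral>\<^sup>+x. ennreal (cmod (h (x - (1 / Suc n) *\<^sub>R y))) * ennreal (gauss y) \<partial>lborel \<partial>lborel)"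
      by (rule lborel_pair.Fubini') measurable
    also have "\<dots> = (\<integral>\<^sup>+x. ennreal (cmod (h x)) \<partial>lborel)"
      by (simp add: nn_integral_multc nn_integral_cmult gauss_nn_integral nn_integral_shift[of "\<lambda>x. ennreal (cmod (h x))"])
    finally show ?thesis .
  qed
  have "(\<integral>\<^sup>+x. ennreal (cmod (fourier (fourier h) (- x))) \<partial>lborel) = (\<integral>\<^sup>+x. liminf (\<lambda>n. ennreal (cmod (?L n x))) \<partial>lborel)"
  proof (rule nn_integral_cong)
    fix x
    have "(\<lambda>n. ennreal (cmod (?L n x))) \<longlonglongrightarrow> ennreal (cmod (fourier (fourier h) (- x)))"
      by (intro tendsto_ennrealI tendsto_norm lim)
    from lim_imp_Liminf[OF _ this] show "ennreal (cmod (fourier (fourier h) (- x))) = liminf (\<lambda>n. ennreal (cmod (?L n x)))" by simp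
  qed
  also have "\<dots> \<le> liminf (\<lambda>n. \<integral>\<^sup>+x. ennreal (cmod (?L n x)) \<partial>lborel)"
    by (rule nn_integral_liminf) measurable
  also have "\<dots> \<le> liminf (\<lambda>n::nat. (\<integral>\<^sup>+x. ennreal (cmod (h x)) \<partial>lborel))"
    by (intro Liminf_mono always_eventually allI L_b)
  also have "\<dots> < \<infinity>" using h by (simp add: integrable_iff_bounded Liminf_const)
  finally have "integrable lborel (\<lambda>x. fourier (fourier h) (- x))"
    by (intro integrableI_bounded) auto
  then show ?thesis by (simp add: integrable_uminus_iff)
qed

text \<open>One half of Plancherel's theorem.  With damping, the left side is the integral of \<open>f\<close> against one of its
Gaussian averages, which is at most the squared \<open>L\<^sup>2\<close> norm because translation preserves that norm;
Fatou's lemma removes the damping.  The right side may be infinite.\<close>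

lemma bessel_inequality:
  fixes f :: "'n::finite cfun"
  assumes f: "integrable lborel f"
  shows "(\<integral>\<^sup>+s. ennreal ((cmod (fourier f s))\<^sup>2) \<partial>lborel) \<le> (\<integral>\<^sup>+t. ennreal ((cmod (f t))\<^sup>2) \<partial>lborel)"
proof -
  note [measurable] = borel_measurable_integrable[OF f]
  let ?N = "\<integral>\<^sup>+t. ennreal ((cmod (f t))\<^sup>2) \<partial>lborel"
  have damped: "(\<integral>\<^sup>+s. ennreal ((cmod (fourier f s))\<^sup>2 * damp \<epsilon> s) \<partial>lborel) \<le> ?N" if e: "\<epsilon> > 0" for \<epsilon>
  proof -
    let ?h = "\<lambda>s t. fourier f s * of_real (damp \<epsilon> s) * cis (2 * pi * (s \<bullet> t)) * cnj (f t)"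
    have Fd: "integrable lborel (\<lambda>s. fourier f s * complex_of_real (damp \<epsilon> s))"
    proof (rule Bochner_Integration.integrable_bound)
      show "integrable lborel (\<lambda>s::real^'n. (\<integral>t. cmod (f t) \<partial>lborel) * damp \<epsilon> s)"
        by (intro integrable_mult_right damp_integrable e)
      show "AE s in lborel. norm (fourier f s * complex_of_real (damp \<epsilon> s)) \<le> norm ((\<integral>t. cmod (f t) \<partial>lborel) * damp \<epsilon> s)"
        using fourier_bound[OF f]
        by (intro AE_I2) (auto simp: norm_mult abs_mult abs_of_pos[OF damp_bounds(1)] 
          intro!: mult_right_mono less_imp_le[OF damp_bounds(1)] order_trans[OF _ abs_ge_self])
    qed measurable
    have int: "integrable (lborel \<Otimes>\<^sub>M lborel) (case_prod ?h)"
      by (rule integrable_pair_bound[OF Fd f]) (auto simp: norm_mult)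
    have cnjF: "cnj (fourier f s) = (\<integral>t. cis (2 * pi * (s \<bullet> t)) * cnj (f t) \<partial>lborel)" for s
      unfolding fourier_def by (subst Bochner_Integration.integral_cnj[symmetric]) (simp add: cis_cnj mult.commute)
    have sq: "integrable lborel (\<lambda>s. (cmod (fourier f s))\<^sup>2 * damp \<epsilon> s)"
    proof (rule Bochner_Integration.integrable_bound)
      show "integrable lborel (\<lambda>s::real^'n. (\<integral>t. cmod (f t) \<partial>lborel)\<^sup>2 * damp \<epsilon> s)"
        by (intro integrable_mult_right damp_integrable e)
      show "AE s in lborel. norm ((cmod (fourier f s))\<^sup>2 * damp \<epsilon> s) \<le> norm ((\<integral>t. cmod (f t) \<partial>lborel)\<^sup>2 * damp \<epsilon> s)"
        using fourier_bound[OF f]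
        by (intro AE_I2) (auto simp: abs_mult abs_of_pos[OF damp_bounds(1)] intro!: mult_right_mono power_mono less_imp_le[OF damp_bounds(1)])
    qed measurable
    have "complex_of_real (\<integral>s. (cmod (fourier f s))\<^sup>2 * damp \<epsilon> s \<partial>lborel)
       = (\<integral>s. complex_of_real ((cmod (fourier f s))\<^sup>2 * damp \<epsilon> s) \<partial>lborel)" 
      by (rule integral_complex_of_real[symmetric])
    also have "\<dots> = (\<integral>s. \<integral>t. ?h s t \<partial>lborel \<partial>lborel)"
    proof (rule Bochner_Integration.integral_cong[OF refl])
      fix s
      have "complex_of_real ((cmod (fourier f s))\<^sup>2 * damp \<epsilon> s) = fourier f s * of_real (damp \<epsilon> s) * cnj (fourier f s)"
        by (simp only: of_real_mult of_real_power[symmetric] complex_norm_square mult_ac)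
      also have "\<dots> = (\<integral>t. ?h s t \<partial>lborel)"
        unfolding cnjF by (simp add: mult.assoc)
      finally show "complex_of_real ((cmod (fourier f s))\<^sup>2 * damp \<epsilon> s) = (\<integral>t. ?h s t \<partial>lborel)" .
    qed
    also have "\<dots> = (\<integral>t. \<integral>s. ?h s t \<partial>lborel \<partial>lborel)"
      using lborel_pair.Fubini_integral[OF int] by simp
    also have "\<dots> = (\<integral>t. (\<integral>y. f (t - \<epsilon> *\<^sub>R y) * of_real (gauss y) \<partial>lborel) * cnj (f t) \<partial>lborel)"
      using gauss_inversion[OF f e] by simp
    finally have eq: "complex_of_real (\<integral>s. (cmod (fourier f s))\<^sup>2 * damp \<epsilon> s \<partial>lborel) = \<dots>" .
    have "ennreal (cmod \<dots>) \<le> (\<integral>\<^sup>+t. ennreal (cmod ((\<integral>y. f (t - \<epsilon> *\<^sub>R y) * of_real (gauss y) \<partial>lborel) * cnj (f t))) \<partial>lborel)"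
      by (cases "integrable lborel (\<lambda>t. (\<integral>y. f (t - \<epsilon> *\<^sub>R y) * of_real (gauss y) \<partial>lborel) * cnj (f t))")
         (auto intro: integral_norm_bound_ennreal simp: not_integrable_integral_eq)
    also have "\<dots> \<le> (\<integral>\<^sup>+t. \<integral>\<^sup>+y. (ennreal ((cmod (f t))\<^sup>2 / 2) + ennreal ((cmod (f (t - \<epsilon> *\<^sub>R y)))\<^sup>2 / 2)) * ennreal (gauss y) \<partial>lborel \<partial>lborel)"
    proof (rule nn_integral_mono)
      fix t
      have "ennreal (cmod ((\<integral>y. f (t - \<epsilon> *\<^sub>R y) * of_real (gauss y) \<partial>lborel) * cnj (f t)))
        = ennreal (cmod (\<integral>y. f (t - \<epsilon> *\<^sub>R y) * of_real (gauss y) * cnj (f t) \<partial>lborel))"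
        by simp
      also have "\<dots> \<le> (\<integral>\<^sup>+y. ennreal (cmod (f (t - \<epsilon> *\<^sub>R y) * of_real (gauss y) * cnj (f t))) \<partial>lborel)"
        by (cases "integrable lborel (\<lambda>y. f (t - \<epsilon> *\<^sub>R y) * of_real (gauss y) * cnj (f t))")
         (auto intro: integral_norm_bound_ennreal simp: not_integrable_integral_eq simp del: integral_mult_left_zero)
      also have "\<dots> \<le> (\<integral>\<^sup>+y. (ennreal ((cmod (f t))\<^sup>2 / 2) + ennreal ((cmod (f (t - \<epsilon> *\<^sub>R y)))\<^sup>2 / 2)) * ennreal (gauss y) \<partial>lborel)"
      proof (rule nn_integral_mono)
        fix y
        (* Arithmetic-geometric mean: by translation invariance each of the two squares integrates to
           half of the squared norm of f. *)
        have "2 * (cmod (f (t - \<epsilon> *\<^sub>R y)) * cmod (f t)) \<le> (cmod (f t))\<^sup>2 + (cmod (f (t - \<epsilon> *\<^sub>R y)))\<^sup>2"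
          using sum_squares_bound[of "cmod (f t)" "cmod (f (t - \<epsilon> *\<^sub>R y))"] by (simp add: mult.assoc mult.commute)
        then have "cmod (f (t - \<epsilon> *\<^sub>R y)) * cmod (f t) * gauss y \<le> ((cmod (f t))\<^sup>2 / 2 + (cmod (f (t - \<epsilon> *\<^sub>R y)))\<^sup>2 / 2) * gauss y"
          using gauss_pos[of y] by (intro mult_right_mono) auto
        then have "ennreal (cmod (f (t - \<epsilon> *\<^sub>R y) * of_real (gauss y) * cnj (f t))) \<le> ennreal (((cmod (f t))\<^sup>2 / 2 + (cmod (f (t - \<epsilon> *\<^sub>R y)))\<^sup>2 / 2) * gauss y)"
          by (intro ennreal_leI) (simp add: norm_mult mult_ac abs_of_pos[OF gauss_pos])
        also have "\<dots> = (ennreal ((cmod (f t))\<^sup>2 / 2) + ennreal ((cmod (f (t - \<epsilon> *\<^sub>R y)))\<^sup>2 / 2)) * ennreal (gauss y)"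
          by (simp add: ennreal_mult less_imp_le[OF gauss_pos] flip: ennreal_plus)
        finally show "ennreal (cmod (f (t - \<epsilon> *\<^sub>R y) * of_real (gauss y) * cnj (f t))) \<le> \<dots>" .
      qed
      finally show "ennreal (cmod ((\<integral>y. f (t - \<epsilon> *\<^sub>R y) * of_real (gauss y) \<partial>lborel) * cnj (f t))) \<le> \<dots>" .
    qed
    also have "\<dots> = (\<integral>\<^sup>+y. \<integral>\<^sup>+t. (ennreal ((cmod (f t))\<^sup>2 / 2) + ennreal ((cmod (f (t - \<epsilon> *\<^sub>R y)))\<^sup>2 / 2)) * ennreal (gauss y) \<partial>lborel \<partial>lborel)"
      by (rule lborel_pair.Fubini') measurable
    also have "\<dots> = ((\<integral>\<^sup>+t. ennreal ((cmod (f t))\<^sup>2 / 2) \<partial>lborel) + (\<integral>\<^sup>+t. ennreal ((cmod (f t))\<^sup>2 / 2) \<partial>lborel))"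
      by (simp add: nn_integral_multc nn_integral_add nn_integral_cmult gauss_nn_integral nn_integral_shift[of "\<lambda>t. ennreal ((cmod (f t))\<^sup>2 / 2)"])
    also have "\<dots> = ?N"
      by (subst nn_integral_add[symmetric]) (auto simp flip: ennreal_plus)
    finally have "ennreal (cmod (complex_of_real (\<integral>s. (cmod (fourier f s))\<^sup>2 * damp \<epsilon> s \<partial>lborel))) \<le> ?N"
      unfolding eq .
    then have "ennreal (\<integral>s. (cmod (fourier f s))\<^sup>2 * damp \<epsilon> s \<partial>lborel) \<le> ?N"
      unfolding norm_of_real by (rule order_trans[OF ennreal_leI[OF abs_ge_self]])
    then show ?thesis
      by (subst nn_integral_eq_integral[OF sq]) (auto simp: less_imp_le[OF damp_bounds(1)])
  qed
  have "(\<integral>\<^sup>+s. ennreal ((cmod (fourier f s))\<^sup>2) \<partial>lborel) = (\<integral>\<^sup>+s. liminf (\<lambda>n. ennreal ((cmod (fourier f s))\<^sup>2 * damp (1 / Suc n) s)) \<partial>lborel)"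
  proof (rule nn_integral_cong)
    fix s
    have "(\<lambda>n. ennreal ((cmod (fourier f s))\<^sup>2 * damp (1 / Suc n) s)) \<longlonglongrightarrow> ennreal ((cmod (fourier f s))\<^sup>2 * 1)"
      by (intro tendsto_ennrealI tendsto_intros damp_lim)
    from lim_imp_Liminf[OF _ this] show "ennreal ((cmod (fourier f s))\<^sup>2) = liminf (\<lambda>n. ennreal ((cmod (fourier f s))\<^sup>2 * damp (1 / Suc n) s))" by simp
  qed
  also have "\<dots> \<le> liminf (\<lambda>n. \<integral>\<^sup>+s. ennreal ((cmod (fourier f s))\<^sup>2 * damp (1 / Suc n) s) \<partial>lborel)"
    by (rule nn_integral_liminf) measurable
  also have "\<dots> \<le> liminf (\<lambda>n::nat. ?N)"
    by (intro Liminf_mono always_eventually allI damped) simp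
  finally show ?thesis by (simp add: Liminf_const)
qed

section \<open>Convolution and its Fourier transform\<close>

definition convolve :: "'n::finite cfun \<Rightarrow> 'n cfun \<Rightarrow> 'n cfun" where
  "convolve b f = (\<lambda>x. LINT y|lborel. b y * f (x - y))"

lemma convolve_integrable:
  fixes b f :: "'n::finite cfun"
  assumes b: "integrable lborel b" and f: "integrable lborel f"
  shows "integrable lborel (convolve b f)"
    and "(LINT x|lborel. cmod (convolve b f x)) \<le> (LINT y|lborel. cmod (b y)) * (LINT x|lborel. cmod (f x))"
proof -
  note [measurable] = borel_measurable_integrable[OF b] borel_measurable_integrable[OF f]
  have int: "integrable (lborel \<Otimes>\<^sub>M lborel) (case_prod (\<lambda>x y. b y * f (x - y)))"
    by (rule integrable_pair_convolution[OF b f]) (auto simp: norm_mult)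
  then show i: "integrable lborel (convolve b f)"
    unfolding convolve_def by (rule lborel_pair.integrable_fst)
  have int': "integrable (lborel \<Otimes>\<^sub>M lborel) (case_prod (\<lambda>x y. cmod (b y * f (x - y))))"
    using integrable_norm[OF int] by (simp add: case_prod_beta')
  have "(LINT x|lborel. cmod (convolve b f x)) \<le> (LINT x|lborel. LINT y|lborel. cmod (b y * f (x - y)))"
    unfolding convolve_def
    by (rule integral_mono[OF integrable_norm[OF lborel_pair.integrable_fst[OF int]] lborel_pair.integrable_fst[OF int']])
       (rule integral_norm_bound)
  also have "\<dots> = (LINT y|lborel. LINT x|lborel. cmod (b y * f (x - y)))"
    by (rule lborel_pair.Fubini_integral[OF int', symmetric])
  also have "\<dots> = (LINT y|lborel. cmod (b y)) * (LINT x|lborel. cmod (f x))"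
    by (simp add: norm_mult integral_shift[of "\<lambda>x. cmod (f x)"])
  finally show "(LINT x|lborel. cmod (convolve b f x)) \<le> (LINT y|lborel. cmod (b y)) * (LINT x|lborel. cmod (f x))" .
qed

lemma cis_inner_add: "cis (- (2 * pi * (s \<bullet> (x + y)))) = cis (- (2 * pi * (s \<bullet> x))) * cis (- (2 * pi * (s \<bullet> y)))"
  by (simp add: cis_mult inner_add_right algebra_simps)

lemma fourier_convolve:
  fixes b f :: "'n::finite cfun"
  assumes b: "integrable lborel b" and f: "integrable lborel f"
  shows "fourier (convolve b f) s = fourier b s * fourier f s"
proof -
  note [measurable] = borel_measurable_integrable[OF b] borel_measurable_integrable[OF f]
  let ?e = "\<lambda>x. cis (- (2 * pi * (s \<bullet> x)))"
  have int: "integrable (lborel \<Otimes>\<^sub>M lborel) (case_prod (\<lambda>x y. b y * f (x - y) * ?e x))"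
    by (rule integrable_pair_convolution[OF b f]) (auto simp: norm_mult)
  have "fourier (convolve b f) s = (LINT x|lborel. LINT y|lborel. b y * f (x - y) * ?e x)"
    unfolding fourier_def convolve_def by (simp only: integral_mult_left_zero)
  also have "\<dots> = (LINT y|lborel. LINT x|lborel. b y * f (x - y) * ?e x)"
    by (rule lborel_pair.Fubini_integral[OF int, symmetric])
  also have "\<dots> = (LINT y|lborel. (b y * ?e y) * (LINT x|lborel. f (x - y) * ?e (x - y)))"
  proof (rule Bochner_Integration.integral_cong[OF refl])
    fix y
    have e: "?e x = ?e (x - y) * ?e y" for x using cis_inner_add[of s "x - y" y] by simp
    have "b y * f (x - y) * ?e x = (b y * ?e y) * (f (x - y) * ?e (x - y))" for x 
      by (subst e) (simp only: mult_ac)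
    then show "(LINT x|lborel. b y * f (x - y) * ?e x) = (b y * ?e y) * (LINT x|lborel. f (x - y) * ?e (x - y))"
      by (simp only: integral_mult_right_zero)
  qed
  also have "\<dots> = fourier b s * fourier f s"
    unfolding integral_shift[of "\<lambda>x. f x * ?e x"] fourier_def by (simp only: integral_mult_left_zero)
  finally show ?thesis .
qed

section \<open>Integrable functions with integrable Fourier transform\<close>

text \<open>For continuous functions of bounded support this is membership in \<open>FL1\<close>, but stated through
\<open>fourier g\<close> itself, the function whose integral defines \<open>FL1_norm\<close>, instead of through some \<open>h\<close> with
\<open>g = fourier h\<close>.\<close>

definition specL1 :: "'n::finite cfun set" where
  "specL1 = {g. integrable lborel g \<and> integrable lborel (fourier g)}"

lemma specL1D: "g \<in> specL1 \<Longrightarrow> integrable lborel g" "g \<in> specL1 \<Longrightarrow> integrable lborel (fourier g)"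
  by (auto simp: specL1_def)

lemma FL1_norm_nonneg: "0 \<le> FL1_norm g"
  by (simp add: FL1_norm_def)

lemma specL1_sup:
  assumes g: "g \<in> specL1" and c: "continuous_on UNIV g" and B: "\<And>x. cmod (g x) \<le> B"
  shows "cmod (g x) \<le> FL1_norm g"
proof -
  have "cmod (g x) = cmod (LINT s|lborel. fourier g s * cis (2 * pi * (s \<bullet> x)))"
    using fourier_inversion[OF specL1D(1)[OF g] c B specL1D(2)[OF g]] by simp
  also have "\<dots> \<le> FL1_norm g"
    unfolding FL1_norm_def by (rule order_trans[OF integral_norm_bound]) (simp add: norm_mult)
  finally show ?thesis .
qed

lemma FL1_imp_specL1: "g \<in> FL1 \<Longrightarrow> integrable lborel g \<Longrightarrow> g \<in> specL1"
  by (auto simp: FL1_def specL1_def intro: integrable_fourier_fourier)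

lemma specL1_imp_FL1:
  assumes g: "g \<in> specL1" and c: "continuous_on UNIV g" and B: "\<And>x. cmod (g x) \<le> B"
  shows "g \<in> FL1"
proof -
  have "g x = fourier (\<lambda>s. fourier g (- s)) x" for x
  proof -
    have "g x = (LINT s|lborel. fourier g s * cis (2 * pi * (s \<bullet> x)))"
      by (rule fourier_inversion[OF specL1D(1)[OF g] c B specL1D(2)[OF g]])
    also have "\<dots> = (LINT s|lborel. fourier g (- s) * cis (2 * pi * (- s \<bullet> x)))"
      by (rule integral_uminus_arg[symmetric])
    also have "\<dots> = fourier (\<lambda>s. fourier g (- s)) x"
      by (simp add: fourier_def inner_commute)
    finally show ?thesis .
  qed
  then have "g = fourier (\<lambda>s. fourier g (- s))" by blast
  then show ?thesis
    unfolding FL1_def using specL1D(2)[OF g] integrable_uminus_iff[of "fourier g"] by blast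
qed

lemma fourier_lincomb:
  assumes "integrable lborel g" "integrable lborel h"
  shows "fourier (\<lambda>x. a * g x + b * h x) s = a * fourier g s + b * fourier h s"
proof -
  have "integrable lborel (\<lambda>t. g t * cis (- (2 * pi * (s \<bullet> t))))" "integrable lborel (\<lambda>t. h t * cis (- (2 * pi * (s \<bullet> t))))"
    using assms by (auto intro!: integrable_cis)
  then show ?thesis
    unfolding fourier_def by (simp add: distrib_right mult.assoc)
qed

lemma specL1_lincomb:
  assumes g: "g \<in> specL1" and h: "h \<in> specL1"
  shows "(\<lambda>x. a * g x + b * h x) \<in> specL1"
    and "FL1_norm (\<lambda>x. a * g x + b * h x) \<le> cmod a * FL1_norm g + cmod b * FL1_norm h"
proof -
  note gh = specL1D[OF g] specL1D[OF h]
  have eq: "fourier (\<lambda>x. a * g x + b * h x) = (\<lambda>s. a * fourier g s + b * fourier h s)"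
    using fourier_lincomb[OF gh(1,3)] by blast
  show "(\<lambda>x. a * g x + b * h x) \<in> specL1"
    using gh by (simp add: specL1_def eq)
  have "(LINT s|lborel. cmod (a * fourier g s + b * fourier h s)) \<le> (LINT s|lborel. cmod a * cmod (fourier g s) + cmod b * cmod (fourier h s))"
    using gh by (intro integral_mono) (auto intro!: norm_triangle_le simp: norm_mult)
  also have "\<dots> = cmod a * FL1_norm g + cmod b * FL1_norm h"
    using gh by (simp add: FL1_norm_def)
  finally show "FL1_norm (\<lambda>x. a * g x + b * h x) \<le> cmod a * FL1_norm g + cmod b * FL1_norm h"
    by (simp add: FL1_norm_def eq)
qed

lemma specL1_zero [simp]: "(\<lambda>x. 0) \<in> specL1" "FL1_norm (\<lambda>x. 0) = 0"
  by (simp_all add: specL1_def fourier_def[abs_def] FL1_norm_def)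

lemma specL1_sum:
  assumes "\<And>i. i \<in> I \<Longrightarrow> g i \<in> specL1"
  shows "(\<lambda>x. \<Sum>i\<in>I. g i x) \<in> specL1 \<and> FL1_norm (\<lambda>x. \<Sum>i\<in>I. g i x) \<le> (\<Sum>i\<in>I. FL1_norm (g i))"
  using assms
proof (induction I rule: infinite_finite_induct)
  case (insert i I)
  then have "(\<lambda>x. \<Sum>i\<in>I. g i x) \<in> specL1" "FL1_norm (\<lambda>x. \<Sum>i\<in>I. g i x) \<le> (\<Sum>i\<in>I. FL1_norm (g i))" "g i \<in> specL1" by auto
  with specL1_lincomb[of "g i" "\<lambda>x. \<Sum>i\<in>I. g i x" 1 1] insert show ?case by auto
qed auto

lemma fourier_translate:
  "fourier (translate y f) s = cis (- (2 * pi * (s \<bullet> y))) * fourier f s"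
proof -
  have "fourier (translate y f) s = (LINT t|lborel. f (t - y) * cis (- (2 * pi * (s \<bullet> t))))"
    by (simp add: fourier_def translate_def)
  also have "\<dots> = (LINT t|lborel. f (t + y - y) * cis (- (2 * pi * (s \<bullet> (t + y)))))"
    using integral_shift[of "\<lambda>t. f (t - y) * cis (- (2 * pi * (s \<bullet> t)))" "- y"] by simp
  also have "\<dots> = (LINT t|lborel. cis (- (2 * pi * (s \<bullet> y))) * (f t * cis (- (2 * pi * (s \<bullet> t)))))"
    by (intro Bochner_Integration.integral_cong refl) (simp only: cis_inner_add add_diff_cancel_right', simp only: mult_ac)
  finally show ?thesis by (simp add: fourier_def)
qed

lemma fourier_flip: "fourier (flip f) s = fourier f (- s)"
  using integral_uminus_arg[of "\<lambda>t. f t * cis (- (2 * pi * (- s \<bullet> t)))"]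
  by (simp add: fourier_def flip_def)

lemma specL1_translate:
  assumes "g \<in> specL1"
  shows "translate y g \<in> specL1" and "FL1_norm (translate y g) = FL1_norm g"
proof -
  have "integrable lborel (\<lambda>s. fourier g s * cis (- (2 * pi * (s \<bullet> y))))"
    using specL1D(2)[OF assms] by (intro integrable_cis) auto
  then have "integrable lborel (fourier (translate y g))"
    by (simp add: fourier_translate[abs_def] mult.commute)
  moreover have "integrable lborel (translate y g)"
    using specL1D(1)[OF assms] by (simp add: translate_def integrable_shift_iff)
  ultimately show "translate y g \<in> specL1" by (simp add: specL1_def)
  show "FL1_norm (translate y g) = FL1_norm g"
    by (simp add: FL1_norm_def fourier_translate norm_mult)
qed

lemma specL1_flip:
  assumes "g \<in> specL1"
  shows "flip g \<in> specL1" and "FL1_norm (flip g) = FL1_norm g"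
proof -
  show "flip g \<in> specL1"
    using specL1D[OF assms]
    by (simp add: specL1_def fourier_flip[abs_def] integrable_uminus_iff) (simp add: flip_def integrable_uminus_iff)
  show "FL1_norm (flip g) = FL1_norm g"
    using integral_uminus_arg[of "\<lambda>s. cmod (fourier g s)"] by (simp add: FL1_norm_def fourier_flip)
qed

text \<open>Fourier inversion for \<open>\<phi>\<close> shows that the transform of a product is the convolution of the transforms,
and convolution is submultiplicative in \<open>L\<^sup>1\<close>.\<close>

lemma specL1_mult:
  fixes f \<phi> :: "'n::finite cfun"
  assumes f: "f \<in> specL1" and p: "\<phi> \<in> specL1" and c: "continuous_on UNIV \<phi>" and B: "\<And>x. cmod (\<phi> x) \<le> B"
  shows "(\<lambda>x. f x * \<phi> x) \<in> specL1"
    and "FL1_norm (\<lambda>x. f x * \<phi> x) \<le> FL1_norm f * FL1_norm \<phi>"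
proof -
  note fi = specL1D[OF f] and pi = specL1D[OF p]
  note [measurable] = borel_measurable_integrable[OF fi(1)] borel_measurable_integrable[OF pi(1)]
  have eq: "fourier (\<lambda>x. f x * \<phi> x) s = convolve (fourier \<phi>) (fourier f) s" for s
  proof -
    let ?h = "\<lambda>t r. f t * cis (- (2 * pi * (s \<bullet> t))) * (fourier \<phi> r * cis (2 * pi * (r \<bullet> t)))"
    have int: "integrable (lborel \<Otimes>\<^sub>M lborel) (case_prod ?h)"
      by (rule integrable_pair_bound[OF fi(1) pi(2)]) (auto simp: norm_mult)
    have "fourier (\<lambda>x. f x * \<phi> x) s = (LINT t|lborel. f t * cis (- (2 * pi * (s \<bullet> t))) * \<phi> t)"
      by (simp add: fourier_def mult_ac)
    also have "\<dots> = (LINT t|lborel. LINT r|lborel. ?h t r)"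
      by (subst fourier_inversion[OF pi(1) c B pi(2)]) (simp only: integral_mult_right_zero)
    also have "\<dots> = (LINT r|lborel. LINT t|lborel. ?h t r)"
      by (rule lborel_pair.Fubini_integral[OF int, symmetric])
    also have "\<dots> = (LINT r|lborel. fourier \<phi> r * fourier f (s - r))"
    proof (rule Bochner_Integration.integral_cong[OF refl])
      fix r
      have "cis (- (2 * pi * ((s - r) \<bullet> t))) = cis (- (2 * pi * (s \<bullet> t))) * cis (2 * pi * (r \<bullet> t))" for t
        by (simp add: cis_mult inner_diff_left algebra_simps)
      then have "?h t r = fourier \<phi> r * (f t * cis (- (2 * pi * ((s - r) \<bullet> t))))" for t
        by (simp only: mult_ac)
      then show "(LINT t|lborel. ?h t r) = fourier \<phi> r * fourier f (s - r)"
        unfolding fourier_def[of f] by (simp only: integral_mult_right_zero)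
    qed
    finally show ?thesis by (simp add: convolve_def)
  qed
  have m: "integrable lborel (\<lambda>x. f x * \<phi> x)"
  proof (rule Bochner_Integration.integrable_bound[of _ "\<lambda>x. of_real B * f x"])
    show "integrable lborel (\<lambda>x. of_real B * f x)" using fi(1) by simp
    show "AE x in lborel. cmod (f x * \<phi> x) \<le> cmod (of_real B * f x)"
    proof (rule AE_I2)
      fix x
      have "cmod (\<phi> x) \<le> \<bar>B\<bar>" using B[of x] by linarith
      then show "cmod (f x * \<phi> x) \<le> cmod (of_real B * f x)"
        by (simp add: norm_mult mult.commute mult_right_mono)
    qed
  qed measurable
  show "(\<lambda>x. f x * \<phi> x) \<in> specL1"
    unfolding specL1_def using m convolve_integrable(1)[OF pi(2) fi(2)] by (simp add: eq[abs_def])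
  show "FL1_norm (\<lambda>x. f x * \<phi> x) \<le> FL1_norm f * FL1_norm \<phi>"
    using convolve_integrable(2)[OF pi(2) fi(2)] unfolding FL1_norm_def eq by (subst mult.commute)
qed

text \<open>The transform of the convolution is a product of two functions that are square integrable by Bessel's
inequality.\<close>

lemma specL1_convolve_L2:
  fixes b f :: "'n::finite cfun"
  assumes b: "integrable lborel b" and f: "integrable lborel f"
    and a: "0 < \<alpha>" "(\<integral>\<^sup>+x. ennreal ((cmod (b x))\<^sup>2) \<partial>lborel) \<le> ennreal (\<alpha>\<^sup>2)"
    and be: "0 < \<beta>" "(\<integral>\<^sup>+x. ennreal ((cmod (f x))\<^sup>2) \<partial>lborel) \<le> ennreal (\<beta>\<^sup>2)"
  shows "convolve b f \<in> specL1" and "FL1_norm (convolve b f) \<le> \<alpha> * \<beta>"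
proof -
  note [measurable] = borel_measurable_integrable[OF b] borel_measurable_integrable[OF f]
  have eq: "fourier (convolve b f) = (\<lambda>s. fourier b s * fourier f s)"
    using fourier_convolve[OF b f] by blast
  (* The weights are chosen such that each of the two terms integrates to at most
     \<alpha> * \<beta> / 2. *)
  have p: "cmod (fourier b s * fourier f s) \<le> (\<beta> / (2 * \<alpha>)) * (cmod (fourier b s))\<^sup>2 + (\<alpha> / (2 * \<beta>)) * (cmod (fourier f s))\<^sup>2" for s
  proof -
    let ?x = "cmod (fourier b s)" and ?y = "cmod (fourier f s)"
    have "0 \<le> (\<beta> * ?x - \<alpha> * ?y)\<^sup>2" by simp
    then have "2 * \<alpha> * \<beta> * (?x * ?y) \<le> \<beta>\<^sup>2 * ?x\<^sup>2 + \<alpha>\<^sup>2 * ?y\<^sup>2"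
      by (simp add: power2_eq_square algebra_simps)
    then have "(2 * \<alpha> * \<beta> * (?x * ?y)) / (2 * \<alpha> * \<beta>) \<le> (\<beta>\<^sup>2 * ?x\<^sup>2 + \<alpha>\<^sup>2 * ?y\<^sup>2) / (2 * \<alpha> * \<beta>)"
      using a(1) be(1) by (intro divide_right_mono) auto
    also have "(\<beta>\<^sup>2 * ?x\<^sup>2 + \<alpha>\<^sup>2 * ?y\<^sup>2) / (2 * \<alpha> * \<beta>) = (\<beta> / (2 * \<alpha>)) * ?x\<^sup>2 + (\<alpha> / (2 * \<beta>)) * ?y\<^sup>2"
      using a(1) be(1) by (simp add: power2_eq_square add_divide_distrib)
    finally show ?thesis using a(1) be(1) by (simp add: norm_mult)
  qed
  have "(\<integral>\<^sup>+s. ennreal (cmod (fourier b s * fourier f s)) \<partial>lborel)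
    \<le> (\<integral>\<^sup>+s. ennreal (\<beta> / (2 * \<alpha>)) * ennreal ((cmod (fourier b s))\<^sup>2) + ennreal (\<alpha> / (2 * \<beta>)) * ennreal ((cmod (fourier f s))\<^sup>2) \<partial>lborel)"
    using p a(1) be(1) by (intro nn_integral_mono) (simp flip: ennreal_mult ennreal_plus)
  also have "\<dots> = ennreal (\<beta> / (2 * \<alpha>)) * (\<integral>\<^sup>+s. ennreal ((cmod (fourier b s))\<^sup>2) \<partial>lborel) 
      + ennreal (\<alpha> / (2 * \<beta>)) * (\<integral>\<^sup>+s. ennreal ((cmod (fourier f s))\<^sup>2) \<partial>lborel)"
    by (subst nn_integral_add) (auto simp: nn_integral_cmult)
  also have "\<dots> \<le> ennreal (\<beta> / (2 * \<alpha>)) * ennreal (\<alpha>\<^sup>2) + ennreal (\<alpha> / (2 * \<beta>)) * ennreal (\<beta>\<^sup>2)"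
    using order_trans[OF bessel_inequality[OF b] a(2)] order_trans[OF bessel_inequality[OF f] be(2)]
    by (intro add_mono mult_left_mono) auto
  also have "\<dots> = ennreal (\<alpha> * \<beta>)"
    using a(1) be(1) by (simp add: power2_eq_square flip: ennreal_mult ennreal_plus)
  finally have n: "(\<integral>\<^sup>+s. ennreal (cmod (fourier b s * fourier f s)) \<partial>lborel) \<le> ennreal (\<alpha> * \<beta>)" .
  then have "integrable lborel (\<lambda>s. fourier b s * fourier f s)"
    by (intro integrableI_bounded) (auto intro: le_less_trans)
  then show "convolve b f \<in> specL1"
    using convolve_integrable(1)[OF b f] by (simp add: specL1_def eq)
  show "FL1_norm (convolve b f) \<le> \<alpha> * \<beta>"
    unfolding FL1_norm_def eq using n a(1) be(1)
    by (intro integral_real_bounded) auto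
qed

section \<open>Smooth compactly supported functions\<close>

lemma continuous_bounded_support:
  fixes f :: "'n::finite cfun"
  assumes c: "continuous_on UNIV f" and z: "\<And>x. norm x > R \<Longrightarrow> f x = 0"
  shows "integrable lborel f" and "\<exists>B. \<forall>x. cmod (f x) \<le> B"
proof -
  have "f = (\<lambda>x. indicator (cball 0 R) x *\<^sub>R f x)"
    using z by (auto simp: fun_eq_iff indicator_def not_le)
  moreover have "integrable lborel (\<lambda>x. indicator (cball 0 R) x *\<^sub>R f x)"
    by (rule borel_integrable_compact) (auto intro: continuous_on_subset[OF c])
  ultimately show "integrable lborel f" by simp
  have "compact (f ` cball 0 R)"
    by (rule compact_continuous_image[OF continuous_on_subset[OF c]]) auto
  then obtain B where B: "\<And>x. x \<in> cball 0 R \<Longrightarrow> cmod (f x) \<le> B"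
    using compact_imp_bounded bounded_iff[of "f ` cball 0 R"] by blast
  have "cmod (f x) \<le> max B 0" for x
    using B[of x] z[of x] by (cases "norm x \<le> R") (auto simp: not_le)
  then show "\<exists>B. \<forall>x. cmod (f x) \<le> B" by blast
qed

lemma frechet_derivative_support:
  fixes f :: "'n::finite cfun"
  assumes z: "\<And>x. norm x > R \<Longrightarrow> f x = 0" and x: "norm x > R"
  shows "frechet_derivative f (at x) v = 0"
proof -
  have "(f has_derivative (\<lambda>_. 0)) (at x)"
  proof (rule has_derivative_transform_within_open)
    show "((\<lambda>_. 0) has_derivative (\<lambda>_. 0)) (at x)" by simp
    show "open {y :: real^'n. R < norm y}" by (intro open_Collect_less continuous_intros)
  qed (use x z in auto)
  then have "(\<lambda>_. 0) = frechet_derivative f (at x)" by (rule frechet_derivative_at)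
  then show ?thesis by metis
qed

lemma cis_difference_quotient:
  "(\<lambda>n. of_real (real (Suc n)) * (cis (\<theta> * (1 / real (Suc n))) - 1)) \<longlonglongrightarrow> \<i> * of_real \<theta>"
proof -
  have "((\<lambda>t. exp (\<i> * of_real \<theta> * t)) has_field_derivative \<i> * of_real \<theta>) (at 0)"
    by (auto intro!: derivative_eq_intros)
  then have "((\<lambda>h. (exp (\<i> * of_real \<theta> * h) - 1) / h) \<longlongrightarrow> \<i> * of_real \<theta>) (at 0)"
    by (simp add: has_field_derivative_iff)
  moreover have "filterlim (\<lambda>n. complex_of_real (1 / real (Suc n))) (at 0) sequentially"
    unfolding filterlim_at
  proof
    have "(\<lambda>n. complex_of_real (1 / real (Suc n))) \<longlonglongrightarrow> complex_of_real 0"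
      by (intro tendsto_of_real LIMSEQ_Suc[OF lim_inverse_n'])
    then show "(\<lambda>n. complex_of_real (1 / real (Suc n))) \<longlonglongrightarrow> 0" by simp
  qed (intro always_eventually, simp del: of_nat_Suc)
  ultimately have "(\<lambda>n. (exp (\<i> * of_real \<theta> * complex_of_real (1 / real (Suc n))) - 1) / complex_of_real (1 / real (Suc n))) \<longlonglongrightarrow> \<i> * of_real \<theta>"
    by (rule filterlim_compose)
  then show ?thesis
    by (rule filterlim_mono_eventually[OF _ order_refl order_refl]) (auto intro!: always_eventually simp: cis_conv_exp mult_ac)
qed

text \<open>Integration by parts is avoided: the difference quotient is a linear combination of translates, whose
transform is explicit, and it converges dominatedly to the derivative by the mean value theorem.\<close>

lemma fourier_directional_derivative:
  fixes f :: "'n::finite cfun"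
  assumes d: "f differentiable_on UNIV"
    and c: "continuous_on UNIV (\<lambda>x. frechet_derivative f (at x) v)"
    and z: "\<And>x. norm x > R \<Longrightarrow> f x = 0"
  shows "fourier (\<lambda>x. frechet_derivative f (at x) v) s = \<i> * of_real (2 * pi * (s \<bullet> v)) * fourier f s"
proof -
  define g where "g x = frechet_derivative f (at x) v" for x
  define t where "t n = 1 / real (Suc n)" for n
  have t: "0 < t n" "t n \<le> 1" for n by (auto simp: t_def)
  have t0: "t \<longlonglongrightarrow> 0" unfolding t_def by (intro LIMSEQ_Suc[OF lim_inverse_n'])
  define h where "h n x = of_real (real (Suc n)) * (f (x + t n *\<^sub>R v) - f x)" for n x
  have cf: "continuous_on UNIV f" by (rule differentiable_imp_continuous_on[OF d])
  have fi: "integrable lborel f" by (rule continuous_bounded_support(1)[OF cf z])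
  have gc: "continuous_on UNIV g" using c by (simp add: g_def[abs_def])
  have gz: "g x = 0" if "norm x > R" for x
    unfolding g_def by (rule frechet_derivative_support[OF z that])
  obtain M where M: "\<And>x. cmod (g x) \<le> M" using continuous_bounded_support(2)[OF gc gz] by blast
  have M0: "0 \<le> M" using M[of 0] norm_ge_zero order_trans by blast
  have D: "(f has_derivative frechet_derivative f (at x)) (at x)" for x
    using d by (simp add: frechet_derivative_works[symmetric] differentiable_on_eq_differentiable_at)
  have lim: "(\<lambda>n. h n x) \<longlonglongrightarrow> g x" for x
  proof (cases "v = 0")
    case True
    then have "g x = 0" using has_derivative_bounded_linear[OF D[of x]] by (simp add: g_def linear_0 bounded_linear.linear)
    then show ?thesis by (simp add: h_def True)
  next
    case False
    interpret L: bounded_linear "frechet_derivative f (at x)" by (rule has_derivative_bounded_linear[OF D])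
    have q: "((\<lambda>u. cmod (f (x + u) - f x - frechet_derivative f (at x) u) / norm u) \<longlongrightarrow> 0) (at 0)"
      using D[of x] by (simp add: has_derivative_at)
    have "filterlim (\<lambda>n. t n *\<^sub>R v) (at 0) sequentially"
      unfolding filterlim_at using tendsto_scaleR[OF t0 tendsto_const[of v]] t(1) False
      by (auto simp: less_imp_neq[symmetric] intro!: always_eventually)
    from tendsto_mult_left_zero[OF filterlim_compose[OF q this], of "norm v"]
    have "(\<lambda>n. cmod (f (x + t n *\<^sub>R v) - f x - frechet_derivative f (at x) (t n *\<^sub>R v)) / norm (t n *\<^sub>R v) * norm v) \<longlonglongrightarrow> 0" .
    moreover have "cmod (f (x + t n *\<^sub>R v) - f x - frechet_derivative f (at x) (t n *\<^sub>R v)) / norm (t n *\<^sub>R v) * norm v = cmod (h n x - g x)" for n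
    proof -
      have e: "h n x - g x = of_real (real (Suc n)) * (f (x + t n *\<^sub>R v) - f x - frechet_derivative f (at x) (t n *\<^sub>R v))"
        by (simp add: h_def g_def L.scaleR t_def scaleR_conv_of_real[where 'a=complex] right_diff_distrib del: of_nat_Suc)
      show ?thesis unfolding e norm_mult using False by (simp add: t_def del: of_nat_Suc)
    qed
    ultimately have "(\<lambda>n. cmod (h n x - g x)) \<longlonglongrightarrow> 0" by simp
    then show ?thesis by (simp add: tendsto_norm_zero_iff LIM_zero_iff)
  qed
  have hb: "cmod (h n x) \<le> M" for n x
  proof -
    have "cmod (f (x + t n *\<^sub>R v) - f (x + 0 *\<^sub>R v)) \<le> M * norm (t n - 0)"
    proof (rule differentiable_bound[where S=UNIV and f'="\<lambda>\<tau> u. u *\<^sub>R g (x + \<tau> *\<^sub>R v)" and f="\<lambda>\<tau>. f (x + \<tau> *\<^sub>R v)"])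
      fix \<tau> :: real
      interpret L: bounded_linear "frechet_derivative f (at (x + \<tau> *\<^sub>R v))" by (rule has_derivative_bounded_linear[OF D])
      have "((\<lambda>\<tau>. x + \<tau> *\<^sub>R v) has_derivative (\<lambda>u. u *\<^sub>R v)) (at \<tau>)"
        by (auto intro!: derivative_eq_intros)
      from has_derivative_compose[OF this D]
      show "((\<lambda>\<tau>. f (x + \<tau> *\<^sub>R v)) has_derivative (\<lambda>u. u *\<^sub>R g (x + \<tau> *\<^sub>R v))) (at \<tau> within UNIV)"
        by (simp add: g_def L.scaleR)
      show "onorm (\<lambda>u. u *\<^sub>R g (x + \<tau> *\<^sub>R v)) \<le> M"
        by (rule onorm_bound[OF M0]) (metis M abs_ge_zero mult.commute mult_left_mono norm_scaleR real_norm_def)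
    qed auto
    then have "cmod (f (x + t n *\<^sub>R v) - f x) \<le> M * t n" using t(1)[of n] by simp
    then have "real (Suc n) * cmod (f (x + t n *\<^sub>R v) - f x) \<le> real (Suc n) * (M * t n)"
      by (intro mult_left_mono) auto
    then show ?thesis by (simp add: h_def norm_mult t_def del: of_nat_Suc)
  qed
  have hz: "h n x = 0" if "norm x > R + norm v" for n x
  proof -
    have "norm x \<le> norm (x + t n *\<^sub>R v) + norm (t n *\<^sub>R v)"
      by (metis add_diff_cancel_right' norm_triangle_ineq4)
    moreover have "norm (t n *\<^sub>R v) \<le> norm v" using t[of n] by (simp add: mult_left_le_one_le)
    ultimately have "norm (x + t n *\<^sub>R v) > R" using that by linarith
    moreover have "norm x > R" using that norm_ge_zero[of v] by linarith
    ultimately show ?thesis by (simp add: h_def z)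
  qed
  have hF: "fourier (h n) s = of_real (real (Suc n)) * (cis ((2 * pi * (s \<bullet> v)) * t n) - 1) * fourier f s" for n
  proof -
    have "h n = (\<lambda>x. of_real (real (Suc n)) * translate (- (t n *\<^sub>R v)) f x + (- of_real (real (Suc n))) * f x)"
      by (simp add: h_def translate_def fun_eq_iff right_diff_distrib del: of_nat_Suc)
    moreover have "integrable lborel (translate (- (t n *\<^sub>R v)) f)"
      using fi integrable_shift_iff[of f] by (simp add: translate_def del: diff_minus_eq_add)
    ultimately have "fourier (h n) s = of_real (real (Suc n)) * fourier (translate (- (t n *\<^sub>R v)) f) s + (- of_real (real (Suc n))) * fourier f s"
      using fourier_lincomb[OF _ fi] by presburger
    then show ?thesis by (simp add: fourier_translate algebra_simps del: of_nat_Suc)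
  qed
  have hm: "h n \<in> borel_measurable borel" for n
    unfolding h_def using cf
    by (intro borel_measurable_continuous_onI continuous_intros continuous_on_compose2[OF cf]) auto
  have "(\<lambda>n. fourier (h n) s) \<longlonglongrightarrow> fourier g s"
    unfolding fourier_def
  proof (rule integral_dominated_convergence[where w="\<lambda>x. M * indicator (cball 0 (R + norm v)) x"])
    note [measurable] = hm borel_measurable_continuous_onI[OF gc]
    show "(\<lambda>t. g t * cis (- (2 * pi * (s \<bullet> t)))) \<in> borel_measurable lborel" by measurable
    show "(\<lambda>t. h n t * cis (- (2 * pi * (s \<bullet> t)))) \<in> borel_measurable lborel" for n by measurable
    show "integrable lborel (\<lambda>x::real^'n. M * indicator (cball 0 (R + norm v)) x)"
      by (intro integrable_mult_right integrable_real_indicator) (auto simp: emeasure_lborel_cball_finite[unfolded infinity_ennreal_def])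
    show "AE x in lborel. (\<lambda>n. h n x * cis (- (2 * pi * (s \<bullet> x)))) \<longlonglongrightarrow> g x * cis (- (2 * pi * (s \<bullet> x)))"
      by (intro AE_I2 tendsto_mult lim tendsto_const)
    show "AE x in lborel. cmod (h n x * cis (- (2 * pi * (s \<bullet> x)))) \<le> M * indicator (cball 0 (R + norm v)) x" for n
      using hb hz by (intro AE_I2) (auto simp: norm_mult indicator_def not_le)
  qed
  moreover have "(\<lambda>n. fourier (h n) s) \<longlonglongrightarrow> \<i> * of_real (2 * pi * (s \<bullet> v)) * fourier f s"
    unfolding hF t_def by (intro tendsto_mult cis_difference_quotient tendsto_const)
  ultimately have "fourier g s = \<i> * of_real (2 * pi * (s \<bullet> v)) * fourier f s" by (rule LIMSEQ_unique)
  then show ?thesis by (simp add: g_def[abs_def])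
qed

lemma C_k_continuous: "C_k m f \<Longrightarrow> continuous_on UNIV f"
  by (cases m) (auto intro: differentiable_imp_continuous_on)

lemma fourier_decay:
  fixes f :: "'n::finite cfun"
  assumes "C_k m f" "\<And>x. norm x > R \<Longrightarrow> f x = 0"
  shows "\<exists>C. \<forall>s. \<bar>s \<bullet> v\<bar> ^ m * cmod (fourier f s) \<le> C"
  using assms
proof (induction m arbitrary: f)
  case 0
  then have "integrable lborel f" using continuous_bounded_support(1) C_k_continuous by blast
  then show ?case using fourier_bound[of f] by auto
next
  case (Suc m)
  let ?g = "\<lambda>x. frechet_derivative f (at x) v"
  have g: "C_k m ?g" and d: "f differentiable_on UNIV" using Suc.prems by auto
  have gz: "?g x = 0" if "norm x > R" for x
    by (rule frechet_derivative_support[OF Suc.prems(2) that])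
  obtain C where C: "\<And>s. \<bar>s \<bullet> v\<bar> ^ m * cmod (fourier ?g s) \<le> C"
    using Suc.IH[OF g gz] by blast
  have "\<bar>s \<bullet> v\<bar> ^ Suc m * cmod (fourier f s) \<le> C / (2 * pi)" for s
  proof -
    have "\<bar>s \<bullet> v\<bar> ^ m * (2 * pi * \<bar>s \<bullet> v\<bar> * cmod (fourier f s)) \<le> C"
    proof -
      have "fourier ?g s = \<i> * of_real (2 * pi * (s \<bullet> v)) * fourier f s"
        by (rule fourier_directional_derivative[OF d C_k_continuous[OF g] Suc.prems(2)])
      then show ?thesis using C[of s] by (simp add: norm_mult abs_mult)
    qed
    then show ?thesis by (simp add: field_simps)
  qed
  then show ?case by blast
qed

lemma integrable_decay_1d: "integrable lborel (\<lambda>x::real. 1 / max 1 (x\<^sup>2))"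
proof (rule Bochner_Integration.integrable_bound)
  show "integrable lborel (\<lambda>x::real. 2 * inverse (1 + x\<^sup>2))"
    using integrable_inverse_1_plus_square by (simp add: set_integrable_def)
  show "AE x::real in lborel. norm (1 / max 1 (x\<^sup>2)) \<le> norm (2 * inverse (1 + x\<^sup>2))"
  proof (rule AE_I2)
    fix x :: real
    have p: "0 < (1 + x\<^sup>2) / 2" by (simp add: add_pos_nonneg)
    have "inverse (max 1 (x\<^sup>2)) \<le> inverse ((1 + x\<^sup>2) / 2)"
      by (rule le_imp_inverse_le[OF _ p]) simp
    then have "1 / max 1 (x\<^sup>2) \<le> 2 * inverse (1 + x\<^sup>2)" by (simp add: inverse_eq_divide)
    moreover have "0 \<le> 1 / max 1 (x\<^sup>2)" by simp
    ultimately show "norm (1 / max 1 (x\<^sup>2)) \<le> norm (2 * inverse (1 + x\<^sup>2))"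
      unfolding real_norm_def by linarith
  qed
qed measurable

lemma integrable_decay: "integrable lborel (\<lambda>s::'a::euclidean_space. \<Prod>b\<in>Basis. 1 / max 1 ((s \<bullet> b)\<^sup>2))"
proof -
  have "integrable lborel (\<lambda>s::'a. \<Prod>b\<in>Basis. complex_of_real (1 / max 1 ((s \<bullet> b)\<^sup>2)))"
    by (rule integral_Basis_prod(1)) (intro integrable_of_real integrable_decay_1d)
  then have "integrable lborel (\<lambda>s::'a. complex_of_real (\<Prod>b\<in>Basis. 1 / max 1 ((s \<bullet> b)\<^sup>2)))"
    by simp
  then show ?thesis by (subst (asm) complex_of_real_integrable_eq)
qed

text \<open>Decay of order \<open>2 d\<close> along each coordinate direction gives the bound
\<open>K / (\<Prod>b\<in>Basis. max 1 ((s \<bullet> b)\<^sup>2))\<close> for the transform, which is integrable as a product of integrable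
functions of one variable.\<close>

lemma smooth_specL1:
  fixes f :: "'n::finite cfun"
  assumes f: "\<And>m. C_k m f" and z: "\<And>x. norm x > R \<Longrightarrow> f x = 0"
  shows "f \<in> specL1"
proof -
  have fi: "integrable lborel f" by (rule continuous_bounded_support(1)[OF C_k_continuous[OF f] z])
  let ?D = "DIM(real^'n)"
  have "\<forall>b. \<exists>C. \<forall>s. \<bar>s \<bullet> b\<bar> ^ (2 * ?D) * cmod (fourier f s) \<le> C"
    using fourier_decay[OF f z] by blast
  then obtain C where C: "\<And>b s. \<bar>s \<bullet> b\<bar> ^ (2 * ?D) * cmod (fourier f s) \<le> C b" by metis
  have Cn: "0 \<le> C b" for b by (rule order_trans[OF _ C[of 0 b]]) simp
  define C0 where "C0 = (LINT t|lborel. cmod (f t))"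
  have C0: "cmod (fourier f s) \<le> C0" for s using fourier_bound[OF fi] by (simp add: C0_def)
  define K where "K = C0 + (\<Sum>b\<in>Basis. C b)"
  (* If b is the direction in which s has its largest coordinate, and this is at least one, then
     the product is at most \<bar>s \<bullet> b\<bar> ^ (2 * d). *)
  have main: "cmod (fourier f s) * (\<Prod>b\<in>Basis. max 1 ((s \<bullet> b)\<^sup>2)) \<le> K" for s
  proof (cases "\<forall>b\<in>Basis. \<bar>s \<bullet> b\<bar> \<le> 1")
    case True
    then have "(\<Prod>b\<in>Basis. max 1 ((s \<bullet> b)\<^sup>2)) = 1"
      by (intro prod.neutral) (auto simp: max_def abs_square_le_1 intro: antisym)
    moreover have "0 \<le> (\<Sum>b\<in>Basis. C b)" by (rule sum_nonneg) (rule Cn)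
    ultimately show ?thesis using C0[of s] by (simp add: K_def)
  next
    case False
    obtain b where b: "b \<in> Basis" "\<And>b'. b' \<in> Basis \<Longrightarrow> \<bar>s \<bullet> b'\<bar> \<le> \<bar>s \<bullet> b\<bar>"
    proof -
      have "Max ((\<lambda>b. \<bar>s \<bullet> b\<bar>) ` Basis) \<in> (\<lambda>b. \<bar>s \<bullet> b\<bar>) ` Basis" by (intro Max_in) auto
      then obtain b where "b \<in> Basis" "Max ((\<lambda>b. \<bar>s \<bullet> b\<bar>) ` Basis) = \<bar>s \<bullet> b\<bar>" by blast
      then show ?thesis using that[of b] by (metis (no_types, lifting) Max_ge finite_Basis finite_imageI imageI)
    qed
    then have b1: "\<bar>s \<bullet> b\<bar> \<ge> 1" using False by force
    have "(\<Prod>b'\<in>Basis. max 1 ((s \<bullet> b')\<^sup>2)) \<le> (\<Prod>b'\<in>(Basis :: (real^'n) set). \<bar>s \<bullet> b\<bar>\<^sup>2)"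
    proof (rule prod_mono)
      fix b' :: "real^'n" assume "b' \<in> Basis"
      then have "(s \<bullet> b')\<^sup>2 \<le> \<bar>s \<bullet> b\<bar>\<^sup>2" using b(2) by (metis abs_ge_zero power2_abs power_mono)
      moreover have "1 \<le> \<bar>s \<bullet> b\<bar>\<^sup>2" using b1 by (rule one_le_power)
      ultimately show "0 \<le> max 1 ((s \<bullet> b')\<^sup>2) \<and> max 1 ((s \<bullet> b')\<^sup>2) \<le> \<bar>s \<bullet> b\<bar>\<^sup>2" by simp
    qed
    also have "\<dots> = \<bar>s \<bullet> b\<bar> ^ (2 * ?D)" by (simp only: prod_constant power_mult)
    finally have "cmod (fourier f s) * (\<Prod>b\<in>Basis. max 1 ((s \<bullet> b)\<^sup>2)) \<le> cmod (fourier f s) * \<bar>s \<bullet> b\<bar> ^ (2 * ?D)"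
      by (rule mult_left_mono) simp
    also have "\<dots> \<le> C b" using C[of s b] by (simp only: mult.commute)
    also have "\<dots> \<le> (\<Sum>b\<in>Basis. C b)" by (rule member_le_sum[OF b(1)]) (auto simp: Cn)
    also have "\<dots> \<le> K" using order_trans[OF norm_ge_zero C0[of 0]] by (simp add: K_def)
    finally show ?thesis .
  qed
  have "integrable lborel (fourier f)"
  proof (rule Bochner_Integration.integrable_bound)
    show "integrable lborel (\<lambda>s::real^'n. K * (\<Prod>b\<in>Basis. 1 / max 1 ((s \<bullet> b)\<^sup>2)))"
      by (intro integrable_mult_right integrable_decay)
    show "fourier f \<in> borel_measurable lborel" 
      using fourier_measurable[of f] borel_measurable_integrable[OF fi] by simp
    show "AE s in lborel. cmod (fourier f s) \<le> norm (K * (\<Prod>b\<in>Basis. 1 / max 1 ((s \<bullet> b)\<^sup>2)))"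
    proof (rule AE_I2)
      fix s :: "real^'n"
      let ?P = "\<Prod>b\<in>Basis. max 1 ((s \<bullet> b)\<^sup>2)"
      have P: "?P > 0" by (rule prod_pos) (auto simp: max_def)
      have "(\<Prod>b\<in>Basis. 1 / max 1 ((s \<bullet> b)\<^sup>2)) = 1 / ?P" by (simp only: prod_dividef prod.neutral_const)
      moreover have "cmod (fourier f s) \<le> K / ?P" using main[of s] P by (simp only: pos_le_divide_eq)
      ultimately show "cmod (fourier f s) \<le> norm (K * (\<Prod>b\<in>Basis. 1 / max 1 ((s \<bullet> b)\<^sup>2)))"
        by (simp only: times_divide_eq_right mult_1_right real_norm_def)
    qed
  qed
  then show ?thesis using fi by (simp add: specL1_def)
qed

section \<open>The Segal algebra and its synthesis from local pieces\<close>

text \<open>Half-open, so that a box is the disjoint union of the boxes that subdivide it.\<close>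

definition hbox :: "real^'n::finite \<Rightarrow> real \<Rightarrow> (real^'n) set" where
  "hbox x r = {z. \<forall>i. x $ i \<le> z $ i \<and> z $ i < x $ i + r}"

lemma cube_hbox: "cube k = hbox k 1"
  by (auto simp: mem_cube hbox_def)

lemma hbox_borel [measurable]: "hbox x r \<in> sets borel"
proof -
  have "hbox x r = (\<Inter>i. {z. x $ i \<le> z $ i} \<inter> {z. z $ i < x $ i + r})" by (auto simp: hbox_def)
  also have "\<dots> \<in> sets borel"
    by (intro sets.finite_INT sets.Int borel_closed borel_open closed_Collect_le open_Collect_less continuous_intros) auto
  finally show ?thesis .
qed

lemma hbox_norm:
  fixes x :: "real^'n::finite"
  assumes "z \<in> hbox x r" shows "norm (z - x) \<le> real CARD('n) * r"
proof -
  have "norm (z - x) \<le> (\<Sum>i\<in>UNIV. \<bar>(z - x) $ i\<bar>)" by (rule norm_le_l1_cart)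
  also have "\<dots> \<le> (\<Sum>i\<in>(UNIV::'n set). r)"
  proof (rule sum_mono)
    fix i
    have "x $ i \<le> z $ i" "z $ i < x $ i + r" using assms by (auto simp: hbox_def)
    then show "\<bar>(z - x) $ i\<bar> \<le> r" by simp
  qed
  finally show ?thesis by simp
qed

lemma hbox_bounded: "bounded (hbox (x :: real^'n::finite) r)"
proof -
  have "hbox x r \<subseteq> cball x (real CARD('n) * r)"
    using hbox_norm by (auto simp: dist_norm norm_minus_commute)
  then show ?thesis using bounded_cball bounded_subset by blast
qed

lemma hbox_bounded_borel [simp]: "hbox x r \<in> bounded_borel"
  by (simp add: bounded_borel_def hbox_bounded)

lemma emeasure_hbox:
  fixes x :: "real^'n::finite"
  assumes r: "r > 0"
  shows "emeasure lborel (hbox x r) = ennreal (r ^ CARD('n))"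
proof -
  let ?u = "x + (\<chi> i. r)"
  have b: "(\<Prod>b\<in>Basis. (?u - x) \<bullet> b) = r ^ CARD('n)"
  proof -
    have "(\<Prod>b\<in>Basis. (?u - x) \<bullet> b) = (\<Prod>b\<in>(Basis :: (real^'n) set). r)"
      by (rule prod.cong) (auto simp: Basis_vec_def inner_axis)
    then show ?thesis by simp
  qed
  have le: "x \<bullet> b \<le> ?u \<bullet> b" if "b \<in> Basis" for b
    using that r by (auto simp: Basis_vec_def inner_axis)
  have "box x ?u \<subseteq> hbox x r" "hbox x r \<subseteq> cbox x ?u"
    by (auto simp: mem_box_cart hbox_def less_imp_le)
  then have "emeasure lborel (box x ?u) \<le> emeasure lborel (hbox x r)" "emeasure lborel (hbox x r) \<le> emeasure lborel (cbox x ?u)"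
    by (auto intro!: emeasure_mono)
  moreover have "emeasure lborel (box x ?u) = ennreal (r ^ CARD('n))" "emeasure lborel (cbox x ?u) = ennreal (r ^ CARD('n))"
    using b le by auto
  ultimately show ?thesis by (metis antisym)
qed

lemma lebesgue_hbox:
  fixes x :: "real^'n::finite"
  assumes "r > 0" shows "measure lborel (hbox x r) = r ^ CARD('n)"
  using emeasure_hbox[OF assms, of x] assms by (simp add: measure_def)

lemma sum_near_neutral:
  assumes "near r x \<subseteq> near r' x'" and z: "\<And>k. norm (x - k) > r \<Longrightarrow> g k = (0::complex)"
  shows "(\<Sum>k\<in>near r' x'. g k) = (\<Sum>k\<in>near r x. g k)"
proof (rule sum.mono_neutral_right[OF finite_near assms(1)])
  show "\<forall>i\<in>near r' x' - near r x. g i = 0"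
    by (auto simp: near_def not_le norm_minus_commute intro!: z)
qed

locale partition =
  fixes \<psi> :: "'n::finite cfun"
  assumes part: "smooth_partition \<psi>"
begin

lemma psi_radius_exists: "\<exists>R\<ge>0. \<forall>x. norm x > R \<longrightarrow> \<psi> x = 0"
proof -
  have "bounded (closure {x. \<psi> x \<noteq> 0})"
    using part by (auto simp: smooth_partition_def test_function_def compact_imp_bounded)
  then have "bounded {x. \<psi> x \<noteq> 0}" using closure_subset bounded_subset by blast
  then obtain R where "R > 0" "\<And>x. \<psi> x \<noteq> 0 \<Longrightarrow> norm x \<le> R" unfolding bounded_pos by blast
  then show ?thesis by (intro exI[of _ R]) force
qed

text \<open>A radius for the support of the window; its value only enters the constants.\<close>

definition R :: real where "R = (SOME R. R \<ge> 0 \<and> (\<forall>x. norm x > R \<longrightarrow> \<psi> x = 0))"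

lemma R_nonneg: "R \<ge> 0" and psi_support: "norm x > R \<Longrightarrow> \<psi> x = 0"
proof -
  have "R \<ge> 0 \<and> (\<forall>x. norm x > R \<longrightarrow> \<psi> x = 0)"
    unfolding R_def by (rule someI_ex) (use psi_radius_exists in blast)
  then show "R \<ge> 0" "norm x > R \<Longrightarrow> \<psi> x = 0" by auto
qed

lemma psi_smooth: "C_k m \<psi>"
  using part by (simp add: smooth_partition_def test_function_def)

lemma psi_continuous: "continuous_on UNIV \<psi>"
  by (rule C_k_continuous[OF psi_smooth])

lemma psi_specL1: "\<psi> \<in> specL1"
  by (rule smooth_specL1[OF psi_smooth psi_support])

definition psi_max :: real where "psi_max = (SOME B. \<forall>x. cmod (\<psi> x) \<le> B)"

lemma psi_max: "cmod (\<psi> x) \<le> psi_max"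
  using someI_ex[OF continuous_bounded_support(2)[OF psi_continuous psi_support]] by (simp add: psi_max_def)

definition psi_norm :: real where "psi_norm = FL1_norm \<psi>"

lemma psi_norm_nonneg: "0 \<le> psi_norm" by (simp add: psi_norm_def FL1_norm_nonneg)

lemma psi_shift_support: "norm (x - k) > R \<Longrightarrow> translate k \<psi> x = 0"
  by (simp add: translate_def psi_support)

lemma psi_sum: "(\<Sum>k\<in>near R x. translate k \<psi> x) = 1"
proof -
  have "((\<lambda>k. \<psi> (x - k)) has_sum 1) int_lattice" using part by (simp add: smooth_partition_def)
  moreover have "((\<lambda>k. \<psi> (x - k)) has_sum 1) int_lattice \<longleftrightarrow> ((\<lambda>k. \<psi> (x - k)) has_sum 1) (near R x)"
    by (rule has_sum_cong_neutral) (auto simp: near_def norm_minus_commute intro!: psi_support)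
  ultimately have "((\<lambda>k. \<psi> (x - k)) has_sum 1) (near R x)" by simp
  then have "(\<Sum>k\<in>near R x. \<psi> (x - k)) = 1" by (metis finite_near has_sum_finite has_sum_unique)
  then show ?thesis by (simp add: translate_def)
qed

definition piece :: "'n cfun \<Rightarrow> real^'n \<Rightarrow> 'n cfun" where
  "piece f k = (\<lambda>x. f x * translate k \<psi> x)"

lemma piece_support: "norm (x - k) > R \<Longrightarrow> piece f k x = 0"
  by (simp add: piece_def psi_shift_support)

lemma piece_continuous: "continuous_on UNIV f \<Longrightarrow> continuous_on UNIV (piece f k)"
  unfolding piece_def by (intro continuous_intros translate_continuous psi_continuous)

lemma piece_support0:
  assumes "norm x > norm k + R" shows "piece f k x = 0"
proof (rule piece_support)
  have "norm x \<le> norm (x - k) + norm k" by (metis diff_add_cancel norm_triangle_ineq)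
  then show "norm (x - k) > R" using assms by linarith
qed

lemma piece_sum: "(\<Sum>k\<in>near R x. piece f k x) = f x"
  by (simp add: piece_def sum_distrib_left[symmetric] psi_sum)

lemma piece_bound: 
  assumes "continuous_on UNIV f" shows "\<exists>B. \<forall>x. cmod (piece f k x) \<le> B"
  by (rule continuous_bounded_support(2)[OF piece_continuous[OF assms] piece_support0])

lemma piece_FL1_iff:
  assumes c: "continuous_on UNIV f"
  shows "piece f k \<in> FL1 \<longleftrightarrow> piece f k \<in> specL1"
  using FL1_imp_specL1[OF _ continuous_bounded_support(1)[OF piece_continuous[OF c] piece_support0]]
    specL1_imp_FL1[OF _ piece_continuous[OF c]] piece_bound[OF c] by blast

lemma S0_iff: "f \<in> S0 \<psi> \<longleftrightarrow> continuous_on UNIV f \<and> (\<forall>k\<in>int_lattice. piece f k \<in> specL1) 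
    \<and> (\<lambda>k. FL1_norm (piece f k)) summable_on int_lattice"
  by (auto simp: S0_def piece_def[symmetric] piece_FL1_iff)

lemma S0_norm_eq: "S0_norm \<psi> f = (\<Sum>\<^sub>\<infinity>k\<in>int_lattice. FL1_norm (piece f k))"
  by (simp add: S0_norm_def piece_def)

lemma S0_norm_nonneg: "0 \<le> S0_norm \<psi> f"
  unfolding S0_norm_eq by (rule infsum_nonneg) (rule FL1_norm_nonneg)

text \<open>Bound for the norm of the synthesis map on local pieces supported at distance at most \<open>r\<close> from their lattice
points.\<close>

definition synth :: "real \<Rightarrow> real" where
  "synth r = real (card (near (r + R) (0 :: real^'n))) * psi_norm"

lemma synth_nonneg: "0 \<le> synth r" by (simp add: synth_def psi_norm_nonneg)

text \<open>Each local piece of \<open>f\<close> meets only those \<open>g m\<close> with \<open>m\<close> close to its lattice point, and multiplying by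
the window costs the factor \<open>FL1_norm \<psi>\<close>; summing up is a convolution on the lattice.  Translates,
reflections and convolutions are put into \<open>S\<^sub>0\<close> in this way.\<close>

lemma S0_synthesis:
  assumes c: "continuous_on UNIV f"
    and g: "\<And>k. k \<in> int_lattice \<Longrightarrow> g k \<in> specL1"
    and supp: "\<And>k x. norm (x - k) > r \<Longrightarrow> g k x = 0"
    and f: "\<And>x. f x = (\<Sum>k\<in>near r x. g k x)"
    and a: "a summable_on int_lattice" "\<And>k. k \<in> int_lattice \<Longrightarrow> FL1_norm (g k) \<le> a k"
  shows "f \<in> S0 \<psi>" and "S0_norm \<psi> f \<le> synth r * (\<Sum>\<^sub>\<infinity>k\<in>int_lattice. a k)"
proof -
  have piece: "piece f k = (\<lambda>x. \<Sum>m\<in>near (r + R) k. g m x * translate k \<psi> x)" for k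
  proof
    fix x
    show "piece f k x = (\<Sum>m\<in>near (r + R) k. g m x * translate k \<psi> x)"
    proof (cases "norm (x - k) \<le> R")
      case True
      then have "(\<Sum>m\<in>near (r + R) k. g m x) = (\<Sum>m\<in>near r x. g m x)"
        by (intro sum_near_neutral[OF near_shift[OF True]] supp)
      then show ?thesis unfolding sum_distrib_right[symmetric] by (simp add: piece_def f)
    next
      case False
      then show ?thesis using psi_shift_support[of x k] by (simp add: piece_def)
    qed
  qed
  have l: "m \<in> int_lattice" if "m \<in> near \<rho> k" for m k \<rho> using that by (simp add: near_def)
  have pk: "piece f k \<in> specL1 \<and> FL1_norm (piece f k) \<le> (\<Sum>m\<in>near (r + R) k. a m) * psi_norm" if k: "k \<in> int_lattice" for k
  proof -
    have t: "translate k \<psi> \<in> specL1" "FL1_norm (translate k \<psi>) = psi_norm"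
      using specL1_translate[OF psi_specL1] by (auto simp: psi_norm_def)
    have tb: "cmod (translate k \<psi> x) \<le> psi_max" for x by (simp add: translate_def psi_max)
    note m = specL1_mult[OF g[OF l] t(1) translate_continuous[OF psi_continuous] tb]
    have s: "piece f k \<in> specL1 \<and> FL1_norm (piece f k) \<le> (\<Sum>m\<in>near (r + R) k. FL1_norm (\<lambda>x. g m x * translate k \<psi> x))"
      unfolding piece by (rule specL1_sum) (rule m(1))
    moreover have "(\<Sum>m\<in>near (r + R) k. FL1_norm (\<lambda>x. g m x * translate k \<psi> x)) \<le> (\<Sum>m\<in>near (r + R) k. a m * psi_norm)"
    proof (rule sum_mono)
      fix i assume i: "i \<in> near (r + R) k"
      have "FL1_norm (\<lambda>x. g i x * translate k \<psi> x) \<le> FL1_norm (g i) * psi_norm" using m(2)[OF i] t(2) by simp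
      also have "\<dots> \<le> a i * psi_norm" by (intro mult_right_mono a(2) l[OF i] psi_norm_nonneg)
      finally show "FL1_norm (\<lambda>x. g i x * translate k \<psi> x) \<le> a i * psi_norm" .
    qed
    ultimately show ?thesis by (auto simp: sum_distrib_right)
  qed
  have s: "(\<lambda>k. (\<Sum>m\<in>near (r + R) k. a m) * psi_norm) summable_on int_lattice"
    by (intro summable_on_cmult_left lattice_convolution_sum a)
  have s': "(\<lambda>k. FL1_norm (piece f k)) summable_on int_lattice"
    by (rule summable_on_comparison_test[OF s]) (use pk FL1_norm_nonneg in auto)
  show "f \<in> S0 \<psi>" unfolding S0_iff using c pk s' by blast
  have "S0_norm \<psi> f \<le> (\<Sum>\<^sub>\<infinity>k\<in>int_lattice. (\<Sum>m\<in>near (r + R) k. a m) * psi_norm)"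
    unfolding S0_norm_eq by (rule infsum_mono[OF s' s]) (use pk in auto)
  also have "\<dots> = synth r * (\<Sum>\<^sub>\<infinity>k\<in>int_lattice. a k)"
    using lattice_convolution_sum[OF a(1), of "r + R"] by (simp add: infsum_cmult_left synth_def)
  finally show "S0_norm \<psi> f \<le> synth r * (\<Sum>\<^sub>\<infinity>k\<in>int_lattice. a k)" .
qed

lemma S0D: "f \<in> S0 \<psi> \<Longrightarrow> continuous_on UNIV f" 
   "f \<in> S0 \<psi> \<Longrightarrow> k \<in> int_lattice \<Longrightarrow> piece f k \<in> specL1"
   "f \<in> S0 \<psi> \<Longrightarrow> (\<lambda>k. FL1_norm (piece f k)) summable_on int_lattice"
  by (auto simp: S0_iff)

lemma piece_sup:
  assumes "f \<in> S0 \<psi>" "k \<in> int_lattice" shows "cmod (piece f k x) \<le> FL1_norm (piece f k)"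
  using specL1_sup[OF S0D(2)[OF assms] piece_continuous[OF S0D(1)[OF assms(1)]]] piece_bound[OF S0D(1)[OF assms(1)]] by blast

definition wiener_const :: real where "wiener_const = real (card (near (R + real CARD('n)) (0 :: real^'n)))"

text \<open>A function is bounded by the \<open>L\<^sup>1\<close> norm of its Fourier transform.\<close>

lemma S0_wiener:
  assumes f: "f \<in> S0 \<psi>"
  shows "f \<in> wiener" and "wiener_norm f \<le> wiener_const * S0_norm \<psi> f"
proof -
  have le: "cmod (f x) \<le> (\<Sum>k\<in>near R x. FL1_norm (piece f k))" for x
  proof -
    have "cmod (f x) = cmod (\<Sum>k\<in>near R x. piece f k x)" by (simp add: piece_sum)
    also have "\<dots> \<le> (\<Sum>k\<in>near R x. FL1_norm (piece f k))"
      by (rule sum_norm_le) (use piece_sup[OF f] in \<open>auto simp: near_def\<close>)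
    finally show ?thesis .
  qed
  show "f \<in> wiener" "wiener_norm f \<le> wiener_const * S0_norm \<psi> f"
    unfolding S0_norm_eq wiener_const_def
    by (rule wienerI_near[OF S0D(1)[OF f] S0D(3)[OF f] FL1_norm_nonneg le])+
qed

lemma S0_lincomb:
  assumes f: "f \<in> S0 \<psi>" and g: "g \<in> S0 \<psi>"
  shows "(\<lambda>x. a * f x + b * g x) \<in> S0 \<psi>"
    and "S0_norm \<psi> (\<lambda>x. a * f x + b * g x) \<le> cmod a * S0_norm \<psi> f + cmod b * S0_norm \<psi> g"
proof -
  have p: "piece (\<lambda>x. a * f x + b * g x) k = (\<lambda>x. a * piece f k x + b * piece g k x)" for k
    by (simp add: piece_def algebra_simps)
  note l = specL1_lincomb[OF S0D(2)[OF f] S0D(2)[OF g], of _ _ a b]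
  have hs: "((\<lambda>k. cmod a * FL1_norm (piece f k) + cmod b * FL1_norm (piece g k)) has_sum 
      (cmod a * S0_norm \<psi> f + cmod b * S0_norm \<psi> g)) int_lattice"
    unfolding S0_norm_eq using S0D(3)[OF f] S0D(3)[OF g] by (intro has_sum_add has_sum_cmult_right has_sum_infsum)
  have s: "(\<lambda>k. FL1_norm (piece (\<lambda>x. a * f x + b * g x) k)) summable_on int_lattice"
    by (rule summable_on_comparison_test[OF has_sum_imp_summable[OF hs]]) (use l(2) FL1_norm_nonneg in \<open>auto simp: p\<close>)
  show "(\<lambda>x. a * f x + b * g x) \<in> S0 \<psi>"
    unfolding S0_iff using s l(1) S0D(1)[OF f] S0D(1)[OF g] by (auto simp: p intro!: continuous_intros)
  have "S0_norm \<psi> (\<lambda>x. a * f x + b * g x) \<le> infsum (\<lambda>k. cmod a * FL1_norm (piece f k) + cmod b * FL1_norm (piece g k)) int_lattice"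
    unfolding S0_norm_eq by (rule infsum_mono[OF s has_sum_imp_summable[OF hs]]) (use l(2) in \<open>auto simp: p\<close>)
  then show "S0_norm \<psi> (\<lambda>x. a * f x + b * g x) \<le> cmod a * S0_norm \<psi> f + cmod b * S0_norm \<psi> g"
    using infsumI[OF hs] by simp
qed

lemma S0_zero [simp]: "(\<lambda>x. 0) \<in> S0 \<psi>" "S0_norm \<psi> (\<lambda>x. 0) = 0"
proof -
  have "piece (\<lambda>x. 0) k = (\<lambda>x. 0)" for k by (simp add: piece_def)
  then show "(\<lambda>x. 0) \<in> S0 \<psi>" "S0_norm \<psi> (\<lambda>x. 0) = 0" by (auto simp: S0_iff S0_norm_eq)
qed

lemma S0_cmult: "f \<in> S0 \<psi> \<Longrightarrow> (\<lambda>x. a * f x) \<in> S0 \<psi>"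
   "f \<in> S0 \<psi> \<Longrightarrow> S0_norm \<psi> (\<lambda>x. a * f x) \<le> cmod a * S0_norm \<psi> f"
  using S0_lincomb[of f f a 0] by auto

lemma S0_add: "f \<in> S0 \<psi> \<Longrightarrow> g \<in> S0 \<psi> \<Longrightarrow> (\<lambda>x. f x + g x) \<in> S0 \<psi>"
  using S0_lincomb(1)[of f g 1 1] by auto

lemma S0_diff: "f \<in> S0 \<psi> \<Longrightarrow> g \<in> S0 \<psi> \<Longrightarrow> (\<lambda>x. f x - g x) \<in> S0 \<psi>"
  using S0_lincomb(1)[of f g 1 "-1"] by auto

lemma S0_sum: "(\<And>i. i \<in> I \<Longrightarrow> f i \<in> S0 \<psi>) \<Longrightarrow> (\<lambda>x. \<Sum>i\<in>I. f i x) \<in> S0 \<psi>"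
  by (induction I rule: infinite_finite_induct) (auto intro: S0_add)

lemma norm_shift_gt: "norm (x - k) > R + norm y \<Longrightarrow> norm (x - y - (k :: real^'n)) > R"
proof -
  assume a: "norm (x - k) > R + norm y"
  have "norm (x - k) \<le> norm (x - y - k) + norm y"
    using norm_triangle_ineq[of "x - y - k" y] by (simp add: algebra_simps)
  with a show ?thesis by linarith
qed

lemma translated_piece_sum:
  assumes "norm y \<le> \<rho>"
  shows "f (x - y) = (\<Sum>k\<in>near (R + \<rho>) x. piece f k (x - y))"
proof -
  have "(\<Sum>k\<in>near (R + \<rho>) x. piece f k (x - y)) = (\<Sum>k\<in>near R (x - y). piece f k (x - y))"
  proof (rule sum_near_neutral)
    show "near R (x - y) \<subseteq> near (R + \<rho>) x"
      by (rule near_shift) (use assms in simp)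
  qed (rule piece_support)
  then show ?thesis by (simp add: piece_sum)
qed

text \<open>The translated pieces are farther from their lattice points by at most \<open>norm y\<close>, and translation
preserves \<open>FL1_norm\<close>.\<close>

lemma S0_translate:
  assumes f: "f \<in> S0 \<psi>"
  shows "translate y f \<in> S0 \<psi>"
    and "S0_norm \<psi> (translate y f) \<le> synth (R + norm y) * S0_norm \<psi> f"
proof -
  have *: "translate y f x = (\<Sum>k\<in>near (R + norm y) x. translate y (piece f k) x)" for x
    using translated_piece_sum[of y "norm y" f x] by (simp add: translate_def)
  have **: "translate y (piece f k) x = 0" if "norm (x - k) > R + norm y" for k x
    using norm_shift_gt[OF that] by (simp add: translate_def piece_support)
  have n: "FL1_norm (translate y (piece f k)) \<le> FL1_norm (piece f k)" if "k \<in> int_lattice" for k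
    using specL1_translate(2)[OF S0D(2)[OF f that]] by simp
  note s = S0_synthesis[OF translate_continuous[OF S0D(1)[OF f]] specL1_translate(1)[OF S0D(2)[OF f]] ** * S0D(3)[OF f] n]
  show "translate y f \<in> S0 \<psi>" "S0_norm \<psi> (translate y f) \<le> synth (R + norm y) * S0_norm \<psi> f"
    using s by (auto simp: S0_norm_eq)
qed

lemma S0_flip:
  assumes f: "f \<in> S0 \<psi>"
  shows "flip f \<in> S0 \<psi>" and "S0_norm \<psi> (flip f) \<le> synth R * S0_norm \<psi> f"
proof -
  have near_minus: "near R x = uminus ` near R (- x)" for x :: "real^'n"
  proof -
    have "k \<in> near R x \<longleftrightarrow> - k \<in> near R (- x)" for k
      using norm_minus_cancel[of "k - x"] lattice_minus[of k] lattice_minus[of "- k"] by (auto simp: near_def)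
    moreover have "k \<in> uminus ` S \<longleftrightarrow> - k \<in> S" for k :: "real^'n" and S
      by (auto simp: image_iff intro: bexI[of _ "- k"])
    ultimately show ?thesis by blast
  qed
  have *: "flip f x = (\<Sum>k\<in>near R x. flip (piece f (- k)) x)" for x
  proof -
    have "(\<Sum>k\<in>near R x. piece f (- k) (- x)) = (\<Sum>k\<in>near R (- x). piece f k (- x))"
      unfolding near_minus[of x] by (subst sum.reindex) auto
    then show ?thesis by (simp add: flip_def piece_sum)
  qed
  have **: "flip (piece f (- k)) x = 0" if "norm (x - k) > R" for k x
  proof -
    have "norm (- x - (- k)) > R" using that norm_minus_commute[of x k] by simp
    from piece_support[OF this] show ?thesis by (simp add: flip_def)
  qed
  have a: "(\<lambda>k. FL1_norm (piece f (- k))) summable_on int_lattice" 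
     "(\<Sum>\<^sub>\<infinity>k\<in>int_lattice. FL1_norm (piece f (- k))) = S0_norm \<psi> f"
    using S0D(3)[OF f] summable_on_reindex_bij_betw[OF bij_lattice_minus, of "\<lambda>k. FL1_norm (piece f k)"]
      infsum_reindex_bij_betw[OF bij_lattice_minus, of "\<lambda>k. FL1_norm (piece f k)"] by (auto simp: S0_norm_eq)
  have n: "flip (piece f (- k)) \<in> specL1" "FL1_norm (flip (piece f (- k))) \<le> FL1_norm (piece f (- k))" if "k \<in> int_lattice" for k
    using specL1_flip[OF S0D(2)[OF f lattice_minus[OF that]]] by auto
  note s = S0_synthesis[OF flip_continuous[OF S0D(1)[OF f]] n(1) ** * a(1) n(2)]
  show "flip f \<in> S0 \<psi>" "S0_norm \<psi> (flip f) \<le> synth R * S0_norm \<psi> f"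
    using s a(2) by auto
qed

end

section \<open>Continuity of translation and averaging\<close>

lemma cmod_cis_minus_1: "cmod (cis x - 1) \<le> \<bar>x\<bar>"
  using iexp_approx1[of x 0] by (simp add: cis_conv_exp)

text \<open>Multipliers that converge to one boundedly converge strongly, by dominated convergence on the Fourier
side.  Translations and averages over cubes are both of this kind.\<close>

lemma multiplier_null:
  fixes p :: "'n::finite cfun"
  assumes p: "p \<in> specL1" and q: "\<And>n. q n \<in> specL1"
    and F: "\<And>n s. fourier (q n) s = (m n s - 1) * fourier p s"
    and m: "\<And>n s. cmod (m n s) \<le> 1" and lim: "\<And>s. (\<lambda>n. m n s) \<longlonglongrightarrow> 1"
  shows "FL1_norm (q n) \<le> 2 * FL1_norm p" and "(\<lambda>n. FL1_norm (q n)) \<longlonglongrightarrow> 0"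
proof -
  have b: "cmod (fourier (q n) s) \<le> 2 * cmod (fourier p s)" for n s
  proof -
    have "cmod (m n s - 1) \<le> 2" using norm_triangle_ineq4[of "m n s" 1] m[of n s] by simp
    then show ?thesis by (simp add: F norm_mult mult_right_mono)
  qed
  have pi: "integrable lborel (\<lambda>s. 2 * cmod (fourier p s))" using specL1D(2)[OF p] by simp
  show "FL1_norm (q n) \<le> 2 * FL1_norm p"
  proof -
    have "FL1_norm (q n) \<le> (LINT s|lborel. 2 * cmod (fourier p s))"
      unfolding FL1_norm_def using specL1D(2)[OF q] b by (intro integral_mono pi) auto
    then show ?thesis by (simp add: FL1_norm_def)
  qed
  have "(\<lambda>n. LINT s|lborel. cmod (fourier (q n) s)) \<longlonglongrightarrow> (LINT (s::real^'n)|lborel. (0::real))"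
  proof (rule integral_dominated_convergence[OF _ _ pi])
    show "(\<lambda>s. cmod (fourier (q n) s)) \<in> borel_measurable lborel" for n
      using borel_measurable_integrable[OF specL1D(2)[OF q[of n]]] by measurable
    have "(\<lambda>n. cmod (fourier (q n) s)) \<longlonglongrightarrow> cmod ((1 - 1) * fourier p s)" for s
      unfolding F by (intro tendsto_intros lim)
    then show "AE s in lborel. (\<lambda>n. cmod (fourier (q n) s)) \<longlonglongrightarrow> 0" by simp
  qed (use b in auto)
  then show "(\<lambda>n. FL1_norm (q n)) \<longlonglongrightarrow> 0" by (simp add: FL1_norm_def)
qed

lemma convolve_continuous:
  fixes b f :: "'n::finite cfun"
  assumes b: "integrable lborel b" and c: "continuous_on UNIV f" and B: "\<And>x. cmod (f x) \<le> B"
  shows "continuous_on UNIV (convolve b f)"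
  unfolding continuous_on_sequentially
proof (intro allI ballI impI, elim conjE)
  fix u and a :: "real^'n" assume u: "u \<longlonglongrightarrow> a"
  note [measurable] = borel_measurable_integrable[OF b] borel_measurable_continuous_onI[OF c]
  show "(convolve b f \<circ> u) \<longlonglongrightarrow> convolve b f a"
    unfolding convolve_def o_def
  proof (rule integral_dominated_convergence[where w="\<lambda>y. cmod (b y) * B"])
    show "integrable lborel (\<lambda>y. cmod (b y) * B)" using b by simp
    have "(\<lambda>n. f (u n - y)) \<longlonglongrightarrow> f (a - y)" for y
      by (rule continuous_on_tendsto_compose[OF c]) (auto intro: tendsto_diff u)
    then show "AE y in lborel. (\<lambda>n. b y * f (u n - y)) \<longlonglongrightarrow> b y * f (a - y)"
      by (intro AE_I2 tendsto_mult tendsto_const)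
    show "AE y in lborel. cmod (b y * f (u n - y)) \<le> cmod (b y) * B" for n
      using B by (intro AE_I2) (auto simp: norm_mult intro!: mult_left_mono)
  qed measurable
qed

lemma integrable_mult_shift:
  fixes b f :: "'n::finite cfun"
  assumes b: "integrable lborel b" and m: "f \<in> borel_measurable borel" and B: "\<And>x. cmod (f x) \<le> B"
  shows "integrable lborel (\<lambda>y. b y * f (x - y))"
proof (rule Bochner_Integration.integrable_bound)
  note [measurable] = borel_measurable_integrable[OF b] m
  show "integrable lborel (\<lambda>y. of_real B * b y)" using b by simp
  show "(\<lambda>y. b y * f (x - y)) \<in> borel_measurable lborel" by measurable
  show "AE y in lborel. cmod (b y * f (x - y)) \<le> cmod (of_real B * b y)"
  proof (rule AE_I2)
    fix y
    have "cmod (f (x - y)) \<le> \<bar>B\<bar>" using B[of "x - y"] by linarith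
    then show "cmod (b y * f (x - y)) \<le> cmod (of_real B * b y)"
      using mult_right_mono[of "cmod (f (x - y))" "\<bar>B\<bar>" "cmod (b y)"] by (simp add: norm_mult mult.commute)
  qed
qed

lemma convolve_finite_sum:
  fixes b f :: "'n::finite cfun"
  assumes b: "integrable lborel b" and bz: "\<And>y. norm y > \<rho> \<Longrightarrow> b y = 0"
    and m: "\<And>k. g k \<in> borel_measurable borel" and B: "\<And>k x. cmod (g k x) \<le> B k"
    and f: "\<And>y. norm y \<le> \<rho> \<Longrightarrow> f (x - y) = (\<Sum>k\<in>K. g k (x - y))"
  shows "convolve b f x = (\<Sum>k\<in>K. convolve b (g k) x)"
proof -
  have "b y * f (x - y) = (\<Sum>k\<in>K. b y * g k (x - y))" for y
    using f[of y] bz[of y] by (cases "norm y \<le> \<rho>") (auto simp: sum_distrib_left)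
  then have "convolve b f x = (LINT y|lborel. (\<Sum>k\<in>K. b y * g k (x - y)))" by (simp add: convolve_def)
  also have "\<dots> = (\<Sum>k\<in>K. convolve b (g k) x)"
    unfolding convolve_def by (rule Bochner_Integration.integral_sum) (rule integrable_mult_shift[OF b m B])
  finally show ?thesis .
qed

lemma convolve_support:
  fixes b f :: "'n::finite cfun"
  assumes bz: "\<And>y. norm y > \<rho> \<Longrightarrow> b y = 0" and fz: "\<And>x. norm (x - k) > r \<Longrightarrow> f x = 0"
    and x: "norm (x - k) > r + \<rho>"
  shows "convolve b f x = 0"
proof -
  have "b y * f (x - y) = 0" for y
  proof (cases "norm y \<le> \<rho>")
    case True
    have "norm (x - k) \<le> norm (x - y - k) + norm y"
      using norm_triangle_ineq[of "x - y - k" y] by (simp add: algebra_simps)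
    then have "norm (x - y - k) > r" using x True by linarith
    then show ?thesis by (simp add: fz)
  qed (simp add: bz)
  then have "(\<lambda>y. b y * f (x - y)) = (\<lambda>y. 0)" by blast
  then show ?thesis by (simp add: convolve_def)
qed

lemma complex_indicator_integrable:
  assumes "A \<in> sets borel" "emeasure lborel A < \<infinity>"
  shows "integrable lborel (indicator A :: 'n::finite cfun)"
proof -
  have "integrable lborel (\<lambda>x. complex_of_real (indicator A x))"
    using assms by (intro integrable_of_real integrable_real_indicator) auto
  moreover have "(\<lambda>x. complex_of_real (indicator A x)) = indicator A" by (auto simp: indicator_def)
  ultimately show ?thesis by simp
qed

text \<open>Convolution with \<open>avg r\<close> averages over a cube of side \<open>r\<close>.  It is real and nonnegative, but takes complex
values to be an argument of \<open>convolve\<close> and \<open>fourier\<close>.\<close>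

definition avg :: "real \<Rightarrow> 'n::finite cfun" where
  "avg r x = of_real (1 / r ^ CARD('n)) * indicator (hbox 0 r) x"

lemma avg_integrable:
  assumes "r > 0" shows "integrable lborel (avg r :: 'n::finite cfun)"
  unfolding avg_def
  by (intro integrable_mult_right complex_indicator_integrable) (simp_all add: emeasure_hbox assms)

lemma avg_eq_norm: "r > 0 \<Longrightarrow> avg r x = of_real (cmod (avg r (x :: real^'n::finite)))"
  by (auto simp: avg_def indicator_def norm_divide norm_power)

lemma avg_integral:
  assumes "r > 0" shows "(LINT x|lborel. cmod (avg r (x :: real^'n::finite))) = 1" "(LINT x|lborel. avg r (x :: real^'n::finite)) = 1"
proof -
  have "(\<lambda>x. cmod (avg r (x :: real^'n))) = (\<lambda>x. (1 / r ^ CARD('n)) * indicator (hbox 0 r) x)"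
    using assms by (auto simp: avg_def norm_mult indicator_def norm_divide norm_power)
  then have "(LINT x|lborel. cmod (avg r (x :: real^'n))) = (1 / r ^ CARD('n)) * (LINT x|lborel. indicator (hbox 0 r) (x :: real^'n))"
    by (simp only: integral_mult_right_zero)
  also have "\<dots> = 1" using assms lebesgue_hbox[OF assms, of "0 :: real^'n"] by simp
  finally show 1: "(LINT x|lborel. cmod (avg r (x :: real^'n))) = 1" .
  have "(LINT x|lborel. avg r (x :: real^'n)) = (LINT x|lborel. of_real (cmod (avg r (x :: real^'n))))"
    by (rule Bochner_Integration.integral_cong[OF refl avg_eq_norm[OF assms]])
  also have "\<dots> = of_real (LINT x|lborel. cmod (avg r (x :: real^'n)))" by (rule integral_complex_of_real)
  finally show "(LINT x|lborel. avg r (x :: real^'n)) = 1" using 1 by simp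
qed

lemma avg_support: "norm (y :: real^'n::finite) > real CARD('n) * r \<Longrightarrow> avg r y = 0"
  using hbox_norm[of y 0 r] by (auto simp: avg_def indicator_def)

lemma avg_average:
  fixes h :: "'n::finite cfun"
  assumes r: "r > 0" and h: "h \<in> borel_measurable borel" 
    and B: "\<And>y. norm y \<le> real CARD('n) * r \<Longrightarrow> cmod (h y - c) \<le> B"
  shows "cmod ((LINT y|lborel. avg r y * h y) - c) \<le> B"
proof -
  note ai = avg_integrable[OF r, where 'n='n]
  note [measurable] = borel_measurable_integrable[OF ai] h
  have B0: "0 \<le> B" using B[of 0] r norm_ge_zero[of "h 0 - c"] by (simp del: norm_ge_zero)
  have le: "cmod (avg r y * (h y - c)) \<le> B * cmod (avg r y)" for y
  proof (cases "norm y \<le> real CARD('n) * r")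
    case True
    from mult_left_mono[OF B[OF this], of "cmod (avg r y)"] show ?thesis
      by (simp add: norm_mult mult.commute)
  qed (simp add: avg_support)
  have i1: "integrable lborel (\<lambda>y. avg r y * (h y - c))"
  proof (rule Bochner_Integration.integrable_bound)
    show "integrable lborel (\<lambda>y. of_real B * avg r (y :: real^'n))" using ai by simp
    show "AE y in lborel. cmod (avg r y * (h y - c)) \<le> cmod (of_real B * avg r y)"
      using le B0 by (intro AE_I2) (simp add: norm_mult)
  qed measurable
  have i2: "integrable lborel (\<lambda>y. avg r (y :: real^'n) * c)" using ai by simp
  have "avg r y * h y = avg r y * (h y - c) + avg r y * c" for y by (simp add: algebra_simps)
  then have "(LINT y|lborel. avg r y * h y) = (LINT y|lborel. avg r y * (h y - c)) + (LINT y|lborel. avg r (y :: real^'n) * c)"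
    using Bochner_Integration.integral_add[OF i1 i2] by simp
  then have "(LINT y|lborel. avg r y * h y) - c = (LINT y|lborel. avg r y * (h y - c))"
    using avg_integral(2)[OF r, where 'n='n] by simp
  then have "cmod ((LINT y|lborel. avg r y * h y) - c) \<le> (LINT y|lborel. cmod (avg r y * (h y - c)))" by simp
  also have "\<dots> \<le> (LINT y|lborel. B * cmod (avg r (y :: real^'n)))"
    by (rule integral_mono[OF integrable_norm[OF i1] integrable_mult_right[OF integrable_norm[OF ai]] le])
  also have "\<dots> = B" using avg_integral(1)[OF r, where 'n='n] by simp
  finally show ?thesis .
qed

lemma fourier_avg:
  assumes r: "r > 0"
  shows "cmod (fourier (avg r) (s :: real^'n::finite)) \<le> 1"
    and "cmod (fourier (avg r) (s :: real^'n::finite) - 1) \<le> 2 * pi * norm s * real CARD('n) * r"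
proof -
  show "cmod (fourier (avg r) s) \<le> 1"
    using fourier_bound[OF avg_integrable[OF r]] avg_integral(1)[OF r, where 'n='n] by metis
  show "cmod (fourier (avg r) s - 1) \<le> 2 * pi * norm s * real CARD('n) * r"
    unfolding fourier_def
  proof (rule avg_average[OF r])
    fix t :: "real^'n" assume t: "norm t \<le> real CARD('n) * r"
    have "cmod (cis (- (2 * pi * (s \<bullet> t))) - 1) \<le> \<bar>- (2 * pi * (s \<bullet> t))\<bar>" by (rule cmod_cis_minus_1)
    also have "\<dots> = 2 * pi * \<bar>s \<bullet> t\<bar>" by (simp add: abs_mult)
    also have "\<dots> \<le> 2 * pi * (norm s * norm t)" by (intro mult_left_mono Cauchy_Schwarz_ineq2) auto
    also have "\<dots> \<le> 2 * pi * (norm s * (real CARD('n) * r))" by (intro mult_left_mono t) auto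
    finally show "cmod (cis (- (2 * pi * (s \<bullet> t))) - 1) \<le> 2 * pi * norm s * real CARD('n) * r" by (simp only: mult.assoc)
  qed measurable
qed

lemma wiener_avg:
  fixes f :: "'n::finite cfun"
  assumes f: "f \<in> wiener" and e: "e > 0"
  shows "\<exists>r>0. r \<le> 1 \<and> (\<lambda>x. convolve (avg r) f x - f x) \<in> wiener \<and> wiener_norm (\<lambda>x. convolve (avg r) f x - f x) \<le> e"
proof -
  have c: "continuous_on UNIV f" by (rule wiener_continuous[OF f])
  obtain \<delta> where d: "\<delta> > 0"
    "\<And>g. continuous_on UNIV g \<Longrightarrow> (\<And>x B. (\<And>y. norm y \<le> \<delta> \<Longrightarrow> cmod (f (x - y) - f x) \<le> B) \<Longrightarrow> cmod (g x) \<le> B)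
       \<Longrightarrow> g \<in> wiener \<and> wiener_norm g \<le> e"
    using wiener_oscillation[OF f e] by blast
  define r where "r = min 1 (\<delta> / real CARD('n))"
  have r: "r > 0" "r \<le> 1" using d(1) by (auto simp: r_def)
  have rd: "real CARD('n) * r \<le> \<delta>" by (auto simp: r_def min_def field_simps)
  have "(\<lambda>x. convolve (avg r) f x - f x) \<in> wiener \<and> wiener_norm (\<lambda>x. convolve (avg r) f x - f x) \<le> e"
  proof (rule d(2))
    show "continuous_on UNIV (\<lambda>x. convolve (avg r) f x - f x)"
      by (intro continuous_intros c convolve_continuous[OF avg_integrable[OF r(1)] c wiener_norm_sup[OF f]])
    fix x B assume B: "\<And>y. norm y \<le> \<delta> \<Longrightarrow> cmod (f (x - y) - f x) \<le> B"
    show "cmod (convolve (avg r) f x - f x) \<le> B"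
      unfolding convolve_def
    proof (rule avg_average[OF r(1)])
      show "(\<lambda>y. f (x - y)) \<in> borel_measurable borel"
        using borel_measurable_continuous_onI[OF c] by measurable
      show "cmod (f (x - y) - f x) \<le> B" if "norm y \<le> real CARD('n) * r" for y
        by (rule B) (use that rd in linarith)
    qed
  qed
  with r show ?thesis by blast
qed

context partition
begin

text \<open>\<open>multiplier_null\<close> on each piece, combined by synthesis; the sum over the pieces is dominated
by twice the norm of \<open>f\<close>.\<close>

lemma S0_multiplier_null:
  assumes f: "f \<in> S0 \<psi>"
    and m: "\<And>n s. cmod (m n s) \<le> 1" and lim: "\<And>s. (\<lambda>n. m n s) \<longlonglongrightarrow> 1"
    and c: "\<And>n. continuous_on UNIV (h n)"
    and q: "\<And>n k. k \<in> int_lattice \<Longrightarrow> q n k \<in> specL1"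
    and supp: "\<And>n k x. norm (x - k) > r \<Longrightarrow> q n k x = 0"
    and h: "\<And>n x. h n x = (\<Sum>k\<in>near r x. q n k x)"
    and F: "\<And>n k s. k \<in> int_lattice \<Longrightarrow> fourier (q n k) s = (m n s - 1) * fourier (piece f k) s"
  shows "\<And>n. h n \<in> S0 \<psi>" and "(\<lambda>n. S0_norm \<psi> (h n)) \<longlonglongrightarrow> 0"
proof -
  note mn = multiplier_null[OF S0D(2)[OF f] q F m lim]
  have bs: "(\<lambda>k. 2 * FL1_norm (piece f k)) summable_on int_lattice"
    by (intro summable_on_cmult_right S0D(3)[OF f])
  have s: "(\<lambda>k. FL1_norm (q n k)) summable_on int_lattice" for n
    by (rule summable_on_comparison_test[OF bs]) (use mn(1) FL1_norm_nonneg in auto)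
  note syn = S0_synthesis[OF c q supp h s order_refl]
  show "h n \<in> S0 \<psi>" for n by (rule syn(1))
  have "(\<lambda>n. \<Sum>\<^sub>\<infinity>k\<in>int_lattice. FL1_norm (q n k)) \<longlonglongrightarrow> 0"
    by (rule infsum_dominated_null[OF bs FL1_norm_nonneg]) (use mn in auto)
  then have "(\<lambda>n. synth r * (\<Sum>\<^sub>\<infinity>k\<in>int_lattice. FL1_norm (q n k))) \<longlonglongrightarrow> 0"
    by (rule tendsto_mult_right_zero)
  then show "(\<lambda>n. S0_norm \<psi> (h n)) \<longlonglongrightarrow> 0"
    by (rule tendsto_sandwich[OF _ _ tendsto_const, rotated 2]) (auto intro!: always_eventually syn(2) S0_norm_nonneg)
qed

lemma S0_translate_null:
  assumes f: "f \<in> S0 \<psi>" and y: "y \<longlonglongrightarrow> 0" and y1: "\<And>n. norm (y n) \<le> 1"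
  shows "(\<lambda>n. S0_norm \<psi> (\<lambda>x. translate (y n) f x - f x)) \<longlonglongrightarrow> 0"
proof (rule S0_multiplier_null(2)[OF f, where m="\<lambda>n s. cis (- (2 * pi * (s \<bullet> y n)))" and r="R + 1"
      and q="\<lambda>n k x. translate (y n) (piece f k) x - piece f k x"])
  show "(\<lambda>n. cis (- (2 * pi * (s \<bullet> y n)))) \<longlonglongrightarrow> 1" for s
  proof -
    have "(\<lambda>n. cis (- (2 * pi * (s \<bullet> y n)))) \<longlonglongrightarrow> cis (- (2 * pi * (s \<bullet> 0)))"
      by (intro continuous_on_tendsto_compose[of UNIV cis] continuous_intros tendsto_intros y) auto
    then show ?thesis by simp
  qed
  show "continuous_on UNIV (\<lambda>x. translate (y n) f x - f x)" for n
    by (intro continuous_intros translate_continuous S0D(1)[OF f])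
  show "(\<lambda>x. translate (y n) (piece f k) x - piece f k x) \<in> specL1" if "k \<in> int_lattice" for n k
    using specL1_lincomb(1)[OF specL1_translate(1)[OF S0D(2)[OF f that]] S0D(2)[OF f that], of 1 _ "-1"] by simp
  show "translate (y n) (piece f k) x - piece f k x = 0" if "norm (x - k) > R + 1" for n k x
  proof -
    have "norm (x - k) > R" "norm (x - k) > R + norm (y n)" using that y1[of n] by auto
    then show ?thesis using norm_shift_gt[of "y n" x k] by (simp add: translate_def piece_support)
  qed
  show "translate (y n) f x - f x = (\<Sum>k\<in>near (R + 1) x. translate (y n) (piece f k) x - piece f k x)" for n x
    using translated_piece_sum[OF y1, of f x n] translated_piece_sum[of 0 1 f x] 
    by (simp add: sum_subtractf translate_def)
  show "fourier (\<lambda>x. translate (y n) (piece f k) x - piece f k x) s = (cis (- (2 * pi * (s \<bullet> y n))) - 1) * fourier (piece f k) s"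
    if "k \<in> int_lattice" for n k s
    using fourier_lincomb[OF specL1D(1)[OF specL1_translate(1)[OF S0D(2)[OF f that]]] specL1D(1)[OF S0D(2)[OF f that]], of 1 _ "-1"]
    by (simp add: fourier_translate algebra_simps)
qed auto

lemma S0_translate_small:
  assumes f: "f \<in> S0 \<psi>" and e: "e > 0"
  obtains \<delta> where "\<delta> > 0" "\<And>y. norm y \<le> \<delta> \<Longrightarrow> S0_norm \<psi> (\<lambda>x. translate y f x - f x) \<le> e"
proof (rule ccontr)
  assume "\<not> thesis"
  then have "\<forall>n::nat. \<exists>y. norm y \<le> 1 / real (Suc n) \<and> \<not> S0_norm \<psi> (\<lambda>x. translate y f x - f x) \<le> e"
    using that by (metis divide_pos_pos of_nat_0_less_iff zero_less_Suc zero_less_one)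
  then obtain y where y: "\<And>n. norm (y n) \<le> 1 / real (Suc n)" "\<And>n. \<not> S0_norm \<psi> (\<lambda>x. translate (y n) f x - f x) \<le> e"
    by metis
  have "y \<longlonglongrightarrow> 0"
    by (rule Lim_null_comparison[OF _ LIMSEQ_Suc[OF lim_inverse_n']]) (use y(1) in \<open>auto intro: always_eventually\<close>)
  moreover have "norm (y n) \<le> 1" for n by (rule order_trans[OF y(1)]) simp
  ultimately have "(\<lambda>n. S0_norm \<psi> (\<lambda>x. translate (y n) f x - f x)) \<longlonglongrightarrow> 0" by (rule S0_translate_null[OF f])
  then have "\<forall>\<^sub>F n in sequentially. S0_norm \<psi> (\<lambda>x. translate (y n) f x - f x) < e"
    by (rule order_tendstoD(2)) (rule e)
  then obtain n where "S0_norm \<psi> (\<lambda>x. translate (y n) f x - f x) < e" 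
    using eventually_happens' sequentially_bot by blast
  with y(2)[of n] show False by simp
qed

text \<open>The restrictions of \<open>f\<close> to the unit cubes have \<open>L\<^sup>2\<close> norms at most the local suprema, hence summable.
Their convolutions with \<open>b\<close> have integrable transforms and stay near their cubes, as
synthesis requires.  That the bound involves only the \<open>L\<^sup>2\<close> norm of \<open>b\<close> is what later gives
countable additivity and bounded variation.\<close>

lemma S0_convolve:
  assumes f: "f \<in> wiener" and b: "integrable lborel b" and bz: "\<And>y. norm y > \<rho> \<Longrightarrow> b y = 0"
    and a: "0 < \<alpha>" "(\<integral>\<^sup>+x. ennreal ((cmod (b x))\<^sup>2) \<partial>lborel) \<le> ennreal (\<alpha>\<^sup>2)"
  shows "convolve b f \<in> S0 \<psi>" 
    and "S0_norm \<psi> (convolve b f) \<le> synth (real CARD('n) + \<rho>) * (\<alpha> * wiener_norm f)"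
proof -
  have c: "continuous_on UNIV f" by (rule wiener_continuous[OF f])
  note [measurable] = borel_measurable_continuous_onI[OF c]
  define g where "g k x = f x * indicator (cube k) x" for k x
  have cm [measurable]: "cube k \<in> sets borel" for k :: "real^'n" by (simp add: cube_hbox)
  have gm: "g k \<in> borel_measurable borel" for k unfolding g_def by measurable
  have gb: "cmod (g k x) \<le> cube_sup f k" for k x
    using cube_sup_upper[OF c, of x k] cube_sup_nonneg[OF c, of k] by (auto simp: g_def indicator_def)
  have gi: "integrable lborel (g k)" for k
  proof (rule Bochner_Integration.integrable_bound)
    show "integrable lborel (\<lambda>x. complex_of_real (cube_sup f k) * indicator (cube k) x)"
      unfolding cube_hbox by (intro integrable_mult_right complex_indicator_integrable) (auto simp: emeasure_hbox)
    show "AE x in lborel. cmod (g k x) \<le> cmod (complex_of_real (cube_sup f k) * indicator (cube k) x)"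
      using cube_sup_upper[OF c, of _ k] cube_sup_nonneg[OF c, of k] by (intro AE_I2) (auto simp: g_def indicator_def)
  qed (use gm in auto)
  have spec: "convolve b (g k) \<in> specL1 \<and> FL1_norm (convolve b (g k)) \<le> \<alpha> * cube_sup f k" for k
  proof (cases "cube_sup f k = 0")
    case True
    then have "g k = (\<lambda>x. 0)" using gb[of k] by (auto simp: fun_eq_iff)
    then have "convolve b (g k) = (\<lambda>x. 0)" by (simp add: convolve_def)
    then show ?thesis using True by simp
  next
    case False
    then have pos: "0 < cube_sup f k" using cube_sup_nonneg[OF c, of k] by linarith
    have "(\<integral>\<^sup>+x. ennreal ((cmod (g k x))\<^sup>2) \<partial>lborel) \<le> (\<integral>\<^sup>+x. ennreal ((cube_sup f k)\<^sup>2) * indicator (cube k) x \<partial>lborel)"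
    proof (rule nn_integral_mono)
      fix x
      show "ennreal ((cmod (g k x))\<^sup>2) \<le> ennreal ((cube_sup f k)\<^sup>2) * indicator (cube k) x"
        using gb[of k x] by (auto simp: indicator_def g_def intro!: ennreal_leI power_mono)
    qed
    also have "\<dots> = ennreal ((cube_sup f k)\<^sup>2)"
      by (subst nn_integral_cmult_indicator) (auto simp: cube_hbox emeasure_hbox)
    finally show ?thesis
      using specL1_convolve_L2[OF b gi a pos] by blast
  qed
  have supp: "convolve b (g k) x = 0" if "norm (x - k) > real CARD('n) + \<rho>" for k x
  proof (rule convolve_support[OF bz _ that])
    show "g k x = 0" if "norm (x - k) > real CARD('n)" for x
      using cube_norm[of x k] that by (auto simp: g_def indicator_def norm_minus_commute)
  qed
  have sum: "convolve b f x = (\<Sum>k\<in>near (real CARD('n) + \<rho>) x. convolve b (g k) x)" for x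
  proof (rule convolve_finite_sum[OF b bz gm gb])
    fix y :: "real^'n" assume y: "norm y \<le> \<rho>"
    have mem: "vfloor (x - y) \<in> near (real CARD('n) + \<rho>) x" by (rule vfloor_near') (use y in simp)
    have "(\<Sum>k\<in>near (real CARD('n) + \<rho>) x. g k (x - y)) = (\<Sum>k\<in>{vfloor (x - y)}. g k (x - y))"
    proof (rule sum.mono_neutral_right)
      show "\<forall>i\<in>near (real CARD('n) + \<rho>) x - {vfloor (x - y)}. g i (x - y) = 0"
        using cube_unique by (auto simp: g_def near_def indicator_def)
    qed (use mem in auto)
    then show "f (x - y) = (\<Sum>k\<in>near (real CARD('n) + \<rho>) x. g k (x - y))" by (simp add: g_def)
  qed
  have as: "(\<lambda>k. \<alpha> * cube_sup f k) summable_on int_lattice"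
    using f by (intro summable_on_cmult_right) (simp add: wiener_iff)
  note syn = S0_synthesis[OF convolve_continuous[OF b c wiener_norm_sup[OF f]] _ supp sum as]
  show "convolve b f \<in> S0 \<psi>" "S0_norm \<psi> (convolve b f) \<le> synth (real CARD('n) + \<rho>) * (\<alpha> * wiener_norm f)"
    using syn spec by (auto simp: wiener_norm_eq infsum_cmult_right')
qed

lemma S0_avg_null:
  assumes f: "f \<in> S0 \<psi>" and r: "r \<longlonglongrightarrow> 0" and r1: "\<And>n. 0 < r n" "\<And>n. r n \<le> 1"
  shows "(\<lambda>n. S0_norm \<psi> (\<lambda>x. convolve (avg (r n)) f x - f x)) \<longlonglongrightarrow> 0"
proof (rule S0_multiplier_null(2)[OF f, where m="\<lambda>n. fourier (avg (r n))" and r="R + real CARD('n)"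
      and q="\<lambda>n k x. convolve (avg (r n)) (piece f k) x - piece f k x"])
  have z: "avg (r n) y = 0" if "norm y > real CARD('n)" for y :: "real^'n" and n
  proof (rule avg_support)
    have "real CARD('n) * r n \<le> real CARD('n) * 1" by (rule mult_left_mono[OF r1(2)]) simp
    then show "norm y > real CARD('n) * r n" using that by linarith
  qed
  note ai = avg_integrable[OF r1(1), where 'n='n]
  show "cmod (fourier (avg (r n)) s) \<le> 1" for n s by (rule fourier_avg(1)[OF r1(1)])
  show "(\<lambda>n. fourier (avg (r n)) s) \<longlonglongrightarrow> 1" for s :: "real^'n"
  proof -
    have "(\<lambda>n. 2 * pi * norm s * real CARD('n) * r n) \<longlonglongrightarrow> 0"
      by (rule tendsto_mult_right_zero[OF r])
    then have "(\<lambda>n. fourier (avg (r n)) s - 1) \<longlonglongrightarrow> 0"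
      by (rule Lim_null_comparison[rotated]) (intro always_eventually allI fourier_avg(2) r1)
    then show ?thesis by (simp add: LIM_zero_iff)
  qed
  have fw: "f \<in> wiener" by (rule S0_wiener(1)[OF f])
  show "continuous_on UNIV (\<lambda>x. convolve (avg (r n)) f x - f x)" for n
    by (intro continuous_intros S0D(1)[OF f] convolve_continuous[OF ai S0D(1)[OF f] wiener_norm_sup[OF fw]])
  have conv: "convolve (avg (r n)) (piece f k) \<in> specL1" if k: "k \<in> int_lattice" for n k
  proof -
    note pk = specL1D[OF S0D(2)[OF f k]]
    have "integrable lborel (\<lambda>s. fourier (avg (r n)) s * fourier (piece f k) s)"
    proof (rule Bochner_Integration.integrable_bound[OF pk(2)])
      show "(\<lambda>s. fourier (avg (r n)) s * fourier (piece f k) s) \<in> borel_measurable lborel"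
        using fourier_measurable[of "avg (r n) :: 'n cfun"] fourier_measurable[of "piece f k"]
          borel_measurable_integrable[OF pk(1)] borel_measurable_integrable[OF ai] by simp
      show "AE s in lborel. cmod (fourier (avg (r n)) s * fourier (piece f k) s) \<le> cmod (fourier (piece f k) s)"
        using fourier_avg(1)[OF r1(1)] by (intro AE_I2) (auto simp: norm_mult intro!: mult_left_le_one_le)
    qed
    then show ?thesis
      using convolve_integrable(1)[OF ai pk(1)] fourier_convolve[OF ai pk(1)] by (simp add: specL1_def fourier_convolve[OF ai pk(1), abs_def])
  qed
  show "(\<lambda>x. convolve (avg (r n)) (piece f k) x - piece f k x) \<in> specL1" if "k \<in> int_lattice" for n k
    using specL1_lincomb(1)[OF conv[OF that] S0D(2)[OF f that], of 1 _ "-1"] by simp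
  show "convolve (avg (r n)) (piece f k) x - piece f k x = 0" if "norm (x - k) > R + real CARD('n)" for n k x
  proof -
    have "norm (x - k) > R" using that by auto
    then show ?thesis using convolve_support[OF z piece_support that] by (simp add: piece_support)
  qed
  show "convolve (avg (r n)) f x - f x = (\<Sum>k\<in>near (R + real CARD('n)) x. convolve (avg (r n)) (piece f k) x - piece f k x)" for n x
  proof -
    obtain B where B: "\<And>k x. cmod (piece f k x) \<le> B k" using piece_bound[OF S0D(1)[OF f]] by metis
    have m: "piece f k \<in> borel_measurable borel" for k
      by (rule borel_measurable_continuous_onI[OF piece_continuous[OF S0D(1)[OF f]]])
    have "convolve (avg (r n)) f x = (\<Sum>k\<in>near (R + real CARD('n)) x. convolve (avg (r n)) (piece f k) x)"
      by (rule convolve_finite_sum[where \<rho>="real CARD('n)", OF ai _ m B]) (auto intro: z translated_piece_sum)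
    then show ?thesis using translated_piece_sum[of 0 "real CARD('n)" f x] by (simp add: sum_subtractf)
  qed
  show "fourier (\<lambda>x. convolve (avg (r n)) (piece f k) x - piece f k x) s = (fourier (avg (r n)) s - 1) * fourier (piece f k) s"
    if "k \<in> int_lattice" for n k s
    using fourier_lincomb[OF specL1D(1)[OF conv[OF that]] specL1D(1)[OF S0D(2)[OF f that]], of 1 n "-1"]
      fourier_convolve[OF ai specL1D(1)[OF S0D(2)[OF f that]]]
    by (simp add: algebra_simps)
qed

end

section \<open>Translation-bounded measures\<close>

lemma bounded_borelD: "A \<in> bounded_borel \<Longrightarrow> A \<in> sets borel" "A \<in> bounded_borel \<Longrightarrow> bounded A"
  by (auto simp: bounded_borel_def)

lemma bounded_borel_empty [simp]: "{} \<in> bounded_borel" by (simp add: bounded_borel_def)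

lemma bounded_borel_Un [intro]: "A \<in> bounded_borel \<Longrightarrow> B \<in> bounded_borel \<Longrightarrow> A \<union> B \<in> bounded_borel"
  by (auto simp: bounded_borel_def)

lemma bounded_borel_Diff [intro]: "A \<in> bounded_borel \<Longrightarrow> B \<in> bounded_borel \<Longrightarrow> A - B \<in> bounded_borel"
  by (auto simp: bounded_borel_def bounded_diff)

lemma bounded_borel_Int [intro]: "A \<in> bounded_borel \<Longrightarrow> B \<in> sets borel \<Longrightarrow> A \<inter> B \<in> bounded_borel"
  by (auto simp: bounded_borel_def bounded_Int)

lemma bounded_borel_UN: "finite I \<Longrightarrow> (\<And>i. i \<in> I \<Longrightarrow> B i \<in> bounded_borel) \<Longrightarrow> (\<Union>i\<in>I. B i) \<in> bounded_borel"
  by (induction I rule: finite_induct) auto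

lemma cube_bounded_borel [simp]: "cube k \<in> bounded_borel" by (simp add: cube_hbox)

lemma radon_zero: "radon_measure \<mu> \<Longrightarrow> A \<notin> bounded_borel \<Longrightarrow> \<mu> A = 0"
  by (simp add: radon_measure_def)

lemma radon_sums:
  fixes A :: "nat \<Rightarrow> (real^'n::finite) set"
  assumes "radon_measure \<mu>" "\<And>i. A i \<in> bounded_borel" "disjoint_family A" "bounded (\<Union>i. A i)"
  shows "(\<lambda>i. \<mu> (A i)) sums \<mu> (\<Union>i. A i)"
  using assms unfolding radon_measure_def by blast

lemma radon_empty:
  assumes m: "radon_measure \<mu>" shows "\<mu> {} = 0"
proof -
  have "(\<lambda>i::nat. \<mu> {}) sums \<mu> (\<Union>i::nat. {})"
    by (rule radon_sums[OF m]) (auto simp: disjoint_family_on_def)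
  then have "(\<lambda>i::nat. \<mu> {}) \<longlonglongrightarrow> 0" by (intro summable_LIMSEQ_zero) (rule sums_summable)
  then show ?thesis by (simp add: LIMSEQ_const_iff)
qed

lemma radon_Un:
  assumes m: "radon_measure \<mu>" and AB: "A \<in> bounded_borel" "B \<in> bounded_borel" "A \<inter> B = {}"
  shows "\<mu> (A \<union> B) = \<mu> A + \<mu> B"
proof -
  have "(\<lambda>i. \<mu> (binaryset A B i)) sums \<mu> (\<Union>i. binaryset A B i)"
  proof (rule radon_sums[OF m])
    show "binaryset A B i \<in> bounded_borel" for i using AB by (auto simp: binaryset_def)
    show "disjoint_family (binaryset A B)" using AB(3) by (auto simp: disjoint_family_on_def binaryset_def)
    show "bounded (\<Union>i. binaryset A B i)" using AB by (simp add: UN_binaryset_eq bounded_borelD)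
  qed
  moreover have "(\<lambda>i. \<mu> (binaryset A B i)) sums (\<mu> A + \<mu> B)"
    by (rule binaryset_sums) (rule radon_empty[OF m])
  ultimately show ?thesis by (metis UN_binaryset_eq sums_unique2)
qed

lemma radon_finite_UN:
  assumes m: "radon_measure \<mu>" and I: "finite I" and B: "\<And>i. i \<in> I \<Longrightarrow> B i \<in> bounded_borel" and d: "disjoint_family_on B I"
  shows "\<mu> (\<Union>i\<in>I. B i) = (\<Sum>i\<in>I. \<mu> (B i))"
  using I B d
proof (induction I rule: finite_induct)
  case empty
  show ?case by (simp add: radon_empty[OF m])
next
  case (insert i I)
  have "B i \<inter> (\<Union>i\<in>I. B i) = {}" using insert.hyps insert.prems(2) by (auto simp: disjoint_family_on_def)
  moreover have "disjoint_family_on B I" using insert.prems(2) by (auto simp: disjoint_family_on_def)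
  ultimately show ?case
    using radon_Un[OF m insert.prems(1)[of i] bounded_borel_UN[of I B]] insert by simp
qed

lemma tb_measuresD: "\<mu> \<in> tb_measures \<Longrightarrow> radon_measure \<mu>" by (simp add: tb_measures_def)

lemma tb_norm_nonneg: "0 \<le> tb_norm \<mu>" by (simp add: tb_norm_def)

lemma total_variation_le_tb_norm:
  assumes "\<mu> \<in> tb_measures" "k \<in> int_lattice"
  shows "total_variation \<mu> (cube k) \<le> ennreal (tb_norm \<mu>)"
proof -
  have "total_variation \<mu> (cube k) \<le> (SUP k\<in>int_lattice. total_variation \<mu> (cube k))"
    by (rule SUP_upper) (rule assms(2))
  also have "\<dots> = ennreal (tb_norm \<mu>)"
    using assms(1) by (simp add: tb_norm_def tb_measures_def less_top ennreal_enn2real)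
  finally show ?thesis .
qed

text \<open>A disjoint family inside a cube becomes a partition of the cube by adding the complement.  Empty
members are dropped first, since a partition is a set and could contain the empty set only once.\<close>

lemma tb_cube_sum_le:
  assumes mu: "\<mu> \<in> tb_measures" and k: "k \<in> int_lattice" and I: "finite I"
    and B: "\<And>i. i \<in> I \<Longrightarrow> B i \<in> bounded_borel" and sub: "\<And>i. i \<in> I \<Longrightarrow> B i \<subseteq> cube k" and d: "disjoint_family_on B I"
  shows "(\<Sum>i\<in>I. cmod (\<mu> (B i))) \<le> tb_norm \<mu>"
proof -
  have m: "radon_measure \<mu>" by (rule tb_measuresD[OF mu])
  define J where "J = {i \<in> I. B i \<noteq> {}}"
  have J: "finite J" "J \<subseteq> I" using I by (auto simp: J_def)
  have inj: "inj_on B J" using d by (force simp: J_def disjoint_family_on_def inj_on_def)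
  define D where "D = cube k - (\<Union>i\<in>J. B i)"
  define P where "P = insert D (B ` J)"
  have D: "D \<in> bounded_borel" unfolding D_def using J B by (intro bounded_borel_Diff bounded_borel_UN) auto
  have P: "finite P \<and> disjoint P \<and> P \<subseteq> bounded_borel \<and> \<Union>P = cube k"
  proof (intro conjI)
    show "finite P" using J by (simp add: P_def)
    show "P \<subseteq> bounded_borel" using D J B by (auto simp: P_def)
    show "\<Union>P = cube k" using J sub by (auto simp: P_def D_def)
    have "disjoint (B ` J)" using d J by (force simp: disjoint_def disjoint_family_on_def)
    then show "disjoint P" unfolding P_def by (force simp: disjoint_def D_def)
  qed
  have "(\<Sum>i\<in>I. cmod (\<mu> (B i))) = (\<Sum>i\<in>J. cmod (\<mu> (B i)))"
    using I by (intro sum.mono_neutral_right) (auto simp: J_def radon_empty[OF m])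
  also have "\<dots> = (\<Sum>A\<in>B ` J. cmod (\<mu> A))" using inj by (simp add: sum.reindex)
  also have "\<dots> \<le> (\<Sum>A\<in>P. cmod (\<mu> A))" using P by (intro sum_mono2) (auto simp: P_def)
  finally have "ennreal (\<Sum>i\<in>I. cmod (\<mu> (B i))) \<le> (\<Sum>A\<in>P. ennreal (cmod (\<mu> A)))"
    by (simp add: sum_ennreal ennreal_leI)
  also have "\<dots> \<le> total_variation \<mu> (cube k)"
    unfolding total_variation_def by (rule SUP_upper) (use P in simp)
  also have "\<dots> \<le> ennreal (tb_norm \<mu>)" by (rule total_variation_le_tb_norm[OF mu k])
  finally show ?thesis by (simp add: tb_norm_nonneg)
qed

text \<open>Intersecting the family with the cubes that meet the ball reduces it to families inside a cube.\<close>

lemma tb_bounded_sum_le: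
  fixes \<mu> :: "'n::finite cmeas"
  assumes mu: "\<mu> \<in> tb_measures" and I: "finite I"
    and B: "\<And>i. i \<in> I \<Longrightarrow> B i \<in> bounded_borel" and sub: "\<And>i x. i \<in> I \<Longrightarrow> x \<in> B i \<Longrightarrow> norm (x - p) \<le> \<rho>" and d: "disjoint_family_on B I"
  shows "(\<Sum>i\<in>I. cmod (\<mu> (B i))) \<le> real (card (near (\<rho> + 2 * real CARD('n)) (0 :: real^'n))) * tb_norm \<mu>"
proof -
  have m: "radon_measure \<mu>" by (rule tb_measuresD[OF mu])
  let ?K = "near (\<rho> + real CARD('n)) p"
  have cb: "cube k \<in> sets borel" for k :: "real^'n" by (simp add: cube_hbox)
  have dk: "disjoint_family_on (\<lambda>k. B i \<inter> cube k) ?K" for i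
    by (auto simp: disjoint_family_on_def near_def dest: cube_unique)
  have split: "B i = (\<Union>k\<in>?K. B i \<inter> cube k)" if "i \<in> I" for i
  proof -
    have "vfloor x \<in> ?K" if x: "x \<in> B i" for x
      using vfloor_near'[OF sub[OF \<open>i \<in> I\<close> x]] by (simp add: add.commute)
    then show ?thesis using mem_cube_vfloor by blast
  qed
  have "(\<Sum>i\<in>I. cmod (\<mu> (B i))) \<le> (\<Sum>i\<in>I. \<Sum>k\<in>?K. cmod (\<mu> (B i \<inter> cube k)))"
  proof (rule sum_mono)
    fix i assume i: "i \<in> I"
    have "\<mu> (B i) = \<mu> (\<Union>k\<in>?K. B i \<inter> cube k)" using split[OF i] by simp
    also have "\<dots> = (\<Sum>k\<in>?K. \<mu> (B i \<inter> cube k))"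
      by (rule radon_finite_UN[OF m finite_near _ dk]) (use B[OF i] cb in auto)
    finally show "cmod (\<mu> (B i)) \<le> (\<Sum>k\<in>?K. cmod (\<mu> (B i \<inter> cube k)))" by (simp add: norm_sum)
  qed
  also have "\<dots> = (\<Sum>k\<in>?K. \<Sum>i\<in>I. cmod (\<mu> (B i \<inter> cube k)))" by (rule sum.swap)
  also have "\<dots> \<le> (\<Sum>k\<in>?K. tb_norm \<mu>)"
  proof (rule sum_mono)
    fix k assume "k \<in> ?K"
    then have k: "k \<in> int_lattice" by (simp add: near_def)
    show "(\<Sum>i\<in>I. cmod (\<mu> (B i \<inter> cube k))) \<le> tb_norm \<mu>"
    proof (rule tb_cube_sum_le[OF mu k I])
      show "disjoint_family_on (\<lambda>i. B i \<inter> cube k) I"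
        using d unfolding disjoint_family_on_def by blast
    qed (use B cb in auto)
  qed
  also have "\<dots> \<le> real (card (near (\<rho> + 2 * real CARD('n)) (0 :: real^'n))) * tb_norm \<mu>"
    using card_near_le[of "\<rho> + real CARD('n)" p] tb_norm_nonneg[of \<mu>]
    unfolding mult_2 sum_constant add.assoc by (intro mult_right_mono) simp_all
  finally show ?thesis .
qed

lemma tb_measuresI:
  assumes m: "radon_measure \<mu>" and M: "0 \<le> M"
    and le: "\<And>k P. k \<in> int_lattice \<Longrightarrow> finite P \<Longrightarrow> disjoint P \<Longrightarrow> P \<subseteq> bounded_borel \<Longrightarrow> \<Union>P = cube k
       \<Longrightarrow> (\<Sum>B\<in>P. cmod (\<mu> B)) \<le> M"
  shows "\<mu> \<in> tb_measures" and "tb_norm \<mu> \<le> M"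
proof -
  have "total_variation \<mu> (cube k) \<le> ennreal M" if "k \<in> int_lattice" for k
    unfolding total_variation_def by (rule SUP_least) (use le that in \<open>auto simp: sum_ennreal intro!: ennreal_leI\<close>)
  then have "(SUP k\<in>int_lattice. total_variation \<mu> (cube k)) \<le> ennreal M" by (rule SUP_least)
  then show "\<mu> \<in> tb_measures" "tb_norm \<mu> \<le> M"
    using m M by (auto simp: tb_measures_def tb_norm_def enn2real_leI intro: le_less_trans)
qed

section \<open>The operator defined by a functional\<close>

lemma bounded_borel_radius: "A \<in> bounded_borel \<Longrightarrow> \<exists>\<rho>. \<forall>x\<in>A. norm x \<le> \<rho>"
  by (auto simp: bounded_borel_def bounded_iff)

lemma bounded_borel_finite: "A \<in> bounded_borel \<Longrightarrow> emeasure lborel A < \<infinity>"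
  using emeasure_bounded_finite[OF bounded_borelD(2)] by blast

lemma indicator_integrable: "A \<in> bounded_borel \<Longrightarrow> integrable lborel (indicator A :: 'n::finite cfun)"
  by (intro complex_indicator_integrable bounded_borelD bounded_borel_finite)

lemma convolve_sum_left:
  fixes f :: "'n::finite cfun"
  assumes b: "\<And>i. i \<in> I \<Longrightarrow> integrable lborel (b i)" and f: "f \<in> wiener"
  shows "convolve (\<lambda>y. \<Sum>i\<in>I. c i * b i y) f = (\<lambda>x. \<Sum>i\<in>I. c i * convolve (b i) f x)"
proof
  fix x
  have m: "f \<in> borel_measurable borel" by (rule borel_measurable_continuous_onI[OF wiener_continuous[OF f]])
  have "convolve (\<lambda>y. \<Sum>i\<in>I. c i * b i y) f x = (LINT y|lborel. (\<Sum>i\<in>I. c i * (b i y * f (x - y))))"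
    by (simp add: convolve_def sum_distrib_right mult.assoc)
  also have "\<dots> = (\<Sum>i\<in>I. (LINT y|lborel. c i * (b i y * f (x - y))))"
    by (rule Bochner_Integration.integral_sum) (intro integrable_mult_right integrable_mult_shift[OF b m wiener_norm_sup[OF f]])
  finally show "convolve (\<lambda>y. \<Sum>i\<in>I. c i * b i y) f x = (\<Sum>i\<in>I. c i * convolve (b i) f x)"
    by (simp add: convolve_def)
qed

lemma convolve_lincomb_right:
  fixes f g :: "'n::finite cfun"
  assumes b: "integrable lborel b" and f: "f \<in> wiener" and g: "g \<in> wiener"
  shows "convolve b (\<lambda>x. a * f x + c * g x) = (\<lambda>x. a * convolve b f x + c * convolve b g x)"
proof
  fix x
  have m: "f \<in> borel_measurable borel" "g \<in> borel_measurable borel"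
    using borel_measurable_continuous_onI wiener_continuous f g by blast+
  have i: "integrable lborel (\<lambda>y. b y * f (x - y))" "integrable lborel (\<lambda>y. b y * g (x - y))"
    using integrable_mult_shift[OF b m(1) wiener_norm_sup[OF f]] integrable_mult_shift[OF b m(2) wiener_norm_sup[OF g]] by auto
  have "convolve b (\<lambda>x. a * f x + c * g x) x = (LINT y|lborel. a * (b y * f (x - y)) + c * (b y * g (x - y)))"
    by (simp add: convolve_def algebra_simps)
  also have "\<dots> = a * convolve b f x + c * convolve b g x"
    using i by (simp add: convolve_def)
  finally show "convolve b (\<lambda>x. a * f x + c * g x) x = a * convolve b f x + c * convolve b g x" .
qed

text \<open>Moves the support of \<open>b\<close> to the origin, so that bounds depending on its distance from the origin
become uniform.\<close>

lemma convolve_translate: "convolve (translate (- k) b) (translate k f) = convolve b f"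
proof
  fix x
  have "convolve (translate (- k) b) (translate k f) x = (LINT y|lborel. b (y - (- k)) * f (x - (y - (- k))))"
    by (simp add: convolve_def translate_def algebra_simps)
  also have "\<dots> = convolve b f x"
    using integral_shift[of "\<lambda>y. b y * f (x - y)" "- k"] by (simp add: convolve_def)
  finally show "convolve (translate (- k) b) (translate k f) x = convolve b f x" .
qed

lemma flip_lincomb: "flip (\<lambda>x. a * f x + b * g x) = (\<lambda>x. a * flip f x + b * flip g x)"
  by (simp add: flip_def)

lemma flip_flip [simp]: "flip (flip f) = f" by (simp add: flip_def)

context partition
begin

text \<open>Homogeneity turns the supremum over the unit ball into a bound at every \<open>f\<close>; at \<open>S0_norm \<psi> f = 0\<close>
the bound assumed in the definition of the dual gives zero directly.\<close>

lemma dualD: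
  assumes "\<sigma> \<in> S0_dual \<psi>"
  shows "f \<in> S0 \<psi> \<Longrightarrow> g \<in> S0 \<psi> \<Longrightarrow> \<sigma> (\<lambda>x. a * f x + b * g x) = a * \<sigma> f + b * \<sigma> g"
    and "f \<in> S0 \<psi> \<Longrightarrow> cmod (\<sigma> f) \<le> S0_dual_norm \<psi> \<sigma> * S0_norm \<psi> f"
    and "0 \<le> S0_dual_norm \<psi> \<sigma>"
proof -
  have lin: "\<And>f g a b. f \<in> S0 \<psi> \<Longrightarrow> g \<in> S0 \<psi> \<Longrightarrow> \<sigma> (\<lambda>x. a * f x + b * g x) = a * \<sigma> f + b * \<sigma> g"
    using assms by (auto simp: S0_dual_def)
  then show "f \<in> S0 \<psi> \<Longrightarrow> g \<in> S0 \<psi> \<Longrightarrow> \<sigma> (\<lambda>x. a * f x + b * g x) = a * \<sigma> f + b * \<sigma> g" .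
  obtain C where C: "\<And>f. f \<in> S0 \<psi> \<Longrightarrow> cmod (\<sigma> f) \<le> C * S0_norm \<psi> f" using assms unfolding S0_dual_def by blast
  have bdd: "bdd_above ((\<lambda>f. cmod (\<sigma> f)) ` {f \<in> S0 \<psi>. S0_norm \<psi> f \<le> 1})"
  proof (rule bdd_aboveI[of _ "\<bar>C\<bar>"], clarify)
    fix f assume f: "f \<in> S0 \<psi>" "S0_norm \<psi> f \<le> 1"
    have "C * S0_norm \<psi> f \<le> \<bar>C\<bar> * 1"
      using f(2) S0_norm_nonneg[of f] by (intro mult_mono) auto
    then show "cmod (\<sigma> f) \<le> \<bar>C\<bar>" using C[OF f(1)] by linarith
  qed
  have up: "cmod (\<sigma> f) \<le> S0_dual_norm \<psi> \<sigma>" if "f \<in> S0 \<psi>" "S0_norm \<psi> f \<le> 1" for f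
    unfolding S0_dual_norm_def by (rule cSUP_upper[OF _ bdd]) (use that in auto)
  show "0 \<le> S0_dual_norm \<psi> \<sigma>" using up[of "\<lambda>x. 0"] norm_ge_zero[of "\<sigma> (\<lambda>x. 0)"] by (simp del: norm_ge_zero)
  show "cmod (\<sigma> f) \<le> S0_dual_norm \<psi> \<sigma> * S0_norm \<psi> f" if f: "f \<in> S0 \<psi>"
  proof (cases "S0_norm \<psi> f = 0")
    case True
    then show ?thesis using C[OF f] by simp
  next
    case False
    then have n: "S0_norm \<psi> f > 0" using S0_norm_nonneg[of f] by linarith
    let ?c = "complex_of_real (1 / S0_norm \<psi> f)"
    have "S0_norm \<psi> (\<lambda>x. ?c * f x) \<le> cmod ?c * S0_norm \<psi> f" by (rule S0_cmult(2)[OF f])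
    also have "\<dots> = 1" using n by (simp add: norm_divide)
    finally have "cmod (\<sigma> (\<lambda>x. ?c * f x)) \<le> S0_dual_norm \<psi> \<sigma>" by (rule up[OF S0_cmult(1)[OF f]])
    moreover have "\<sigma> (\<lambda>x. ?c * f x) = ?c * \<sigma> f" using lin[OF f f, of ?c 0] by simp
    ultimately have "cmod (\<sigma> f) / S0_norm \<psi> f \<le> S0_dual_norm \<psi> \<sigma>" using n by (simp add: norm_mult norm_divide)
    then show ?thesis using n by (simp add: pos_divide_le_eq)
  qed
qed

lemma dual_cmult: "\<sigma> \<in> S0_dual \<psi> \<Longrightarrow> f \<in> S0 \<psi> \<Longrightarrow> \<sigma> (\<lambda>x. a * f x) = a * \<sigma> f"
  using dualD(1)[of \<sigma> f f a 0] by simp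

lemma dual_diff: "\<sigma> \<in> S0_dual \<psi> \<Longrightarrow> f \<in> S0 \<psi> \<Longrightarrow> g \<in> S0 \<psi> \<Longrightarrow> \<sigma> (\<lambda>x. f x - g x) = \<sigma> f - \<sigma> g"
  using dualD(1)[of \<sigma> f g 1 "-1"] by simp

lemma dual_sum:
  assumes s: "\<sigma> \<in> S0_dual \<psi>" and f: "\<And>i. i \<in> I \<Longrightarrow> f i \<in> S0 \<psi>"
  shows "\<sigma> (\<lambda>x. \<Sum>i\<in>I. c i * f i x) = (\<Sum>i\<in>I. c i * \<sigma> (f i))"
  using f
proof (induction I rule: infinite_finite_induct)
  case (insert i I)
  then have "(\<lambda>x. \<Sum>i\<in>I. c i * f i x) \<in> S0 \<psi>" by (intro S0_sum S0_cmult) auto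
  from dualD(1)[OF s _ this, of "f i" "c i" 1] insert show ?case by simp
qed (use dual_cmult[OF s S0_zero(1), of 0] in auto)

text \<open>Exchanging \<open>\<sigma>\<close> with the integral over \<open>A\<close> turns the integral of the density \<open>x \<mapsto> \<sigma> (translate x (flip f))\<close> into this
value.  As a definition it makes sense for all \<open>f\<close> in Wiener's algebra, for which that density
need not exist.\<close>

definition conv_measure :: "('n cfun \<Rightarrow> complex) \<Rightarrow> 'n cfun \<Rightarrow> 'n cmeas" where
  "conv_measure \<sigma> f A = (if A \<in> bounded_borel then \<sigma> (convolve (indicator A) (flip f)) else 0)"

definition conv_operator :: "('n cfun \<Rightarrow> complex) \<Rightarrow> 'n cfun \<Rightarrow> 'n cmeas" where
  "conv_operator \<sigma> = (\<lambda>f\<in>wiener. conv_measure \<sigma> f)"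

lemma nn_integral_step_square:
  assumes "finite P" "disjoint P" "P \<subseteq> bounded_borel" and c: "\<And>B. B \<in> P \<Longrightarrow> cmod (c B) \<le> 1"
  shows "(\<integral>\<^sup>+y. ennreal ((cmod (\<Sum>B\<in>P. c B * indicator B y))\<^sup>2) \<partial>lborel) \<le> emeasure lborel (\<Union>P)"
proof -
  have m: "\<Union>P \<in> sets lborel" using assms bounded_borelD(1) by (auto intro!: sets.finite_Union)
  have "ennreal ((cmod (\<Sum>B\<in>P. c B * indicator B y))\<^sup>2) \<le> indicator (\<Union>P) y" for y
  proof (cases "y \<in> \<Union>P")
    case True
    then obtain B where B: "B \<in> P" "y \<in> B" by blast
    have "(\<Sum>B\<in>P. c B * indicator B y) = (\<Sum>B\<in>{B}. c B * indicator B y)"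
      using assms(1,2) B by (intro sum.mono_neutral_right) (auto simp: disjoint_def indicator_def)
    then have "cmod (\<Sum>B\<in>P. c B * indicator B y) \<le> 1" using c[OF B(1)] B by simp
    then show ?thesis using True by (simp add: power_le_one)
  next
    case False
    then have "(\<Sum>B\<in>P. c B * indicator B y) = 0" by (intro sum.neutral) auto
    then show ?thesis by simp
  qed
  then have "(\<integral>\<^sup>+y. ennreal ((cmod (\<Sum>B\<in>P. c B * indicator B y))\<^sup>2) \<partial>lborel) \<le> (\<integral>\<^sup>+y. indicator (\<Union>P) y \<partial>lborel)"
    by (rule nn_integral_mono)
  then show ?thesis using m by simp
qed

text \<open>The summand \<open>\<delta>\<close> covers sets of measure zero, as the \<open>L\<^sup>2\<close> bound on \<open>b\<close> in \<open>S0_convolve\<close> is a positive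
number.\<close>

lemma indicator_convolve_S0:
  assumes A: "A \<in> bounded_borel" and f: "f \<in> wiener"
  shows "convolve (indicator A) f \<in> S0 \<psi>"
    and "\<And>\<delta> \<rho>. \<delta> > 0 \<Longrightarrow> (\<And>x. x \<in> A \<Longrightarrow> norm x \<le> \<rho>) \<Longrightarrow> 
      S0_norm \<psi> (convolve (indicator A) f) \<le> synth (real CARD('n) + \<rho>) * (sqrt (measure lborel A + \<delta>) * wiener_norm f)"
proof -
  have main: "convolve (indicator A) f \<in> S0 \<psi> \<and> S0_norm \<psi> (convolve (indicator A) f) \<le> synth (real CARD('n) + \<rho>) * (sqrt (measure lborel A + \<delta>) * wiener_norm f)"
    if "\<delta> > 0" "\<And>x. x \<in> A \<Longrightarrow> norm x \<le> \<rho>" for \<delta> \<rho>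
  proof -
    have z: "indicator A y = (0::complex)" if "norm y > \<rho>" for y
      using \<open>\<And>x. x \<in> A \<Longrightarrow> norm x \<le> \<rho>\<close>[of y] that by (auto simp: indicator_def)
    have p: "0 < measure lborel A + \<delta>" using that(1) by (simp add: add_nonneg_pos)
    have "(\<integral>\<^sup>+x. ennreal ((cmod (indicator A x))\<^sup>2) \<partial>lborel) = (\<integral>\<^sup>+x. indicator A x \<partial>lborel)"
      by (intro nn_integral_cong) (auto simp: indicator_def)
    also have "\<dots> = emeasure lborel A" using bounded_borelD(1)[OF A] by simp
    also have "\<dots> = ennreal (measure lborel A)"
      using bounded_borel_finite[OF A] by (intro emeasure_eq_ennreal_measure) auto
    also have "\<dots> \<le> ennreal ((sqrt (measure lborel A + \<delta>))\<^sup>2)"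
      using p that(1) by (intro ennreal_leI) simp
    finally show ?thesis
      using S0_convolve[OF f indicator_integrable[OF A] z, where \<alpha>="sqrt (measure lborel A + \<delta>)"] p by auto
  qed
  show "convolve (indicator A) f \<in> S0 \<psi>" using main[of 1] bounded_borel_radius[OF A] by auto
  show "\<And>\<delta> \<rho>. \<delta> > 0 \<Longrightarrow> (\<And>x. x \<in> A \<Longrightarrow> norm x \<le> \<rho>) \<Longrightarrow> 
      S0_norm \<psi> (convolve (indicator A) f) \<le> synth (real CARD('n) + \<rho>) * (sqrt (measure lborel A + \<delta>) * wiener_norm f)"
    using main by blast
qed

lemma conv_measure_Un:
  assumes s: "\<sigma> \<in> S0_dual \<psi>" and f: "f \<in> wiener" and A: "A \<in> bounded_borel" "B \<in> bounded_borel" "A \<inter> B = {}"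
  shows "conv_measure \<sigma> f (A \<union> B) = conv_measure \<sigma> f A + conv_measure \<sigma> f B"
proof -
  have ff: "flip f \<in> wiener" by (rule wiener_flip(1)[OF f])
  have AB: "A \<union> B \<in> bounded_borel" using A by auto
  let ?C = "\<lambda>c. if c then A else B"
  have C: "?C c \<in> bounded_borel" for c using A by simp
  have "indicator (A \<union> B) = (\<lambda>y. \<Sum>c\<in>UNIV. 1 * indicator (?C c) y :: complex)"
    using A(3) by (intro ext) (auto simp: UNIV_bool split: split_indicator)
  then have "convolve (indicator (A \<union> B)) (flip f) = (\<lambda>x. \<Sum>c\<in>UNIV. 1 * convolve (indicator (?C c)) (flip f) x)"
    using convolve_sum_left[of UNIV "\<lambda>c. indicator (?C c)" "flip f" "\<lambda>_. 1", OF indicator_integrable[OF C] ff] by simp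
  then have "\<sigma> (convolve (indicator (A \<union> B)) (flip f)) = (\<Sum>c\<in>UNIV. 1 * \<sigma> (convolve (indicator (?C c)) (flip f)))"
    using dual_sum[OF s, where I=UNIV and c="\<lambda>_. 1" and f="\<lambda>c. convolve (indicator (?C c)) (flip f)"]
      indicator_convolve_S0(1)[OF C ff] by simp
  then show ?thesis
    using A AB by (simp add: conv_measure_def UNIV_bool add.commute)
qed

lemma conv_measure_bound:
  assumes s: "\<sigma> \<in> S0_dual \<psi>" and f: "f \<in> wiener" and A: "A \<in> bounded_borel" and r: "\<And>x. x \<in> A \<Longrightarrow> norm x \<le> \<rho>" and d: "\<delta> > 0"
  shows "cmod (conv_measure \<sigma> f A) \<le> S0_dual_norm \<psi> \<sigma> * (synth (real CARD('n) + \<rho>) * (sqrt (measure lborel A + \<delta>) * wiener_norm (flip f)))"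
proof -
  have ff: "flip f \<in> wiener" by (rule wiener_flip(1)[OF f])
  have "cmod (conv_measure \<sigma> f A) \<le> S0_dual_norm \<psi> \<sigma> * S0_norm \<psi> (convolve (indicator A) (flip f))"
    using dualD(2)[OF s indicator_convolve_S0(1)[OF A ff]] A by (simp add: conv_measure_def)
  also have "\<dots> \<le> S0_dual_norm \<psi> \<sigma> * (synth (real CARD('n) + \<rho>) * (sqrt (measure lborel A + \<delta>) * wiener_norm (flip f)))"
    by (intro mult_left_mono dualD(3)[OF s] indicator_convolve_S0(2)[OF A ff d r])
  finally show ?thesis .
qed

text \<open>The tails of a disjoint union inside a bounded set have measures tending to zero, so their indicators tend to
zero in \<open>L\<^sup>2\<close>.\<close>

lemma conv_measure_radon:
  assumes s: "\<sigma> \<in> S0_dual \<psi>" and f: "f \<in> wiener"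
  shows "radon_measure (conv_measure \<sigma> f)"
  unfolding radon_measure_def
proof (intro conjI allI impI, simp add: conv_measure_def, elim conjE)
  fix A :: "nat \<Rightarrow> (real^'n) set"
  assume A: "range A \<subseteq> bounded_borel" and dis: "disjoint_family A" and bd: "bounded (\<Union>i. A i)"
  let ?U = "\<Union>i. A i"
  define D where "D n = ?U - (\<Union>i<n. A i)" for n
  have Ab: "A i \<in> bounded_borel" for i using A by auto
  have Un: "(\<Union>i<n. A i) \<in> bounded_borel" for n by (rule bounded_borel_UN) (auto simp: Ab)
  have U: "?U \<in> bounded_borel" using Ab bd by (auto simp: bounded_borel_def)
  have Db: "D n \<in> bounded_borel" for n using U Un by (auto simp: D_def)
  obtain \<rho> where rho: "\<And>x. x \<in> ?U \<Longrightarrow> norm x \<le> \<rho>" using bounded_borel_radius[OF U] by blast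
  have sum: "conv_measure \<sigma> f (\<Union>i<n. A i) = (\<Sum>i<n. conv_measure \<sigma> f (A i))" for n
  proof (induction n)
    case 0
    show ?case using conv_measure_Un[OF s f, of "{}" "{}"] by simp
  next
    case (Suc n)
    have "(\<Union>i<n. A i) \<inter> A n = {}"
      using dis by (auto simp: disjoint_family_on_def) (metis IntI UNIV_I empty_iff less_irrefl)
    then show ?case
      using conv_measure_Un[OF s f Un[of n] Ab[of n]] Suc by (simp add: lessThan_Suc Un_commute)
  qed
  have eq: "conv_measure \<sigma> f ?U - (\<Sum>i<n. conv_measure \<sigma> f (A i)) = conv_measure \<sigma> f (D n)" for n
  proof -
    have "?U = (\<Union>i<n. A i) \<union> D n" "(\<Union>i<n. A i) \<inter> D n = {}" by (auto simp: D_def)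
    then show ?thesis using conv_measure_Un[OF s f Un[of n] Db[of n]] sum[of n] by simp
  qed
  (* 1 / Suc n is the positive summand \<delta> of conv_measure_bound; it must tend to zero as well. *)
  define M where "M n = S0_dual_norm \<psi> \<sigma> * (synth (real CARD('n) + \<rho>) * (sqrt (measure lborel (D n) + 1 / real (Suc n)) * wiener_norm (flip f)))" for n
  have le: "cmod (conv_measure \<sigma> f (D n)) \<le> M n" for n
    unfolding M_def by (rule conv_measure_bound[OF s f Db]) (auto simp: D_def intro!: rho)
  have "(\<lambda>n. measure lborel (D n)) \<longlonglongrightarrow> measure lborel (\<Inter>n. D n)"
  proof (rule Lim_measure_decseq)
    show "range D \<subseteq> sets lborel" using Db bounded_borelD(1) by auto
    show "decseq D" unfolding decseq_def D_def by (auto intro: less_le_trans)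
    show "emeasure lborel (D n) \<noteq> \<infinity>" for n using bounded_borel_finite[OF Db[of n]] by simp
  qed
  moreover have "(\<Inter>n. D n) = {}"
  proof -
    have "x \<notin> (\<Inter>n. D n)" if "x \<in> A i" for x i using that by (auto simp: D_def intro!: exI[of _ "Suc i"])
    then show ?thesis by (fastforce simp: D_def)
  qed
  ultimately have D0: "(\<lambda>n. measure lborel (D n)) \<longlonglongrightarrow> 0" by simp
  have sq: "(\<lambda>n. sqrt (measure lborel (D n) + 1 / real (Suc n))) \<longlonglongrightarrow> sqrt (0 + 0)"
    by (intro tendsto_real_sqrt tendsto_add D0 LIMSEQ_Suc[OF lim_inverse_n'])
  have "M \<longlonglongrightarrow> S0_dual_norm \<psi> \<sigma> * (synth (real CARD('n) + \<rho>) * (sqrt (0 + 0) * wiener_norm (flip f)))"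
    unfolding M_def by (intro tendsto_mult tendsto_const sq)
  then have "M \<longlonglongrightarrow> 0" by simp
  then have "(\<lambda>n. conv_measure \<sigma> f (D n)) \<longlonglongrightarrow> 0"
    by (rule Lim_null_comparison[rotated]) (auto intro: always_eventually le)
  then have "(\<lambda>n. conv_measure \<sigma> f ?U - conv_measure \<sigma> f (D n)) \<longlonglongrightarrow> conv_measure \<sigma> f ?U - 0"
    by (intro tendsto_diff tendsto_const)
  moreover have "(\<lambda>n. conv_measure \<sigma> f ?U - conv_measure \<sigma> f (D n)) = (\<lambda>n. \<Sum>i<n. conv_measure \<sigma> f (A i))"
    by (simp add: eq[symmetric])
  ultimately show "(\<lambda>i. conv_measure \<sigma> f (A i)) sums conv_measure \<sigma> f ?U" by (simp add: sums_def)
qed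

definition operator_const :: real where
  "operator_const = synth (2 * real CARD('n)) * real (card (near (2 * real CARD('n)) (0 :: real^'n)))"

lemma operator_const_nonneg: "0 \<le> operator_const" by (simp add: operator_const_def synth_nonneg)

text \<open>Multiplying each value by the conjugate of its sign turns the variation sum into the value of \<open>\<sigma>\<close> at the convolution
of \<open>flip f\<close> with a step function.  That function has modulus at most one on a unit cube, whatever the partition.\<close>

lemma conv_measure_tb:
  assumes s: "\<sigma> \<in> S0_dual \<psi>" and f: "f \<in> wiener"
  shows "conv_measure \<sigma> f \<in> tb_measures"
    and "tb_norm (conv_measure \<sigma> f) \<le> operator_const * S0_dual_norm \<psi> \<sigma> * wiener_norm f"
proof -
  have ff: "flip f \<in> wiener" by (rule wiener_flip(1)[OF f])
  have le: "(\<Sum>B\<in>P. cmod (conv_measure \<sigma> f B)) \<le> operator_const * S0_dual_norm \<psi> \<sigma> * wiener_norm f"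
    if k: "k \<in> int_lattice" and P: "finite P" "disjoint P" "P \<subseteq> bounded_borel" "\<Union>P = cube k" for k P
  proof -
    (* sgn 0 = 0 causes no harm, as only an upper bound for the modulus of c B is used. *)
    define c where "c B = cnj (sgn (conv_measure \<sigma> f B))" for B
    have c1: "cmod (c B) \<le> 1" for B by (simp add: c_def norm_sgn)
    have cc: "complex_of_real (cmod (conv_measure \<sigma> f B)) = c B * conv_measure \<sigma> f B" for B
    proof (cases "conv_measure \<sigma> f B = 0")
      case False
      let ?z = "conv_measure \<sigma> f B"
      have "c B * ?z = (?z * cnj ?z) / of_real (cmod ?z)" by (simp add: c_def sgn_eq mult.commute)
      also have "?z * cnj ?z = of_real ((cmod ?z)\<^sup>2)" by (rule complex_norm_square[symmetric])
      also have "\<dots> / of_real (cmod ?z) = of_real (cmod ?z)" using False by (simp add: power2_eq_square)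
      finally show ?thesis by simp
    qed simp
    let ?b = "\<lambda>y. \<Sum>B\<in>P. c B * indicator B y"
    have bi: "integrable lborel ?b"
      using P by (intro Bochner_Integration.integrable_sum integrable_mult_right indicator_integrable) auto
    (* Translating by the lattice point k keeps the support radius, and with it the constant,
       independent of the cube. *)
    have bti: "integrable lborel (translate (- k) ?b)" 
      using bi integrable_shift_iff[of ?b "- k"] by (simp add: translate_def del: diff_minus_eq_add)
    have bz: "translate (- k) ?b y = 0" if "norm y > real CARD('n)" for y
    proof -
      have "y + k \<notin> cube k" using cube_norm[of "y + k" k] that by auto
      then have "y + k \<notin> B" if "B \<in> P" for B using P(4) that by auto
      then show ?thesis by (simp add: translate_def)
    qed
    have "(\<integral>\<^sup>+y. ennreal ((cmod (translate (- k) ?b y))\<^sup>2) \<partial>lborel) = (\<integral>\<^sup>+y. ennreal ((cmod (?b y))\<^sup>2) \<partial>lborel)"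
    proof -
      note [measurable] = borel_measurable_integrable[OF bi]
      have "(\<lambda>y. ennreal ((cmod (?b y))\<^sup>2)) \<in> borel_measurable borel" by measurable
      from nn_integral_shift[OF this, of "- k"] show ?thesis by (simp add: translate_def)
    qed
    also have "\<dots> \<le> emeasure lborel (cube k)"
      using nn_integral_step_square[OF P(1-3) c1] P(4) by simp
    also have "\<dots> = ennreal (1\<^sup>2)" by (simp add: cube_hbox emeasure_hbox)
    finally have sq: "(\<integral>\<^sup>+y. ennreal ((cmod (translate (- k) ?b y))\<^sup>2) \<partial>lborel) \<le> ennreal (1\<^sup>2)" .
    have tf: "translate k (flip f) \<in> wiener" "wiener_norm (translate k (flip f)) = wiener_norm (flip f)"
      using wiener_translate[OF ff] wiener_norm_translate[OF k ff] by auto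
    note S = S0_convolve[OF tf(1) bti bz zero_less_one sq, unfolded convolve_translate tf(2)]
    have "complex_of_real (\<Sum>B\<in>P. cmod (conv_measure \<sigma> f B)) = (\<Sum>B\<in>P. c B * conv_measure \<sigma> f B)"
      by (simp add: cc)
    also have "\<dots> = (\<Sum>B\<in>P. c B * \<sigma> (convolve (indicator B) (flip f)))"
      using P(3) by (intro sum.cong) (auto simp: conv_measure_def)
    also have "\<dots> = \<sigma> (\<lambda>x. \<Sum>B\<in>P. c B * convolve (indicator B) (flip f) x)"
      using P(3) by (intro dual_sum[OF s, symmetric] indicator_convolve_S0(1)[OF _ ff]) auto
    also have "(\<lambda>x. \<Sum>B\<in>P. c B * convolve (indicator B) (flip f) x) = convolve ?b (flip f)"
      using P(3) by (intro convolve_sum_left[symmetric] indicator_integrable ff) auto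
    finally have "(\<Sum>B\<in>P. cmod (conv_measure \<sigma> f B)) \<le> cmod (\<sigma> (convolve ?b (flip f)))"
      by (metis abs_ge_self norm_of_real)
    also have "\<dots> \<le> S0_dual_norm \<psi> \<sigma> * S0_norm \<psi> (convolve ?b (flip f))" by (rule dualD(2)[OF s S(1)])
    also have "\<dots> \<le> S0_dual_norm \<psi> \<sigma> * (synth (real CARD('n) + real CARD('n)) * (1 * wiener_norm (flip f)))"
      by (rule mult_left_mono[OF S(2) dualD(3)[OF s]])
    also have "\<dots> \<le> S0_dual_norm \<psi> \<sigma> * (synth (real CARD('n) + real CARD('n)) * (1 * (real (card (near (2 * real CARD('n)) (0::real^'n))) * wiener_norm f)))"
      by (intro mult_left_mono dualD(3)[OF s] synth_nonneg wiener_flip(2)[OF f]) auto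
    also have "\<dots> = operator_const * S0_dual_norm \<psi> \<sigma> * wiener_norm f" by (simp add: operator_const_def)
    finally show ?thesis .
  qed
  have "0 \<le> operator_const * S0_dual_norm \<psi> \<sigma> * wiener_norm f"
    using operator_const_nonneg dualD(3)[OF s] wiener_norm_nonneg[OF f] by simp
  from tb_measuresI[OF conv_measure_radon[OF s f] this le]
  show "conv_measure \<sigma> f \<in> tb_measures" "tb_norm (conv_measure \<sigma> f) \<le> operator_const * S0_dual_norm \<psi> \<sigma> * wiener_norm f" by auto
qed

lemma bounded_borel_shift: "(\<lambda>z. z - x) ` A \<in> bounded_borel \<longleftrightarrow> A \<in> bounded_borel" for x :: "real^'n"
proof -
  have 1: "(\<lambda>z. z - x) ` A \<in> bounded_borel" if "A \<in> bounded_borel" for A and x :: "real^'n"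
  proof -
    have "(\<lambda>z. z - x) ` A = (\<lambda>z. z + x) -` A \<inter> space borel" by (auto simp: image_iff intro!: bexI[of _ "_ + x"])
    also have "\<dots> \<in> sets borel" by (rule measurable_sets[of _ _ borel]) (use that in \<open>auto simp: bounded_borel_def\<close>)
    finally show ?thesis using that bounded_translation_minus[of A x] by (simp add: bounded_borel_def)
  qed
  have "(\<lambda>z. z - (- x)) ` ((\<lambda>z. z - x) ` A) = A" by (auto simp: image_image)
  then show ?thesis using 1[of A x] 1[of "(\<lambda>z. z - x) ` A" "- x"] by metis
qed

text \<open>Translating \<open>f\<close> by \<open>x\<close> and translating \<open>A\<close> by \<open>- x\<close> have the same effect on \<open>1\<^sub>A * flip f\<close>.\<close>

lemma conv_operator_invariant:
  assumes s: "\<sigma> \<in> S0_dual \<psi>"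
  shows "conv_operator \<sigma> \<in> invariant_operators"
    and "operator_norm (conv_operator \<sigma>) \<le> operator_const * S0_dual_norm \<psi> \<sigma>"
proof -
  have ev: "conv_operator \<sigma> f = conv_measure \<sigma> f" if "f \<in> wiener" for f
    using that by (simp add: conv_operator_def)
  have lin: "conv_operator \<sigma> (\<lambda>x. a * f x + b * g x) = (\<lambda>A. a * conv_operator \<sigma> f A + b * conv_operator \<sigma> g A)"
    if f: "f \<in> wiener" and g: "g \<in> wiener" for f g a b
  proof
    fix A
    note fg = wiener_flip(1)[OF f] wiener_flip(1)[OF g]
    show "conv_operator \<sigma> (\<lambda>x. a * f x + b * g x) A = a * conv_operator \<sigma> f A + b * conv_operator \<sigma> g A"
    proof (cases "A \<in> bounded_borel")
      case True
      have "\<sigma> (convolve (indicator A) (\<lambda>x. a * flip f x + b * flip g x)) = a * \<sigma> (convolve (indicator A) (flip f)) + b * \<sigma> (convolve (indicator A) (flip g))"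
        unfolding convolve_lincomb_right[OF indicator_integrable[OF True] fg]
        by (rule dualD(1)[OF s]) (rule indicator_convolve_S0(1)[OF True] fg)+
      then show ?thesis using f g wiener_lincomb(1)[OF f g, of a b] True by (simp add: ev conv_measure_def flip_lincomb)
    qed (use f g wiener_lincomb(1)[OF f g, of a b] in \<open>simp add: ev conv_measure_def\<close>)
  qed
  have trans: "conv_operator \<sigma> (translate x f) = translate_measure x (conv_operator \<sigma> f)" if f: "f \<in> wiener" for x f
  proof
    fix A
    have fl: "flip (translate x f) = translate (- x) (flip f)" by (simp add: flip_def translate_def fun_eq_iff)
    have ind: "indicator ((\<lambda>z. z - x) ` A) = translate (- x) (indicator A :: 'n cfun)"
      by (auto simp: fun_eq_iff translate_def indicator_def image_iff intro!: bexI[of _ "_ + x"])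
    have "convolve (indicator A) (flip (translate x f)) = convolve (indicator ((\<lambda>z. z - x) ` A)) (flip f)"
    proof -
      have "convolve (indicator A) (flip (translate x f)) = convolve (translate (- x) (indicator A)) (translate x (translate (- x) (flip f)))"
        unfolding fl by (rule convolve_translate[symmetric])
      also have "translate x (translate (- x) (flip f)) = flip f" by (simp add: translate_def)
      finally show ?thesis unfolding ind .
    qed
    then show "conv_operator \<sigma> (translate x f) A = translate_measure x (conv_operator \<sigma> f) A"
      using f wiener_translate[OF f, of x] by (simp add: ev translate_measure_def conv_measure_def bounded_borel_shift)
  qed
  show "conv_operator \<sigma> \<in> invariant_operators"
    unfolding invariant_operators_def bounded_operators_def
    using lin trans conv_measure_tb[OF s] by (auto simp: ev conv_operator_def intro!: exI[of _ "operator_const * S0_dual_norm \<psi> \<sigma>"])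
  show "operator_norm (conv_operator \<sigma>) \<le> operator_const * S0_dual_norm \<psi> \<sigma>"
    unfolding operator_norm_def
  proof (rule cSUP_least)
    have "(\<lambda>x. 0) \<in> {f :: 'n cfun. f \<in> wiener \<and> wiener_norm f \<le> 1}" by simp
    then show "{f :: 'n cfun. f \<in> wiener \<and> wiener_norm f \<le> 1} \<noteq> {}" by blast
    fix f :: "'n cfun" assume f: "f \<in> {f \<in> wiener. wiener_norm f \<le> 1}"
    then have "tb_norm (conv_operator \<sigma> f) \<le> operator_const * S0_dual_norm \<psi> \<sigma> * wiener_norm f" using conv_measure_tb(2)[OF s] by (simp add: ev)
    also have "\<dots> \<le> operator_const * S0_dual_norm \<psi> \<sigma> * 1"
      using f operator_const_nonneg dualD(3)[OF s] by (intro mult_left_mono) auto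
    finally show "tb_norm (conv_operator \<sigma> f) \<le> operator_const * S0_dual_norm \<psi> \<sigma>" by simp
  qed
qed

text \<open>The quotient is \<open>\<sigma>\<close> at an average of \<open>flip f\<close> over a small cube, and these averages converge in \<open>S\<^sub>0\<close>.\<close>

lemma conv_operator_limit:
  assumes s: "\<sigma> \<in> S0_dual \<psi>" and f: "f \<in> S0 \<psi>" and r: "r \<longlonglongrightarrow> 0" and r1: "\<And>n. 0 < r n" "\<And>n. r n \<le> 1"
  shows "(\<lambda>n. conv_operator \<sigma> f (hbox 0 (r n)) / of_real (r n ^ CARD('n))) \<longlonglongrightarrow> \<sigma> (flip f)"
proof -
  note ff = S0_flip(1)[OF f]
  have w: "f \<in> wiener" "flip f \<in> wiener" using S0_wiener(1) f ff by auto
  have b: "hbox 0 (r n) \<in> bounded_borel" for n by simp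
  have ce: "convolve (avg (r n)) (flip f) = (\<lambda>x. of_real (1 / r n ^ CARD('n)) * convolve (indicator (hbox 0 (r n))) (flip f) x)" for n
    by (simp add: convolve_def avg_def[abs_def] mult.assoc fun_eq_iff del: of_real_divide)
  have eq: "conv_operator \<sigma> f (hbox 0 (r n)) / of_real (r n ^ CARD('n)) = \<sigma> (convolve (avg (r n)) (flip f))" for n
    unfolding ce using dual_cmult[OF s indicator_convolve_S0(1)[OF b w(2)], of "of_real (1 / r n ^ CARD('n))" n] w
    by (simp add: conv_operator_def conv_measure_def)
  have cS: "convolve (avg (r n)) (flip f) \<in> S0 \<psi>" for n
    unfolding ce by (rule S0_cmult(1)[OF indicator_convolve_S0(1)[OF b w(2)]])
  have "(\<lambda>n. S0_dual_norm \<psi> \<sigma> * S0_norm \<psi> (\<lambda>x. convolve (avg (r n)) (flip f) x - flip f x)) \<longlonglongrightarrow> 0"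
    by (rule tendsto_mult_right_zero[OF S0_avg_null[OF ff r r1]])
  then have "(\<lambda>n. \<sigma> (convolve (avg (r n)) (flip f)) - \<sigma> (flip f)) \<longlonglongrightarrow> 0"
  proof (rule Lim_null_comparison[rotated], intro always_eventually allI)
    fix n
    show "cmod (\<sigma> (convolve (avg (r n)) (flip f)) - \<sigma> (flip f)) \<le> S0_dual_norm \<psi> \<sigma> * S0_norm \<psi> (\<lambda>x. convolve (avg (r n)) (flip f) x - flip f x)"
      using dualD(2)[OF s S0_diff[OF cS ff]] dual_diff[OF s cS ff] by simp
  qed
  then show ?thesis unfolding eq by (simp add: LIM_zero_iff)
qed

end

section \<open>Riemann sums of parameter integrals\<close>

text \<open>The approximation is uniform in \<open>z\<close> while the weights keep the total mass of \<open>c\<close>.  Simple functions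
\<open>r\<close> approximating the identity yield finitely many sample points \<open>q\<close>, and each takes the integral
of \<open>c\<close> over \<open>{p. r p = q}\<close> as its weight.  Only the integral of \<open>|c|\<close> enters, so the parameter may range over the whole space.\<close>

lemma riemann_sum_approx:
  fixes c :: "'p::euclidean_space \<Rightarrow> complex" and H :: "'p \<Rightarrow> 'b \<Rightarrow> complex"
  assumes c: "integrable lborel c"
    and lip: "\<And>p q z. cmod (H p z - H q z) \<le> L * min 1 (dist p q)" and L: "0 \<le> L"
    and int: "\<And>z. integrable lborel (\<lambda>p. c p * H p z)"
    and e: "e > 0"
  obtains I a where "finite I" "(\<Sum>q\<in>I. cmod (a q)) \<le> (LINT p|lborel. cmod (c p))"
    "\<And>z. cmod ((LINT p|lborel. c p * H p z) - (\<Sum>q\<in>I. a q * H q z)) \<le> e"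
proof -
  note [measurable] = borel_measurable_integrable[OF c]
  obtain r where r: "\<And>i::nat. simple_function lborel (r i)" "\<And>p. (\<lambda>i. r i p) \<longlonglongrightarrow> (p :: 'p)"
    using borel_measurable_implies_sequence_metric[of "\<lambda>p::'p. p" lborel 0] by auto
  have rm [measurable]: "r i \<in> borel_measurable borel" for i
    using borel_measurable_simple_function[OF r(1)[of i]] by simp
  have dm [measurable]: "(\<lambda>p. dist p (r i p)) \<in> borel_measurable borel" for i by measurable
  have "(\<lambda>i. LINT p|lborel. cmod (c p) * (L * min 1 (dist p (r i p)))) \<longlonglongrightarrow> (LINT (p::'p)|lborel. (0::real))"
  proof (rule integral_dominated_convergence[where w="\<lambda>p. cmod (c p) * L"])
    show "integrable lborel (\<lambda>p. cmod (c p) * L)" using c by simp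
    have "(\<lambda>i. dist p (r i p)) \<longlonglongrightarrow> dist p p" for p by (intro tendsto_dist tendsto_const r(2))
    then have "(\<lambda>i. cmod (c p) * (L * min 1 (dist p (r i p)))) \<longlonglongrightarrow> cmod (c p) * (L * min 1 (dist p p))" for p
      by (intro tendsto_mult tendsto_min tendsto_const)
    then show "AE p in lborel. (\<lambda>i. cmod (c p) * (L * min 1 (dist p (r i p)))) \<longlonglongrightarrow> 0" by simp
    show "AE p in lborel. norm (cmod (c p) * (L * min 1 (dist p (r i p)))) \<le> cmod (c p) * L" for i
      using L by (intro AE_I2) (auto simp: abs_mult intro!: mult_left_mono mult_left_le)
  qed measurable
  then have "\<forall>\<^sub>F i in sequentially. (LINT p|lborel. cmod (c p) * (L * min 1 (dist p (r i p)))) < e"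
    by (intro order_tendstoD(2)) (use e in auto)
  then obtain i where i: "(LINT p|lborel. cmod (c p) * (L * min 1 (dist p (r i p)))) < e"
    using eventually_happens' sequentially_bot by blast
  define I where "I = range (r i)"
  define a where "a q = (LINT p|lborel. c p * indicator {p. r i p = q} p)" for q
  have fin: "finite I" using simple_functionD(1)[OF r(1)[of i]] by (simp add: I_def)
  have S [measurable]: "{p. r i p = q} \<in> sets borel" for q by measurable
  have ci: "integrable lborel (\<lambda>p. c p * indicator {p. r i p = q} p)" for q
    by (rule Bochner_Integration.integrable_bound[OF c]) (auto simp: indicator_def)
  have one: "(\<Sum>q\<in>I. indicator {p. r i p = q} p * h q) = h (r i p)" for p and h :: "'p \<Rightarrow> complex"
  proof -
    have "(\<Sum>q\<in>I. indicator {p. r i p = q} p * h q) = (\<Sum>q\<in>{r i p}. indicator {p. r i p = q} p * h q)"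
      by (rule sum.mono_neutral_right[OF fin]) (auto simp: I_def indicator_def)
    then show ?thesis by simp
  qed
  have A: "(\<Sum>q\<in>I. cmod (a q)) \<le> (LINT p|lborel. cmod (c p))"
  proof -
    have "(\<Sum>q\<in>I. cmod (a q)) \<le> (\<Sum>q\<in>I. LINT p|lborel. cmod (c p * indicator {p. r i p = q} p))"
      unfolding a_def by (intro sum_mono integral_norm_bound)
    also have "\<dots> = (LINT p|lborel. (\<Sum>q\<in>I. cmod (c p * indicator {p. r i p = q} p)))"
      by (rule Bochner_Integration.integral_sum[symmetric]) (intro integrable_norm ci)
    also have "(\<lambda>p. \<Sum>q\<in>I. cmod (c p * indicator {p. r i p = q} p)) = (\<lambda>p. cmod (c p))"
    proof
      fix p
      have "(\<Sum>q\<in>I. cmod (c p * indicator {p. r i p = q} p)) = (\<Sum>q\<in>{r i p}. cmod (c p * indicator {p. r i p = q} p))"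
        by (rule sum.mono_neutral_right[OF fin]) (auto simp: I_def indicator_def)
      then show "(\<Sum>q\<in>I. cmod (c p * indicator {p. r i p = q} p)) = cmod (c p)" by simp
    qed
    finally show ?thesis .
  qed
  have B: "cmod ((LINT p|lborel. c p * H p z) - (\<Sum>q\<in>I. a q * H q z)) \<le> e" for z
  proof -
    have ii: "integrable lborel (\<lambda>p. c p * indicator {p. r i p = q} p * H q z)" for q using ci by simp
    have "(\<Sum>q\<in>I. a q * H q z) = (LINT p|lborel. (\<Sum>q\<in>I. c p * indicator {p. r i p = q} p * H q z))"
      unfolding a_def by (subst Bochner_Integration.integral_sum[OF ii]) (simp only: integral_mult_left_zero)
    also have "(\<lambda>p. \<Sum>q\<in>I. c p * indicator {p. r i p = q} p * H q z) = (\<lambda>p. c p * H (r i p) z)"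
      using one[of _ "\<lambda>q. H q z"] by (simp only: mult.assoc sum_distrib_left[symmetric])
    finally have s: "(\<Sum>q\<in>I. a q * H q z) = (LINT p|lborel. c p * H (r i p) z)" .
    have si: "integrable lborel (\<lambda>p. c p * H (r i p) z)"
    proof -
      have "integrable lborel (\<lambda>p. \<Sum>q\<in>I. c p * indicator {p. r i p = q} p * H q z)" by (intro Bochner_Integration.integrable_sum ii)
      then show ?thesis using one[of _ "\<lambda>q. H q z"] by (simp only: mult.assoc sum_distrib_left[symmetric])
    qed
    have wi: "integrable lborel (\<lambda>p. cmod (c p) * (L * min 1 (dist p (r i p))))"
    proof (rule Bochner_Integration.integrable_bound)
      show "integrable lborel (\<lambda>p. cmod (c p) * L)" using c by simp
      show "AE p in lborel. norm (cmod (c p) * (L * min 1 (dist p (r i p)))) \<le> norm (cmod (c p) * L)"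
        using L by (intro AE_I2) (auto simp: abs_mult intro!: mult_left_mono mult_left_le)
    qed measurable
    have "(LINT p|lborel. c p * H p z) - (\<Sum>q\<in>I. a q * H q z) = (LINT p|lborel. c p * H p z - c p * H (r i p) z)"
      unfolding s using Bochner_Integration.integral_diff[OF int si] by simp
    then have "cmod ((LINT p|lborel. c p * H p z) - (\<Sum>q\<in>I. a q * H q z)) \<le> (LINT p|lborel. cmod (c p * H p z - c p * H (r i p) z))"
      by simp
    also have "\<dots> \<le> (LINT p|lborel. cmod (c p) * (L * min 1 (dist p (r i p))))"
    proof (rule integral_mono[OF _ wi])
      show "integrable lborel (\<lambda>p. cmod (c p * H p z - c p * H (r i p) z))" using int si by simp
      show "cmod (c p * H p z - c p * H (r i p) z) \<le> cmod (c p) * (L * min 1 (dist p (r i p)))" for p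
        unfolding right_diff_distrib[symmetric] norm_mult by (intro mult_left_mono lip) auto
    qed
    finally show ?thesis using i by linarith
  qed
  show thesis by (rule that[OF fin A B])
qed

text \<open>The integral of \<open>H p\<close> is formed pointwise, not in a space on which \<open>\<Lambda>\<close> is continuous, so \<open>\<Lambda>\<close> cannot
simply be taken inside it.  For a bound, Riemann sums suffice: they are linear combinations of the \<open>H q\<close> with controlled
coefficients, and \<open>small\<close> controls the error.  Linearity is assumed only for the
decomposition used, so that \<open>\<Lambda>\<close> can be linear on a set of functions rather than a vector space type.\<close>

lemma functional_of_integral_bound:
  fixes c :: "'p::euclidean_space \<Rightarrow> complex" and H :: "'p \<Rightarrow> 'b \<Rightarrow> complex"
  assumes c: "integrable lborel c"
    and lip: "\<And>p q z. cmod (H p z - H q z) \<le> L * min 1 (dist p q)" and L: "0 \<le> L"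
    and int: "\<And>z. integrable lborel (\<lambda>p. c p * H p z)"
    and F: "F = (\<lambda>z. LINT p|lborel. c p * H p z)"
    and lin: "\<And>I a. finite I \<Longrightarrow> \<Lambda> F = \<Lambda> (\<lambda>z. F z - (\<Sum>q\<in>I. a q * H q z)) + (\<Sum>q\<in>I. a q * \<Lambda> (H q))"
    and small: "\<And>I a e. finite I \<Longrightarrow> (\<And>z. cmod (F z - (\<Sum>q\<in>I. a q * H q z)) \<le> e) 
       \<Longrightarrow> cmod (\<Lambda> (\<lambda>z. F z - (\<Sum>q\<in>I. a q * H q z)) :: complex) \<le> K * e"
    and bd: "\<And>q. cmod (\<Lambda> (H q)) \<le> C"
  shows "cmod (\<Lambda> F) \<le> C * (LINT p|lborel. cmod (c p))"
proof -
  have C: "0 \<le> C" using bd[of 0] norm_ge_zero order_trans by blast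
  have "cmod (\<Lambda> F) \<le> C * (LINT p|lborel. cmod (c p)) + d" if d: "d > 0" for d
  proof -
    define e where "e = d / (\<bar>K\<bar> + 1)"
    have e: "e > 0" using d by (simp add: e_def)
    obtain I a where Ia: "finite I" "(\<Sum>q\<in>I. cmod (a q)) \<le> (LINT p|lborel. cmod (c p))"
       "\<And>z. cmod ((LINT p|lborel. c p * H p z) - (\<Sum>q\<in>I. a q * H q z)) \<le> e"
      by (rule riemann_sum_approx[where H=H, OF c lip L int e]) (rule that)
    have "cmod (\<Lambda> F) \<le> cmod (\<Lambda> (\<lambda>z. F z - (\<Sum>q\<in>I. a q * H q z))) + cmod (\<Sum>q\<in>I. a q * \<Lambda> (H q))"
      by (subst lin[OF Ia(1), of a]) (rule norm_triangle_ineq)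
    also have "cmod (\<Lambda> (\<lambda>z. F z - (\<Sum>q\<in>I. a q * H q z))) \<le> K * e"
      by (rule small[OF Ia(1)]) (use Ia(3) in \<open>simp add: F\<close>)
    also have "K * e \<le> d"
    proof -
      have "K * e \<le> (\<bar>K\<bar> + 1) * e" using e by (intro mult_right_mono) auto
      also have "\<dots> = d" by (simp add: e_def)
      finally show ?thesis .
    qed
    also have "cmod (\<Sum>q\<in>I. a q * \<Lambda> (H q)) \<le> (\<Sum>q\<in>I. cmod (a q) * C)"
      by (rule sum_norm_le) (simp add: norm_mult mult_left_mono bd)
    also have "\<dots> = C * (\<Sum>q\<in>I. cmod (a q))" by (simp add: sum_distrib_left mult.commute)
    also have "\<dots> \<le> C * (LINT p|lborel. cmod (c p))" by (intro mult_left_mono Ia(2) C)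
    finally show ?thesis by simp
  qed
  then show ?thesis by (rule field_le_epsilon)
qed

section \<open>Subdividing boxes\<close>

definition grid :: "nat \<Rightarrow> (real^'n::finite) set" where
  "grid N = {j \<in> int_lattice. \<forall>i. 0 \<le> j $ i \<and> j $ i < real N}"

lemma grid_lattice: "j \<in> grid N \<Longrightarrow> j \<in> int_lattice" by (simp add: grid_def)

lemma mem_hbox_scaled:
  fixes z x j :: "real^'n::finite"
  assumes r: "r > 0"
  shows "z \<in> hbox (x + r *\<^sub>R j) r \<longleftrightarrow> (1 / r) *\<^sub>R (z - x) \<in> cube j"
  using r by (auto simp: hbox_def mem_cube field_simps)

lemma hbox_scaled_disjoint:
  assumes r: "r > 0" and j: "j \<in> int_lattice" "j' \<in> int_lattice" "j \<noteq> (j' :: real^'n::finite)"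
  shows "hbox (x + r *\<^sub>R j) r \<inter> hbox (x + r *\<^sub>R j') r = {}"
proof -
  have False if "z \<in> hbox (x + r *\<^sub>R j) r" "z \<in> hbox (x + r *\<^sub>R j') r" for z
    using cube_unique[OF j(1) that(1)[unfolded mem_hbox_scaled[OF r]]]
      cube_unique[OF j(2) that(2)[unfolded mem_hbox_scaled[OF r]]] j(3) by simp
  then show ?thesis by blast
qed

lemma hbox_split:
  fixes x :: "real^'n::finite"
  assumes r: "r > 0"
  shows "hbox x (real N * r) = (\<Union>j\<in>grid N. hbox (x + r *\<^sub>R j) r)"
proof (intro equalityI subsetI)
  fix z assume z: "z \<in> hbox x (real N * r)"
  let ?w = "(1 / r) *\<^sub>R (z - x)"
  have w: "0 \<le> ?w $ i" "?w $ i < real N" for i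
  proof -
    have "x $ i \<le> z $ i" "z $ i < x $ i + real N * r" using z by (auto simp: hbox_def)
    then show "0 \<le> ?w $ i" "?w $ i < real N" using r by (auto simp: field_simps)
  qed
  have "vfloor ?w \<in> grid N"
    unfolding grid_def
  proof (intro CollectI conjI allI vfloor_lattice)
    fix i
    show "0 \<le> vfloor ?w $ i" using w(1)[of i] by (simp add: vfloor_def)
    show "vfloor ?w $ i < real N" using w(2)[of i] of_int_floor_le[of "?w $ i"] unfolding vfloor_def vec_lambda_beta by linarith
  qed
  moreover have "z \<in> hbox (x + r *\<^sub>R vfloor ?w) r" by (simp only: mem_hbox_scaled[OF r] mem_cube_vfloor)
  ultimately show "z \<in> (\<Union>j\<in>grid N. hbox (x + r *\<^sub>R j) r)" by blast
next
  fix z assume "z \<in> (\<Union>j\<in>grid N. hbox (x + r *\<^sub>R j) r)"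
  then obtain j where j: "j \<in> grid N" "z \<in> hbox (x + r *\<^sub>R j) r" by blast
  have "x $ i \<le> z $ i \<and> z $ i < x $ i + real N * r" for i
  proof -
    have z: "x $ i + r * j $ i \<le> z $ i" "z $ i < x $ i + r * j $ i + r" using j(2) by (auto simp: hbox_def)
    have g: "0 \<le> j $ i" "j $ i < real N" "j $ i \<in> \<int>" using j(1) by (auto simp: grid_def int_lattice_def)
    then obtain m where "j $ i = of_int m" by (auto elim: Ints_cases)
    then have m: "j $ i = of_int m" .
    with g(2) have "real_of_int m < real_of_int (int N)" by simp
    then have "real_of_int (m + 1) \<le> real_of_int (int N)" by (simp only: of_int_less_iff of_int_le_iff)
    with m have "j $ i + 1 \<le> real N" by simp
    then have "r * (j $ i + 1) \<le> r * real N" using r by (intro mult_left_mono) auto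
    moreover have "0 \<le> r * j $ i" using r g by simp
    ultimately show ?thesis using z by (simp add: algebra_simps)
  qed
  then show "z \<in> hbox x (real N * r)" by (simp add: hbox_def)
qed

lemma grid_scaled_norm:
  assumes "j \<in> grid N" "N > 0" shows "norm ((1 / real N) *\<^sub>R (j :: real^'n::finite)) \<le> real CARD('n)"
proof -
  have "(1 / real N) *\<^sub>R j \<in> hbox 0 1"
    using assms by (auto simp: hbox_def grid_def field_simps)
  from hbox_norm[OF this] show ?thesis by simp
qed

lemma grid_finite: "finite (grid N :: (real^'n::finite) set)"
proof (cases "N = 0")
  case True
  then have "grid N = ({} :: (real^'n) set)" by (force simp: grid_def)
  then show ?thesis by simp
next
  case False
  have "grid N \<subseteq> near (real N * real CARD('n)) (0 :: real^'n)"
  proof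
    fix j :: "real^'n" assume j: "j \<in> grid N"
    have "norm j = real N * norm ((1 / real N) *\<^sub>R j)" using False by simp
    also have "\<dots> \<le> real N * real CARD('n)" using grid_scaled_norm[OF j] False by (intro mult_left_mono) auto
    finally show "j \<in> near (real N * real CARD('n)) 0" using j by (simp add: near_def grid_lattice)
  qed
  then show ?thesis using finite_near finite_subset by blast
qed

lemma grid_card:
  fixes r :: real
  assumes r: "r > 0" and N: "N > 0"
  shows "real (card (grid N :: (real^'n::finite) set)) * r ^ CARD('n) = (real N * r) ^ CARD('n)"
proof -
  have "measure lborel (hbox (0 :: real^'n) (real N * r)) = (\<Sum>j\<in>grid N. measure lborel (hbox (0 + r *\<^sub>R j :: real^'n) r))"
    unfolding hbox_split[OF r]
  proof (rule measure_finite_Union[OF grid_finite])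
    show "disjoint_family_on (\<lambda>j. hbox (0 + r *\<^sub>R j :: real^'n) r) (grid N)"
      unfolding disjoint_family_on_def using hbox_scaled_disjoint[OF r grid_lattice grid_lattice] by blast
  qed (auto simp: emeasure_hbox[OF r])
  then show ?thesis using lebesgue_hbox[OF r, where 'n='n] lebesgue_hbox[of "real N * r" "0 :: real^'n"] r N by simp
qed

lemma hbox_shift: "(\<lambda>z. z - y) ` hbox x r = hbox (x - y) (r :: real)"
proof -
  have "z \<in> (\<lambda>z. z - y) ` hbox x r \<longleftrightarrow> z + y \<in> hbox x r" for z
    by (auto simp: image_iff intro: bexI[of _ "z + y"])
  moreover have "z + y \<in> hbox x r \<longleftrightarrow> z \<in> hbox (x - y) r" for z by (auto simp: hbox_def algebra_simps)
  ultimately show ?thesis by blast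
qed

section \<open>Invariant operators\<close>

lemma invariantD:
  fixes T :: "'n::finite cfun \<Rightarrow> 'n cmeas"
  assumes "T \<in> invariant_operators"
  shows "f \<in> wiener \<Longrightarrow> T f \<in> tb_measures"
    and "f \<in> wiener \<Longrightarrow> g \<in> wiener \<Longrightarrow> T (\<lambda>x. a * f x + b * g x) A = a * T f A + b * T g A"
    and "f \<in> wiener \<Longrightarrow> T (translate x f) A = T f ((\<lambda>z. z - x) ` A)"
    and "\<exists>C. 0 \<le> C \<and> (\<forall>f\<in>wiener. tb_norm (T f) \<le> C * wiener_norm f)"
    and "T \<in> extensional wiener"
proof -
  have b: "T \<in> bounded_operators" using assms by (simp add: invariant_operators_def)
  then show "f \<in> wiener \<Longrightarrow> T f \<in> tb_measures" "T \<in> extensional wiener" by (auto simp: bounded_operators_def)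
  show "f \<in> wiener \<Longrightarrow> g \<in> wiener \<Longrightarrow> T (\<lambda>x. a * f x + b * g x) A = a * T f A + b * T g A"
    using b by (simp add: bounded_operators_def)
  show "f \<in> wiener \<Longrightarrow> T (translate x f) A = T f ((\<lambda>z. z - x) ` A)"
    using assms by (simp add: invariant_operators_def translate_measure_def)
  obtain C where "\<forall>f\<in>wiener. tb_norm (T f) \<le> C * wiener_norm f" using b unfolding bounded_operators_def by blast
  then have "\<forall>f\<in>wiener. tb_norm (T f) \<le> \<bar>C\<bar> * wiener_norm f"
    using wiener_norm_nonneg by (meson abs_ge_self mult_right_mono order_trans)
  then show "\<exists>C. 0 \<le> C \<and> (\<forall>f\<in>wiener. tb_norm (T f) \<le> C * wiener_norm f)" by (intro exI[of _ "\<bar>C\<bar>"]) auto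
qed

lemma operator_cmult: "T \<in> invariant_operators \<Longrightarrow> f \<in> wiener \<Longrightarrow> T (\<lambda>x. a * f x) A = a * T f A"
  using invariantD(2)[of T f f a 0] by simp

lemma operator_diff: "T \<in> invariant_operators \<Longrightarrow> f \<in> wiener \<Longrightarrow> g \<in> wiener \<Longrightarrow> T (\<lambda>x. f x - g x) A = T f A - T g A"
  using invariantD(2)[of T f g 1 "-1"] by simp

lemma operator_sum:
  assumes T: "T \<in> invariant_operators" and f: "\<And>i. i \<in> I \<Longrightarrow> f i \<in> wiener"
  shows "T (\<lambda>x. \<Sum>i\<in>I. c i * f i x) A = (\<Sum>i\<in>I. c i * T (f i) A)"
  using f
proof (induction I rule: infinite_finite_induct)
  case (insert i I)
  then have "(\<lambda>x. \<Sum>i\<in>I. c i * f i x) \<in> wiener" by (intro wiener_sum wiener_cmult) auto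
  from invariantD(2)[OF T _ this, of "f i" "c i" 1] insert show ?case by simp
qed (use operator_cmult[OF T wiener_zero(1), of 0] in auto)

lemma operator_norm_upper:
  fixes T :: "'n::finite cfun \<Rightarrow> 'n cmeas"
  assumes T: "T \<in> invariant_operators" and f: "f \<in> wiener" "wiener_norm f \<le> 1"
  shows "tb_norm (T f) \<le> operator_norm T"
proof -
  obtain C where C: "0 \<le> C" "\<And>f. f \<in> wiener \<Longrightarrow> tb_norm (T f) \<le> C * wiener_norm f" using invariantD(4)[OF T] by blast
  have "bdd_above ((\<lambda>f. tb_norm (T f)) ` {f \<in> wiener. wiener_norm f \<le> 1})"
  proof (rule bdd_aboveI[of _ C], clarify)
    fix f :: "'n cfun" assume "f \<in> wiener" "wiener_norm f \<le> 1"
    then show "tb_norm (T f) \<le> C" using C(2)[of f] mult_left_mono[of "wiener_norm f" 1 C] C(1) by linarith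
  qed
  then show ?thesis unfolding operator_norm_def by (rule cSUP_upper[rotated]) (use f in simp)
qed

lemma operator_norm_nonneg: "T \<in> invariant_operators \<Longrightarrow> 0 \<le> operator_norm T"
  by (rule order_trans[OF tb_norm_nonneg operator_norm_upper[of T "\<lambda>x. 0"]]) auto

lemma operator_value_bound:
  fixes T :: "'n::finite cfun \<Rightarrow> 'n cmeas"
  assumes T: "T \<in> invariant_operators" and A: "A \<in> bounded_borel"
  shows "\<exists>K\<ge>0. \<forall>f\<in>wiener. cmod (T f A) \<le> K * wiener_norm f"
proof -
  obtain C where C: "0 \<le> C" "\<And>f. f \<in> wiener \<Longrightarrow> tb_norm (T f) \<le> C * wiener_norm f" using invariantD(4)[OF T] by blast
  obtain \<rho> where rho: "\<And>x. x \<in> A \<Longrightarrow> norm x \<le> \<rho>" using bounded_borel_radius[OF A] by blast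
  define k where "k = real (card (near (\<rho> + 2 * real CARD('n)) (0 :: real^'n)))"
  have "cmod (T f A) \<le> (k * C) * wiener_norm f" if f: "f \<in> wiener" for f
  proof -
    have "(\<Sum>i\<in>{()}. cmod (T f A)) \<le> k * tb_norm (T f)"
      unfolding k_def
      by (rule tb_bounded_sum_le[OF invariantD(1)[OF T f], where p=0]) (use A rho in \<open>auto simp: disjoint_family_on_def\<close>)
    also have "\<dots> \<le> k * (C * wiener_norm f)" by (intro mult_left_mono C(2)[OF f]) (simp add: k_def)
    finally show ?thesis by simp
  qed
  then show ?thesis using C(1) by (intro exI[of _ "k * C"]) (simp add: k_def)
qed

section \<open>The local estimate for invariant operators\<close>

text \<open>One on the ball of radius \<open>\<rho>\<close> and zero outside radius \<open>\<rho> + 1\<close>; being Lipschitz is all the smoothness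
that the Riemann sums use.\<close>

definition plateau :: "real \<Rightarrow> 'n::finite cfun" where
  "plateau \<rho> z = of_real (max 0 (min 1 (\<rho> + 1 - norm z)))"

lemma plateau_continuous: "continuous_on UNIV (plateau \<rho>)"
  unfolding plateau_def by (intro continuous_intros)

lemma plateau_le_1: "cmod (plateau \<rho> z) \<le> 1"
  by (simp add: plateau_def)

lemma plateau_eq_1: "norm z \<le> \<rho> \<Longrightarrow> plateau \<rho> z = 1"
  by (simp add: plateau_def)

lemma plateau_eq_0: "norm z > \<rho> + 1 \<Longrightarrow> plateau \<rho> z = 0"
  by (simp add: plateau_def)

lemma plateau_lipschitz: "cmod (plateau \<rho> z - plateau \<rho> w) \<le> min 1 (norm (z - w))"
proof -
  let ?m = "\<lambda>t::real. max 0 (min 1 t)"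
  have "\<bar>?m a - ?m b\<bar> \<le> min 1 \<bar>a - b\<bar>" for a b by (simp add: max_def min_def)
  from this[of "\<rho> + 1 - norm z" "\<rho> + 1 - norm w"]
  have "\<bar>?m (\<rho> + 1 - norm z) - ?m (\<rho> + 1 - norm w)\<bar> \<le> min 1 \<bar>norm w - norm z\<bar>" by simp
  also have "\<dots> \<le> min 1 (norm (z - w))"
    using norm_triangle_ineq3[of w z] by (simp add: norm_minus_commute)
  finally show ?thesis unfolding plateau_def of_real_diff[symmetric] norm_of_real .
qed

lemma plateau_sum_bound: "cmod (\<Sum>j\<in>J. plateau \<rho> (v j)) \<le> real (card J)"
  by (rule order_trans[OF sum_norm_le[where g="\<lambda>_. 1"]]) (auto intro: plateau_le_1)

lemma cis_lipschitz: "cmod (cis a - cis b) \<le> \<bar>a - b\<bar>"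
proof -
  have "cis a - cis b = cis b * (cis (a - b) - 1)" by (simp add: right_diff_distrib cis_mult)
  then show ?thesis using cmod_cis_minus_1[of "a - b"] by (simp add: norm_mult)
qed

context partition
begin

definition plateau_radius :: real where "plateau_radius = R + real CARD('n)"
definition bump_radius :: real where "bump_radius = plateau_radius + 1 + 2 * real CARD('n)"

text \<open>A plane wave cut off near \<open>k\<close>.  The plateau exceeds the support radius of a piece by at least the
diameter of a unit cube, so it still equals one there after a shift by a vector of that cube.\<close>

definition wave :: "real^'n \<Rightarrow> real^'n \<Rightarrow> 'n cfun" where
  "wave s k z = cis (2 * pi * (s \<bullet> z)) * plateau plateau_radius (z - k)"

definition wave_const :: real where "wave_const = real (card (near (plateau_radius + 1 + 2 * real CARD('n)) (0 :: real^'n)))"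

text \<open>The average of the plateau over the shifts by the unit cube, split along the subdivision of the cube into
boxes of side \<open>1 / N\<close>: the convolution averages over one box and the sum runs over the boxes.\<close>

definition bump :: "nat \<Rightarrow> 'n cfun" where
  "bump N = convolve (indicator (hbox 0 (1 / real N))) (\<lambda>u. \<Sum>j\<in>grid N. plateau plateau_radius (u - (1 / real N) *\<^sub>R j))"

definition bwave :: "nat \<Rightarrow> real^'n \<Rightarrow> real^'n \<Rightarrow> 'n cfun" where
  "bwave N s k z = cis (2 * pi * (s \<bullet> z)) * bump N (z - k)"

definition tile_const :: real where "tile_const = real (card (near (4 * real CARD('n)) (0 :: real^'n)))"

lemma radii_nonneg: "0 \<le> plateau_radius" "R \<le> bump_radius" using R_nonneg by (auto simp: plateau_radius_def bump_radius_def)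

lemma wave_const_pos: "0 < wave_const"
proof -
  have "0 \<in> near (plateau_radius + 1 + 2 * real CARD('n)) (0 :: real^'n)" using radii_nonneg by (simp add: near_def)
  then show ?thesis by (auto simp: wave_const_def card_gt_0_iff)
qed

lemma wave_wiener: "wave s k \<in> wiener" "wiener_norm (wave s k) \<le> wave_const"
proof -
  have c: "continuous_on UNIV (wave s k)"
    unfolding wave_def by (intro continuous_intros continuous_on_compose2[OF plateau_continuous]) auto
  have z: "wave s k x = 0" if "norm (x - k) > plateau_radius + 1" for x using plateau_eq_0[OF that] by (simp add: wave_def)
  have B: "cmod (wave s k x) \<le> 1" for x by (simp add: wave_def norm_mult plateau_le_1)
  from wiener_bounded_support[OF c z B] show "wave s k \<in> wiener" "wiener_norm (wave s k) \<le> wave_const"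
    by (auto simp: wave_const_def)
qed

text \<open>The shifts that occur fill the unit cube, whose volume is one.\<close>

lemma bump_facts:
  assumes N: "N > 0"
  shows "continuous_on UNIV (bump N)" and "norm w \<le> R \<Longrightarrow> bump N w = 1"
    and "norm w > bump_radius \<Longrightarrow> bump N w = 0" and "cmod (bump N w) \<le> 1"
proof -
  let ?r = "1 / real N" and ?g = "\<lambda>u. \<Sum>j\<in>grid N. plateau plateau_radius (u - (1 / real N) *\<^sub>R (j :: real^'n))"
  have r: "?r > 0" using N by simp
  have card: "real (card (grid N :: (real^'n) set)) * ?r ^ CARD('n) = 1" using grid_card[OF r N, where 'n='n] N by simp
  have gc: "continuous_on UNIV ?g"
    by (intro continuous_intros continuous_on_compose2[OF plateau_continuous]) auto
  have gb: "cmod (?g u) \<le> real (card (grid N :: (real^'n) set))" for u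
    by (rule plateau_sum_bound)
  have ii: "integrable lborel (indicator (hbox 0 ?r) :: 'n cfun)" by (rule indicator_integrable) simp
  show "continuous_on UNIV (bump N)" unfolding bump_def by (rule convolve_continuous[OF ii gc gb])
  have jn: "norm (?r *\<^sub>R j) \<le> real CARD('n)" if "j \<in> grid N" for j :: "real^'n" by (rule grid_scaled_norm[OF that N])
  have yn: "norm y \<le> real CARD('n) * ?r" if "y \<in> hbox 0 ?r" for y :: "real^'n" using hbox_norm[OF that] by simp
  have r1: "real CARD('n) * ?r \<le> real CARD('n)" using N by (simp add: divide_le_eq)
  have li: "(LINT y|lborel. indicator (hbox 0 ?r) (y :: real^'n) * (of_nat (card (grid N :: (real^'n) set)) :: complex)) = 1"
  proof -
    have "(LINT y|lborel. indicator (hbox 0 ?r) (y :: real^'n) :: complex) = (LINT y|lborel. of_real (indicator (hbox 0 ?r) (y :: real^'n)))"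
      by (intro Bochner_Integration.integral_cong) (auto simp: indicator_def)
    also have "\<dots> = of_real (LINT y|lborel. indicator (hbox 0 ?r) (y :: real^'n))" by (rule integral_complex_of_real)
    also have "\<dots> = of_real (?r ^ CARD('n))" using lebesgue_hbox[OF r, of "0 :: real^'n"] by simp
    finally have i: "(LINT y|lborel. indicator (hbox 0 ?r) (y :: real^'n) :: complex) = of_real (?r ^ CARD('n))" .
    have "of_real (real (card (grid N :: (real^'n) set)) * ?r ^ CARD('n)) = (1 :: complex)" unfolding card by simp
    then show ?thesis unfolding integral_mult_left_zero i by (simp add: mult.commute)
  qed
  show "bump N w = 1" if w: "norm w \<le> R"
  proof -
    have "indicator (hbox 0 ?r) y * ?g (w - y) = indicator (hbox 0 ?r) y * of_nat (card (grid N :: (real^'n) set))" for y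
    proof (cases "y \<in> hbox 0 ?r")
      case True
      have "plateau plateau_radius (w - y - ?r *\<^sub>R j) = 1" if j: "j \<in> grid N" for j :: "real^'n"
      proof (rule plateau_eq_1)
        have yj: "y + ?r *\<^sub>R j \<in> hbox 0 (real N * ?r)"
        proof -
          have "y + ?r *\<^sub>R j \<in> hbox (0 + ?r *\<^sub>R j) ?r" using True by (simp add: hbox_def)
          then show ?thesis unfolding hbox_split[OF r] using j by blast
        qed
        then have "norm (y + ?r *\<^sub>R j) \<le> real CARD('n)" using hbox_norm[OF yj] N by simp
        moreover have "norm (w - y - ?r *\<^sub>R j) \<le> norm w + norm (y + ?r *\<^sub>R j)"
          using norm_triangle_ineq4[of w "y + ?r *\<^sub>R j"] by (simp add: diff_diff_eq)
        ultimately show "norm (w - y - ?r *\<^sub>R j) \<le> plateau_radius" using w by (simp add: plateau_radius_def)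
      qed
      then show ?thesis by simp
    qed simp
    then show ?thesis unfolding bump_def convolve_def by (simp only: li)
  qed
  show "bump N w = 0" if w: "norm w > bump_radius"
  proof -
    have "indicator (hbox 0 ?r) y * ?g (w - y) = 0" for y
    proof (cases "y \<in> hbox 0 ?r")
      case True
      have "plateau plateau_radius (w - y - ?r *\<^sub>R j) = 0" if j: "j \<in> grid N" for j :: "real^'n"
      proof (rule plateau_eq_0)
        have "norm w \<le> norm (w - y - ?r *\<^sub>R j) + norm (y + ?r *\<^sub>R j)"
          using norm_triangle_ineq[of "w - y - ?r *\<^sub>R j" "y + ?r *\<^sub>R j"] by simp
        moreover have "norm (y + ?r *\<^sub>R j) \<le> norm y + norm (?r *\<^sub>R j)" by (rule norm_triangle_ineq)
        ultimately show "norm (w - y - ?r *\<^sub>R j) > plateau_radius + 1" using jn[OF j] yn[OF True] r1 w by (simp add: bump_radius_def)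
      qed
      then show ?thesis by simp
    qed simp
    note z = this
    show ?thesis unfolding bump_def convolve_def by (simp only: z integral_zero)
  qed
  show "cmod (bump N w) \<le> 1"
  proof -
    have "cmod (bump N w) \<le> (LINT y|lborel. cmod (indicator (hbox 0 ?r) y * ?g (w - y)))"
      unfolding bump_def convolve_def by (rule integral_norm_bound)
    also have "\<dots> \<le> (LINT y|lborel. indicator (hbox 0 ?r) (y :: real^'n) * real (card (grid N :: (real^'n) set)))"
    proof (rule integral_mono)
      show "integrable lborel (\<lambda>y. cmod (indicator (hbox 0 ?r) y * ?g (w - y)))"
        by (intro integrable_norm integrable_mult_shift[OF ii borel_measurable_continuous_onI[OF gc] gb])
      show "integrable lborel (\<lambda>y. indicator (hbox 0 ?r) (y :: real^'n) * real (card (grid N :: (real^'n) set)))"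
        by (intro integrable_mult_left integrable_real_indicator) (simp_all add: emeasure_hbox[OF r])
      show "cmod (indicator (hbox 0 ?r) y * ?g (w - y)) \<le> indicator (hbox 0 ?r) y * real (card (grid N :: (real^'n) set))" for y
        using gb[of "w - y"] by (auto simp: norm_mult indicator_def)
    qed
    also have "\<dots> = ?r ^ CARD('n) * real (card (grid N :: (real^'n) set))"
      using lebesgue_hbox[OF r, of "0 :: real^'n"] by simp
    also have "\<dots> = 1" using card by (simp add: mult.commute)
    finally show ?thesis .
  qed
qed

lemma bwave_wiener:
  assumes N: "N > 0"
  shows "continuous_on UNIV (bwave N s k)" "bwave N s k \<in> wiener" "norm (z - k) > bump_radius \<Longrightarrow> bwave N s k z = 0"
proof -
  show c: "continuous_on UNIV (bwave N s k)"
    unfolding bwave_def by (intro continuous_intros continuous_on_compose2[OF bump_facts(1)[OF N]]) auto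
  show z: "norm (z - k) > bump_radius \<Longrightarrow> bwave N s k z = 0" for z by (simp add: bwave_def bump_facts(3)[OF N])
  show "bwave N s k \<in> wiener"
    by (rule wiener_bounded_support(1)[where B=1, OF c z]) (auto simp: bwave_def norm_mult bump_facts(4)[OF N])
qed

lemma operator_small:
  fixes k :: "real^'n" and T :: "'n cfun \<Rightarrow> 'n cmeas"
  assumes T: "T \<in> invariant_operators" and A: "A \<in> bounded_borel"
  shows "\<exists>K. \<forall>u e. continuous_on UNIV u \<longrightarrow> (\<forall>z. norm (z - k) > \<rho> \<longrightarrow> u z = 0) \<longrightarrow> (\<forall>z. cmod (u z) \<le> e)
     \<longrightarrow> cmod (T u A) \<le> K * (e :: real)"
proof -
  obtain K where K: "K \<ge> 0" "\<And>f. f \<in> wiener \<Longrightarrow> cmod (T f A) \<le> K * wiener_norm f" using operator_value_bound[OF T A] by blast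
  let ?c = "real (card (near (\<rho> + 2 * real CARD('n)) (0 :: real^'n)))"
  have "cmod (T u A) \<le> (K * ?c) * e"
    if "continuous_on UNIV u" "\<forall>z. norm (z - k) > \<rho> \<longrightarrow> u z = 0" "\<forall>z. cmod (u z) \<le> e" for u :: "'n cfun" and e
  proof -
    have w: "u \<in> wiener" "wiener_norm u \<le> ?c * e"
      using wiener_bounded_support[OF that(1), of \<rho> k e] that(2,3) by auto
    have "cmod (T u A) \<le> K * wiener_norm u" by (rule K(2)[OF w(1)])
    also have "\<dots> \<le> K * (?c * e)" by (intro mult_left_mono w(2) K(1))
    finally show ?thesis by (simp only: mult.assoc)
  qed
  then show ?thesis by blast
qed

text \<open>The boxes are disjoint and fill a cube of side one, so the sum is part of a variation sum of the
measure \<open>T (wave s k)\<close>.  The bound does not depend on \<open>N\<close>: this is the gain of the factor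
\<open>N\<^sup>d\<close> over estimating the boxes separately.\<close>

lemma wave_tile_bound:
  assumes T: "T \<in> invariant_operators" and N: "N > 0"
  shows "(\<Sum>j\<in>grid N. cmod (T (wave s k) (hbox (p - (1 / real N) *\<^sub>R j) (1 / real N)))) \<le> tile_const * wave_const * operator_norm T"
proof -
  let ?r = "1 / real N"
  have r: "?r > 0" using N by simp
  define G where "G = (\<lambda>z. of_real (1 / wave_const) * wave s k z)"
  have G: "G \<in> wiener" unfolding G_def by (rule wiener_cmult[OF wave_wiener(1)])
  have "wiener_norm G \<le> cmod (of_real (1 / wave_const)) * wiener_norm (wave s k)"
    unfolding G_def by (rule wiener_norm_cmult_le[OF wave_wiener(1)])
  also have "\<dots> \<le> cmod (of_real (1 / wave_const)) * wave_const" by (intro mult_left_mono wave_wiener(2)) simp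
  also have "\<dots> = 1" using wave_const_pos by (simp add: norm_divide)
  finally have G1: "wiener_norm G \<le> 1" .
  have TG: "cmod (T (wave s k) B) = wave_const * cmod (T G B)" for B
    unfolding G_def operator_cmult[OF T wave_wiener(1)] using wave_const_pos by (simp add: norm_mult norm_divide)
  have "(\<Sum>j\<in>grid N. cmod (T G (hbox (p - ?r *\<^sub>R j) ?r))) \<le> real (card (near (2 * real CARD('n) + 2 * real CARD('n)) (0 :: real^'n))) * tb_norm (T G)"
  proof (rule tb_bounded_sum_le[OF invariantD(1)[OF T G] grid_finite, where p=p])
    fix j x assume j: "j \<in> grid N" and x: "x \<in> hbox (p - ?r *\<^sub>R j) ?r"
    have "norm (x - p) \<le> norm (x - (p - ?r *\<^sub>R j)) + norm (?r *\<^sub>R j)"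
      using norm_triangle_ineq4[of "x - (p - ?r *\<^sub>R j)" "?r *\<^sub>R j"] by simp
    moreover have "norm (x - (p - ?r *\<^sub>R j)) \<le> real CARD('n) * ?r" by (rule hbox_norm[OF x])
    moreover have "real CARD('n) * ?r \<le> real CARD('n)" using N by (simp add: divide_le_eq)
    ultimately show "norm (x - p) \<le> 2 * real CARD('n)" using grid_scaled_norm[OF j N] by linarith
  next
    have "hbox (p - ?r *\<^sub>R j) ?r \<inter> hbox (p - ?r *\<^sub>R j') ?r = {}" if "j \<in> grid N" "j' \<in> grid N" "j \<noteq> j'" for j j'
      using hbox_scaled_disjoint[OF r, of "- j" "- j'" p] that by (simp add: grid_lattice)
    then show "disjoint_family_on (\<lambda>j. hbox (p - ?r *\<^sub>R j) ?r) (grid N)" by (simp add: disjoint_family_on_def)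
  qed simp
  also have "\<dots> = tile_const * tb_norm (T G)" by (simp add: tile_const_def)
  also have "\<dots> \<le> tile_const * operator_norm T"
    by (intro mult_left_mono operator_norm_upper[OF T G G1]) (simp add: tile_const_def)
  finally have "wave_const * (\<Sum>j\<in>grid N. cmod (T G (hbox (p - ?r *\<^sub>R j) ?r))) \<le> wave_const * (tile_const * operator_norm T)"
    using wave_const_pos by (intro mult_left_mono) auto
  then show ?thesis by (simp add: TG sum_distrib_left mult_ac)
qed

text \<open>\<open>bwave N s k\<close> is the integral, over shifts \<open>y\<close> in a box of volume \<open>N\<^sup>-\<^sup>d\<close>, of the sum over the grid of
translates of \<open>wave s k\<close> multiplied by unimodular constants.  By invariance \<open>T\<close> of that sum at a box is a sum of values of \<open>T (wave s k)\<close>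
at disjoint boxes, which \<open>wave_tile_bound\<close> controls for each \<open>y\<close>.\<close>

lemma bwave_bound:
  assumes T: "T \<in> invariant_operators" and N: "N > 0"
  shows "cmod (T (bwave N s k) (hbox x (1 / real N))) \<le> tile_const * wave_const * operator_norm T * (1 / real N) ^ CARD('n)"
proof -
  let ?r = "1 / real N" and ?A = "hbox x (1 / real N)"
  let ?L = "real (card (grid N :: (real^'n) set))"
  have r: "?r > 0" using N by simp
  (* Only y in hbox 0 ?r matters, but the Riemann sums may sample anywhere.  Replacing y by its
     closest point in a ball is Lipschitz and keeps the supports of all H y in one bounded set. *)
  define cl :: "real^'n \<Rightarrow> real^'n" where "cl = closest_point (cball 0 (real CARD('n)))"
  have cl_lip: "dist (cl y) (cl y') \<le> dist y y'" for y y'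
    unfolding cl_def by (rule closest_point_lipschitz) auto
  have cl_n: "norm (cl y) \<le> real CARD('n)" for y
    using closest_point_in_set[of "cball (0::real^'n) (real CARD('n))" y] by (simp add: cl_def)
  have cl_id: "cl y = y" if "y \<in> hbox 0 ?r" for y
  proof -
    have "norm y \<le> real CARD('n) * ?r" using hbox_norm[OF that] by simp
    also have "\<dots> \<le> real CARD('n)" using N by (simp add: divide_le_eq)
    finally show ?thesis unfolding cl_def by (intro closest_point_self) simp
  qed
  have cl_c: "continuous_on UNIV cl" unfolding cl_def by (rule continuous_on_closest_point) auto
  define H where "H y z = cis (2 * pi * (s \<bullet> z)) * (\<Sum>j\<in>grid N. plateau plateau_radius (z - k - cl y - ?r *\<^sub>R j))" for y z :: "real^'n"
  have Hc: "continuous_on UNIV (H y)" for y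
    unfolding H_def by (intro continuous_intros continuous_on_compose2[OF plateau_continuous]) auto
  have Hc': "continuous_on UNIV (\<lambda>y. H y z)" for z
    unfolding H_def by (intro continuous_intros continuous_on_compose2[OF plateau_continuous] cl_c) auto
  have Hb: "cmod (H y z) \<le> ?L" for y z
    using plateau_sum_bound[of plateau_radius "\<lambda>j. z - k - cl y - ?r *\<^sub>R j" "grid N"] by (simp add: H_def norm_mult)
  have jn: "norm (?r *\<^sub>R j) \<le> real CARD('n)" if "j \<in> grid N" for j :: "real^'n" by (rule grid_scaled_norm[OF that N])
  have Hz: "H y z = 0" if "norm (z - k) > bump_radius" for y z
  proof -
    have "plateau plateau_radius (z - k - cl y - ?r *\<^sub>R j) = 0" if j: "j \<in> grid N" for j
    proof (rule plateau_eq_0)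
      have "norm (z - k) \<le> norm (z - k - cl y - ?r *\<^sub>R j) + norm (cl y + ?r *\<^sub>R j)"
        using norm_triangle_ineq[of "z - k - cl y - ?r *\<^sub>R j" "cl y + ?r *\<^sub>R j"] by simp
      moreover have "norm (cl y + ?r *\<^sub>R j) \<le> norm (cl y) + norm (?r *\<^sub>R j)" by (rule norm_triangle_ineq)
      ultimately show "norm (z - k - cl y - ?r *\<^sub>R j) > plateau_radius + 1" using jn[OF j] cl_n[of y] \<open>norm (z - k) > bump_radius\<close> by (simp add: bump_radius_def)
    qed
    then show ?thesis by (simp add: H_def)
  qed
  have Hw: "H y \<in> wiener" for y by (rule wiener_bounded_support(1)[OF Hc Hz Hb])
  have ci: "integrable lborel (indicator (hbox 0 ?r) :: 'n cfun)" by (rule indicator_integrable) simp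
  obtain K where K: "\<And>u e. continuous_on UNIV u \<Longrightarrow> (\<forall>z. norm (z - k) > bump_radius \<longrightarrow> u z = 0) \<Longrightarrow> (\<forall>z. cmod (u z) \<le> e)
     \<Longrightarrow> cmod (T u ?A) \<le> K * (e :: real)"
    using operator_small[OF T hbox_bounded_borel[of x "1 / real N"], where k=k and \<rho>=bump_radius] by blast
  have "cmod (T (bwave N s k) ?A) \<le> (tile_const * wave_const * operator_norm T) * (LINT y|lborel. cmod (indicator (hbox 0 ?r) (y :: real^'n)))"
  proof (rule functional_of_integral_bound[where H=H and L="?L" and \<Lambda>="\<lambda>u. T u ?A" and K=K, OF ci])
    show "cmod (H y z - H y' z) \<le> ?L * min 1 (dist y y')" for y y' z
    proof -
      have "H y z - H y' z = cis (2 * pi * (s \<bullet> z)) * (\<Sum>j\<in>grid N. plateau plateau_radius (z - k - cl y - ?r *\<^sub>R j) - plateau plateau_radius (z - k - cl y' - ?r *\<^sub>R j))"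
        by (simp add: H_def sum_subtractf right_diff_distrib)
      then have "cmod (H y z - H y' z) = cmod (\<Sum>j\<in>grid N. plateau plateau_radius (z - k - cl y - ?r *\<^sub>R j) - plateau plateau_radius (z - k - cl y' - ?r *\<^sub>R j))"
        by (simp add: norm_mult)
      also have "\<dots> \<le> (\<Sum>j\<in>(grid N :: (real^'n) set). min 1 (dist y y'))"
      proof (rule sum_norm_le)
        fix j :: "real^'n"
        have "cmod (plateau plateau_radius (z - k - cl y - ?r *\<^sub>R j) - plateau plateau_radius (z - k - cl y' - ?r *\<^sub>R j)) \<le> min 1 (norm (cl y' - cl y))"
          using plateau_lipschitz[of plateau_radius "z - k - cl y - ?r *\<^sub>R j" "z - k - cl y' - ?r *\<^sub>R j"] by simp
        also have "\<dots> \<le> min 1 (dist y y')" using cl_lip[of y y'] by (simp add: dist_norm norm_minus_commute)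
        finally show "cmod (plateau plateau_radius (z - k - cl y - ?r *\<^sub>R j) - plateau plateau_radius (z - k - cl y' - ?r *\<^sub>R j)) \<le> min 1 (dist y y')" .
      qed
      finally show ?thesis by simp
    qed
    show "integrable lborel (\<lambda>y. indicator (hbox 0 ?r) y * H y z)" for z
    proof (rule Bochner_Integration.integrable_bound)
      show "integrable lborel (\<lambda>y. of_nat (card (grid N :: (real^'n) set)) * indicator (hbox 0 ?r) (y :: real^'n) :: complex)" using ci by simp
      show "(\<lambda>y. indicator (hbox 0 ?r) y * H y z) \<in> borel_measurable lborel"
        using borel_measurable_continuous_onI[OF Hc', of z] by measurable
      show "AE y in lborel. cmod (indicator (hbox 0 ?r) y * H y z) \<le> cmod (of_nat (card (grid N :: (real^'n) set)) * indicator (hbox 0 ?r) y)"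
        using Hb by (intro AE_I2) (auto simp: norm_mult indicator_def)
    qed
    show "bwave N s k = (\<lambda>z. LINT y|lborel. indicator (hbox 0 ?r) y * H y z)"
    proof
      fix z
      have e: "indicator (hbox 0 ?r) y * H y z = cis (2 * pi * (s \<bullet> z)) * (indicator (hbox 0 ?r) y * (\<Sum>j\<in>grid N. plateau plateau_radius (z - k - y - ?r *\<^sub>R j)))" for y
        using cl_id[of y] by (cases "y \<in> hbox 0 ?r") (auto simp: H_def)
      show "bwave N s k z = (LINT y|lborel. indicator (hbox 0 ?r) y * H y z)"
        unfolding e integral_mult_right_zero bwave_def bump_def convolve_def ..
    qed
    show "T (bwave N s k) ?A = T (\<lambda>z. bwave N s k z - (\<Sum>q\<in>I. a q * H q z)) ?A + (\<Sum>q\<in>I. a q * T (H q) ?A)" for I a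
      using operator_diff[OF T bwave_wiener(2)[OF N] wiener_sum[of I "\<lambda>q z. a q * H q z"], of s k ?A] operator_sum[OF T Hw, where c=a and I=I and A="?A"] wiener_cmult[OF Hw]
      by simp
    show "cmod (T (\<lambda>z. bwave N s k z - (\<Sum>q\<in>I. a q * H q z)) ?A) \<le> K * e"
      if "\<And>z. cmod (bwave N s k z - (\<Sum>q\<in>I. a q * H q z)) \<le> e" for I a e
    proof -
      show ?thesis
        by (rule K) (use that Hz bwave_wiener[OF N] in \<open>auto intro!: continuous_intros Hc bwave_wiener(1)[OF N]\<close>)
    qed
    show "cmod (T (H y) ?A) \<le> tile_const * wave_const * operator_norm T" for y
    proof -
      let ?w = "\<lambda>j. cl y + ?r *\<^sub>R j"
      have "H y = (\<lambda>z. \<Sum>j\<in>grid N. cis (2 * pi * (s \<bullet> ?w j)) * translate (?w j) (wave s k) z)"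
      proof
        fix z
        (* A shift of the plane wave is a phase, so H y is a combination of translates of one wave. *)
        have c: "cis (2 * pi * (s \<bullet> z)) = cis (2 * pi * (s \<bullet> ?w j)) * cis (2 * pi * (s \<bullet> (z - ?w j)))" for j
          by (simp add: cis_mult inner_diff_right inner_add_right algebra_simps)
        have a: "z - ?w j - k = z - k - cl y - ?r *\<^sub>R j" for j by (simp add: algebra_simps)
        have "cis (2 * pi * (s \<bullet> ?w j)) * translate (?w j) (wave s k) z = cis (2 * pi * (s \<bullet> z)) * plateau plateau_radius (z - k - cl y - ?r *\<^sub>R j)" for j
          by (simp only: translate_def wave_def a mult.assoc[symmetric] c[symmetric])
        then show "H y z = (\<Sum>j\<in>grid N. cis (2 * pi * (s \<bullet> ?w j)) * translate (?w j) (wave s k) z)"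
          by (simp add: H_def sum_distrib_left)
      qed
      then have "T (H y) ?A = (\<Sum>j\<in>grid N. cis (2 * pi * (s \<bullet> ?w j)) * T (translate (?w j) (wave s k)) ?A)"
        using operator_sum[OF T wiener_translate[OF wave_wiener(1)], where c="\<lambda>j. cis (2 * pi * (s \<bullet> ?w j))" and I="grid N" and A="?A"] by simp
      also have "\<dots> = (\<Sum>j\<in>grid N. cis (2 * pi * (s \<bullet> ?w j)) * T (wave s k) (hbox (x - cl y - ?r *\<^sub>R j) ?r))"
        unfolding invariantD(3)[OF T wave_wiener(1)] hbox_shift by (simp add: diff_diff_eq)
      finally have "cmod (T (H y) ?A) \<le> (\<Sum>j\<in>grid N. cmod (T (wave s k) (hbox (x - cl y - ?r *\<^sub>R j) ?r)))"
        using sum_norm_le[of "grid N" "\<lambda>j. cis (2 * pi * (s \<bullet> ?w j)) * T (wave s k) (hbox (x - cl y - ?r *\<^sub>R j) ?r)"] by (simp add: norm_mult)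
      also have "\<dots> \<le> tile_const * wave_const * operator_norm T" by (rule wave_tile_bound[OF T N])
      finally show ?thesis .
    qed
  qed auto
  also have "(LINT y|lborel. cmod (indicator (hbox 0 ?r) (y :: real^'n))) = ?r ^ CARD('n)"
  proof -
    have "(\<lambda>y. cmod (indicator (hbox 0 ?r) (y :: real^'n))) = indicator (hbox 0 ?r)" by (auto simp: indicator_def fun_eq_iff)
    then show ?thesis using lebesgue_hbox[OF r, of "0 :: real^'n"] by simp
  qed
  finally show ?thesis .
qed

text \<open>On the support of the piece the bump is one, so Fourier inversion represents the piece as an integral of
the functions \<open>bwave N s k\<close> with weight the transform of the piece.\<close>

lemma piece_box_bound:
  assumes T: "T \<in> invariant_operators" and N: "N > 0" and f: "f \<in> S0 \<psi>" and k: "k \<in> int_lattice"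
  shows "cmod (T (piece f k) (hbox x (1 / real N))) \<le> tile_const * wave_const * operator_norm T * (1 / real N) ^ CARD('n) * FL1_norm (piece f k)"
proof -
  let ?A = "hbox x (1 / real N)"
  note p = specL1D[OF S0D(2)[OF f k]]
  have pc: "continuous_on UNIV (piece f k)" by (rule piece_continuous[OF S0D(1)[OF f]])
  obtain B where B: "\<And>x. cmod (piece f k x) \<le> B" using piece_bound[OF S0D(1)[OF f]] by metis
  define Z where "Z = norm k + bump_radius"
  have Z: "0 \<le> Z" using radii_nonneg R_nonneg by (simp add: Z_def)
  have pw: "piece f k \<in> wiener"
    by (rule wiener_bounded_support(1)[OF pc _ B]) (rule piece_support)
  obtain K where K: "\<And>u e. continuous_on UNIV u \<Longrightarrow> (\<forall>z. norm (z - k) > bump_radius \<longrightarrow> u z = 0) \<Longrightarrow> (\<forall>z. cmod (u z) \<le> e)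
     \<Longrightarrow> cmod (T u ?A) \<le> K * (e :: real)"
    using operator_small[OF T hbox_bounded_borel[of x "1 / real N"], where k=k and \<rho>=bump_radius] by blast
  have "cmod (T (piece f k) ?A) \<le> (tile_const * wave_const * operator_norm T * (1 / real N) ^ CARD('n)) * (LINT s|lborel. cmod (fourier (piece f k) s))"
  proof (rule functional_of_integral_bound[where H="\<lambda>s. bwave N s k" and L="2 + 2 * pi * Z" and \<Lambda>="\<lambda>u. T u ?A" and K=K, OF p(2)])
    show "cmod (bwave N s k z - bwave N s' k z) \<le> (2 + 2 * pi * Z) * min 1 (dist s s')" for s s' z
    proof (cases "norm (z - k) \<le> bump_radius")
      case True
      have z: "norm z \<le> Z" using norm_triangle_ineq[of "z - k" k] True by (simp add: Z_def)
      have 1: "cmod (cis (2 * pi * (s \<bullet> z)) - cis (2 * pi * (s' \<bullet> z))) \<le> 2"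
        using norm_triangle_ineq4[of "cis (2 * pi * (s \<bullet> z))" "cis (2 * pi * (s' \<bullet> z))"] by simp
      have "cmod (cis (2 * pi * (s \<bullet> z)) - cis (2 * pi * (s' \<bullet> z))) \<le> \<bar>2 * pi * (s \<bullet> z) - 2 * pi * (s' \<bullet> z)\<bar>"
        by (rule cis_lipschitz)
      also have "\<dots> = 2 * pi * \<bar>(s - s') \<bullet> z\<bar>" by (simp add: inner_diff_left right_diff_distrib[symmetric] abs_mult)
      also have "\<dots> \<le> 2 * pi * (norm (s - s') * norm z)" by (intro mult_left_mono Cauchy_Schwarz_ineq2) auto
      also have "\<dots> \<le> 2 * pi * (norm (s - s') * Z)" by (intro mult_left_mono z) auto
      finally have 2: "cmod (cis (2 * pi * (s \<bullet> z)) - cis (2 * pi * (s' \<bullet> z))) \<le> 2 * pi * Z * dist s s'" by (simp add: dist_norm mult_ac)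
      have 3: "cmod (cis (2 * pi * (s \<bullet> z)) - cis (2 * pi * (s' \<bullet> z))) \<le> (2 + 2 * pi * Z) * min 1 (dist s s')"
      proof (cases "dist s s' \<le> 1")
        case True
        have "2 * pi * Z * dist s s' \<le> (2 + 2 * pi * Z) * dist s s'" by (intro mult_right_mono) auto
        then show ?thesis using 2 True by (simp add: min_def)
      next
        case False
        have "0 \<le> 2 * pi * Z" using Z by simp
        then show ?thesis using 1 False by (simp add: min_def)
      qed
      have "cmod (bwave N s k z - bwave N s' k z) = cmod (cis (2 * pi * (s \<bullet> z)) - cis (2 * pi * (s' \<bullet> z))) * cmod (bump N (z - k))"
        by (simp add: bwave_def left_diff_distrib[symmetric] norm_mult)
      also have "\<dots> \<le> cmod (cis (2 * pi * (s \<bullet> z)) - cis (2 * pi * (s' \<bullet> z)))"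
        by (rule mult_left_le[OF bump_facts(4)[OF N]]) simp
      finally show ?thesis using 3 by linarith
    next
      case False
      then show ?thesis using bwave_wiener(3)[OF N, of z k] Z by simp
    qed
    show "0 \<le> 2 + 2 * pi * Z" using Z by (simp add: add_nonneg_nonneg)
    show "integrable lborel (\<lambda>s. fourier (piece f k) s * bwave N s k z)" for z
    proof -
      have "integrable lborel (\<lambda>s. fourier (piece f k) s * cis (2 * pi * (s \<bullet> z)) * bump N (z - k))"
        by (intro integrable_mult_left integrable_cis p(2)) auto
      then show ?thesis by (simp add: bwave_def mult.assoc)
    qed
    show "piece f k = (\<lambda>z. LINT s|lborel. fourier (piece f k) s * bwave N s k z)"
    proof
      fix z
      have "(LINT s|lborel. fourier (piece f k) s * bwave N s k z) = (LINT s|lborel. fourier (piece f k) s * cis (2 * pi * (s \<bullet> z)) * bump N (z - k))"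
        by (simp only: bwave_def mult.assoc)
      also have "\<dots> = piece f k z * bump N (z - k)"
        by (simp only: integral_mult_left_zero fourier_inversion[OF p(1) pc B p(2), symmetric])
      also have "\<dots> = piece f k z"
        using bump_facts(2)[OF N, of "z - k"] piece_support[of z k f] by (cases "norm (z - k) \<le> R") auto
      finally show "piece f k z = (LINT s|lborel. fourier (piece f k) s * bwave N s k z)" ..
    qed
    show "T (piece f k) ?A = T (\<lambda>z. piece f k z - (\<Sum>q\<in>I. a q * bwave N q k z)) ?A + (\<Sum>q\<in>I. a q * T (bwave N q k) ?A)" for I a
      using operator_diff[OF T pw wiener_sum[of I "\<lambda>q z. a q * bwave N q k z"], of ?A] operator_sum[OF T bwave_wiener(2)[OF N], where c=a and I=I and A="?A"] wiener_cmult[OF bwave_wiener(2)[OF N]]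
      by simp
    show "cmod (T (\<lambda>z. piece f k z - (\<Sum>q\<in>I. a q * bwave N q k z)) ?A) \<le> K * e"
      if "\<And>z. cmod (piece f k z - (\<Sum>q\<in>I. a q * bwave N q k z)) \<le> e" for I a e
    proof -
      have z: "piece f k z - (\<Sum>q\<in>I. a q * bwave N q k z) = 0" if "norm (z - k) > bump_radius" for z
      proof -
        have "norm (z - k) > R" using that radii_nonneg by linarith
        then show ?thesis using bwave_wiener(3)[OF N that] by (simp add: piece_support)
      qed
      show ?thesis
        by (rule K) (use that z in \<open>auto intro!: continuous_intros pc bwave_wiener(1)[OF N]\<close>)
    qed
    show "cmod (T (bwave N s k) ?A) \<le> tile_const * wave_const * operator_norm T * (1 / real N) ^ CARD('n)" for s
      by (rule bwave_bound[OF T N])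
  qed
  then show ?thesis by (simp only: FL1_norm_def)
qed

definition box_const :: real where "box_const = tile_const * wave_const"

lemma box_const_nonneg: "0 \<le> box_const" by (simp add: box_const_def tile_const_def wave_const_def)

text \<open>The estimate for single pieces is summed over finitely many lattice points.  The rest is small in the Wiener norm, where
\<open>T\<close> is bounded, though with a constant that depends on the box; it disappears in the limit.\<close>

lemma S0_box_bound:
  assumes T: "T \<in> invariant_operators" and N: "N > 0" and f: "f \<in> S0 \<psi>"
  shows "cmod (T f (hbox x (1 / real N))) \<le> box_const * operator_norm T * (1 / real N) ^ CARD('n) * S0_norm \<psi> f"
proof -
  let ?A = "hbox x (1 / real N)"
  let ?C = "box_const * operator_norm T * (1 / real N) ^ CARD('n)"
  have C: "0 \<le> ?C" using box_const_nonneg operator_norm_nonneg[OF T] by simp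
  have fw: "f \<in> wiener" by (rule S0_wiener(1)[OF f])
  obtain K where K: "K \<ge> 0" "\<And>f. f \<in> wiener \<Longrightarrow> cmod (T f ?A) \<le> K * wiener_norm f" 
    using operator_value_bound[OF T hbox_bounded_borel[of x "1 / real N"]] by blast
  let ?N = "\<lambda>k. FL1_norm (piece f k)"
  note Ns = S0D(3)[OF f]
  have pw: "piece f k \<in> wiener" for k
  proof -
    obtain B where B: "\<And>x. cmod (piece f k x) \<le> B" using piece_bound[OF S0D(1)[OF f]] by metis
    show ?thesis by (rule wiener_bounded_support(1)[OF piece_continuous[OF S0D(1)[OF f]] _ B]) (rule piece_support)
  qed
  have main: "cmod (T f ?A) \<le> ?C * S0_norm \<psi> f + d" if d: "d > 0" for d
  proof -
    define e where "e = d / (K * wiener_const + 1)"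
    have Kc: "0 \<le> K * wiener_const" using K(1) by (simp add: wiener_const_def)
    then have e: "e > 0" using d by (simp add: e_def)
    obtain F where F: "finite F" "F \<subseteq> int_lattice" "dist (sum ?N F) (infsum ?N int_lattice) \<le> e"
      using infsum_finite_approximation[OF Ns e] by auto
    (* The majorant of the pieces outside F. *)
    define a where "a k = (if k \<in> F then 0 else ?N k)" for k
    have hF: "((\<lambda>k. if k \<in> F then ?N k else 0) has_sum (sum ?N F)) int_lattice"
      by (rule has_sum_finite_neutralI[of F]) (use F in auto)
    have "((\<lambda>k. ?N k + (- (if k \<in> F then ?N k else 0))) has_sum (infsum ?N int_lattice + (- sum ?N F))) int_lattice"
      using hF Ns by (intro has_sum_add has_sum_infsum) (auto simp: has_sum_uminus)
    moreover have "(\<lambda>k. ?N k + (- (if k \<in> F then ?N k else 0))) = a" by (auto simp: a_def fun_eq_iff)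
    ultimately have ha: "(a has_sum (infsum ?N int_lattice - sum ?N F)) int_lattice" by simp
    let ?g = "\<lambda>x. f x - (\<Sum>k\<in>F. 1 * piece f k x)"
    have gle: "cmod (?g y) \<le> (\<Sum>k\<in>near R y. a k)" for y
    proof -
      have "(\<Sum>k\<in>F. piece f k y) = (\<Sum>k\<in>F \<inter> near R y. piece f k y)"
        using F by (intro sum.mono_neutral_right) (auto simp: near_def norm_minus_commute intro!: piece_support)
      also have "\<dots> = (\<Sum>k\<in>near R y. if k \<in> F then piece f k y else 0)"
        by (subst sum.inter_restrict[symmetric]) (auto simp: Int_commute)
      finally have "?g y = (\<Sum>k\<in>near R y. piece f k y - (if k \<in> F then piece f k y else 0))"
        using piece_sum[of f y] by (simp add: sum_subtractf)
      also have "cmod \<dots> \<le> (\<Sum>k\<in>near R y. a k)"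
      proof (rule sum_norm_le)
        fix k assume k: "k \<in> near R y"
        then show "cmod (piece f k y - (if k \<in> F then piece f k y else 0)) \<le> a k"
          using piece_sup[OF f, of k y] by (auto simp: a_def near_def)
      qed
      finally show ?thesis .
    qed
    have sw: "(\<lambda>x. \<Sum>k\<in>F. 1 * piece f k x) \<in> wiener" by (intro wiener_sum wiener_cmult pw)
    have gw: "?g \<in> wiener" by (rule wiener_diff[OF fw sw])
    have "wiener_norm ?g \<le> wiener_const * infsum a int_lattice"
      unfolding wiener_const_def
      by (rule wienerI_near(2)[OF wiener_continuous[OF gw] has_sum_imp_summable[OF ha] _ gle]) (simp add: a_def FL1_norm_nonneg)
    also have "infsum a int_lattice = infsum ?N int_lattice - sum ?N F" by (rule infsumI[OF ha])
    also have "wiener_const * (infsum ?N int_lattice - sum ?N F) \<le> wiener_const * e"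
      using F(3) unfolding dist_real_def by (intro mult_left_mono) (auto simp: wiener_const_def)
    finally have ge: "wiener_norm ?g \<le> wiener_const * e" .
    have "T f ?A = T ?g ?A + (\<Sum>k\<in>F. 1 * T (piece f k) ?A)"
      using operator_diff[OF T fw sw, of ?A] operator_sum[OF T pw, where c="\<lambda>_. 1" and I=F and A="?A"] by simp
    then have "cmod (T f ?A) \<le> cmod (T ?g ?A) + cmod (\<Sum>k\<in>F. 1 * T (piece f k) ?A)" by (simp only: norm_triangle_ineq)
    also have "cmod (T ?g ?A) \<le> K * (wiener_const * e)" by (rule order_trans[OF K(2)[OF gw] mult_left_mono[OF ge K(1)]])
    also have "K * (wiener_const * e) \<le> d"
    proof -
      have "(K * wiener_const) * e \<le> (K * wiener_const + 1) * e" using e by (intro mult_right_mono) auto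
      also have "\<dots> = d" using Kc by (simp add: e_def)
      finally show ?thesis by (simp only: mult.assoc)
    qed
    also have "cmod (\<Sum>k\<in>F. 1 * T (piece f k) ?A) \<le> (\<Sum>k\<in>F. ?C * ?N k)"
      by (rule sum_norm_le) (use piece_box_bound[OF T N f] F in \<open>auto simp: box_const_def\<close>)
    also have "\<dots> = ?C * sum ?N F" by (simp add: sum_distrib_left)
    also have "\<dots> \<le> ?C * S0_norm \<psi> f"
      unfolding S0_norm_eq by (intro mult_left_mono C finite_sum_le_infsum Ns F) (auto simp: FL1_norm_nonneg)
    finally show ?thesis by simp
  qed
  show ?thesis by (rule field_le_epsilon) (rule main)
qed

end

section \<open>Dyadic cubes determine a measure\<close>

definition dyadic :: "nat \<Rightarrow> real^'n::finite \<Rightarrow> (real^'n) set" where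
  "dyadic m j = hbox ((1 / 2 ^ m) *\<^sub>R j) (1 / 2 ^ m)"

lemma mem_dyadic:
  "z \<in> dyadic m j \<longleftrightarrow> (\<forall>i. j $ i \<le> 2 ^ m * z $ i \<and> 2 ^ m * z $ i < j $ i + 1)"
  by (auto simp: dyadic_def hbox_def field_simps)

text \<open>Two dyadic cubes are nested or disjoint.  In the integer coordinates \<open>a\<close> and \<open>b\<close> of the corners this
is the fact that strict inequalities between integers can be sharpened by one.\<close>

lemma dyadic_nested:
  fixes j j' :: "real^'n::finite"
  assumes ml: "m \<le> l" and j: "j \<in> int_lattice" "j' \<in> int_lattice" and z: "z \<in> dyadic m j" "z \<in> dyadic l j'"
  shows "dyadic l j' \<subseteq> dyadic m j"
proof
  fix w assume w: "w \<in> dyadic l j'"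
  have "j $ i \<le> 2 ^ m * w $ i \<and> 2 ^ m * w $ i < j $ i + 1" for i
  proof -
    have "j $ i \<in> \<int>" "j' $ i \<in> \<int>" using j by (auto simp: int_lattice_def)
    then obtain a b where ab: "j $ i = of_int a" "j' $ i = of_int b" by (auto simp: Ints_def)
    define p :: int where "p = 2 ^ (l - m)"
    have p: "p > 0" by (simp add: p_def)
    have lm: "(2::real) ^ l = of_int p * 2 ^ m" using ml by (simp add: p_def power_add[symmetric])
    have zm: "of_int a \<le> 2 ^ m * z $ i" "2 ^ m * z $ i < of_int a + 1" using z(1)[unfolded mem_dyadic, rule_format, of i] ab by auto
    have zl: "of_int b \<le> of_int p * (2 ^ m * z $ i)" "of_int p * (2 ^ m * z $ i) < of_int b + 1"
      using z(2)[unfolded mem_dyadic, rule_format, of i] ab by (auto simp: lm mult.assoc)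
    have wl: "of_int b \<le> of_int p * (2 ^ m * w $ i)" "of_int p * (2 ^ m * w $ i) < of_int b + 1"
      using w[unfolded mem_dyadic, rule_format, of i] ab by (auto simp: lm mult.assoc)
    have pr: "(of_int p :: real) > 0" using p by simp
    have "real_of_int (p * a) \<le> of_int p * (2 ^ m * z $ i)" using zm(1) pr by simp
    then have "real_of_int (p * a) < of_int (b + 1)" using zl(2) by simp
    then have "p * a < b + 1" by (simp only: of_int_less_iff)
    then have lo: "real_of_int (p * a) \<le> of_int b" by (simp only: of_int_le_iff)
    have "of_int p * (2 ^ m * z $ i) < real_of_int (p * (a + 1))" using zm(2) pr by simp
    then have "real_of_int b < of_int (p * (a + 1))" using zl(1) by linarith
    then have "b < p * (a + 1)" by (simp only: of_int_less_iff)
    then have hi: "real_of_int (b + 1) \<le> of_int (p * (a + 1))" by (simp only: of_int_le_iff)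
    have "of_int p * of_int a \<le> of_int p * (2 ^ m * w $ i)" using lo wl(1) by simp
    then have 1: "of_int a \<le> 2 ^ m * w $ i" using pr by simp
    have "of_int p * (2 ^ m * w $ i) < of_int p * (of_int a + 1)" using hi wl(2) by simp
    then have "2 ^ m * w $ i < of_int a + 1" using pr by simp
    with 1 show ?thesis by (simp add: ab)
  qed
  then show "w \<in> dyadic m j" by (simp add: mem_dyadic)
qed

definition dyadic_cubes :: "(real^'n::finite) set set" where
  "dyadic_cubes = {dyadic m j | m j. j \<in> int_lattice}"

lemma countable_lattice: "countable (int_lattice :: (real^'n::finite) set)"
proof -
  have "int_lattice \<subseteq> (\<Union>n::nat. near (real n) (0 :: real^'n))"
    by (auto simp: near_def intro: real_arch_simple)
  then show ?thesis by (rule countable_subset) (intro countable_UN countable_finite finite_near countableI_type)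
qed

lemma dyadic_bounded_borel [simp]: "dyadic m j \<in> bounded_borel"
  by (simp add: dyadic_def)

lemma cube_dyadic: "cube k = dyadic 0 k"
  by (auto simp: mem_dyadic mem_cube)

lemma Int_stable_dyadics: "Int_stable (insert {} dyadic_cubes :: (real^'n::finite) set set)"
proof (rule Int_stableI)
  fix a b :: "(real^'n) set" assume "a \<in> insert {} dyadic_cubes" "b \<in> insert {} dyadic_cubes"
  then consider "a \<inter> b = {}" | m j l j' z where "a = dyadic m j" "b = dyadic l j'" "j \<in> int_lattice" "j' \<in> int_lattice" "z \<in> dyadic m j" "z \<in> dyadic l j'"
    by (auto simp: dyadic_cubes_def) blast
  then show "a \<inter> b \<in> insert {} dyadic_cubes"
  proof cases
    case 2
    show ?thesis
    proof (cases "m \<le> l")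
      case True
      from dyadic_nested[OF True 2(3-6)] 2 show ?thesis by (auto simp: dyadic_cubes_def Int_absorb1)
    next
      case False
      then have "l \<le> m" by simp
      from dyadic_nested[OF this 2(4,3,6,5)] 2 show ?thesis by (auto simp: dyadic_cubes_def Int_absorb2)
    qed
  qed simp
qed

lemma dyadics_generate: "sets borel = sigma_sets UNIV (insert {} dyadic_cubes :: (real^'n::finite) set set)"
proof
  let ?S = "sigma_sets UNIV (insert {} dyadic_cubes :: (real^'n) set set)"
  have "insert {} dyadic_cubes \<subseteq> (sets borel :: (real^'n) set set)"
    using bounded_borelD(1)[OF dyadic_bounded_borel] by (auto simp: dyadic_cubes_def)
  then have "sigma_sets (space borel) (insert {} dyadic_cubes) \<subseteq> (sets borel :: (real^'n) set set)"
    by (rule sets.sigma_sets_subset)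
  then show "?S \<subseteq> sets borel" by (simp only: space_borel)
  have cd: "countable (dyadic_cubes :: (real^'n) set set)"
  proof -
    have eq: "dyadic_cubes = (\<lambda>(m, j). dyadic m j) ` (UNIV \<times> (int_lattice :: (real^'n) set))" by (auto simp: dyadic_cubes_def)
    show ?thesis unfolding eq by (intro countable_image countable_SIGMA countable_lattice countableI_type)
  qed
  have op: "U \<in> ?S" if U: "open U" for U
  proof -
    have "U = \<Union>{D \<in> dyadic_cubes. D \<subseteq> U}"
    proof (intro equalityI subsetI)
      fix x assume x: "x \<in> U"
      then obtain e where e: "e > 0" "ball x e \<subseteq> U" using U openE by blast
      obtain m where m: "real CARD('n) / 2 ^ m < e"
      proof -
        have "(\<lambda>m. real CARD('n) * (1 / 2) ^ m) \<longlonglongrightarrow> real CARD('n) * 0"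
          by (intro tendsto_mult tendsto_const LIMSEQ_power_zero) simp
        then have "\<forall>\<^sub>F m in sequentially. real CARD('n) * (1 / 2) ^ m < e"
          by (intro order_tendstoD(2)) (use e in auto)
        then obtain m where "real CARD('n) * (1 / 2) ^ m < e" using eventually_happens' sequentially_bot by blast
        then show ?thesis using that[of m] by (simp add: power_divide)
      qed
      define j where "j = vfloor ((2 ^ m) *\<^sub>R x)"
      have xd: "x \<in> dyadic m j"
        using mem_cube_vfloor[of "(2 ^ m) *\<^sub>R x"] by (simp add: mem_dyadic mem_cube j_def)
      have "dyadic m j \<subseteq> ball x e"
      proof
        fix w assume w: "w \<in> dyadic m j"
        have "(2 ^ m) *\<^sub>R w \<in> cube j" "(2 ^ m) *\<^sub>R x \<in> cube j" using w xd by (auto simp: mem_dyadic mem_cube)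
        have "norm (w - x) \<le> (\<Sum>i\<in>UNIV. \<bar>(w - x) $ i\<bar>)" by (rule norm_le_l1_cart)
        also have "\<dots> \<le> (\<Sum>i\<in>(UNIV :: 'n set). 1 / 2 ^ m)"
        proof (rule sum_mono)
          fix i
          have "j $ i \<le> 2 ^ m * w $ i" "2 ^ m * w $ i < j $ i + 1" "j $ i \<le> 2 ^ m * x $ i" "2 ^ m * x $ i < j $ i + 1"
            using w xd by (auto simp: mem_dyadic)
          then have "\<bar>2 ^ m * w $ i - 2 ^ m * x $ i\<bar> \<le> 1" by linarith
          then have "2 ^ m * \<bar>w $ i - x $ i\<bar> \<le> 1" unfolding right_diff_distrib[symmetric] abs_mult by simp
          then show "\<bar>(w - x) $ i\<bar> \<le> 1 / 2 ^ m" by (simp add: field_simps)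
        qed
        also have "\<dots> < e" using m by simp
        finally show "w \<in> ball x e" by (simp add: dist_norm norm_minus_commute)
      qed
      then show "x \<in> \<Union>{D \<in> dyadic_cubes. D \<subseteq> U}" 
      proof -
        have "dyadic m j \<in> dyadic_cubes" unfolding dyadic_cubes_def j_def using vfloor_lattice by blast
        then show ?thesis using xd e(2) \<open>dyadic m j \<subseteq> ball x e\<close> by blast
      qed
    qed auto
    moreover have "\<Union>{D \<in> dyadic_cubes. D \<subseteq> U} \<in> ?S"
      by (rule sigma_sets_UNION) (auto intro: countable_subset[OF _ cd] sigma_sets.Basic)
    ultimately show ?thesis by simp
  qed
  have "sigma_sets UNIV (Collect open) \<subseteq> ?S" by (rule sigma_sets_mono) (use op in auto)
  then show "sets borel \<subseteq> ?S" by (simp add: borel_def)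
qed

text \<open>Dyadic cubes are closed under intersection up to the empty set and generate the Borel sets, so the
\<open>\<pi>\<close>-\<open>\<lambda>\<close> theorem applies.  Only bounded sets have a value, so it is applied to the sets \<open>B \<inter> cube k\<close>, and a bounded
set is a finite union of such parts.\<close>

lemma radon_dyadic_zero:
  fixes \<nu> :: "'n::finite cmeas"
  assumes m: "radon_measure \<nu>" and z: "\<And>n j. j \<in> int_lattice \<Longrightarrow> \<nu> (dyadic n j) = 0"
  shows "\<nu> A = 0"
proof (cases "A \<in> bounded_borel")
  case False
  then show ?thesis by (rule radon_zero[OF m])
next
  case True
  have cb: "cube k \<in> sets borel" for k :: "real^'n" by (rule bounded_borelD(1)) simp
  have all: "B \<in> sets borel \<Longrightarrow> \<nu> (B \<inter> cube k) = 0" if k: "k \<in> int_lattice" for k B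
  proof -
    have g: "insert {} dyadic_cubes \<subseteq> Pow (UNIV :: (real^'n) set)" by simp
    assume "B \<in> sets borel"
    then have "B \<in> sigma_sets UNIV (insert {} dyadic_cubes)" by (simp only: dyadics_generate)
    with Int_stable_dyadics g show "\<nu> (B \<inter> cube k) = 0"
  proof (induction rule: sigma_sets_induct_disjoint)
    case (basic B)
    show ?case
    proof (cases "B \<inter> cube k = {}")
      case True
      then show ?thesis by (simp add: radon_empty[OF m])
    next
      case False
      then obtain x where x: "x \<in> B" "x \<in> cube k" by blast
      with basic obtain n j where j: "B = dyadic n j" "j \<in> int_lattice" by (auto simp: dyadic_cubes_def)
      have "dyadic n j \<subseteq> dyadic 0 k" 
        by (rule dyadic_nested[of 0 n k j x]) (use x j k in \<open>auto simp: cube_dyadic\<close>)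
      then have "B \<inter> cube k = dyadic n j" using j by (auto simp: cube_dyadic)
      then show ?thesis using z[OF j(2)] by simp
    qed
  next
    case empty
    show ?case by (simp add: radon_empty[OF m])
  next
    case (compl B)
    have B: "B \<in> sets borel" using compl(1) by (simp only: dyadics_generate)
    have "cube k = (UNIV - B) \<inter> cube k \<union> B \<inter> cube k" by blast
    then have "\<nu> (cube k) = \<nu> ((UNIV - B) \<inter> cube k) + \<nu> (B \<inter> cube k)"
      using radon_Un[OF m, of "(UNIV - B) \<inter> cube k" "B \<inter> cube k"] B cb
      by (auto simp: Int_commute[of _ "cube k"] bounded_borel_Int)
    then show ?case using compl z[OF k, of 0] by (simp add: cube_dyadic)
  next
    case (union B)
    have B: "B i \<in> sets borel" for i using union(2) by (auto simp: dyadics_generate)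
    have "(\<lambda>i. \<nu> (B i \<inter> cube k)) sums \<nu> (\<Union>i. B i \<inter> cube k)"
    proof (rule radon_sums[OF m])
      show "B i \<inter> cube k \<in> bounded_borel" for i using B by (auto simp: Int_commute[of _ "cube k"])
      show "disjoint_family (\<lambda>i. B i \<inter> cube k)" using union(1) by (auto simp: disjoint_family_on_def)
      show "bounded (\<Union>i. B i \<inter> cube k)"
        by (rule bounded_subset[OF bounded_borelD(2)[OF cube_bounded_borel[of k]]]) auto
    qed
    then have "(\<lambda>i. 0) sums \<nu> (\<Union>i. B i \<inter> cube k)" using union(3) by simp
    then have "\<nu> (\<Union>i. B i \<inter> cube k) = 0" by (rule sums_unique2) (rule sums_zero)
    then show ?case by simp
  qed
  qed
  obtain \<rho> where rho: "\<And>x. x \<in> A \<Longrightarrow> norm x \<le> \<rho>" using bounded_borel_radius[OF True] by blast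
  let ?K = "near (\<rho> + real CARD('n)) (0 :: real^'n)"
  have "A = (\<Union>k\<in>?K. A \<inter> cube k)"
  proof -
    have "vfloor x \<in> ?K" if x: "x \<in> A" for x
      using vfloor_near'[of x 0 \<rho>] rho[OF x] by (simp add: add.commute)
    then show ?thesis using mem_cube_vfloor by blast
  qed
  moreover have "\<nu> (\<Union>k\<in>?K. A \<inter> cube k) = (\<Sum>k\<in>?K. \<nu> (A \<inter> cube k))"
  proof (rule radon_finite_UN[OF m finite_near])
    show "disjoint_family_on (\<lambda>k. A \<inter> cube k) ?K"
      by (auto simp: disjoint_family_on_def near_def dest: cube_unique)
  qed (use True cb in auto)
  moreover have "(\<Sum>k\<in>?K. \<nu> (A \<inter> cube k)) = 0"
    by (rule sum.neutral) (use all bounded_borelD(1)[OF True] in \<open>auto simp: near_def\<close>)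
  ultimately show ?thesis by simp
qed

section \<open>Measures with a continuous density\<close>

lemma continuous_set_integrable:
  fixes u :: "'n::finite cfun"
  assumes c: "continuous_on UNIV u" and A: "A \<in> bounded_borel"
  shows "set_integrable lborel A u"
proof -
  obtain \<rho> where rho: "\<And>x. x \<in> A \<Longrightarrow> norm x \<le> \<rho>" using bounded_borel_radius[OF A] by blast
  have "integrable lborel (\<lambda>x. indicator (cball 0 \<rho>) x *\<^sub>R u x)"
    by (rule borel_integrable_compact) (auto intro: continuous_on_subset[OF c])
  then have "set_integrable lborel (cball 0 \<rho>) u" by (simp add: set_integrable_def)
  then show ?thesis
    by (rule set_integrable_subset) (use bounded_borelD(1)[OF A] rho in auto)
qed

lemma density_radon:
  fixes u :: "'n::finite cfun"
  assumes c: "continuous_on UNIV u" and m: "radon_measure \<mu>"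
  shows "radon_measure (\<lambda>A. if A \<in> bounded_borel then \<mu> A - (LINT x:A|lborel. u x) else 0)"
  unfolding radon_measure_def
proof (intro conjI allI impI, simp, elim conjE)
  fix A :: "nat \<Rightarrow> (real^'n) set"
  assume A: "range A \<subseteq> bounded_borel" and dis: "disjoint_family A" and bd: "bounded (\<Union>i. A i)"
  have Ab: "A i \<in> bounded_borel" for i using A by auto
  have U: "(\<Union>i. A i) \<in> bounded_borel" using Ab bd by (auto simp: bounded_borel_def)
  have s1: "(\<lambda>i. \<mu> (A i)) sums \<mu> (\<Union>i. A i)" by (rule radon_sums[OF m Ab dis bd])
  have ui: "set_integrable lborel (\<Union>i. A i) u" by (rule continuous_set_integrable[OF c U])
  have s2: "(\<lambda>i. LINT x:A i|lborel. u x) sums (LINT x:(\<Union>i. A i)|lborel. u x)"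
  proof -
    have "(\<lambda>n. LINT x:(\<Union>i<n. A i)|lborel. u x) \<longlonglongrightarrow> (LINT x:(\<Union>n. \<Union>i<n. A i)|lborel. u x)"
    proof (rule set_integral_cont_up)
      show "(\<Union>i<n. A i) \<in> sets lborel" for n using Ab bounded_borelD(1) by auto
      show "incseq (\<lambda>n. \<Union>i<n. A i)" by (auto simp: incseq_def intro: less_le_trans)
      have "(\<Union>n. \<Union>i<n. A i) = (\<Union>i. A i)" by (auto intro: lessI)
      then show "set_integrable lborel (\<Union>n. \<Union>i<n. A i) u" using ui by simp
    qed
    moreover have "(\<Union>n. \<Union>i<n. A i) = (\<Union>i. A i)" by (auto intro: lessI)
    moreover have "(LINT x:(\<Union>i<n. A i)|lborel. u x) = (\<Sum>i<n. LINT x:A i|lborel. u x)" for n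
    proof (rule set_integral_finite_Union)
      show "disjoint_family_on A {..<n}" using dis by (auto simp: disjoint_family_on_def)
      show "A i \<in> sets lborel" for i using Ab[of i] bounded_borelD(1) by simp
      show "set_integrable lborel (A i) u" for i by (rule continuous_set_integrable[OF c Ab])
    qed auto
    ultimately show ?thesis by (simp add: sums_def)
  qed
  show "(\<lambda>i. if A i \<in> bounded_borel then \<mu> (A i) - (LINT x:A i|lborel. u x) else 0) sums
     (if (\<Union>i. A i) \<in> bounded_borel then \<mu> (\<Union>i. A i) - (LINT x:(\<Union>i. A i)|lborel. u x) else 0)"
    using sums_diff[OF s1 s2] Ab U by simp
qed

lemma set_integral_hbox_close:
  fixes u :: "'n::finite cfun"
  assumes i: "set_integrable lborel (hbox x r) u" and r: "r > 0" and le: "\<And>z. z \<in> hbox x r \<Longrightarrow> cmod (u z - c) \<le> e"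
  shows "cmod ((LINT z:hbox x r|lborel. u z) - of_real (r ^ CARD('n)) * c) \<le> r ^ CARD('n) * e"
proof -
  have ci: "set_integrable lborel (hbox x r) (\<lambda>z. c)"
    by (rule continuous_set_integrable) (auto intro: continuous_intros)
  have cI: "(LINT z:hbox x r|lborel. c) = of_real (r ^ CARD('n)) * c"
    using lebesgue_hbox[OF r, of x] by (simp add: set_lebesgue_integral_def scaleR_conv_of_real)
  have di: "set_integrable lborel (hbox x r) (\<lambda>z. u z - c)" by (rule set_integral_diff(1)[OF i ci])
  have "(LINT z:hbox x r|lborel. u z) - of_real (r ^ CARD('n)) * c = (LINT z:hbox x r|lborel. u z - c)"
    unfolding cI[symmetric] by (rule set_integral_diff(2)[OF i ci, symmetric])
  also have "cmod \<dots> \<le> (LINT z:hbox x r|lborel. cmod (u z - c))" by (rule set_integral_norm_bound[OF di])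
  also have "\<dots> \<le> (LINT z:hbox x r|lborel. e)"
  proof (rule set_integral_mono[OF set_integrable_norm[OF di] _ le])
    show "set_integrable lborel (hbox x r) (\<lambda>z. e)"
      unfolding set_integrable_def by (intro integrable_scaleR_left integrable_real_indicator) (auto simp: emeasure_hbox r)
  qed
  also have "\<dots> = r ^ CARD('n) * e" using lebesgue_hbox[OF r, of x] by (simp add: set_lebesgue_integral_def)
  finally show ?thesis .
qed

section \<open>The correspondence\<close>

text \<open>The side length of a dyadic cube of generation \<open>m\<close>.\<close>

definition rad :: "nat \<Rightarrow> real" where "rad m = 1 / 2 ^ m"

lemma rad_facts: "0 < rad m" "rad m \<le> 1" "rad m = 1 / real (2 ^ m)" "real (2 ^ l) * rad (m + l) = rad m"
  by (auto simp: rad_def power_add field_simps)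

lemma rad_lim: "rad \<longlonglongrightarrow> 0"
proof -
  have "(\<lambda>m. (1 / 2 :: real) ^ m) \<longlonglongrightarrow> 0" by (rule LIMSEQ_power_zero) simp
  then show ?thesis by (simp add: rad_def[abs_def] power_divide)
qed

lemma rad_small:
  assumes "\<delta> > 0" shows "\<exists>m0. \<forall>m\<ge>m0. real CARD('n::finite) * rad m \<le> \<delta>"
proof -
  have "(\<lambda>m. real CARD('n) * rad m) \<longlonglongrightarrow> real CARD('n) * 0" by (intro tendsto_mult tendsto_const rad_lim)
  then have "\<forall>\<^sub>F m in sequentially. real CARD('n) * rad m < \<delta>" by (intro order_tendstoD(2)) (use assms in auto)
  then show ?thesis by (auto simp: eventually_sequentially intro: less_imp_le)
qed

lemma density_limit:
  fixes u :: "'n::finite cfun"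
  assumes d: "has_density \<mu> u" and c: "\<And>e. e > 0 \<Longrightarrow> \<exists>\<delta>>0. \<forall>y. norm y \<le> \<delta> \<longrightarrow> cmod (u (x + y) - u x) \<le> e"
  shows "(\<lambda>m. \<mu> (hbox x (rad m)) / of_real (rad m ^ CARD('n))) \<longlonglongrightarrow> u x"
proof (rule LIMSEQ_I)
  fix e :: real assume e: "e > 0"
  obtain \<delta> where \<delta>: "\<delta> > 0" "\<And>y. norm y \<le> \<delta> \<Longrightarrow> cmod (u (x + y) - u x) \<le> e / 2" using c[of "e / 2"] e by auto
  obtain m0 where m0: "\<And>m. m \<ge> m0 \<Longrightarrow> real CARD('n) * rad m \<le> \<delta>" using rad_small[OF \<delta>(1), where 'n='n] by blast
  have "cmod (\<mu> (hbox x (rad m)) / of_real (rad m ^ CARD('n)) - u x) < e" if m: "m \<ge> m0" for m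
  proof -
    have r: "rad m ^ CARD('n) > 0" using rad_facts(1) by simp
    have s: "set_integrable lborel (hbox x (rad m)) u" "\<mu> (hbox x (rad m)) = (LINT z:hbox x (rad m)|lborel. u z)"
      using d hbox_bounded_borel unfolding has_density_def by blast+
    have "cmod (\<mu> (hbox x (rad m)) - of_real (rad m ^ CARD('n)) * u x) \<le> rad m ^ CARD('n) * (e / 2)"
      unfolding s(2)
    proof (rule set_integral_hbox_close[OF s(1) rad_facts(1)])
      fix z assume z: "z \<in> hbox x (rad m)"
      have "norm (z - x) \<le> \<delta>" using hbox_norm[OF z] m0[OF m] by linarith
      from \<delta>(2)[OF this] show "cmod (u z - u x) \<le> e / 2" by simp
    qed
    moreover have "\<mu> (hbox x (rad m)) / of_real (rad m ^ CARD('n)) - u x = (\<mu> (hbox x (rad m)) - of_real (rad m ^ CARD('n)) * u x) / of_real (rad m ^ CARD('n))"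
      using r rad_facts(1)[of m] by (simp add: diff_divide_distrib)
    ultimately have "cmod (\<mu> (hbox x (rad m)) / of_real (rad m ^ CARD('n)) - u x) \<le> (rad m ^ CARD('n) * (e / 2)) / rad m ^ CARD('n)"
      using r by (simp only: norm_divide norm_of_real abs_of_pos divide_right_mono less_imp_le)
    also have "\<dots> = e / 2" using r rad_facts(1)[of m] by simp
    finally show ?thesis using e by linarith
  qed
  then show "\<exists>m0. \<forall>m\<ge>m0. cmod (\<mu> (hbox x (rad m)) / of_real (rad m ^ CARD('n)) - u x) < e" by blast
qed

lemma continuous_oscillation:
  fixes u :: "'n::finite cfun"
  assumes "continuous_on UNIV u" "e > 0"
  shows "\<exists>\<delta>>0. \<forall>y. norm y \<le> \<delta> \<longrightarrow> cmod (u (x + y) - u x) \<le> e"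
proof -
  obtain d where d: "d > 0" "\<And>x'. dist x' x < d \<Longrightarrow> dist (u x') (u x) < e"
    using assms unfolding continuous_on_iff by (metis UNIV_I)
  have "cmod (u (x + y) - u x) \<le> e" if "norm y \<le> d / 2" for y
  proof -
    have "dist (x + y) x < d" using that d(1) by (simp add: dist_norm)
    from d(2)[OF this] show ?thesis by (simp add: dist_norm)
  qed
  with d(1) show ?thesis by (intro exI[of _ "d / 2"]) auto
qed

lemma hbox_radon_split:
  fixes x :: "real^'n::finite"
  assumes m: "radon_measure \<mu>"
  shows "\<mu> (hbox x (rad m)) = (\<Sum>j\<in>grid (2 ^ l). \<mu> (hbox (x + rad (m + l) *\<^sub>R j) (rad (m + l))))"
proof -
  have eq: "hbox x (rad m) = (\<Union>j\<in>grid (2 ^ l). hbox (x + rad (m + l) *\<^sub>R j) (rad (m + l)))"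
    using hbox_split[OF rad_facts(1)[of "m + l"], of x "2 ^ l"] by (simp only: rad_facts(4))
  have dis: "disjoint_family_on (\<lambda>j. hbox (x + rad (m + l) *\<^sub>R j) (rad (m + l))) (grid (2 ^ l))"
    unfolding disjoint_family_on_def
    using hbox_scaled_disjoint[OF rad_facts(1) grid_lattice grid_lattice] by blast
  show ?thesis unfolding eq by (rule radon_finite_UN[OF m grid_finite _ dis]) simp
qed

lemma grid_rad_card: "real (card (grid (2 ^ l) :: (real^'n::finite) set)) * rad (m + l) ^ CARD('n) = rad m ^ CARD('n)"
  using grid_card[OF rad_facts(1)[of "m + l"], of "2 ^ l", where 'n='n] by (simp only: rad_facts(4)) simp

lemma grid_rad_norm:
  fixes j :: "real^'n::finite"
  assumes "j \<in> grid (2 ^ l)" shows "norm (rad (m + l) *\<^sub>R j) \<le> real CARD('n) * rad m"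
proof -
  have "rad (m + l) *\<^sub>R j \<in> hbox (0 + rad (m + l) *\<^sub>R j) (rad (m + l))" using rad_facts(1)[of "m + l"] by (simp add: hbox_def)
  then have "rad (m + l) *\<^sub>R j \<in> hbox 0 (rad m)"
    using hbox_split[OF rad_facts(1)[of "m + l"], of "0 :: real^'n" "2 ^ l"] assms by (simp only: rad_facts(4)) blast
  from hbox_norm[OF this] show ?thesis by simp
qed

context partition
begin

text \<open>By \<open>S0_box_bound\<close> the averages \<open>q m\<close> of \<open>T f\<close> over dyadic boxes satisfy the bound claimed for \<open>u\<close>;
applied to a translate of \<open>f\<close> minus \<open>f\<close>, it makes them equicontinuous.  An average over a box is the mean of the averages over its parts,
so equicontinuity forces uniform convergence.  The difference between \<open>T f\<close> and the limit density then has
arbitrarily small mean over small boxes, hence vanishes on all of them.\<close>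

lemma operator_density:
  assumes T: "T \<in> invariant_operators" and f: "f \<in> S0 \<psi>"
  shows "\<exists>u. continuous_on UNIV u \<and> has_density (T f) u \<and> (\<forall>x. cmod (u x) \<le> box_const * operator_norm T * S0_norm \<psi> f)"
proof -
  define M where "M = box_const * operator_norm T"
  have M: "0 \<le> M" using box_const_nonneg operator_norm_nonneg[OF T] by (simp add: M_def)
  have fw: "f \<in> wiener" by (rule S0_wiener(1)[OF f])
  have rm: "radon_measure (T f)" by (rule tb_measuresD[OF invariantD(1)[OF T fw]])
  have rp: "0 < rad m ^ CARD('n)" for m using rad_facts(1) by simp
  define q where "q m x = T f (hbox x (rad m)) / of_real (rad m ^ CARD('n))" for m x
  have Tq: "T f (hbox x (rad m)) = of_real (rad m ^ CARD('n)) * q m x" for m x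
    using rp[of m] rad_facts(1)[of m] by (simp add: q_def)
  have box: "cmod (T g (hbox x (rad m))) \<le> M * rad m ^ CARD('n) * S0_norm \<psi> g" if "g \<in> S0 \<psi>" for g x m
    using S0_box_bound[OF T _ that, of "2 ^ m" x] by (simp add: M_def rad_def)
  have quot: "cmod (z / of_real (rad m ^ CARD('n))) \<le> b" if "cmod z \<le> rad m ^ CARD('n) * b" for z :: complex and m b
  proof -
    have "cmod (z / of_real (rad m ^ CARD('n))) = cmod z / rad m ^ CARD('n)" using rp[of m] by (simp only: norm_divide norm_of_real abs_of_pos)
    then show ?thesis using that rp[of m] by (simp only: pos_divide_le_eq mult.commute)
  qed
  have qb: "cmod (q m x) \<le> M * S0_norm \<psi> f" for m x
    unfolding q_def by (rule quot) (use box[OF f, of x m] in \<open>simp only: mult_ac\<close>)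
  (* By invariance, moving the box is translating f. *)
  have shift: "cmod (q m (x + y) - q m x) \<le> M * S0_norm \<psi> (\<lambda>z. translate (- y) f z - f z)" for m x y
  proof -
    note tf = S0_translate(1)[OF f, of "- y"]
    have "T f (hbox (x + y) (rad m)) = T (translate (- y) f) (hbox x (rad m))"
      using invariantD(3)[OF T fw, of "- y" "hbox x (rad m)"] hbox_shift[of "- y" x "rad m"] by simp
    then have "q m (x + y) - q m x = T (\<lambda>z. translate (- y) f z - f z) (hbox x (rad m)) / of_real (rad m ^ CARD('n))"
      using operator_diff[OF T S0_wiener(1)[OF tf] fw] by (simp add: q_def diff_divide_distrib)
    then show ?thesis
      using quot[of "T (\<lambda>z. translate (- y) f z - f z) (hbox x (rad m))" m] box[OF S0_diff[OF tf f], of x m] by (simp only: mult_ac)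
  qed
  have small: "\<exists>\<delta>>0. \<forall>m x y. norm y \<le> \<delta> \<longrightarrow> cmod (q m (x + y) - q m x) \<le> \<epsilon>" if e: "\<epsilon> > 0" for \<epsilon>
  proof -
    have e1: "\<epsilon> / (M + 1) > 0" using e M by simp
    obtain \<delta> where \<delta>: "\<delta> > 0" "\<And>y. norm y \<le> \<delta> \<Longrightarrow> S0_norm \<psi> (\<lambda>z. translate y f z - f z) \<le> \<epsilon> / (M + 1)"
      using S0_translate_small[OF f e1] by blast
    have "cmod (q m (x + y) - q m x) \<le> \<epsilon>" if "norm y \<le> \<delta>" for m x y
    proof -
      have "cmod (q m (x + y) - q m x) \<le> M * (\<epsilon> / (M + 1))"
        by (rule order_trans[OF shift mult_left_mono[OF \<delta>(2) M]]) (use that in simp)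
      also have "\<dots> \<le> (M + 1) * (\<epsilon> / (M + 1))" using e1 by (intro mult_right_mono) auto
      also have "\<dots> = \<epsilon>" using M by simp
      finally show ?thesis .
    qed
    with \<delta>(1) show ?thesis by blast
  qed
  have average: "cmod (q m x - c) \<le> \<epsilon>"
    if "\<And>j. j \<in> grid (2 ^ l) \<Longrightarrow> cmod (q (m + l) (x + rad (m + l) *\<^sub>R j) - c) \<le> \<epsilon>" for m l x c \<epsilon>
  proof -
    let ?G = "grid (2 ^ l) :: (real^'n) set" and ?r = "rad (m + l) ^ CARD('n)"
    have "of_real (rad m ^ CARD('n)) * (q m x - c) = (\<Sum>j\<in>?G. of_real ?r * q (m + l) (x + rad (m + l) *\<^sub>R j)) - of_real (real (card ?G) * ?r) * c"
      unfolding right_diff_distrib Tq[symmetric] hbox_radon_split[OF rm, of x m l] grid_rad_card ..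
    also have "\<dots> = (\<Sum>j\<in>?G. of_real ?r * (q (m + l) (x + rad (m + l) *\<^sub>R j) - c))"
      by (simp add: right_diff_distrib sum_subtractf)
    finally have "cmod (of_real (rad m ^ CARD('n)) * (q m x - c)) \<le> (\<Sum>j\<in>?G. ?r * \<epsilon>)"
      using rp[of "m + l"] that by (simp only:) (intro sum_norm_le, auto simp: norm_mult norm_power abs_of_pos[OF rad_facts(1)] intro!: mult_left_mono)
    also have "\<dots> = rad m ^ CARD('n) * \<epsilon>" by (simp add: grid_rad_card[of l m, where 'n='n, symmetric])
    finally show ?thesis using rp[of m] by (simp add: norm_mult norm_power abs_of_pos[OF rad_facts(1)])
  qed
  (* The boxes of the finer generation inside a box start within distance d * rad m of its
     corner, so their averages differ little from the average over the box at that corner. *)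
  have refine: "\<exists>m0. \<forall>m\<ge>m0. \<forall>l x. cmod (q m x - q (m + l) x) \<le> \<epsilon>" if e: "\<epsilon> > 0" for \<epsilon>
  proof -
    obtain \<delta> where \<delta>: "\<delta> > 0" "\<And>m x y. norm y \<le> \<delta> \<Longrightarrow> cmod (q m (x + y) - q m x) \<le> \<epsilon>" using small[OF e] by blast
    obtain m0 where m0: "\<And>m. m \<ge> m0 \<Longrightarrow> real CARD('n) * rad m \<le> \<delta>" using rad_small[OF \<delta>(1), where 'n='n] by blast
    have "cmod (q m x - q (m + l) x) \<le> \<epsilon>" if "m \<ge> m0" for m l x
      by (rule average[of l]) (use \<delta>(2) grid_rad_norm m0[OF that] order_trans in blast)
    then show ?thesis by blast
  qed
  have cauchy: "Cauchy (\<lambda>m. q m x)" for x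
  proof (rule CauchyI)
    fix e :: real assume e: "e > 0"
    obtain m0 where m0: "\<And>m l x. m \<ge> m0 \<Longrightarrow> cmod (q m x - q (m + l) x) \<le> e / 3" using refine[of "e / 3"] e by auto
    have "cmod (q m x - q n x) < e" if "m \<ge> m0" "n \<ge> m0" for m n
    proof -
      have "cmod (q m0 x - q m x) \<le> e / 3" "cmod (q m0 x - q n x) \<le> e / 3"
        using m0[of m0 x "m - m0"] m0[of m0 x "n - m0"] that by auto
      moreover have "cmod (q m x - q n x) \<le> cmod (q m0 x - q n x) + cmod (q m0 x - q m x)"
        using norm_triangle_ineq4[of "q m0 x - q n x" "q m0 x - q m x"] by simp
      ultimately show ?thesis using e by linarith
    qed
    then show "\<exists>M. \<forall>m\<ge>M. \<forall>n\<ge>M. cmod (q m x - q n x) < e" by blast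
  qed
  define u where "u x = lim (\<lambda>m. q m x)" for x
  have u: "(\<lambda>m. q m x) \<longlonglongrightarrow> u x" for x
    unfolding u_def using Cauchy_convergent[OF cauchy] by (simp only: convergent_LIMSEQ_iff)
  have ub: "cmod (u x) \<le> M * S0_norm \<psi> f" for x
    by (rule LIMSEQ_le_const2[OF tendsto_norm[OF u]]) (use qb in auto)
  have ush: "\<exists>\<delta>>0. \<forall>x y. norm y \<le> \<delta> \<longrightarrow> cmod (u (x + y) - u x) \<le> \<epsilon>" if e: "\<epsilon> > 0" for \<epsilon>
  proof -
    obtain \<delta> where \<delta>: "\<delta> > 0" "\<And>m x y. norm y \<le> \<delta> \<Longrightarrow> cmod (q m (x + y) - q m x) \<le> \<epsilon>" using small[OF e] by blast
    have "cmod (u (x + y) - u x) \<le> \<epsilon>" if "norm y \<le> \<delta>" for x y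
      by (rule LIMSEQ_le_const2[OF tendsto_norm[OF tendsto_diff[OF u u]]]) (use \<delta>(2)[OF that] in auto)
    with \<delta>(1) show ?thesis by blast
  qed
  have uq: "\<exists>m0. \<forall>m\<ge>m0. \<forall>x. cmod (q m x - u x) \<le> \<epsilon>" if e: "\<epsilon> > 0" for \<epsilon>
  proof -
    obtain m0 where m0: "\<And>m l x. m \<ge> m0 \<Longrightarrow> cmod (q m x - q (m + l) x) \<le> \<epsilon>" using refine[OF e] by blast
    have "cmod (q m x - u x) \<le> \<epsilon>" if "m \<ge> m0" for m x
    proof (rule LIMSEQ_le_const2[OF tendsto_norm[OF tendsto_diff[OF tendsto_const]]])
      show "(\<lambda>l. q (m + l) x) \<longlonglongrightarrow> u x" using LIMSEQ_ignore_initial_segment[OF u[of x], of m] by (simp add: add.commute)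
    qed (use m0[OF that] in auto)
    then show ?thesis by blast
  qed
  have uc: "continuous_on UNIV u"
    unfolding continuous_on_iff
  proof (intro ballI allI impI)
    fix x :: "real^'n" and e :: real assume e: "0 < e"
    obtain \<delta> where \<delta>: "\<delta> > 0" "\<And>x y. norm y \<le> \<delta> \<Longrightarrow> cmod (u (x + y) - u x) \<le> e / 2" using ush[of "e / 2"] e by auto
    have "dist (u x') (u x) < e" if "dist x' x < \<delta>" for x'
      using \<delta>(2)[of "x' - x" x] that e by (simp add: dist_norm)
    with \<delta>(1) show "\<exists>d>0. \<forall>x'\<in>UNIV. dist x' x < d \<longrightarrow> dist (u x') (u x) < e" by blast
  qed
  (* The part of T f that the density u does not account for. *)
  define \<nu> where "\<nu> A = (if A \<in> bounded_borel then T f A - (LINT x:A|lborel. u x) else 0)" for A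
  have nr: "radon_measure \<nu>" unfolding \<nu>_def[abs_def] by (rule density_radon[OF uc rm])
  have nz: "\<nu> (hbox x (rad m)) = 0" for x m
  proof -
    have "cmod (\<nu> (hbox x (rad m))) \<le> 0 + d" if d: "d > 0" for d
    proof -
      define \<epsilon> where "\<epsilon> = d / (2 * rad m ^ CARD('n))"
      have e: "\<epsilon> > 0" using d rp[of m] by (simp add: \<epsilon>_def)
      obtain \<delta> where \<delta>: "\<delta> > 0" "\<And>x y. norm y \<le> \<delta> \<Longrightarrow> cmod (u (x + y) - u x) \<le> \<epsilon>" using ush[OF e] by blast
      obtain m1 where m1: "\<And>m. m \<ge> m1 \<Longrightarrow> real CARD('n) * rad m \<le> \<delta>" using rad_small[OF \<delta>(1), where 'n='n] by blast
      obtain m2 where m2: "\<And>m x. m \<ge> m2 \<Longrightarrow> cmod (q m x - u x) \<le> \<epsilon>" using uq[OF e] by blast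
      define l where "l = max m1 m2"
      let ?G = "grid (2 ^ l) :: (real^'n) set" and ?r = "rad (m + l) ^ CARD('n)"
      have lm: "m + l \<ge> m1" "m + l \<ge> m2" by (auto simp: l_def)
      have each: "cmod (\<nu> (hbox y (rad (m + l)))) \<le> ?r * (2 * \<epsilon>)" for y
      proof -
        have "cmod ((LINT z:hbox y (rad (m + l))|lborel. u z) - of_real ?r * u y) \<le> ?r * \<epsilon>"
        proof (rule set_integral_hbox_close[OF continuous_set_integrable[OF uc hbox_bounded_borel] rad_facts(1)])
          fix z assume z: "z \<in> hbox y (rad (m + l))"
          have "norm (z - y) \<le> \<delta>" using hbox_norm[OF z] m1[OF lm(1)] by linarith
          from \<delta>(2)[OF this, of y] show "cmod (u z - u y) \<le> \<epsilon>" by simp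
        qed
        moreover have "cmod (of_real ?r * (q (m + l) y - u y)) \<le> ?r * \<epsilon>"
          using m2[OF lm(2), of y] rp[of "m + l"] by (simp add: norm_mult norm_power abs_of_pos[OF rad_facts(1)])
        moreover have "\<nu> (hbox y (rad (m + l))) = of_real ?r * (q (m + l) y - u y) - ((LINT z:hbox y (rad (m + l))|lborel. u z) - of_real ?r * u y)"
          by (simp add: \<nu>_def Tq right_diff_distrib)
        ultimately show ?thesis
          using norm_triangle_ineq4[of "of_real ?r * (q (m + l) y - u y)" "(LINT z:hbox y (rad (m + l))|lborel. u z) - of_real ?r * u y"] by simp
      qed
      have "cmod (\<nu> (hbox x (rad m))) \<le> (\<Sum>j\<in>?G. ?r * (2 * \<epsilon>))"
        unfolding hbox_radon_split[OF nr, of x m l] by (rule sum_norm_le) (rule each)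
      also have "\<dots> = rad m ^ CARD('n) * (2 * \<epsilon>)" by (simp add: grid_rad_card[of l m, where 'n='n, symmetric])
      also have "\<dots> = d" using rp[of m] rad_facts(1)[of m] by (simp add: \<epsilon>_def)
      finally show ?thesis by simp
    qed
    then have "cmod (\<nu> (hbox x (rad m))) \<le> 0" by (rule field_le_epsilon)
    then show ?thesis by simp
  qed
  have "\<nu> A = 0" for A
    by (rule radon_dyadic_zero[OF nr]) (use nz in \<open>simp add: dyadic_def rad_def\<close>)
  then have "T f A = (LINT x:A|lborel. u x)" if "A \<in> bounded_borel" for A
    using that by (auto simp: \<nu>_def split: if_splits) (metis eq_iff_diff_eq_0)
  then have "has_density (T f) u"
    unfolding has_density_def using continuous_set_integrable[OF uc] by blast
  then show ?thesis using uc ub by (auto simp: M_def)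
qed

definition symbol_const :: real where "symbol_const = box_const * synth R"

lemma symbol_const_nonneg: "0 \<le> symbol_const" by (simp add: symbol_const_def box_const_nonneg synth_nonneg)

text \<open>The functional is the density of \<open>T (flip f)\<close> at the origin; invariance of \<open>T\<close> moves the origin to any other
point.\<close>

lemma symbol_exists:
  assumes T: "T \<in> invariant_operators"
  shows "\<exists>\<sigma>\<in>S0_dual \<psi>. is_convolution \<psi> T \<sigma> \<and> S0_dual_norm \<psi> \<sigma> \<le> symbol_const * operator_norm T"
proof -
  define M where "M = box_const * operator_norm T"
  have M: "0 \<le> M" using box_const_nonneg operator_norm_nonneg[OF T] by (simp add: M_def)
  obtain U where U: "\<And>f. f \<in> S0 \<psi> \<Longrightarrow> continuous_on UNIV (U f)" "\<And>f. f \<in> S0 \<psi> \<Longrightarrow> has_density (T f) (U f)"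
     "\<And>f x. f \<in> S0 \<psi> \<Longrightarrow> cmod (U f x) \<le> M * S0_norm \<psi> f"
    using operator_density[OF T] unfolding M_def by metis
  have lim: "(\<lambda>m. T f (hbox x (rad m)) / of_real (rad m ^ CARD('n))) \<longlonglongrightarrow> U f x" if "f \<in> S0 \<psi>" for f x
    by (rule density_limit[OF U(2)[OF that] continuous_oscillation[OF U(1)[OF that]]])
  define \<sigma> where "\<sigma> = (\<lambda>f\<in>S0 \<psi>. U (flip f) 0)"
  have s: "\<sigma> f = U (flip f) 0" if "f \<in> S0 \<psi>" for f using that by (simp add: \<sigma>_def)
  have lin: "\<sigma> (\<lambda>x. a * f x + b * g x) = a * \<sigma> f + b * \<sigma> g" if f: "f \<in> S0 \<psi>" and g: "g \<in> S0 \<psi>" for f g a b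
  proof -
    note fl = S0_flip(1)[OF f] S0_flip(1)[OF g]
    note l = S0_lincomb(1)[OF fl, of a b]
    have "U (\<lambda>x. a * flip f x + b * flip g x) 0 = a * U (flip f) 0 + b * U (flip g) 0"
    proof (rule LIMSEQ_unique[OF lim[OF l]])
      have "(\<lambda>m. a * (T (flip f) (hbox 0 (rad m)) / of_real (rad m ^ CARD('n))) + b * (T (flip g) (hbox 0 (rad m)) / of_real (rad m ^ CARD('n)))) \<longlonglongrightarrow> a * U (flip f) 0 + b * U (flip g) 0"
        by (intro tendsto_add tendsto_mult tendsto_const lim fl)
      then show "(\<lambda>m. T (\<lambda>x. a * flip f x + b * flip g x) (hbox 0 (rad m)) / of_real (rad m ^ CARD('n))) \<longlonglongrightarrow> a * U (flip f) 0 + b * U (flip g) 0"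
        using invariantD(2)[OF T S0_wiener(1)[OF fl(1)] S0_wiener(1)[OF fl(2)]] by (simp add: add_divide_distrib)
    qed
    then show ?thesis using s[OF f] s[OF g] s[OF S0_lincomb(1)[OF f g, of a b]] by (simp add: flip_lincomb)
  qed
  have bd: "cmod (\<sigma> f) \<le> (M * synth R) * S0_norm \<psi> f" if f: "f \<in> S0 \<psi>" for f
  proof -
    have "cmod (\<sigma> f) \<le> M * S0_norm \<psi> (flip f)" using U(3)[OF S0_flip(1)[OF f]] s[OF f] by simp
    also have "\<dots> \<le> M * (synth R * S0_norm \<psi> f)" by (rule mult_left_mono[OF S0_flip(2)[OF f] M])
    finally show ?thesis by (simp only: mult.assoc)
  qed
  have sd: "\<sigma> \<in> S0_dual \<psi>" 
    unfolding S0_dual_def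
  proof (intro CollectI conjI ballI allI)
    show "\<sigma> \<in> extensional (S0 \<psi>)" by (simp add: \<sigma>_def)
    show "\<exists>C. \<forall>f\<in>S0 \<psi>. cmod (\<sigma> f) \<le> C * S0_norm \<psi> f" using bd by blast
  qed (rule lin)
  have "is_convolution \<psi> T \<sigma>"
    unfolding is_convolution_def
  proof
    fix f assume f: "f \<in> S0 \<psi>"
    have "conv \<sigma> f x = U f x" for x
    proof -
      have tS: "translate x (flip f) \<in> S0 \<psi>" "translate (- x) f \<in> S0 \<psi>"
        using S0_translate(1) S0_flip(1)[OF f] f by auto
      have fl: "flip (translate x (flip f)) = translate (- x) f" by (simp add: flip_def translate_def fun_eq_iff add.commute)
      have "T (translate (- x) f) (hbox 0 (rad m)) = T f (hbox x (rad m))" for m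
        using invariantD(3)[OF T S0_wiener(1)[OF f], of "- x" "hbox 0 (rad m)"] hbox_shift[of "- x" 0 "rad m"] by simp
      then have "U (translate (- x) f) 0 = U f x"
        using LIMSEQ_unique[OF lim[OF tS(2), of 0]] lim[OF f, of x] by simp
      then show ?thesis using s[OF tS(1)] fl by (simp add: conv_def)
    qed
    then have "conv \<sigma> f = U f" by blast
    then show "has_density (T f) (conv \<sigma> f)" using U(2)[OF f] by simp
  qed
  moreover have "S0_dual_norm \<psi> \<sigma> \<le> symbol_const * operator_norm T"
    unfolding S0_dual_norm_def
  proof (rule cSUP_least)
    have "(\<lambda>x. 0) \<in> {f \<in> S0 \<psi>. S0_norm \<psi> f \<le> 1}" by simp
    then show "{f \<in> S0 \<psi>. S0_norm \<psi> f \<le> 1} \<noteq> {}" by blast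
    fix f assume f: "f \<in> {f \<in> S0 \<psi>. S0_norm \<psi> f \<le> 1}"
    have "cmod (\<sigma> f) \<le> (M * synth R) * S0_norm \<psi> f" using bd f by blast
    also have "\<dots> \<le> (M * synth R) * 1" using f M synth_nonneg by (intro mult_left_mono) auto
    finally show "cmod (\<sigma> f) \<le> symbol_const * operator_norm T" by (simp add: M_def symbol_const_def mult_ac)
  qed
  ultimately show ?thesis using sd by blast
qed

text \<open>The density \<open>\<sigma> * f\<close> is continuous at the origin because translation is continuous in \<open>S\<^sub>0\<close>.\<close>

lemma symbol_limit:
  assumes s: "\<sigma> \<in> S0_dual \<psi>" and T: "is_convolution \<psi> T \<sigma>" and f: "f \<in> S0 \<psi>"
  shows "(\<lambda>m. T f (hbox 0 (rad m)) / of_real (rad m ^ CARD('n))) \<longlonglongrightarrow> \<sigma> (flip f)"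
proof -
  note ff = S0_flip(1)[OF f]
  have c0: "conv \<sigma> f 0 = \<sigma> (flip f)" by (simp add: conv_def translate_def)
  have "(\<lambda>m. T f (hbox 0 (rad m)) / of_real (rad m ^ CARD('n))) \<longlonglongrightarrow> conv \<sigma> f 0"
  proof (rule density_limit)
    show "has_density (T f) (conv \<sigma> f)" using T f by (simp add: is_convolution_def)
    fix e :: real assume e: "e > 0"
    let ?D = "S0_dual_norm \<psi> \<sigma>"
    have D: "0 \<le> ?D" by (rule dualD(3)[OF s])
    have e1: "e / (?D + 1) > 0" using e D by simp
    obtain \<delta> where \<delta>: "\<delta> > 0" "\<And>y. norm y \<le> \<delta> \<Longrightarrow> S0_norm \<psi> (\<lambda>z. translate y (flip f) z - flip f z) \<le> e / (?D + 1)"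
      using S0_translate_small[OF ff e1] by blast
    have "cmod (conv \<sigma> f (0 + y) - conv \<sigma> f 0) \<le> e" if "norm y \<le> \<delta>" for y
    proof -
      have "conv \<sigma> f (0 + y) - conv \<sigma> f 0 = \<sigma> (\<lambda>z. translate y (flip f) z - flip f z)"
        using dual_diff[OF s S0_translate(1)[OF ff] ff, of y] unfolding c0 by (simp add: conv_def)
      also have "cmod \<dots> \<le> ?D * S0_norm \<psi> (\<lambda>z. translate y (flip f) z - flip f z)"
        by (rule dualD(2)[OF s S0_diff[OF S0_translate(1)[OF ff] ff]])
      also have "\<dots> \<le> ?D * (e / (?D + 1))" by (rule mult_left_mono[OF \<delta>(2)[OF that] D])
      also have "\<dots> \<le> (?D + 1) * (e / (?D + 1))" using e1 by (intro mult_right_mono) auto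
      also have "\<dots> = e" using D by simp
      finally show ?thesis .
    qed
    with \<delta>(1) show "\<exists>\<delta>>0. \<forall>y. norm y \<le> \<delta> \<longrightarrow> cmod (conv \<sigma> f (0 + y) - conv \<sigma> f 0) \<le> e" by blast
  qed
  then show ?thesis by (simp add: c0)
qed

lemma dual_eqI:
  assumes s: "\<sigma> \<in> S0_dual \<psi>" "\<sigma>' \<in> S0_dual \<psi>" and eq: "\<And>f. f \<in> S0 \<psi> \<Longrightarrow> \<sigma> (flip f) = \<sigma>' (flip f)"
  shows "\<sigma> = \<sigma>'"
proof (rule extensionalityI)
  show "\<sigma> \<in> extensional (S0 \<psi>)" "\<sigma>' \<in> extensional (S0 \<psi>)" using s by (auto simp: S0_dual_def)
  show "\<sigma> f = \<sigma>' f" if "f \<in> S0 \<psi>" for f using eq[OF S0_flip(1)[OF that]] by simp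
qed

lemma symbol_unique:
  assumes s: "\<sigma> \<in> S0_dual \<psi>" "is_convolution \<psi> T \<sigma>" and s': "\<sigma>' \<in> S0_dual \<psi>" "is_convolution \<psi> T \<sigma>'"
  shows "\<sigma> = \<sigma>'"
  by (rule dual_eqI[OF s(1) s'(1)]) (rule LIMSEQ_unique[OF symbol_limit[OF s] symbol_limit[OF s']])

text \<open>No exchange of \<open>\<sigma>\<close> with an integral is involved: the operator is a convolution with some functional
because it is invariant, and differentiation at the origin identifies that functional.\<close>

lemma conv_operator_is_convolution:
  assumes s: "\<sigma> \<in> S0_dual \<psi>"
  shows "is_convolution \<psi> (conv_operator \<sigma>) \<sigma>"
proof -
  obtain \<sigma>' where s': "\<sigma>' \<in> S0_dual \<psi>" "is_convolution \<psi> (conv_operator \<sigma>) \<sigma>'"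
    using symbol_exists[OF conv_operator_invariant(1)[OF s]] by blast
  have "\<sigma> = \<sigma>'"
    by (rule dual_eqI[OF s s'(1)])
       (rule LIMSEQ_unique[OF conv_operator_limit[OF s _ rad_lim rad_facts(1,2)] symbol_limit[OF s']])
  with s' show ?thesis by simp
qed

text \<open>The averages of \<open>f\<close> over small cubes lie in \<open>S\<^sub>0\<close>, where both operators are given by \<open>\<sigma>\<close>, and converge to \<open>f\<close>
in Wiener's algebra.\<close>

lemma operator_unique:
  assumes T: "T \<in> invariant_operators" "is_convolution \<psi> T \<sigma>" and T': "T' \<in> invariant_operators" "is_convolution \<psi> T' \<sigma>"
  shows "T = T'"
proof (rule extensionalityI[OF invariantD(5)[OF T(1)] invariantD(5)[OF T'(1)]])
  fix f :: "'n cfun" assume f: "f \<in> wiener"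
  show "T f = T' f"
  proof
    fix A
    show "T f A = T' f A"
    proof (cases "A \<in> bounded_borel")
      case False
      then show ?thesis
        using radon_zero[OF tb_measuresD[OF invariantD(1)[OF T(1) f]]] radon_zero[OF tb_measuresD[OF invariantD(1)[OF T'(1) f]]] by simp
    next
      case True
      obtain K where K: "K \<ge> 0" "\<And>f. f \<in> wiener \<Longrightarrow> cmod (T f A) \<le> K * wiener_norm f" using operator_value_bound[OF T(1) True] by blast
      obtain K' where K': "K' \<ge> 0" "\<And>f. f \<in> wiener \<Longrightarrow> cmod (T' f A) \<le> K' * wiener_norm f" using operator_value_bound[OF T'(1) True] by blast
      have "cmod (T f A - T' f A) \<le> 0 + d" if d: "d > 0" for d
      proof -
        define e where "e = d / (K + K' + 1)"
        have e: "e > 0" using d K(1) K'(1) by (simp add: e_def)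
        obtain r where r: "r > 0" "(\<lambda>x. convolve (avg r) f x - f x) \<in> wiener" "wiener_norm (\<lambda>x. convolve (avg r) f x - f x) \<le> e"
          using wiener_avg[OF f e] by blast
        let ?h = "convolve (avg r) f" and ?g = "\<lambda>x. convolve (avg r) f x - f x"
        have hS: "?h \<in> S0 \<psi>"
        proof -
          have eq: "?h = (\<lambda>x. of_real (1 / r ^ CARD('n)) * convolve (indicator (hbox 0 r)) f x)"
            by (simp add: convolve_def avg_def[abs_def] mult.assoc fun_eq_iff del: of_real_divide)
          show ?thesis unfolding eq by (rule S0_cmult(1)[OF indicator_convolve_S0(1)[OF hbox_bounded_borel f]])
        qed
        have hw: "?h \<in> wiener" by (rule S0_wiener(1)[OF hS])
        have "T ?h A = (LINT x:A|lborel. conv \<sigma> ?h x)" "T' ?h A = (LINT x:A|lborel. conv \<sigma> ?h x)"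
          using T(2) T'(2) hS True by (auto simp: is_convolution_def has_density_def)
        then have "T f A - T' f A = T' ?g A - T ?g A"
          using operator_diff[OF T(1) hw f, of A] operator_diff[OF T'(1) hw f, of A] by simp
        then have "cmod (T f A - T' f A) \<le> cmod (T' ?g A) + cmod (T ?g A)" by (simp only: norm_triangle_ineq4)
        also have "\<dots> \<le> K' * e + K * e"
          using K(2)[OF r(2)] K'(2)[OF r(2)] mult_left_mono[OF r(3) K(1)] mult_left_mono[OF r(3) K'(1)] by linarith
        also have "\<dots> \<le> (K + K' + 1) * e" using e by (simp add: algebra_simps)
        also have "\<dots> = d" using K(1) K'(1) by (simp add: e_def)
        finally show ?thesis by simp
      qed
      then have "cmod (T f A - T' f A) \<le> 0" by (rule field_le_epsilon)
      then show ?thesis by simp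
    qed
  qed
qed

lemma dual_lincomb:
  assumes s: "\<sigma> \<in> S0_dual \<psi>" and t: "\<tau> \<in> S0_dual \<psi>"
  shows "(\<lambda>f\<in>S0 \<psi>. a * \<sigma> f + b * \<tau> f) \<in> S0_dual \<psi>"
proof -
  have "cmod (a * \<sigma> f + b * \<tau> f) \<le> (cmod a * S0_dual_norm \<psi> \<sigma> + cmod b * S0_dual_norm \<psi> \<tau>) * S0_norm \<psi> f" if f: "f \<in> S0 \<psi>" for f
  proof -
    have "cmod (a * \<sigma> f + b * \<tau> f) \<le> cmod a * cmod (\<sigma> f) + cmod b * cmod (\<tau> f)" by (metis norm_mult norm_triangle_ineq)
    also have "\<dots> \<le> cmod a * (S0_dual_norm \<psi> \<sigma> * S0_norm \<psi> f) + cmod b * (S0_dual_norm \<psi> \<tau> * S0_norm \<psi> f)"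
      by (intro add_mono mult_left_mono dualD(2)[OF s f] dualD(2)[OF t f]) auto
    finally show ?thesis by (simp add: algebra_simps)
  qed
  moreover have "a * \<sigma> (\<lambda>x. c * f x + d * g x) + b * \<tau> (\<lambda>x. c * f x + d * g x) = c * (a * \<sigma> f + b * \<tau> f) + d * (a * \<sigma> g + b * \<tau> g)"
    if "f \<in> S0 \<psi>" "g \<in> S0 \<psi>" for f g c d
    unfolding dualD(1)[OF s that] dualD(1)[OF t that] by (simp add: algebra_simps)
  ultimately show ?thesis unfolding S0_dual_def using S0_lincomb(1) by auto
qed

definition symbol :: "('n cfun \<Rightarrow> 'n cmeas) \<Rightarrow> 'n cfun \<Rightarrow> complex" where
  "symbol T = (THE \<sigma>. \<sigma> \<in> S0_dual \<psi> \<and> is_convolution \<psi> T \<sigma>)"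

lemma symbol_eqI: "\<sigma> \<in> S0_dual \<psi> \<Longrightarrow> is_convolution \<psi> T \<sigma> \<Longrightarrow> symbol T = \<sigma>"
  unfolding symbol_def by (rule the_equality) (auto intro: symbol_unique)

lemma symbol:
  assumes T: "T \<in> invariant_operators"
  shows "symbol T \<in> S0_dual \<psi>" "is_convolution \<psi> T (symbol T)" "S0_dual_norm \<psi> (symbol T) \<le> symbol_const * operator_norm T"
    "T = conv_operator (symbol T)"
proof -
  obtain \<sigma> where s: "\<sigma> \<in> S0_dual \<psi>" "is_convolution \<psi> T \<sigma>" "S0_dual_norm \<psi> \<sigma> \<le> symbol_const * operator_norm T"
    using symbol_exists[OF T] by blast
  have "symbol T = \<sigma>" by (rule symbol_eqI[OF s(1,2)])
  with s show 1: "symbol T \<in> S0_dual \<psi>" "is_convolution \<psi> T (symbol T)" "S0_dual_norm \<psi> (symbol T) \<le> symbol_const * operator_norm T" by auto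
  show "T = conv_operator (symbol T)"
    by (rule operator_unique[OF T 1(2) conv_operator_invariant(1)[OF 1(1)] conv_operator_is_convolution[OF 1(1)]])
qed

lemma symbol_conv_operator: "\<sigma> \<in> S0_dual \<psi> \<Longrightarrow> symbol (conv_operator \<sigma>) = \<sigma>"
  by (rule symbol_eqI) (auto intro: conv_operator_is_convolution)

text \<open>\<open>conv_operator\<close> is visibly linear in the functional, and \<open>symbol\<close> inverts it.\<close>

lemma symbol_lincomb:
  assumes T: "T \<in> invariant_operators" and U: "U \<in> invariant_operators"
  shows "symbol (\<lambda>f\<in>wiener. \<lambda>A. a * T f A + b * U f A) = (\<lambda>f\<in>S0 \<psi>. a * symbol T f + b * symbol U f)"
proof -
  let ?\<tau> = "\<lambda>f\<in>S0 \<psi>. a * symbol T f + b * symbol U f"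
  have "(\<lambda>f\<in>wiener. \<lambda>A. a * conv_operator (symbol T) f A + b * conv_operator (symbol U) f A) = conv_operator ?\<tau>"
  proof (intro extensionalityI[of _ wiener] ext)
    show "(\<lambda>f\<in>wiener. \<lambda>A. a * conv_operator (symbol T) f A + b * conv_operator (symbol U) f A) f A = conv_operator ?\<tau> f A"
      if "f \<in> wiener" for f A
      using that indicator_convolve_S0(1)[OF _ wiener_flip(1)[OF that], of A]
      by (simp add: conv_operator_def conv_measure_def)
  qed (auto simp: conv_operator_def)
  then have "(\<lambda>f\<in>wiener. \<lambda>A. a * T f A + b * U f A) = conv_operator ?\<tau>"
    using symbol(4)[OF T] symbol(4)[OF U] by simp
  then show ?thesis using symbol_conv_operator[OF dual_lincomb[OF symbol(1)[OF T] symbol(1)[OF U]]] by simp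
qed

end

theorem theorem2:
  fixes \<psi> :: "real^'n::finite \<Rightarrow> complex"
  assumes "smooth_partition \<psi>"
  shows "S0 \<psi> \<subseteq> wiener \<and>
    (\<forall>T\<in>invariant_operators. \<exists>!\<sigma>. \<sigma> \<in> S0_dual \<psi> \<and> is_convolution \<psi> T \<sigma>) \<and>
    (\<forall>\<sigma>\<in>S0_dual \<psi>. \<exists>!T. T \<in> invariant_operators \<and> is_convolution \<psi> T \<sigma>) \<and>
    (\<exists>\<Phi>. bij_betw \<Phi> invariant_operators (S0_dual \<psi>) \<and>
      (\<forall>T\<in>invariant_operators. is_convolution \<psi> T (\<Phi> T)) \<and>
      (\<forall>T\<in>invariant_operators. \<forall>U\<in>invariant_operators. \<forall>a b.
        \<Phi> (\<lambda>f\<in>wiener. \<lambda>A. a * T f A + b * U f A) = (\<lambda>f\<in>S0 \<psi>. a * \<Phi> T f + b * \<Phi> U f)) \<and>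
      (\<exists>c>0. \<exists>C>0. \<forall>T\<in>invariant_operators.
        c * S0_dual_norm \<psi> (\<Phi> T) \<le> operator_norm T \<and>
        operator_norm T \<le> C * S0_dual_norm \<psi> (\<Phi> T)))"
proof -
  interpret partition \<psi> by standard (rule assms)
  have "S0 \<psi> \<subseteq> wiener" using S0_wiener(1) by blast
  moreover have "\<exists>!\<sigma>. \<sigma> \<in> S0_dual \<psi> \<and> is_convolution \<psi> T \<sigma>" if T: "T \<in> invariant_operators" for T
    using symbol(1,2)[OF T] by (intro ex1I[of _ "symbol T"]) (auto intro: symbol_unique)
  moreover have "\<exists>!T. T \<in> invariant_operators \<and> is_convolution \<psi> T \<sigma>" if s: "\<sigma> \<in> S0_dual \<psi>" for \<sigma>
    using conv_operator_invariant(1)[OF s] conv_operator_is_convolution[OF s]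
    by (intro ex1I[of _ "conv_operator \<sigma>"]) (auto intro: operator_unique)
  moreover have "bij_betw symbol invariant_operators (S0_dual \<psi>)"
    by (rule bij_betwI[where g=conv_operator])
       (use symbol(1) symbol(4) conv_operator_invariant(1) symbol_conv_operator in auto)
  moreover have "\<exists>c>0. \<exists>C>0. \<forall>T\<in>invariant_operators.
        c * S0_dual_norm \<psi> (symbol T) \<le> operator_norm T \<and> operator_norm T \<le> C * S0_dual_norm \<psi> (symbol T)"
  proof (intro exI conjI ballI)
    (* The two constants are only known to be nonnegative; adding one makes them positive. *)
    show "1 / (symbol_const + 1) > 0" "operator_const + 1 > 0" using symbol_const_nonneg operator_const_nonneg by auto
    fix T :: "'n cfun \<Rightarrow> 'n cmeas" assume T: "T \<in> invariant_operators"
    have "S0_dual_norm \<psi> (symbol T) \<le> (symbol_const + 1) * operator_norm T"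
      using symbol(3)[OF T] operator_norm_nonneg[OF T] by (simp add: distrib_right)
    then show "1 / (symbol_const + 1) * S0_dual_norm \<psi> (symbol T) \<le> operator_norm T"
      using symbol_const_nonneg by (simp add: field_simps)
    have "operator_norm T \<le> operator_const * S0_dual_norm \<psi> (symbol T)"
      using conv_operator_invariant(2)[OF symbol(1)[OF T]] symbol(4)[OF T] by simp
    also have "\<dots> \<le> (operator_const + 1) * S0_dual_norm \<psi> (symbol T)"
      using dualD(3)[OF symbol(1)[OF T]] by (intro mult_right_mono) auto
    finally show "operator_norm T \<le> (operator_const + 1) * S0_dual_norm \<psi> (symbol T)" .
  qed
  ultimately show ?thesis
    using symbol(2) symbol_lincomb by (intro conjI ballI exI[of _ symbol]) blast+
qed

end
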